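(* Let $N=\sum_{i\ge1}\delta_{X_i}$ be a $B_4$-mixing point process on $\mathbb{R}^d$ with intensity $\lambda>0$, let $(W_n)$ be a convex averaging sequence, let $R>0$, and suppose that $$\frac{N(W_n)-\lambda|W_n|}{\sqrt{|W_n|}}\ \xrightarrow[n\to\infty]{d}\ \mathcal N(0,\sigma^2)\qquad\text{with}\qquad \sigma^2=\lambda\bigl(1+\gamma^{(2)}_{red}(\mathbb{R}^d)\bigr).$$ Suppose further that there is a constant $a_0>0$ with $\alpha^{(2)}_{red}(A)\le a_0|A|$ for all bounded Borel sets $A\subset\mathbb{R}^d$. (i) If $1/4<\alpha<1$ and $c_n^\alpha/\varrho(W_n)\to0$, then $$\{\Delta^{(\alpha)}_{B,n}(r):r\in[0,R]\}\ \xrightarrow[n\to\infty]{d}\ \{G_B(r):=2\lambda|B|r^d\,\mathcal N(0,\sigma^2):r\in[0,R]\}$$ weakly in the Skorohod space $D[0,R]$ (the same Gaussian random variable being used for all $r$). (ii) If, in addition, $\gamma^{(3)}_{red}$ and $\gamma^{(4)}_{red}$ have Lebesgue densities $\kappa^{(3)}$ and $\kappa^{(4)}$ and there are constants $a_{01},a_{02}$ such that $|\kappa^{(3)}(x,y)|\le a_{01}$ for all $x,y\in\mathbb{R}^d$ and $$\int_{\mathbb{R}^d}\int_{\mathbb{R}^d}\Bigl(\int_{\mathbb{R}^d}|\kappa^{(4)}(x,y+z,z)|\,dz\Bigr)^2dy\,dx\le a_{02},$$ then the same weak convergence in $D[0,R]$ holds for every $0<\alpha<1$ with $c_n^\alp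ha/\varrho(W_n)\to0$.
   Context: $|\cdot|$ is Lebesgue measure on $\mathbb{R}^d$ (or absolute value), $\mathcal N(0,\tau^2)$ a centered Gaussian random variable with variance $\tau^2$, $\xrightarrow{d}$ convergence in distribution, $\sum^{\ne}$ a sum over tuples of pairwise distinct indices. $D[0,R]$ is the space of càdlàg functions on $[0,R]$ with the Skorohod ($J_1$) topology. Point processes. $N=\sum_{i\ge1}\delta_{X_i}$ is a simple point process on $\mathbb{R}^d$ with intensity $\lambda=\mathbf E N([0,1)^d)>0$. Its $k$-th factorial moment measure is $\alpha^{(k)}(A_1\times\dots\times A_k)=\mathbf E\sum^{\ne}_{i_1,\dots,i_k\ge1}\mathbf 1_{A_1}(X_{i_1})\cdots\mathbf 1_{A_k}(X_{i_k})$. $N$ is $k$-th order stationary if $\mathbf E N^k([0,1)^d)<\infty$ and, for $j=1,\dots,k$, $\alpha^{(j)}$ is invariant under diagonal shifts $A_1\times\dots\times A_j\mapsto(A_1+x)\times\dots\times(A_j+x)$. The $k$-th factorial cumulant measure is the (locally finite) signed measure $\gamma^{(k)}(A_1\times\dots\times A_k)=\sum_{j=1}^k(-1)^{j-1}(j-1)!\sum_{K_1\cup\dots\cup K_j=\{1,\dots,k\}}\prod_{i=1}^j\alpha^{(\#K_i)}(\times_{l\in K_i}A_l)$, the inner sum being over partitions into $j$ disjoint non-empty subsets. The reduced measures $\alpha^{(k)}_{red},\gamma^{(k)}_{red}$ on $\mathbb{R}^{d(k-1)}$ are defined by $\alpha^{(k)}(A_1\times\dots\times A_k)=\lambda\int_{A_k}\alpha^{(k)}_{red}((A_1-x)\times\dots\times(A_{k-1}-x))\,dx$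 and likewise for $\gamma^{(k)}$; in particular $\gamma^{(2)}_{red}(\cdot)=\alpha^{(2)}_{red}(\cdot)-\lambda|\cdot|$. $\|\gamma^{(k)}_{red}\|_{var}$ is the total variation on $\mathbb{R}^{d(k-1)}$. $N$ is $B_4$-mixing if it is fourth-order stationary and $\|\gamma^{(j)}_{red}\|_{var}<\infty$ for $j=2,3,4$. Windows and $B$. A convex averaging sequence $(W_n)$ is an increasing sequence of convex compact sets $W_n\subset\mathbb{R}^d$ with $\varrho(W_n):=\sup\{r>0: x+rB_e\subseteq W_n\text{ for some }x\in W_n\}\to\infty$, where $B_e$ is the closed Euclidean unit ball. Put $c_n:=|W_n|^{1/d}$. $B\subset\mathbb{R}^d$ is a fixed compact convex set, symmetric about the origin, with the origin as an interior point. $K$-function and estimator. $K_B(r):=\lambda^{-1}\alpha^{(2)}_{red}(rB)$ for $r\ge0$, $$(\widehat{\lambda^2K_B})_n(r):=\sum^{\ne}_{i,j\ge1}\frac{\mathbf 1_{W_n}(X_i)\mathbf 1_{W_n}(X_j)\mathbf 1_{rB}(X_j-X_i)}{|(W_n-X_i)\cap(W_n-X_j)|},$$ $$\Delta^{(\alpha)}_{B,n}(r):=|W_n|^{1/2-\alpha}\bigl((\widehat{\lambda^2K_B})_n(c_n^\alpha r)-\lambda^2K_B(c_n^\alpha r)\bigr).$$ *)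

theory Defs
  imports "HOL-Probability.Probability"
begin

section \<open>Point processes\<close>

text \<open>
  A simple point process is represented by its random set of points
  \<open>X \<omega> = {X\<^sub>1(\<omega>), X\<^sub>2(\<omega>), \<dots>}\<close>, so that \<open>N(A) = card (X \<omega> \<inter> A)\<close>. As the points are
  distinct, sums over tuples of pairwise distinct indices are sums over injective tuples of
  points.
\<close>

definition point_count :: "('w \<Rightarrow> 'a set) \<Rightarrow> 'a set \<Rightarrow> 'w \<Rightarrow> nat" where
  "point_count X A \<omega> = card (X \<omega> \<inter> A)"

definition simple_point_process ::
  "'w measure \<Rightarrow> ('w \<Rightarrow> 'a::euclidean_space set) \<Rightarrow> bool" where
  "simple_point_process M X \<longleftrightarrow>
     prob_space M \<and>
     (\<forall>\<omega>\<in>space M. \<forall>A. bounded A \<longrightarrow> finite (X \<omega> \<inter> A)) \<and>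
     (\<forall>A\<in>sets borel. bounded A \<longrightarrow> point_count X A \<in> M \<rightarrow>\<^sub>M count_space UNIV)"

definition unit_cube :: "'a::euclidean_space set" where
  "unit_cube = {x. \<forall>b\<in>Basis. 0 \<le> x \<bullet> b \<and> x \<bullet> b < 1}"

definition intensity :: "'w measure \<Rightarrow> ('w \<Rightarrow> 'a::euclidean_space set) \<Rightarrow> real" where
  "intensity M X = (\<integral>\<omega>. real (point_count X unit_cube \<omega>) \<partial>M)"

text \<open>
  \<open>fact_moment M X K A\<close> is the factorial moment measure of order \<open>card K\<close> of the rectangle with
  sides \<open>A i\<close> (\<open>i \<in> K\<close>). General finite index sets \<open>K\<close> are allowed because the cumulants need
  the blocks of a partition; the \<open>k\<close>-th order measure is the case \<open>K = {..<k}\<close>.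
\<close>

definition fact_moment ::
  "'w measure \<Rightarrow> ('w \<Rightarrow> 'a set) \<Rightarrow> nat set \<Rightarrow> (nat \<Rightarrow> 'a set) \<Rightarrow> ennreal" where
  "fact_moment M X K A =
     (\<integral>\<^sup>+\<omega>. (\<integral>\<^sup>+x. (\<Prod>i\<in>K. indicator (A i) (x i))
               \<partial>count_space {x \<in> K \<rightarrow>\<^sub>E X \<omega>. inj_on x K}) \<partial>M)"

definition kth_order_stationary ::
  "nat \<Rightarrow> 'w measure \<Rightarrow> ('w \<Rightarrow> 'a::euclidean_space set) \<Rightarrow> bool" where
  "kth_order_stationary k M X \<longleftrightarrow>
     (\<integral>\<^sup>+\<omega>. of_nat (point_count X unit_cube \<omega>) ^ k \<partial>M) < \<infinity> \<and>
     (\<forall>j\<in>{1..k}. \<forall>A x. (\<forall>i<j. A i \<in> sets borel) \<longrightarrow>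
        fact_moment M X {..<j} (\<lambda>i. (\<lambda>y. y + x) ` A i) = fact_moment M X {..<j} A)"

definition fact_cumulant ::
  "'w measure \<Rightarrow> ('w \<Rightarrow> 'a set) \<Rightarrow> nat set \<Rightarrow> (nat \<Rightarrow> 'a set) \<Rightarrow> real" where
  "fact_cumulant M X K A =
     (\<Sum>P | partition_on K P. (-1) ^ (card P - 1) * fact (card P - 1) *
        (\<Prod>L\<in>P. enn2real (fact_moment M X L A)))"

section \<open>Reduced measures\<close>

text \<open>
  The space \<open>(\<real>\<^sup>d)\<^sup>m\<close> is rendered by functions in \<open>PiM {..<m} (\<lambda>_. borel)\<close>. Locally finite signed
  measures on it are represented by their Jordan decomposition \<open>(\<nu>\<^sup>+, \<nu>\<^sup>-)\<close>, which is a pair of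
  mutually singular locally finite measures and is uniquely determined by the signed measure.
\<close>

type_synonym 'b signed_measure = "'b measure \<times> 'b measure"

definition signed_value :: "'b signed_measure \<Rightarrow> 'b set \<Rightarrow> real" where
  "signed_value \<nu> A = measure (fst \<nu>) A - measure (snd \<nu>) A"

definition total_variation :: "'b signed_measure \<Rightarrow> ennreal" where
  "total_variation \<nu> = emeasure (fst \<nu>) (space (fst \<nu>)) + emeasure (snd \<nu>) (space (snd \<nu>))"

definition locally_finite_signed ::
  "nat \<Rightarrow> (nat \<Rightarrow> 'a::euclidean_space) signed_measure \<Rightarrow> bool" where
  "locally_finite_signed m \<nu> \<longleftrightarrow>
     sets (fst \<nu>) = sets (PiM {..<m} (\<lambda>_. borel)) \<and>
     sets (snd \<nu>) = sets (PiM {..<m} (\<lambda>_. borel)) \<and>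
     (\<exists>H \<in> sets (PiM {..<m} (\<lambda>_. borel)).
        emeasure (fst \<nu>) H = 0 \<and> emeasure (snd \<nu>) (space (snd \<nu>) - H) = 0) \<and>
     (\<forall>A. (\<forall>i<m. A i \<in> sets borel \<and> bounded (A i)) \<longrightarrow>
        emeasure (fst \<nu>) (Pi\<^sub>E {..<m} A) < \<infinity> \<and> emeasure (snd \<nu>) (Pi\<^sub>E {..<m} A) < \<infinity>)"

definition has_signed_density :: "'b signed_measure \<Rightarrow> 'b measure \<Rightarrow> ('b \<Rightarrow> real) \<Rightarrow> bool" where
  "has_signed_density \<nu> L \<kappa> \<longleftrightarrow>
     \<kappa> \<in> borel_measurable L \<and>
     fst \<nu> = density L (\<lambda>x. ennreal (\<kappa> x)) \<and>
     snd \<nu> = density L (\<lambda>x. ennreal (- \<kappa> x))"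

text \<open>
  In the disintegrations the last coordinate, with index \<open>k - 1\<close>, is the reference point.
\<close>

definition reduced_moment_measure ::
  "'w measure \<Rightarrow> ('w \<Rightarrow> 'a::euclidean_space set) \<Rightarrow> nat \<Rightarrow> (nat \<Rightarrow> 'a) measure \<Rightarrow> bool" where
  "reduced_moment_measure M X k \<mu> \<longleftrightarrow>
     sets \<mu> = sets (PiM {..<k-1} (\<lambda>_. borel)) \<and>
     (\<forall>A. (\<forall>i<k. A i \<in> sets borel) \<longrightarrow>
        fact_moment M X {..<k} A =
        ennreal (intensity M X) *
          (\<integral>\<^sup>+x\<in>A (k-1). emeasure \<mu> (\<Pi>\<^sub>E i\<in>{..<k-1}. (\<lambda>y. y - x) ` A i) \<partial>lborel))"

definition reduced_cumulant_measure ::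
  "'w measure \<Rightarrow> ('w \<Rightarrow> 'a::euclidean_space set) \<Rightarrow> nat \<Rightarrow> (nat \<Rightarrow> 'a) signed_measure \<Rightarrow> bool"
  where
  "reduced_cumulant_measure M X k \<nu> \<longleftrightarrow>
     locally_finite_signed (k-1) \<nu> \<and>
     (\<forall>A. (\<forall>i<k. A i \<in> sets borel \<and> bounded (A i)) \<longrightarrow>
        fact_cumulant M X {..<k} A =
        intensity M X *
          (LINT x:A (k-1)|lborel. signed_value \<nu> (\<Pi>\<^sub>E i\<in>{..<k-1}. (\<lambda>y. y - x) ` A i)))"

text \<open>
  \<open>Bk_mixing k M X \<gamma>\<close>: the process is \<open>B\<^sub>k\<close>-mixing and \<open>\<gamma> j\<close> is its \<open>j\<close>-th reduced factorial
  cumulant measure for \<open>2 \<le> j \<le> k\<close>.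
\<close>

definition Bk_mixing ::
  "nat \<Rightarrow> 'w measure \<Rightarrow> ('w \<Rightarrow> 'a::euclidean_space set)
     \<Rightarrow> (nat \<Rightarrow> (nat \<Rightarrow> 'a) signed_measure) \<Rightarrow> bool" where
  "Bk_mixing k M X \<gamma> \<longleftrightarrow>
     kth_order_stationary k M X \<and>
     (\<forall>j\<in>{2..k}. reduced_cumulant_measure M X j (\<gamma> j) \<and> total_variation (\<gamma> j) < \<infinity>)"

text \<open>Subsets of \<open>\<real>\<^sup>d\<close> viewed in \<open>(\<real>\<^sup>d)\<^sup>1\<close>, the space carrying the second order reduced measures.\<close>

abbreviation tuple1 :: "'a set \<Rightarrow> (nat \<Rightarrow> 'a) set" where
  "tuple1 A \<equiv> (\<Pi>\<^sub>E i\<in>{..<1}. A)"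

section \<open>Windows and the estimator\<close>

definition inradius :: "'a::euclidean_space set \<Rightarrow> real" where
  "inradius W = Sup {r. 0 < r \<and> (\<exists>x\<in>W. cball x r \<subseteq> W)}"

definition convex_averaging_sequence :: "(nat \<Rightarrow> 'a::euclidean_space set) \<Rightarrow> bool" where
  "convex_averaging_sequence W \<longleftrightarrow>
     incseq W \<and> (\<forall>n. convex (W n) \<and> compact (W n)) \<and>
     filterlim (\<lambda>n. inradius (W n)) at_top sequentially"

definition window_scale :: "'a::euclidean_space set \<Rightarrow> real" where
  "window_scale W = measure lborel W powr (1 / real DIM('a))"

text \<open>The second argument \<open>\<mu>\<close> is the second order reduced factorial moment measure.\<close>

definition K_function ::
  "real \<Rightarrow> (nat \<Rightarrow> 'a::euclidean_space) measure \<Rightarrow> 'a set \<Rightarrow> real \<Rightarrow> real" where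
  "K_function lam \<mu> B r = measure \<mu> (tuple1 ((*\<^sub>R) r ` B)) / lam"

text \<open>
  Where the denominator vanishes the summand is \<open>0\<close>. If \<open>c\<^sub>n\<^sup>\<alpha> = o(\<rho>(W\<^sub>n))\<close>, this does not occur
  for pairs with non-zero numerator and arguments at most \<open>c\<^sub>n\<^sup>\<alpha> R\<close> once \<open>n\<close> is large.
\<close>

definition K_estimator ::
  "('w \<Rightarrow> 'a::euclidean_space set) \<Rightarrow> 'a set \<Rightarrow> 'a set \<Rightarrow> real \<Rightarrow> 'w \<Rightarrow> real" where
  "K_estimator X W B r \<omega> =
     (\<Sum>x\<in>X \<omega> \<inter> W. \<Sum>y\<in>(X \<omega> \<inter> W) - {x}.
        indicator ((*\<^sub>R) r ` B) (y - x) /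
        measure lborel ((\<lambda>w. w - x) ` W \<inter> (\<lambda>w. w - y) ` W))"

definition Delta ::
  "real \<Rightarrow> (nat \<Rightarrow> 'a::euclidean_space) measure \<Rightarrow> ('w \<Rightarrow> 'a set) \<Rightarrow> 'a set \<Rightarrow> 'a set
     \<Rightarrow> real \<Rightarrow> real \<Rightarrow> 'w \<Rightarrow> real" where
  "Delta lam \<mu> X W B \<alpha> r \<omega> =
     measure lborel W powr (1/2 - \<alpha>) *
       (K_estimator X W B (window_scale W powr \<alpha> * r) \<omega>
        - lam\<^sup>2 * K_function lam \<mu> B (window_scale W powr \<alpha> * r))"

section \<open>Weak convergence\<close>

text \<open>The case \<open>\<tau>2 = 0\<close> gives the point mass at \<open>0\<close>.\<close>

definition centered_normal :: "real \<Rightarrow> real measure" where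
  "centered_normal \<tau>2 = distr std_normal_distribution borel (\<lambda>z. sqrt \<tau>2 * z)"

definition cadlag :: "real \<Rightarrow> (real \<Rightarrow> real) set" where
  "cadlag R = {f \<in> extensional {0..R}.
     (\<forall>t\<in>{0..<R}. (f \<longlongrightarrow> f t) (at_right t)) \<and>
     (\<forall>t\<in>{0<..R}. \<exists>l. (f \<longlongrightarrow> l) (at_left t))}"

text \<open>A strictly increasing map of \<open>[0,R]\<close> onto itself is automatically continuous.\<close>

definition time_changes :: "real \<Rightarrow> (real \<Rightarrow> real) set" where
  "time_changes R = {\<phi>. strict_mono_on {0..R} \<phi> \<and> \<phi> ` {0..R} = {0..R}}"

definition skorohod_close :: "real \<Rightarrow> (real \<Rightarrow> real) \<Rightarrow> (real \<Rightarrow> real) \<Rightarrow> real \<Rightarrow> bool" where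
  "skorohod_close R f g e \<longleftrightarrow> 0 \<le> e \<and> (\<exists>\<phi>\<in>time_changes R.
     \<forall>t\<in>{0..R}. \<bar>\<phi> t - t\<bar> \<le> e \<and> \<bar>f t - g (\<phi> t)\<bar> \<le> e)"

text \<open>The locale \<^locale>\<open>Metric_space\<close> requires nonnegativity for all arguments; the infimum is
  over a nonempty set only for arguments in \<open>cadlag R\<close>.\<close>

definition skorohod_dist :: "real \<Rightarrow> (real \<Rightarrow> real) \<Rightarrow> (real \<Rightarrow> real) \<Rightarrow> real" where
  "skorohod_dist R f g =
     (if f \<in> cadlag R \<and> g \<in> cadlag R then Inf {e. skorohod_close R f g e} else 0)"

definition skorohod_topology :: "real \<Rightarrow> (real \<Rightarrow> real) topology" where
  "skorohod_topology R = Metric_space.mtopology (cadlag R) (skorohod_dist R)"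

definition borel_of_top :: "'b topology \<Rightarrow> 'b measure" where
  "borel_of_top T = sigma (topspace T) {U. openin T U}"

text \<open>Convergence in distribution of random elements \<open>Y n\<close> of \<open>T\<close>, defined on \<open>M\<close>, to \<open>Z\<close>,
  defined on \<open>M'\<close>.\<close>

definition converges_in_distribution ::
  "'b topology \<Rightarrow> 'w measure \<Rightarrow> (nat \<Rightarrow> 'w \<Rightarrow> 'b) \<Rightarrow> 'v measure \<Rightarrow> ('v \<Rightarrow> 'b) \<Rightarrow> bool" where
  "converges_in_distribution T M Y M' Z \<longleftrightarrow>
     (\<forall>n. Y n \<in> M \<rightarrow>\<^sub>M borel_of_top T) \<and> Z \<in> M' \<rightarrow>\<^sub>M borel_of_top T \<and>
     (\<forall>F. continuous_map T euclideanreal F \<and> bounded (F ` topspace T) \<longrightarrow>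
        (\<lambda>n. \<integral>\<omega>. F (Y n \<omega>) \<partial>M) \<longlonglongrightarrow> (\<integral>z. F (Z z) \<partial>M'))"

section \<open>The Skorohod distance is a metric\<close>

lemma cadlag_bounded:
  assumes "f \<in> cadlag R"
  shows "\<exists>C. \<forall>t\<in>{0..R}. \<bar>f t\<bar> \<le> C"
proof (cases "0 \<le> R")
  case True
  have "\<exists>C. \<forall>t\<in>{0..R}. 0 \<le> t \<longrightarrow> t \<le> R \<longrightarrow> \<bar>f t\<bar> \<le> C"
  proof (rule Bolzano[OF True, where P = "\<lambda>a b. \<exists>C. \<forall>t\<in>{a..b}. 0 \<le> t \<longrightarrow> t \<le> R \<longrightarrow> \<bar>f t\<bar> \<le> C"])
    fix a b c :: real
    assume "\<exists>C. \<forall>t\<in>{a..b}. 0 \<le> t \<longrightarrow> t \<le> R \<longrightarrow> \<bar>f t\<bar> \<le> C"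
      and "\<exists>C. \<forall>t\<in>{b..c}. 0 \<le> t \<longrightarrow> t \<le> R \<longrightarrow> \<bar>f t\<bar> \<le> C"
    then obtain C D where "\<forall>t\<in>{a..b}. 0 \<le> t \<longrightarrow> t \<le> R \<longrightarrow> \<bar>f t\<bar> \<le> C"
      and "\<forall>t\<in>{b..c}. 0 \<le> t \<longrightarrow> t \<le> R \<longrightarrow> \<bar>f t\<bar> \<le> D" by blast
    then have "\<forall>t\<in>{a..c}. 0 \<le> t \<longrightarrow> t \<le> R \<longrightarrow> \<bar>f t\<bar> \<le> max C D"
      by (metis atLeastAtMost_iff linorder_linear max.coboundedI1 max.coboundedI2)
    then show "\<exists>C. \<forall>t\<in>{a..c}. 0 \<le> t \<longrightarrow> t \<le> R \<longrightarrow> \<bar>f t\<bar> \<le> C" by blast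
  next
    fix x :: real
    assume x: "0 \<le> x" "x \<le> R"
    have r: "\<exists>d>0. \<exists>C. \<forall>t. x < t \<and> t < x + d \<and> t \<le> R \<longrightarrow> \<bar>f t\<bar> \<le> C"
    proof (cases "x < R")
      case True
      then have "(f \<longlongrightarrow> f x) (at_right x)" using assms x by (auto simp: cadlag_def)
      then have "eventually (\<lambda>t. dist (f t) (f x) < 1) (at_right x)"
        by (rule tendstoD) simp
      then obtain b where b: "b > x" "\<forall>y>x. y < b \<longrightarrow> dist (f y) (f x) < 1"
        by (auto simp: eventually_at_right_field)
      then show ?thesis
        by (intro exI[of _ "b - x"] conjI exI[of _ "\<bar>f x\<bar> + 1"])
           (fastforce simp: dist_real_def)+
    next
      case False
      then show ?thesis by (intro exI[of _ 1]) auto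
    qed
    have l: "\<exists>d>0. \<exists>C. \<forall>t. t < x \<and> x - d < t \<and> 0 \<le> t \<longrightarrow> \<bar>f t\<bar> \<le> C"
    proof (cases "0 < x")
      case True
      then have "x \<in> {0<..R}" using x by simp
      then obtain y where "(f \<longlongrightarrow> y) (at_left x)" using assms unfolding cadlag_def by blast
      then have "eventually (\<lambda>t. dist (f t) y < 1) (at_left x)"
        by (rule tendstoD) simp
      then obtain b where b: "b < x" "\<forall>t>b. t < x \<longrightarrow> dist (f t) y < 1"
        by (auto simp: eventually_at_left_field)
      then show ?thesis
        by (intro exI[of _ "x - b"] conjI exI[of _ "\<bar>y\<bar> + 1"])
           (fastforce simp: dist_real_def)+
    next
      case False
      then show ?thesis by (intro exI[of _ 1]) auto
    qed
    from r l obtain d1 C1 d2 C2 where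
      d: "d1 > 0" "\<forall>t. x < t \<and> t < x + d1 \<and> t \<le> R \<longrightarrow> \<bar>f t\<bar> \<le> C1"
         "d2 > 0" "\<forall>t. t < x \<and> x - d2 < t \<and> 0 \<le> t \<longrightarrow> \<bar>f t\<bar> \<le> C2"
      by blast
    show "\<exists>d>0. \<forall>a b. a \<le> x \<and> x \<le> b \<and> b - a < d \<longrightarrow>
             (\<exists>C. \<forall>t\<in>{a..b}. 0 \<le> t \<longrightarrow> t \<le> R \<longrightarrow> \<bar>f t\<bar> \<le> C)"
    proof (rule exI[of _ "min d1 d2"], intro conjI allI impI)
      show "0 < min d1 d2" using d by simp
      fix a b assume ab: "a \<le> x \<and> x \<le> b \<and> b - a < min d1 d2"
      have "\<bar>f t\<bar> \<le> max (\<bar>f x\<bar>) (max C1 C2)" if "t \<in> {a..b}" "0 \<le> t" "t \<le> R" for t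
      proof -
        consider "t < x" | "t = x" | "t > x" by linarith
        then show ?thesis
        proof cases
          case 1
          then have "\<bar>f t\<bar> \<le> C2" using d(4) that ab by auto
          then show ?thesis by simp
        next
          case 3
          then have "\<bar>f t\<bar> \<le> C1" using d(2) that ab by auto
          then show ?thesis by simp
        qed simp
      qed
      then show "\<exists>C. \<forall>t\<in>{a..b}. 0 \<le> t \<longrightarrow> t \<le> R \<longrightarrow> \<bar>f t\<bar> \<le> C" by blast
    qed
  qed
  then show ?thesis by auto
qed auto

lemma time_changes_id: "(\<lambda>t. t) \<in> time_changes R"
  by (auto simp: time_changes_def strict_mono_on_def)

lemma time_changes_maps: "\<phi> \<in> time_changes R \<Longrightarrow> t \<in> {0..R} \<Longrightarrow> \<phi> t \<in> {0..R}"
  by (auto simp: time_changes_def)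

lemma time_changes_comp:
  assumes a: "\<phi> \<in> time_changes R" "\<psi> \<in> time_changes R"
  shows "(\<lambda>t. \<psi> (\<phi> t)) \<in> time_changes R"
proof -
  have "(\<lambda>t. \<psi> (\<phi> t)) ` {0..R} = {0..R}"
    using a by (simp add: time_changes_def image_image[symmetric])
  moreover have "strict_mono_on {0..R} (\<lambda>t. \<psi> (\<phi> t))"
    using a time_changes_maps[OF a(1)]
    by (simp add: time_changes_def strict_mono_on_def del: atLeastAtMost_iff)
  ultimately show ?thesis by (simp add: time_changes_def)
qed

lemma time_changes_inv:
  assumes "\<phi> \<in> time_changes R"
  obtains \<psi> where "\<psi> \<in> time_changes R" "\<And>t. t \<in> {0..R} \<Longrightarrow> \<phi> (\<psi> t) = t"
proof
  have sm: "strict_mono_on {0..R} \<phi>" and im: "\<phi> ` {0..R} = {0..R}"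
    using assms by (auto simp: time_changes_def)
  have inj: "inj_on \<phi> {0..R}" by (rule strict_mono_on_imp_inj_on[OF sm])
  let ?\<psi> = "the_inv_into {0..R} \<phi>"
  show inv: "\<phi> (?\<psi> t) = t" if "t \<in> {0..R}" for t
    using f_the_inv_into_f[OF inj] that im by blast
  have mem: "?\<psi> t \<in> {0..R}" if "t \<in> {0..R}" for t
    using the_inv_into_into[OF inj, of t "{0..R}"] that im by blast
  have "?\<psi> s < ?\<psi> t" if "s \<in> {0..R}" "t \<in> {0..R}" "s < t" for s t
  proof (rule ccontr)
    assume "\<not> ?\<psi> s < ?\<psi> t"
    then have "\<phi> (?\<psi> t) \<le> \<phi> (?\<psi> s)"
      using strict_mono_on_leD[OF sm mem[OF that(2)] mem[OF that(1)]] by simp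
    then show False using inv that by simp
  qed
  moreover have "?\<psi> ` {0..R} = {0..R}"
    using the_inv_into_onto[OF inj] im by simp
  ultimately show "?\<psi> \<in> time_changes R"
    by (auto simp: time_changes_def strict_mono_on_def)
qed

lemma time_changes_end:
  assumes "\<phi> \<in> time_changes R" "0 \<le> R"
  shows "\<phi> R = R"
proof -
  have sm: "strict_mono_on {0..R} \<phi>" and im: "\<phi> ` {0..R} = {0..R}"
    using assms by (auto simp: time_changes_def)
  obtain s where s: "s \<in> {0..R}" "\<phi> s = R" using im assms(2) by (metis atLeastAtMost_iff imageE order_refl)
  then have "\<phi> s \<le> \<phi> R" using strict_mono_on_leD[OF sm, of s R] assms(2) by auto
  moreover have "\<phi> R \<le> R" using time_changes_maps[OF assms(1), of R] assms(2) by auto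
  ultimately show ?thesis using s by simp
qed

lemma skorohod_close_commute: "skorohod_close R f g e \<Longrightarrow> skorohod_close R g f e"
proof -
  assume a: "skorohod_close R f g e"
  then obtain \<phi> where p: "\<phi> \<in> time_changes R" "0 \<le> e"
    "\<And>t. t \<in> {0..R} \<Longrightarrow> \<bar>\<phi> t - t\<bar> \<le> e \<and> \<bar>f t - g (\<phi> t)\<bar> \<le> e"
    by (auto simp: skorohod_close_def)
  obtain \<psi> where q: "\<psi> \<in> time_changes R" "\<And>t. t \<in> {0..R} \<Longrightarrow> \<phi> (\<psi> t) = t"
    using time_changes_inv[OF p(1)] by blast
  have "\<bar>\<psi> t - t\<bar> \<le> e \<and> \<bar>g t - f (\<psi> t)\<bar> \<le> e" if "t \<in> {0..R}" for t
    using p(3)[OF time_changes_maps[OF q(1) that]] q(2)[OF that] by (simp add: abs_minus_commute)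
  then show ?thesis using p(2) q(1) unfolding skorohod_close_def by blast
qed

lemma skorohod_close_trans:
  assumes "skorohod_close R f g a" "skorohod_close R g h b"
  shows "skorohod_close R f h (a + b)"
proof -
  obtain \<phi> where p: "\<phi> \<in> time_changes R" "0 \<le> a"
    "\<And>t. t \<in> {0..R} \<Longrightarrow> \<bar>\<phi> t - t\<bar> \<le> a \<and> \<bar>f t - g (\<phi> t)\<bar> \<le> a"
    using assms(1) by (auto simp: skorohod_close_def)
  obtain \<psi> where q: "\<psi> \<in> time_changes R" "0 \<le> b"
    "\<And>t. t \<in> {0..R} \<Longrightarrow> \<bar>\<psi> t - t\<bar> \<le> b \<and> \<bar>g t - h (\<psi> t)\<bar> \<le> b"
    using assms(2) by (auto simp: skorohod_close_def)
  have "\<bar>\<psi> (\<phi> t) - t\<bar> \<le> a + b \<and> \<bar>f t - h (\<psi> (\<phi> t))\<bar> \<le> a + b" if "t \<in> {0..R}" for t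
    using p(3)[OF that] q(3)[OF time_changes_maps[OF p(1) that]] by linarith
  then show ?thesis
    using p(2) q(2) time_changes_comp[OF p(1) q(1)] unfolding skorohod_close_def by fastforce
qed

lemma skorohod_close_bdd: "bdd_below {e. skorohod_close R f g e}"
  by (rule bdd_belowI[of _ 0]) (simp add: skorohod_close_def)

lemma skorohod_close_ex:
  assumes "f \<in> cadlag R" "g \<in> cadlag R"
  shows "{e. skorohod_close R f g e} \<noteq> {}"
proof -
  obtain C D where "\<forall>t\<in>{0..R}. \<bar>f t\<bar> \<le> C" "\<forall>t\<in>{0..R}. \<bar>g t\<bar> \<le> D"
    using cadlag_bounded assms by meson
  then have "\<bar>f t - g t\<bar> \<le> \<bar>C\<bar> + \<bar>D\<bar>" if "t \<in> {0..R}" for t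
    using that by (smt (verit, best))
  then have "skorohod_close R f g (\<bar>C\<bar> + \<bar>D\<bar>)"
    unfolding skorohod_close_def using time_changes_id[of R] by (auto intro: bexI[of _ "\<lambda>t. t"])
  then show ?thesis by blast
qed

lemma skorohod_dist_lessD:
  assumes "f \<in> cadlag R" "g \<in> cadlag R" "skorohod_dist R f g < e"
  shows "\<exists>a<e. skorohod_close R f g a"
  using assms cInf_lessD[OF skorohod_close_ex[OF assms(1,2)], of e]
  by (auto simp: skorohod_dist_def)

lemma skorohod_dist_leI: "skorohod_close R f g e \<Longrightarrow> skorohod_dist R f g \<le> e"
  unfolding skorohod_dist_def
  using cInf_lower[OF _ skorohod_close_bdd[of R f g], of e] by (auto, auto simp: skorohod_close_def)

lemma skorohod_dist_zeroD:
  assumes f: "f \<in> cadlag R" and g: "g \<in> cadlag R" and "skorohod_dist R f g = 0"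
  shows "f = g"
proof (rule extensionalityI[of f "{0..R}"])
  show "f \<in> extensional {0..R}" "g \<in> extensional {0..R}" using f g by (auto simp: cadlag_def)
  fix t assume t: "t \<in> {0..R}"
  have close: "\<exists>\<phi>\<in>time_changes R. \<forall>s\<in>{0..R}. \<bar>\<phi> s - s\<bar> < e \<and> \<bar>f s - g (\<phi> s)\<bar> < e"
    if "e > 0" for e
    using skorohod_dist_lessD[OF f g, of e] assms(3) that
    unfolding skorohod_close_def by (metis order_le_less_trans)
  show "f t = g t"
  proof (rule ccontr)
    assume ne: "f t \<noteq> g t"
    show False
    proof (cases "t = R")
      case True
      obtain \<phi> where p: "\<phi> \<in> time_changes R" "\<bar>f t - g (\<phi> t)\<bar> < \<bar>f t - g t\<bar>"
        using close[of "\<bar>f t - g t\<bar>"] ne t by force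
      then show False using time_changes_end[OF p(1)] True t by simp
    next
      case False
      define d where "d = \<bar>f t - g t\<bar> / 3"
      have d: "d > 0" using ne by (simp add: d_def)
      have "(f \<longlongrightarrow> f t) (at_right t)" "(g \<longlongrightarrow> g t) (at_right t)"
        using f g t False by (auto simp: cadlag_def)
      then have "eventually (\<lambda>s. dist (f s) (f t) < d \<and> dist (g s) (g t) < d) (at_right t)"
        using d by (auto intro!: eventually_conj dest: tendstoD)
      then obtain b where b: "b > t"
        "\<And>s. t < s \<Longrightarrow> s < b \<Longrightarrow> \<bar>f s - f t\<bar> < d \<and> \<bar>g s - g t\<bar> < d"
        by (auto simp: eventually_at_right_field dist_real_def)
      define h where "h = (min b R - t) / 2"
      have h: "h > 0" "t + 2 * h \<le> b" "t + 2 * h \<le> R" using b t False unfolding h_def by (auto simp: min_def field_simps)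
      obtain \<phi> where p: "\<phi> \<in> time_changes R"
        "\<And>s. s \<in> {0..R} \<Longrightarrow> \<bar>\<phi> s - s\<bar> < min d h \<and> \<bar>f s - g (\<phi> s)\<bar> < min d h"
        using close[of "min d h"] d h by auto
      have s: "t + h \<in> {0..R}" using t h by auto
      have "\<bar>f (t + h) - f t\<bar> < d" using b(2)[of "t + h"] h by auto
      moreover have "\<bar>g (\<phi> (t + h)) - g t\<bar> < d"
        using b(2)[of "\<phi> (t + h)"] p(2)[OF s] h by linarith
      moreover have "\<bar>f (t + h) - g (\<phi> (t + h))\<bar> < d" using p(2)[OF s] by auto
      ultimately have "\<bar>f t - g t\<bar> < 3 * d" by linarith
      then show False by (simp add: d_def)
    qed
  qed
qed

lemma Metric_space_skorohod: "Metric_space (cadlag R) (skorohod_dist R)"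
proof
  show "0 \<le> skorohod_dist R f g" for f g
    using cInf_greatest[OF skorohod_close_ex, of f R g 0]
    by (auto simp: skorohod_dist_def skorohod_close_def)
  have "skorohod_close R f g = skorohod_close R g f" for f g
    using skorohod_close_commute by blast
  then show "skorohod_dist R f g = skorohod_dist R g f" for f g
    by (simp add: skorohod_dist_def)
  show "skorohod_dist R f g = 0 \<longleftrightarrow> f = g" if "f \<in> cadlag R" "g \<in> cadlag R" for f g
  proof
    assume "f = g"
    moreover have "skorohod_close R f f 0"
      by (auto simp: skorohod_close_def intro!: bexI[OF _ time_changes_id])
    ultimately show "skorohod_dist R f g = 0"
      using skorohod_dist_leI \<open>0 \<le> skorohod_dist R f g\<close> by (metis order_antisym)
  qed (rule skorohod_dist_zeroD[OF that])
  show "skorohod_dist R f h \<le> skorohod_dist R f g + skorohod_dist R g h"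
    if that3: "f \<in> cadlag R" "g \<in> cadlag R" "h \<in> cadlag R" for f g h
  proof (rule field_le_epsilon)
    fix e :: real assume "e > 0"
    then obtain a b where "a < skorohod_dist R f g + e / 2" "skorohod_close R f g a"
      "b < skorohod_dist R g h + e / 2" "skorohod_close R g h b"
      using skorohod_dist_lessD[OF that3(1,2), of "skorohod_dist R f g + e / 2"]
        skorohod_dist_lessD[OF that3(2,3), of "skorohod_dist R g h + e / 2"] by auto
    then show "skorohod_dist R f h \<le> skorohod_dist R f g + skorohod_dist R g h + e"
      using skorohod_dist_leI[OF skorohod_close_trans] by fastforce
  qed
qed

end

theory Submission
  imports Defs "HOL-Real_Asymp.Real_Asymp"
begin

text \<open>
  For an annulus \<open>A = r B - s B\<close> the increment of the estimator, minus its mean and minus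
  \<open>2 \<lambda> |A| (N(W) - \<lambda>|W|) / |W|\<close>, splits into a fully centred pair sum and a linear edge
  correction. The second moment of the centred pair sum is a sum of integrals against the cumulant
  measures of order at most four. The edge correction is small because a convex window of inradius
  \<open>\<rho>\<close> loses at most a fraction \<open>d |z| / \<rho>\<close> of its volume when intersected with its translate by \<open>z\<close>.
  Hence \<open>e(r) = \<Delta>(r) - 2 \<lambda> |B| r\<^sup>d Z\<close>, with \<open>Z\<close> the normalised number of points, satisfies
  \<open>E (e(r) - e(s))\<^sup>2 \<le> a + b (r - s) + c (r - s)\<^sup>2\<close> with \<open>a\<close> of order \<open>|W|\<close> to the power \<open>-2 \<alpha>\<close> and
  \<open>b, c\<close> tending to \<open>0\<close>. Dyadic chaining bounds \<open>e\<close> on a grid, and monotonicity of the estimator in \<open>r\<close>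
  carries the bound over to all \<open>r\<close> if the mesh is of smaller order than \<open>|W|\<close> to the power \<open>-1/2\<close>.
  As the grid may have only \<open>o(1/a)\<close> points (up to logarithms), this needs \<open>\<alpha> > 1/4\<close>; under the density
  assumptions the third and fourth order terms are of order \<open>|A|\<close>, and \<open>a\<close> is \<open>0\<close>.
\<close>

section \<open>Bounded Borel functions and continuous linear functionals\<close>

text \<open>The hypotheses on moments and cumulants concern rectangles, but the kernels are not
  products. Each such integral is therefore treated as a linear functional of bounded Borel
  functions, continuous under bounded pointwise limits; two of these agree once they agree on boxes,
  whatever their signs. The weights of the estimator make its mean exact, so there is no bias to
  control. Their price is that the kernel, integrated over one of its points, is not constant near
  the boundary of the window; this is the source of the linear edge term. The obstacle is that in
  general the third and fourth order terms are controlled by total variations only, which do not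
  shrink with the annulus. They produce the constant in the increment bound, and with such a
  constant the chaining cannot be continued to arbitrarily fine levels. Tightness in D[0,R] is
  bypassed: the limit paths form a curve indexed by one real number, a bounded piece of this curve
  is compact, and near a compact set a continuous function is uniformly continuous. Uniform
  closeness in probability to the random curve then suffices.\<close>

definition bdd_borel :: "('b::topological_space \<Rightarrow> real) \<Rightarrow> bool" where
  "bdd_borel f \<longleftrightarrow> f \<in> borel_measurable borel \<and> (\<exists>C. \<forall>x. \<bar>f x\<bar> \<le> C)"

lemma bdd_borelI: "f \<in> borel_measurable borel \<Longrightarrow> (\<And>x. \<bar>f x\<bar> \<le> C) \<Longrightarrow> bdd_borel f"
  by (auto simp: bdd_borel_def)

lemma bdd_borelD: "bdd_borel f \<Longrightarrow> f \<in> borel_measurable borel"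
  by (auto simp: bdd_borel_def)

lemma bdd_borelE:
  assumes "bdd_borel f" obtains C where "C \<ge> 0" "\<And>x. \<bar>f x\<bar> \<le> C"
  using assms unfolding bdd_borel_def by (meson abs_ge_zero order_trans)

lemma bdd_borel_add: "bdd_borel f \<Longrightarrow> bdd_borel g \<Longrightarrow> bdd_borel (\<lambda>x. f x + g x)"
  unfolding bdd_borel_def
  by (auto, meson abs_triangle_ineq add_mono order_trans)

lemma bdd_borel_mult: "bdd_borel f \<Longrightarrow> bdd_borel g \<Longrightarrow> bdd_borel (\<lambda>x. f x * g x)"
proof -
  assume f: "bdd_borel f" and g: "bdd_borel g"
  obtain C where C: "C \<ge> 0" "\<And>x. \<bar>f x\<bar> \<le> C" using f by (rule bdd_borelE) blast
  obtain K where K: "K \<ge> 0" "\<And>x. \<bar>g x\<bar> \<le> K" using g by (rule bdd_borelE) blast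
  show ?thesis
    using C K f g by (intro bdd_borelI[where C = "C * K"])
      (auto dest!: bdd_borelD simp: abs_mult intro!: mult_mono)
qed

lemma bdd_borel_const [simp]: "bdd_borel (\<lambda>x. c)"
  by (rule bdd_borelI[where C = "\<bar>c\<bar>"]) auto

lemma bdd_borel_cmult: "bdd_borel f \<Longrightarrow> bdd_borel (\<lambda>x. c * f x)"
  by (intro bdd_borel_mult) auto

lemma bdd_borel_diff: "bdd_borel f \<Longrightarrow> bdd_borel g \<Longrightarrow> bdd_borel (\<lambda>x. f x - g x)"
  using bdd_borel_add[OF _ bdd_borel_cmult[of g "-1"], of f] by simp

lemma bdd_borel_indicator: "S \<in> sets borel \<Longrightarrow> bdd_borel (indicator S)"
  by (rule bdd_borelI[where C = 1]) (auto simp: indicator_def)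

lemma bdd_borel_sum: "(\<And>i. i \<in> I \<Longrightarrow> bdd_borel (f i)) \<Longrightarrow> bdd_borel (\<lambda>x. \<Sum>i\<in>I. f i x)"
  by (induction I rule: infinite_finite_induct) (auto intro: bdd_borel_add)

lemma bdd_borel_compose:
  assumes "bdd_borel f" "T \<in> borel \<rightarrow>\<^sub>M borel"
  shows "bdd_borel (\<lambda>x. f (T x))"
  using assms measurable_compose[of T borel borel f] unfolding bdd_borel_def by auto

lemma box_Pair: "box (a, c) (b, d) = box a b \<times> box c d"
  unfolding box_def Basis_prod_def ball_Un by auto

text \<open>A monotone class argument with the open boxes as pi-system. Complements need the
  constant 1, obtained as the limit of growing boxes; a general bounded function is the uniform
  limit of floor (k f) / k, which takes finitely many values. All limits are bounded, so the rule
  also serves functionals without a sign.\<close>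

lemma bdd_borel_induct [consumes 1, case_names box add cmult lim]:
  fixes f :: "'b::euclidean_space \<Rightarrow> real"
  assumes f: "bdd_borel f"
    and box: "\<And>a b. P (indicator (box a b))"
    and add: "\<And>f g. bdd_borel f \<Longrightarrow> bdd_borel g \<Longrightarrow> P f \<Longrightarrow> P g \<Longrightarrow> P (\<lambda>x. f x + g x)"
    and cmult: "\<And>c f. bdd_borel f \<Longrightarrow> P f \<Longrightarrow> P (\<lambda>x. c * f x)"
    and lim: "\<And>F f C. (\<And>n::nat. F n \<in> borel_measurable borel) \<Longrightarrow> (\<And>n x. \<bar>F n x\<bar> \<le> C) \<Longrightarrow>
      (\<And>x. (\<lambda>n. F n x) \<longlonglongrightarrow> f x) \<Longrightarrow> (\<And>n. P (F n)) \<Longrightarrow> P f"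
  shows "P f"
proof -
  have Psum: "P (\<lambda>x. \<Sum>i\<in>I. g i x)" if "finite I" "\<And>i. i \<in> I \<Longrightarrow> bdd_borel (g i)" "\<And>i. i \<in> I \<Longrightarrow> P (g i)"
    for I and g :: "'c \<Rightarrow> 'b \<Rightarrow> real"
    using that
  proof (induction I rule: finite_induct)
    case empty
    show ?case using cmult[OF bdd_borel_indicator[OF borel_open[OF open_box]] box, of 0] by simp
  next
    case (insert i I)
    then show ?case by (simp, intro add bdd_borel_sum) auto
  qed
  have one: "P (\<lambda>_. 1)"
  proof (rule lim[where F = "\<lambda>n. indicator (box (- (real n *\<^sub>R One)) (real n *\<^sub>R One))" and C = 1])
    fix x :: 'b
    obtain n :: nat where n: "x \<in> box (- (real n *\<^sub>R One)) (real n *\<^sub>R One)"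
      using UN_box_eq_UNIV by blast
    have "x \<in> box (- (real m *\<^sub>R One)) (real m *\<^sub>R One)" if "m \<ge> n" for m
      unfolding mem_box
    proof
      fix i :: 'b assume "i \<in> Basis"
      then show "- (real m *\<^sub>R One) \<bullet> i < x \<bullet> i \<and> x \<bullet> i < (real m *\<^sub>R One) \<bullet> i"
        using n that unfolding mem_box by (fastforce simp: less_le_trans le_less_trans)
    qed
    then show "(\<lambda>n. indicator (box (- (real n *\<^sub>R One)) (real n *\<^sub>R One)) x) \<longlonglongrightarrow> (1::real)"
      by (intro tendsto_eventually eventually_sequentiallyI[of n]) auto
    next
    show "\<bar>indicat_real (box (- (real n *\<^sub>R One)) (real n *\<^sub>R One)) x\<bar> \<le> 1" for n x
      by (simp add: indicator_def)
  qed (use box in auto)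
  have ind: "P (indicator S)" if "S \<in> sets borel" for S
  proof -
    have st: "Int_stable (range (\<lambda>(a::'b, b). box a b))"
      by (auto simp: Int_stable_def box_Int_box)
    have gen: "range (\<lambda>(a::'b, b). box a b) \<subseteq> Pow UNIV" by simp
    have "S \<in> sigma_sets UNIV (range (\<lambda>(a::'b, b). box a b))"
      using that by (simp add: borel_eq_box)
    from st gen this show ?thesis
    proof (induction rule: sigma_sets_induct_disjoint)
      case (basic A)
      then show ?case using box by auto
    next
      case empty
      show ?case using Psum[of "{}::nat set"] by (simp add: indicator_def)
    next
      case (compl A)
      then have A: "A \<in> sets borel" by (simp add: borel_eq_box)
      have "P (\<lambda>x. 1 + (-1) * indicator A x)"
        using one compl by (intro add cmult bdd_borel_cmult bdd_borel_indicator A) auto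
      moreover have "(\<lambda>x. 1 + (-1) * indicator A x :: real) = indicator (UNIV - A)"
        by (auto simp: indicator_def)
      ultimately show ?case by simp
    next
      case (union A)
      then have A: "A i \<in> sets borel" for i by (auto simp: borel_eq_box)
      show ?case
      proof (rule lim[where F = "\<lambda>n x. \<Sum>i<n. indicator (A i) x" and C = 1])
        fix n x
        have "(\<Sum>i<n. indicator (A i) x :: real) = indicator (\<Union>i<n. A i) x"
          by (rule indicator_UN_disjoint[symmetric]) (use union(1) in \<open>auto simp: disjoint_family_on_def\<close>)
        then show "\<bar>\<Sum>i<n. indicator (A i) x :: real\<bar> \<le> 1" by (simp add: indicator_def)
      next
        fix x
        have "(\<Sum>i<n. indicator (A i) x :: real) = indicator (\<Union>i<n. A i) x" for n
          by (rule indicator_UN_disjoint[symmetric]) (use union(1) in \<open>auto simp: disjoint_family_on_def\<close>)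
        then show "(\<lambda>n. \<Sum>i<n. indicator (A i) x :: real) \<longlonglongrightarrow> indicator (\<Union>i. A i) x"
          using LIMSEQ_indicator_UN[of A x] by simp
      next
        show "P (\<lambda>x. \<Sum>i<n. indicator (A i) x)" for n
          using union A by (intro Psum bdd_borel_indicator) auto
      qed (use A in auto)
    qed
  qed
  obtain C where C: "C \<ge> 0" "\<And>x. \<bar>f x\<bar> \<le> C" using f by (rule bdd_borelE) blast
  have fm [measurable]: "f \<in> borel_measurable borel" using f by (rule bdd_borelD)
  show ?thesis
  proof (rule lim[where F = "\<lambda>n x. real_of_int \<lfloor>real (Suc n) * f x\<rfloor> / real (Suc n)" and C = "C + 1"])
    fix n :: nat and x
    have *: "\<bar>real_of_int \<lfloor>real (Suc n) * f x\<rfloor> / real (Suc n) - f x\<bar> \<le> 1 / real (Suc n)" for n x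
    proof -
      have "real_of_int \<lfloor>real (Suc n) * f x\<rfloor> / real (Suc n) - f x
          = (real_of_int \<lfloor>real (Suc n) * f x\<rfloor> - real (Suc n) * f x) / real (Suc n)"
        by (simp add: field_simps)
      also have "\<bar>\<dots>\<bar> \<le> 1 / real (Suc n)"
        unfolding abs_divide by (intro divide_mono) linarith+
      finally show ?thesis .
    qed
    have "1 / real (Suc n) \<le> 1" by simp
    then show "\<bar>real_of_int \<lfloor>real (Suc n) * f x\<rfloor> / real (Suc n)\<bar> \<le> C + 1"
      using *[of n x] C(2)[of x] by linarith
    show "(\<lambda>n. real_of_int \<lfloor>real (Suc n) * f x\<rfloor> / real (Suc n)) \<longlonglongrightarrow> f x"
    proof (rule LIM_zero_cancel, rule Lim_null_comparison)
      show "\<forall>\<^sub>F n in sequentially. norm (real_of_int \<lfloor>real (Suc n) * f x\<rfloor> / real (Suc n) - f x) \<le> 1 / real (Suc n)"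
        unfolding real_norm_def using * by (intro always_eventually allI)
      show "(\<lambda>n. 1 / real (Suc n)) \<longlonglongrightarrow> 0" using LIMSEQ_inverse_real_of_nat by (simp add: inverse_eq_divide)
    qed
    \<comment> \<open>A finite set of integers containing all values of the floor function at level
      n, by |f| \<le> C; it turns the approximant into a finite sum of indicators.\<close>
    define I where "I = {- \<lceil>real (Suc n) * C\<rceil> - 1..\<lceil>real (Suc n) * C\<rceil>}"
    have I: "\<lfloor>real (Suc n) * f x\<rfloor> \<in> I" for x
    proof -
      have "\<bar>real (Suc n) * f x\<bar> \<le> real (Suc n) * C" unfolding abs_mult using C by (intro mult_mono) auto
      then have "real (Suc n) * f x \<le> real (Suc n) * C" "- (real (Suc n) * C) \<le> real (Suc n) * f x"
        by linarith+
      then have "\<lfloor>real (Suc n) * f x\<rfloor> \<le> \<lceil>real (Suc n) * C\<rceil>" "- \<lceil>real (Suc n) * C\<rceil> - 1 \<le> \<lfloor>real (Suc n) * f x\<rfloor>"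
        by linarith+
      then show ?thesis unfolding I_def by simp
    qed
    have S: "{x. \<lfloor>real (Suc n) * f x\<rfloor> = k} \<in> sets borel" for k by measurable
    have "P (\<lambda>x. \<Sum>k\<in>I. real_of_int k / real (Suc n) * indicator {x. \<lfloor>real (Suc n) * f x\<rfloor> = k} x)"
      using bdd_borel_indicator[OF S] by (intro Psum bdd_borel_cmult cmult ind S) (auto simp: I_def)
    moreover have "(\<Sum>k\<in>I. real_of_int k / real (Suc n) * indicator {x. \<lfloor>real (Suc n) * f x\<rfloor> = k} x)
      = real_of_int \<lfloor>real (Suc n) * f x\<rfloor> / real (Suc n)" for x
    proof -
      have "(\<Sum>k\<in>I. real_of_int k / real (Suc n) * indicator {x. \<lfloor>real (Suc n) * f x\<rfloor> = k} x)
        = (\<Sum>k\<in>I. if \<lfloor>real (Suc n) * f x\<rfloor> = k then real_of_int k / real (Suc n) else 0)"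
        by (intro sum.cong) (auto simp: indicator_def)
      also have "\<dots> = real_of_int \<lfloor>real (Suc n) * f x\<rfloor> / real (Suc n)"
        using I[of x] by (subst sum.delta') (auto simp: I_def)
      finally show ?thesis .
    qed
    ultimately show "P (\<lambda>x. real_of_int \<lfloor>real (Suc n) * f x\<rfloor> / real (Suc n))" by simp
  qed auto
qed

section \<open>Linear functionals continuous under bounded pointwise convergence\<close>

lemma abs_integral_le:
  fixes f g :: "'b \<Rightarrow> real"
  assumes "integrable M f" "integrable M g" "\<And>x. x \<in> space M \<Longrightarrow> \<bar>f x\<bar> \<le> g x"
  shows "\<bar>\<integral>x. f x \<partial>M\<bar> \<le> (\<integral>x. g x \<partial>M)"
proof -
  have "(\<integral>x. \<bar>f x\<bar> \<partial>M) \<le> (\<integral>x. g x \<partial>M)"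
    using assms by (intro integral_mono) auto
  then show ?thesis using integral_abs_bound[of M f] by linarith
qed

text \<open>On bounded Borel functions these are the integrals against finite signed measures, as
  \<open>\<Phi> (indicator A)\<close> is countably additive in \<open>A\<close>. Working with
  functionals avoids constructing the signed measures on products of two, three and four copies of
  the space.\<close>

definition fnl :: "(('b::topological_space \<Rightarrow> real) \<Rightarrow> real) \<Rightarrow> bool" where
  "fnl \<Phi> \<longleftrightarrow>
     (\<forall>f g. bdd_borel f \<longrightarrow> bdd_borel g \<longrightarrow> \<Phi> (\<lambda>x. f x + g x) = \<Phi> f + \<Phi> g) \<and>
     (\<forall>c f. bdd_borel f \<longrightarrow> \<Phi> (\<lambda>x. c * f x) = c * \<Phi> f) \<and>
     (\<forall>F f C. (\<forall>n::nat. F n \<in> borel_measurable borel) \<longrightarrow> (\<forall>n x. \<bar>F n x\<bar> \<le> C) \<longrightarrow>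
        (\<forall>x. (\<lambda>n. F n x) \<longlonglongrightarrow> f x) \<longrightarrow> (\<lambda>n. \<Phi> (F n)) \<longlonglongrightarrow> \<Phi> f)"

lemma fnl_addD: "fnl \<Phi> \<Longrightarrow> bdd_borel f \<Longrightarrow> bdd_borel g \<Longrightarrow> \<Phi> (\<lambda>x. f x + g x) = \<Phi> f + \<Phi> g"
  by (auto simp: fnl_def)

lemma fnl_cmultD: "fnl \<Phi> \<Longrightarrow> bdd_borel f \<Longrightarrow> \<Phi> (\<lambda>x. c * f x) = c * \<Phi> f"
  by (auto simp: fnl_def)

lemma fnl_limD:
  "fnl \<Phi> \<Longrightarrow> (\<And>n::nat. F n \<in> borel_measurable borel) \<Longrightarrow> (\<And>n x. \<bar>F n x\<bar> \<le> C) \<Longrightarrow>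
    (\<And>x. (\<lambda>n. F n x) \<longlonglongrightarrow> f x) \<Longrightarrow> (\<lambda>n. \<Phi> (F n)) \<longlonglongrightarrow> \<Phi> f"
  unfolding fnl_def by blast

lemma bdd_borel_lim:
  assumes "\<And>n::nat. F n \<in> borel_measurable borel" "\<And>n x. \<bar>F n x\<bar> \<le> C" "\<And>x. (\<lambda>n. F n x) \<longlonglongrightarrow> f x"
  shows "bdd_borel f" "\<And>x. \<bar>f x\<bar> \<le> C"
proof -
  have "f \<in> borel_measurable borel" by (rule borel_measurable_LIMSEQ_real[OF assms(3) assms(1)])
  moreover show "\<bar>f x\<bar> \<le> C" for x
    by (rule LIMSEQ_le_const2[OF tendsto_rabs[OF assms(3)]]) (use assms(2) in auto)
  ultimately show "bdd_borel f" by (rule bdd_borelI)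
qed

text \<open>The uniqueness principle behind all moment identities below: a relation known for
  products of sets extends to arbitrary bounded Borel functions of several points, also when both
  sides are signed.\<close>

lemma fnl_eqI:
  fixes f :: "'b::euclidean_space \<Rightarrow> real"
  assumes "bdd_borel f" "fnl \<Phi>" "fnl \<Psi>" "\<And>a b. \<Phi> (indicator (box a b)) = \<Psi> (indicator (box a b))"
  shows "\<Phi> f = \<Psi> f"
  using assms(1)
proof (induction rule: bdd_borel_induct)
  case (lim F f C)
  then show ?case
    using LIMSEQ_unique[OF fnl_limD[OF assms(2), of F C f]] fnl_limD[OF assms(3), of F C f] by auto
qed (simp_all add: assms(4) fnl_addD[OF assms(2)] fnl_addD[OF assms(3)] fnl_cmultD[OF assms(2)] fnl_cmultD[OF assms(3)])

lemma fnlI: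
  assumes "\<And>f g. bdd_borel f \<Longrightarrow> bdd_borel g \<Longrightarrow> \<Phi> (\<lambda>x. f x + g x) = \<Phi> f + \<Phi> g"
    and "\<And>c f. bdd_borel f \<Longrightarrow> \<Phi> (\<lambda>x. c * f x) = c * \<Phi> f"
    and "\<And>F f C. (\<And>n::nat. F n \<in> borel_measurable borel) \<Longrightarrow> (\<And>n x. \<bar>F n x\<bar> \<le> C) \<Longrightarrow>
      (\<And>x. (\<lambda>n. F n x) \<longlonglongrightarrow> f x) \<Longrightarrow> (\<lambda>n. \<Phi> (F n)) \<longlonglongrightarrow> \<Phi> f"
  shows "fnl \<Phi>"
  unfolding fnl_def using assms by blast

lemma fnl_add:
  fixes \<Phi> :: "('a::topological_space \<Rightarrow> real) \<Rightarrow> real"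
  assumes "fnl \<Phi>" "fnl \<Psi>" shows "fnl (\<lambda>f. \<Phi> f + \<Psi> f)"
proof (rule fnlI)
  show "\<Phi> (\<lambda>x. f x + g x) + \<Psi> (\<lambda>x. f x + g x) = \<Phi> f + \<Psi> f + (\<Phi> g + \<Psi> g)"
    if "bdd_borel f" "bdd_borel g" for f g
    using that fnl_addD[OF assms(1)] fnl_addD[OF assms(2)] by simp
  show "\<Phi> (\<lambda>x. c * f x) + \<Psi> (\<lambda>x. c * f x) = c * (\<Phi> f + \<Psi> f)" if "bdd_borel f" for c f
    using that fnl_cmultD[OF assms(1)] fnl_cmultD[OF assms(2)] by (simp add: distrib_left)
next
  fix F :: "nat \<Rightarrow> 'a \<Rightarrow> real" and f C assume F: "\<And>n::nat. F n \<in> borel_measurable borel" "\<And>n x. \<bar>F n x\<bar> \<le> C" "\<And>x. (\<lambda>n. F n x) \<longlonglongrightarrow> f x"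
  show "(\<lambda>n. \<Phi> (F n) + \<Psi> (F n)) \<longlonglongrightarrow> \<Phi> f + \<Psi> f"
    by (intro tendsto_add fnl_limD[OF assms(1) F] fnl_limD[OF assms(2) F])
qed

lemma fnl_cmult:
  fixes \<Phi> :: "('a::topological_space \<Rightarrow> real) \<Rightarrow> real"
  assumes "fnl \<Phi>" shows "fnl (\<lambda>f. c * \<Phi> f)"
proof (rule fnlI)
  show "c * \<Phi> (\<lambda>x. f x + g x) = c * \<Phi> f + c * \<Phi> g" if "bdd_borel f" "bdd_borel g" for f g
    using that fnl_addD[OF assms(1)] by (simp add: distrib_left)
  show "c * \<Phi> (\<lambda>x. k * f x) = k * (c * \<Phi> f)" if "bdd_borel f" for k f
    using that fnl_cmultD[OF assms(1)] by simp
next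
  fix F :: "nat \<Rightarrow> 'a \<Rightarrow> real" and f C assume F: "\<And>n::nat. F n \<in> borel_measurable borel" "\<And>n x. \<bar>F n x\<bar> \<le> C" "\<And>x. (\<lambda>n. F n x) \<longlonglongrightarrow> f x"
  show "(\<lambda>n. c * \<Phi> (F n)) \<longlonglongrightarrow> c * \<Phi> f"
    by (intro tendsto_mult_left fnl_limD[OF assms F])
qed

lemma fnl_diff: "fnl \<Phi> \<Longrightarrow> fnl \<Psi> \<Longrightarrow> fnl (\<lambda>f. \<Phi> f - \<Psi> f)"
  using fnl_add[OF _ fnl_cmult, of \<Phi> \<Psi> "-1"] by simp

lemma integrable_bdd_borel:
  assumes "finite_measure P" "T \<in> P \<rightarrow>\<^sub>M borel" "w \<in> borel_measurable P" "\<And>z. \<bar>w z\<bar> \<le> c" "bdd_borel f"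
  shows "integrable P (\<lambda>z. w z * f (T z))"
proof -
  interpret finite_measure P by fact
  obtain C where C: "C \<ge> 0" "\<And>x. \<bar>f x\<bar> \<le> C" using assms(5) by (rule bdd_borelE) blast
  have [measurable]: "f \<in> borel_measurable borel" using assms(5) by (rule bdd_borelD)
  note [measurable] = assms(2,3)
  show ?thesis
  proof (rule integrable_const_bound[of _ "c * C"])
    have c: "c \<ge> 0" using assms(4) abs_ge_zero order_trans by blast
    show "AE z in P. norm (w z * f (T z)) \<le> c * C"
      using assms(4) C c by (auto simp: abs_mult intro!: mult_mono)
  qed measurable
qed

text \<open>Iterated integration stays in the class. \<open>b\<close> collects the arguments kept as
  parameters, \<open>w\<close> carries signs and window indicators, and \<open>T\<close> the shifts
  by the reference point; dominated convergence over the finite measure \<open>P\<close>, with a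
  constant as majorant, supplies the continuity.\<close>

lemma fnl_comp:
  fixes \<Phi> :: "('b::topological_space \<Rightarrow> real) \<Rightarrow> real" and P :: "'c measure"
    and T :: "'b \<times> 'c \<Rightarrow> 'd::topological_space"
  assumes \<Phi>: "fnl \<Phi>" and P: "finite_measure P"
    and T [measurable]: "T \<in> borel \<Otimes>\<^sub>M P \<rightarrow>\<^sub>M borel" and w [measurable]: "w \<in> borel_measurable (borel \<Otimes>\<^sub>M P)"
    and wb: "\<And>z. \<bar>w z\<bar> \<le> c"
  shows "fnl (\<lambda>F. \<Phi> (\<lambda>b. \<integral>z. w (b, z) * F (T (b, z)) \<partial>P))"
    and "bdd_borel F \<Longrightarrow> bdd_borel (\<lambda>b. \<integral>z. w (b, z) * F (T (b, z)) \<partial>P)"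
proof -
  interpret finite_measure P by fact
  have c: "c \<ge> 0" using wb abs_ge_zero order_trans by blast
  have int: "integrable P (\<lambda>z. w (b, z) * F (T (b, z)))" if "bdd_borel F" for b F
    by (rule integrable_bdd_borel[OF P _ _ _ that, of _ _ c]) (use wb in auto)
  have bnd: "\<bar>\<integral>z. w (b, z) * F (T (b, z)) \<partial>P\<bar> \<le> (c * C) * measure P (space P)"
    if "bdd_borel F" "\<And>x. \<bar>F x\<bar> \<le> C" for F b C
  proof -
    have "\<bar>\<integral>z. w (b, z) * F (T (b, z)) \<partial>P\<bar> \<le> (\<integral>z. c * C \<partial>P)"
      using wb that c by (intro abs_integral_le int) (auto simp: abs_mult intro!: mult_mono)
    then show ?thesis by (simp add: ac_simps)
  qed
  have bb: "bdd_borel (\<lambda>b. \<integral>z. w (b, z) * F (T (b, z)) \<partial>P)" if F: "bdd_borel F" for F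
  proof -
    obtain C where C: "C \<ge> 0" "\<And>x. \<bar>F x\<bar> \<le> C" using F by (rule bdd_borelE) blast
    have [measurable]: "F \<in> borel_measurable borel" using F by (rule bdd_borelD)
    show ?thesis using bnd[OF F C(2)] by (intro bdd_borelI) auto
  qed
  then show "bdd_borel F \<Longrightarrow> bdd_borel (\<lambda>b. \<integral>z. w (b, z) * F (T (b, z)) \<partial>P)" .
  show "fnl (\<lambda>F. \<Phi> (\<lambda>b. \<integral>z. w (b, z) * F (T (b, z)) \<partial>P))"
    unfolding fnl_def
  proof (intro conjI allI impI)
    fix f g :: "'d::topological_space \<Rightarrow> real" assume fg: "bdd_borel f" "bdd_borel g"
    show "\<Phi> (\<lambda>b. \<integral>z. w (b, z) * (f (T (b, z)) + g (T (b, z))) \<partial>P) =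
      \<Phi> (\<lambda>b. \<integral>z. w (b, z) * f (T (b, z)) \<partial>P) + \<Phi> (\<lambda>b. \<integral>z. w (b, z) * g (T (b, z)) \<partial>P)"
      using fg by (simp add: distrib_left int fnl_addD[OF \<Phi>] bb)
  next
    fix k and f :: "'d::topological_space \<Rightarrow> real" assume f: "bdd_borel f"
    show "\<Phi> (\<lambda>b. \<integral>z. w (b, z) * (k * f (T (b, z))) \<partial>P) = k * \<Phi> (\<lambda>b. \<integral>z. w (b, z) * f (T (b, z)) \<partial>P)"
      using f by (simp add: mult.left_commute[of _ k] int fnl_cmultD[OF \<Phi>] bb)
  next
    fix F :: "nat \<Rightarrow> 'd::topological_space \<Rightarrow> real" and f C
    assume "\<forall>n. F n \<in> borel_measurable borel" and F: "\<forall>n x. \<bar>F n x\<bar> \<le> C" "\<forall>x. (\<lambda>n. F n x) \<longlonglongrightarrow> f x"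
    then have Fm [measurable]: "\<And>n. F n \<in> borel_measurable borel" by auto
    have f: "bdd_borel f" by (rule bdd_borel_lim[of F C]) (use Fm F in auto)
    have [measurable]: "f \<in> borel_measurable borel" using f by (rule bdd_borelD)
    have Fb: "bdd_borel (F n)" for n using Fm F by (intro bdd_borelI) auto
    show "(\<lambda>n. \<Phi> (\<lambda>b. \<integral>z. w (b, z) * F n (T (b, z)) \<partial>P)) \<longlonglongrightarrow> \<Phi> (\<lambda>b. \<integral>z. w (b, z) * f (T (b, z)) \<partial>P)"
    proof (rule fnl_limD[OF \<Phi>])
      show "(\<lambda>n. \<integral>z. w (b, z) * F n (T (b, z)) \<partial>P) \<longlonglongrightarrow> (\<integral>z. w (b, z) * f (T (b, z)) \<partial>P)" for b
        using wb F c by (intro integral_dominated_convergence[where w = "\<lambda>_. c * C"])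
          (auto intro!: tendsto_mult_left mult_mono simp: abs_mult)
      show "\<bar>\<integral>z. w (b, z) * F n (T (b, z)) \<partial>P\<bar> \<le> (c * C) * measure P (space P)" for n b
        using bnd[OF Fb] F by auto
      show "(\<lambda>b. \<integral>z. w (b, z) * F n (T (b, z)) \<partial>P) \<in> borel_measurable borel" for n by measurable
    qed
  qed
qed

lemma fnl_integral:
  assumes P: "finite_measure P" and "T \<in> P \<rightarrow>\<^sub>M borel" "w \<in> borel_measurable P" "\<And>z. \<bar>w z\<bar> \<le> c"
  shows "fnl (\<lambda>F. \<integral>z. w z * F (T z) \<partial>P)"
proof -
  \<comment> \<open>Evaluation at 0 serves as the outer functional, so that the parameter becomes a
    dummy.\<close>
  have "fnl (\<lambda>h::real \<Rightarrow> real. h 0)" by (auto simp: fnl_def)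
  moreover have "(\<lambda>p. T (snd p)) \<in> borel \<Otimes>\<^sub>M P \<rightarrow>\<^sub>M borel" "(\<lambda>p. w (snd p)) \<in> borel_measurable (borel \<Otimes>\<^sub>M P)"
    using assms by simp_all
  ultimately show ?thesis
    using fnl_comp(1)[OF _ P, of "\<lambda>h::real \<Rightarrow> real. h 0" "\<lambda>p. T (snd p)" "\<lambda>p. w (snd p)" c] assms(4)
    by simp
qed

section \<open>Variation of a signed measure; representation of positive functionals\<close>

lemma sum_measure_ex:
  assumes "sets N = sets M"
  obtains S where "sets S = sets M" "\<And>A. A \<in> sets M \<Longrightarrow> emeasure S A = emeasure M A + emeasure N A"
    "\<And>f. f \<in> borel_measurable M \<Longrightarrow> (\<integral>\<^sup>+x. f x \<partial>S) = (\<integral>\<^sup>+x. f x \<partial>M) + (\<integral>\<^sup>+x. f x \<partial>N)"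
proof -
  define S where "S = measure_of (space M) (sets M) (\<lambda>A. emeasure M A + emeasure N A)"
  have sp: "space N = space M" using assms by (rule sets_eq_imp_space_eq)
  have ss: "sets S = sets M" by (simp add: S_def sets.sets_measure_of_eq)
  have em: "emeasure S A = emeasure M A + emeasure N A" if "A \<in> sets M" for A
  proof (rule emeasure_measure_of[OF S_def])
    show "positive (sets S) (\<lambda>A. emeasure M A + emeasure N A)" by (simp add: positive_def)
    show "countably_additive (sets S) (\<lambda>A. emeasure M A + emeasure N A)"
      unfolding countably_additive_def ss
    proof (intro allI impI)
      fix A :: "nat \<Rightarrow> _" assume A: "range A \<subseteq> sets M" "disjoint_family A" "\<Union> (range A) \<in> sets M"
      have "(\<Sum>i. emeasure M (A i) + emeasure N (A i)) = (\<Sum>i. emeasure M (A i)) + (\<Sum>i. emeasure N (A i))"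
        by (rule suminf_add[symmetric]) auto
      then show "(\<Sum>i. emeasure M (A i) + emeasure N (A i)) = emeasure M (\<Union> (range A)) + emeasure N (\<Union> (range A))"
        using A suminf_emeasure[of A M] suminf_emeasure[of A N] assms by simp
    qed
  qed (use that ss sets.space_closed in auto)
  have nn: "(\<integral>\<^sup>+x. f x \<partial>S) = (\<integral>\<^sup>+x. f x \<partial>M) + (\<integral>\<^sup>+x. f x \<partial>N)" if "f \<in> borel_measurable M" for f
    using that
  proof (induction rule: borel_measurable_induct)
    case (cong f g)
    have "integral\<^sup>N K f = integral\<^sup>N K g" if "space K = space M" for K
      using that cong by (intro nn_integral_cong) auto
    then show ?case using cong sp sets_eq_imp_space_eq[OF ss] by simp
  next
    case (set A)
    then show ?case by (simp add: em ss assms)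
  next
    case (mult u c)
    then have "u \<in> borel_measurable S" "u \<in> borel_measurable N"
      using measurable_cong_sets[OF ss refl] measurable_cong_sets[OF assms refl] by blast+
    then show ?case using mult by (simp add: nn_integral_cmult distrib_left)
  next
    case (add u v)
    then have "u \<in> borel_measurable S" "u \<in> borel_measurable N" "v \<in> borel_measurable S" "v \<in> borel_measurable N"
      using measurable_cong_sets[OF ss refl] measurable_cong_sets[OF assms refl] by blast+
    then show ?case using add by (simp add: nn_integral_add ac_simps)
  next
    case (seq U)
    have m: "U i \<in> borel_measurable S" "U i \<in> borel_measurable M" "U i \<in> borel_measurable N" for i
      using seq measurable_cong_sets[OF ss refl] measurable_cong_sets[OF assms refl] by blast+
    have inc: "incseq (\<lambda>i. \<integral>\<^sup>+x. U i x \<partial>K)" for K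
      using seq(3) by (auto simp: incseq_def le_fun_def intro!: nn_integral_mono)
    have "(\<integral>\<^sup>+x. (SUP i. U i x) \<partial>S) = (SUP i. (\<integral>\<^sup>+x. U i x \<partial>M) + (\<integral>\<^sup>+x. U i x \<partial>N))"
      using seq m by (simp add: nn_integral_monotone_convergence_SUP)
    also have "\<dots> = (SUP i. \<integral>\<^sup>+x. U i x \<partial>M) + (SUP i. \<integral>\<^sup>+x. U i x \<partial>N)"
      by (rule ennreal_SUP_add[OF inc inc])
    also have "\<dots> = (\<integral>\<^sup>+x. (SUP i. U i x) \<partial>M) + (\<integral>\<^sup>+x. (SUP i. U i x) \<partial>N)"
      using seq m by (simp add: nn_integral_monotone_convergence_SUP)
    finally show ?case by (simp add: SUP_apply image_comp)
  qed
  show thesis by (rule that[OF ss em nn])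
qed

text \<open>Polar decomposition: a finite measure \<open>Q\<close> and a sign \<open>s\<close>. The
  sign is read off the Hahn set \<open>H\<close>, which is null for the positive part, so it is -1
  on \<open>H\<close> and 1 elsewhere; \<open>Q\<close> is the image of the sum of the two parts.
  \<open>T\<close> and \<open>\<iota>\<close> carry everything from tuples indexed by naturals to an
  ordinary product space, where boxes are available; for this \<open>\<iota>\<close> has to undo
  \<open>T\<close> on the tuple space.\<close>

lemma signed_measure_variation:
  assumes lf: "locally_finite_signed m \<nu>" and tv: "total_variation \<nu> < \<infinity>"
    and T: "T \<in> PiM {..<m} (\<lambda>_. borel) \<rightarrow>\<^sub>M borel"
    and \<iota>: "\<iota> \<in> borel \<rightarrow>\<^sub>M PiM {..<m} (\<lambda>_. borel)"
    and inv: "\<And>v. v \<in> space (PiM {..<m} (\<lambda>_. borel :: 'a::euclidean_space measure)) \<Longrightarrow> \<iota> (T v) = v"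
  obtains Q and s :: "'b::topological_space \<Rightarrow> real" where "finite_measure Q" "sets Q = sets borel"
    "s \<in> borel_measurable borel" "\<And>y. \<bar>s y\<bar> \<le> 1"
    "\<And>A. A \<in> sets (PiM {..<m} (\<lambda>_. borel)) \<Longrightarrow> signed_value \<nu> A = (\<integral>y. s y * indicator A (\<iota> y) \<partial>Q)"
    "\<And>f. f \<in> borel_measurable borel \<Longrightarrow>
      (\<integral>\<^sup>+y. f y \<partial>Q) = (\<integral>\<^sup>+v. f (T v) \<partial>fst \<nu>) + (\<integral>\<^sup>+v. f (T v) \<partial>snd \<nu>)"
proof -
  let ?P = "PiM {..<m} (\<lambda>_. borel) :: (nat \<Rightarrow> 'a) measure"
  have s1: "sets (fst \<nu>) = sets ?P" and s2: "sets (snd \<nu>) = sets ?P" and s12: "sets (snd \<nu>) = sets (fst \<nu>)"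
    using lf by (auto simp: locally_finite_signed_def)
  obtain H where H: "H \<in> sets ?P" "emeasure (fst \<nu>) H = 0" "emeasure (snd \<nu>) (space (snd \<nu>) - H) = 0"
    using lf by (auto simp: locally_finite_signed_def)
  obtain S where S: "sets S = sets (fst \<nu>)"
    "\<And>A. A \<in> sets (fst \<nu>) \<Longrightarrow> emeasure S A = emeasure (fst \<nu>) A + emeasure (snd \<nu>) A"
    "\<And>f. f \<in> borel_measurable (fst \<nu>) \<Longrightarrow> (\<integral>\<^sup>+x. f x \<partial>S) = (\<integral>\<^sup>+x. f x \<partial>fst \<nu>) + (\<integral>\<^sup>+x. f x \<partial>snd \<nu>)"
    using sum_measure_ex[OF s12] by blast
  have SP: "sets S = sets ?P" using S(1) s1 by simp
  have sp: "space S = space ?P" "space (fst \<nu>) = space ?P" "space (snd \<nu>) = space ?P"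
    using SP s1 s2 by (auto dest: sets_eq_imp_space_eq)
  have TS [measurable]: "T \<in> S \<rightarrow>\<^sub>M borel" using T by (simp add: measurable_cong_sets[OF SP refl])
  have "emeasure S (space S) = total_variation \<nu>"
    unfolding total_variation_def using S(2)[OF sets.top] sp by simp
  then have fS: "finite_measure S" using tv by (intro finite_measureI) auto
  interpret S: finite_measure S by fact
  have fin: "finite_measure (fst \<nu>)" "finite_measure (snd \<nu>)"
    using tv by (auto intro!: finite_measureI simp: total_variation_def less_top[symmetric])
  interpret F: finite_measure "fst \<nu>" by fact
  interpret G: finite_measure "snd \<nu>" by fact
  define t where "t v = (if v \<in> H then -1 else 1 :: real)" for v
  have t [measurable]: "t \<in> borel_measurable ?P" unfolding t_def[abs_def] using H(1) by measurable
  define Q where "Q = distr S borel T"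
  define s where "s y = t (\<iota> y)" for y
  have s [measurable]: "s \<in> borel_measurable borel" unfolding s_def by (rule measurable_compose[OF \<iota> t])
  have val: "signed_value \<nu> A = (\<integral>y. s y * indicator A (\<iota> y) \<partial>Q)" if A: "A \<in> sets ?P" for A
  proof -
    have "indicat_real A \<in> borel_measurable ?P" using A by simp
    from measurable_compose[OF \<iota> this] have m: "(\<lambda>y. s y * indicator A (\<iota> y)) \<in> borel_measurable borel" by simp
    have "(\<integral>y. s y * indicator A (\<iota> y) \<partial>Q) = (\<integral>v. s (T v) * indicator A (\<iota> (T v)) \<partial>S)"
      unfolding Q_def by (rule integral_distr[OF TS m])
    also have "\<dots> = (\<integral>v. indicator (A - H) v - indicator (A \<inter> H) v \<partial>S)"
      by (intro Bochner_Integration.integral_cong refl) (auto simp: sp inv s_def t_def indicator_def)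
    also have "\<dots> = measure S (A - H) - measure S (A \<inter> H)"
      using A H SP by (subst Bochner_Integration.integral_diff) (auto simp: S.emeasure_eq_measure)
    also have "measure S (A - H) = measure (fst \<nu>) A"
    proof -
      have "emeasure (snd \<nu>) (A - H) \<le> emeasure (snd \<nu>) (space (snd \<nu>) - H)"
        using A H s2 sp sets.sets_into_space[OF A] by (intro emeasure_mono) auto
      then have "emeasure (snd \<nu>) (A - H) = 0" using H by simp
      moreover have "emeasure (fst \<nu>) (A - H) = emeasure (fst \<nu>) A"
        using A H s1 by (intro emeasure_Diff_null_set) (auto simp: null_sets_def)
      ultimately show ?thesis using S(2)[of "A - H"] A H s1 by (simp add: measure_def)
    qed
    also have "measure S (A \<inter> H) = measure (snd \<nu>) A"
    proof -
      have "emeasure (fst \<nu>) (A \<inter> H) \<le> emeasure (fst \<nu>) H"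
        using A H s1 by (intro emeasure_mono) auto
      then have "emeasure (fst \<nu>) (A \<inter> H) = 0" using H by simp
      moreover have "emeasure (snd \<nu>) (A - (space (snd \<nu>) - H)) = emeasure (snd \<nu>) A"
        using A H s2 by (intro emeasure_Diff_null_set) (auto simp: null_sets_def)
      moreover have "A - (space (snd \<nu>) - H) = A \<inter> H" using sets.sets_into_space[OF A] sp by auto
      ultimately show ?thesis using S(2)[of "A \<inter> H"] A H s1 by (simp add: measure_def)
    qed
    finally show ?thesis by (simp add: signed_value_def)
  qed
  have nn: "(\<integral>\<^sup>+y. f y \<partial>Q) = (\<integral>\<^sup>+v. f (T v) \<partial>fst \<nu>) + (\<integral>\<^sup>+v. f (T v) \<partial>snd \<nu>)"
    if [measurable]: "f \<in> borel_measurable borel" for f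
  proof -
    have "(\<lambda>v. f (T v)) \<in> borel_measurable (fst \<nu>)"
      using measurable_compose[OF T that] by (simp add: measurable_cong_sets[OF s1 refl])
    then show ?thesis unfolding Q_def by (simp add: nn_integral_distr S(3))
  qed
  show thesis
  proof (rule that[of Q s])
    show "finite_measure Q" unfolding Q_def by (rule S.finite_measure_distr) simp
    show "sets Q = sets borel" by (simp add: Q_def)
    show "\<And>y. \<bar>s y\<bar> \<le> 1" by (simp add: s_def t_def)
  qed (use val nn s in auto)
qed

text \<open>Turns the mean number of points into a genuine measure, to which Tonelli's theorem can
  be applied.\<close>

lemma positive_fnl_measure:
  fixes \<Phi> :: "('b::euclidean_space \<Rightarrow> real) \<Rightarrow> real"
  assumes \<Phi>: "fnl \<Phi>" and pos: "\<And>f. bdd_borel f \<Longrightarrow> (\<And>x. 0 \<le> f x) \<Longrightarrow> 0 \<le> \<Phi> f"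
  obtains m where "finite_measure m" "sets m = sets borel" "\<And>f. bdd_borel f \<Longrightarrow> \<Phi> f = (\<integral>x. f x \<partial>m)"
    "\<And>A. A \<in> sets borel \<Longrightarrow> emeasure m A = ennreal (\<Phi> (indicator A))"
proof -
  define m where "m = measure_of UNIV (sets (borel :: 'b measure)) (\<lambda>A. ennreal (\<Phi> (indicator A)))"
  have sm: "sets m = sets borel"
    unfolding m_def using sets.sets_measure_of_eq[of "borel :: 'b measure"] by simp
  have p: "0 \<le> \<Phi> (indicator A)" if "A \<in> sets borel" for A
    by (rule pos[OF bdd_borel_indicator[OF that]]) simp
  have em: "emeasure m A = ennreal (\<Phi> (indicator A))" if "A \<in> sets borel" for A
  proof (rule emeasure_measure_of[OF m_def])
    have "indicat_real {} = (\<lambda>x :: 'b. 0)" by (simp add: fun_eq_iff)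
    then have "\<Phi> (indicator {}) = 0" using fnl_cmultD[OF \<Phi> bdd_borel_const, of 0 0] by simp
    then show "positive (sets m) (\<lambda>A. ennreal (\<Phi> (indicator A)))" by (simp add: positive_def)
    show "countably_additive (sets m) (\<lambda>A. ennreal (\<Phi> (indicator A)))"
      unfolding countably_additive_def sm
    proof (intro allI impI)
      fix A :: "nat \<Rightarrow> 'b set" assume A: "range A \<subseteq> sets borel" "disjoint_family A" "\<Union> (range A) \<in> sets borel"
      have Ai: "A i \<in> sets borel" for i using A(1) by auto
      have eq: "(\<Sum>i<n. indicator (A i) x :: real) = indicator (\<Union>i<n. A i) x" for n x
        by (rule indicator_UN_disjoint[symmetric]) (use A(2) in \<open>auto simp: disjoint_family_on_def\<close>)
      have sum: "\<Phi> (\<lambda>x. \<Sum>i<n. indicator (A i) x) = (\<Sum>i<n. \<Phi> (indicator (A i)))" for n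
      proof (induction n)
        case 0 then show ?case using fnl_cmultD[OF \<Phi> bdd_borel_const, of 0 0] by simp
      next
        case (Suc n)
        then show ?case
          using fnl_addD[OF \<Phi> bdd_borel_sum[of "{..<n}" "\<lambda>i. indicator (A i)"] bdd_borel_indicator[OF Ai[of n]]] Ai
          by (simp add: bdd_borel_indicator)
      qed
      have "(\<lambda>n. \<Phi> (\<lambda>x. \<Sum>i<n. indicator (A i) x)) \<longlonglongrightarrow> \<Phi> (indicator (\<Union> (range A)))"
      proof (rule fnl_limD[OF \<Phi>, where C = 1])
        show "(\<lambda>x. \<Sum>i<n. indicator (A i) x :: real) \<in> borel_measurable borel" for n
          using Ai by (intro borel_measurable_sum borel_measurable_indicator)
        show "\<bar>\<Sum>i<n. indicator (A i) x :: real\<bar> \<le> 1" for n x unfolding eq by (simp add: indicator_def)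
        show "(\<lambda>n. \<Sum>i<n. indicator (A i) x :: real) \<longlonglongrightarrow> indicator (\<Union> (range A)) x" for x
          unfolding eq by (rule LIMSEQ_indicator_UN)
      qed
      then have "(\<lambda>i. \<Phi> (indicator (A i))) sums \<Phi> (indicator (\<Union> (range A)))"
        unfolding sum by (simp add: sums_def)
      then show "(\<Sum>i. ennreal (\<Phi> (indicator (A i)))) = ennreal (\<Phi> (indicator (\<Union> (range A))))"
        using p[OF Ai] by (simp add: suminf_ennreal2 sums_iff)
    qed
  qed (use that sm in auto)
  have fm: "finite_measure m"
    using em[of UNIV] sm by (intro finite_measureI) (simp add: sets_eq_imp_space_eq[OF sm])
  have "\<Phi> f = (\<integral>x. f x \<partial>m)" if f: "bdd_borel f" for f
  proof (rule fnl_eqI[OF f \<Phi>])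
    show "fnl (\<lambda>f. \<integral>x. f x \<partial>m)"
      using fnl_integral[OF fm, of "\<lambda>x. x" "\<lambda>_. 1" 1] sm by (simp add: measurable_cong_sets[OF sm refl])
    show "\<Phi> (indicator (box a b)) = (\<integral>x. indicator (box a b) x \<partial>m)" for a b
      using em[of "box a b"] p[of "box a b"] sm by (simp add: measure_def)
  qed
  then show thesis using that fm sm em by blast
qed

section \<open>Sums over tuples of distinct points\<close>

text \<open>The nested form is that of the estimator and suits the algebra of products. The other
  form, with the indicator of distinct tuples on a full product, is a plain sum over a finite set
  and suits measurability and continuity; the two agree for finite \<open>Y\<close>.\<close>

definition dsum2 :: "'a set \<Rightarrow> ('a \<times> 'a \<Rightarrow> 'b::comm_monoid_add) \<Rightarrow> 'b" where
  "dsum2 Y F = (\<Sum>x\<in>Y. \<Sum>y\<in>Y - {x}. F (x, y))"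

definition dsum3 :: "'a set \<Rightarrow> ('a \<times> 'a \<times> 'a \<Rightarrow> 'b::comm_monoid_add) \<Rightarrow> 'b" where
  "dsum3 Y F = (\<Sum>x\<in>Y. \<Sum>y\<in>Y - {x}. \<Sum>z\<in>Y - {x, y}. F (x, y, z))"

definition dsum4 :: "'a set \<Rightarrow> ('a \<times> 'a \<times> 'a \<times> 'a \<Rightarrow> 'b::comm_monoid_add) \<Rightarrow> 'b" where
  "dsum4 Y F = (\<Sum>x\<in>Y. \<Sum>y\<in>Y - {x}. \<Sum>z\<in>Y - {x, y}. \<Sum>w\<in>Y - {x, y, z}. F (x, y, z, w))"

definition distinct2 :: "('a \<times> 'a) set" where
  "distinct2 = {(x, y). x \<noteq> y}"

definition distinct3 :: "('a \<times> 'a \<times> 'a) set" where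
  "distinct3 = {(x, y, z). x \<noteq> y \<and> x \<noteq> z \<and> y \<noteq> z}"

definition distinct4 :: "('a \<times> 'a \<times> 'a \<times> 'a) set" where
  "distinct4 = {(x, y, z, w). x \<noteq> y \<and> x \<noteq> z \<and> y \<noteq> z \<and> x \<noteq> w \<and> y \<noteq> w \<and> z \<noteq> w}"

lemma sum_Diff_if: "finite Y \<Longrightarrow> sum f (Y - S) = (\<Sum>y\<in>Y. if y \<in> S then 0 else f y)"
  by (rule sum.mono_neutral_cong_left) auto

lemma sum_Times3: "sum f (A \<times> B \<times> C) = (\<Sum>x\<in>A. \<Sum>y\<in>B. \<Sum>z\<in>C. f (x, y, z))"
  by (simp add: sum.cartesian_product split_def)

lemma sum_Times4: "sum f (A \<times> B \<times> C \<times> D) = (\<Sum>x\<in>A. \<Sum>y\<in>B. \<Sum>z\<in>C. \<Sum>w\<in>D. f (x, y, z, w))"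
  by (simp add: sum.cartesian_product split_def)

lemma dsum2_eq: "finite Y \<Longrightarrow> dsum2 Y F = (\<Sum>p\<in>Y \<times> Y. indicator distinct2 p * (F p :: real))"
  unfolding dsum2_def sum.cartesian_product'
  by (simp only: sum_Diff_if) (intro sum.cong refl, auto simp: distinct2_def)

lemma dsum3_eq:
  assumes "finite Y" shows "dsum3 Y F = (\<Sum>p\<in>Y \<times> Y \<times> Y. indicator distinct3 p * (F p :: real))"
  unfolding dsum3_def sum_Times3 sum_Diff_if[OF assms]
proof (intro sum.cong refl)
  fix x y assume "x \<in> Y" "y \<in> Y"
  show "(if y \<in> {x} then 0 else \<Sum>z\<in>Y. if z \<in> {x, y} then 0 else F (x, y, z)) =
      (\<Sum>z\<in>Y. indicator distinct3 (x, y, z) * F (x, y, z))"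
    by (cases "y = x") (auto simp: distinct3_def intro!: sum.cong)
qed

lemma dsum4_eq:
  assumes "finite Y" shows "dsum4 Y F = (\<Sum>p\<in>Y \<times> Y \<times> Y \<times> Y. indicator distinct4 p * (F p :: real))"
  unfolding dsum4_def sum_Times4 sum_Diff_if[OF assms]
proof (intro sum.cong refl)
  fix x y assume "x \<in> Y" "y \<in> Y"
  show "(if y \<in> {x} then 0 else \<Sum>z\<in>Y. if z \<in> {x, y} then 0
        else \<Sum>w\<in>Y. if w \<in> {x, y, z} then 0 else F (x, y, z, w)) =
      (\<Sum>z\<in>Y. \<Sum>w\<in>Y. indicator distinct4 (x, y, z, w) * F (x, y, z, w))"
  proof (cases "y = x")
    case False
    have "(if z \<in> {x, y} then 0 else \<Sum>w\<in>Y. if w \<in> {x, y, z} then 0 else F (x, y, z, w)) =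
      (\<Sum>w\<in>Y. indicator distinct4 (x, y, z, w) * F (x, y, z, w))" for z
      using False by (cases "z \<in> {x, y}") (auto simp: distinct4_def intro!: sum.cong)
    then show ?thesis using False by simp
  qed (simp add: distinct4_def)
qed

lemma distinct_borel [measurable]:
  "(distinct2 :: ('a::euclidean_space \<times> 'a) set) \<in> sets borel"
  "(distinct3 :: ('a \<times> 'a \<times> 'a) set) \<in> sets borel"
  "(distinct4 :: ('a \<times> 'a \<times> 'a \<times> 'a) set) \<in> sets borel"
proof -
  have "distinct2 = {p :: 'a \<times> 'a. fst p \<noteq> snd p}" by (auto simp: distinct2_def)
  also have "open \<dots>" by (intro open_Collect_neq continuous_intros)
  finally show "(distinct2 :: ('a \<times> 'a) set) \<in> sets borel" by (rule borel_open)
  have "distinct3 = {p :: 'a \<times> 'a \<times> 'a. fst p \<noteq> fst (snd p)} \<inter> {p. fst p \<noteq> snd (snd p)} \<inter> {p. fst (snd p) \<noteq> snd (snd p)}"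
    by (auto simp: distinct3_def)
  also have "open \<dots>" by (intro open_Int open_Collect_neq continuous_intros)
  finally show "(distinct3 :: ('a \<times> 'a \<times> 'a) set) \<in> sets borel" by (rule borel_open)
  have "distinct4 = {p :: 'a \<times> 'a \<times> 'a \<times> 'a. fst p \<noteq> fst (snd p)} \<inter> {p. fst p \<noteq> fst (snd (snd p))}
    \<inter> {p. fst (snd p) \<noteq> fst (snd (snd p))} \<inter> {p. fst p \<noteq> snd (snd (snd p))}
    \<inter> {p. fst (snd p) \<noteq> snd (snd (snd p))} \<inter> {p. fst (snd (snd p)) \<noteq> snd (snd (snd p))}"
    by (auto simp: distinct4_def)
  also have "open \<dots>" by (intro open_Int open_Collect_neq continuous_intros)
  finally show "(distinct4 :: ('a \<times> 'a \<times> 'a \<times> 'a) set) \<in> sets borel" by (rule borel_open)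
qed

section \<open>Injective tuples, the index set of factorial moments\<close>

definition inj_tuples :: "'i set \<Rightarrow> 'a set \<Rightarrow> ('i \<Rightarrow> 'a) set" where
  "inj_tuples K Y = {x \<in> K \<rightarrow>\<^sub>E Y. inj_on x K}"

lemma finite_inj_tuples: "finite K \<Longrightarrow> finite Y \<Longrightarrow> finite (inj_tuples K Y)"
  unfolding inj_tuples_def by (rule finite_subset[OF _ finite_PiE]) auto

lemma inj_tuples_empty: "inj_tuples {} Y = {\<lambda>_. undefined}"
  by (auto simp: inj_tuples_def)

text \<open>An injective tuple on \<open>insert i K\<close> is an injective tuple on
  \<open>K\<close> together with a value at \<open>i\<close> outside its range. Tuples are
  extensional, so the inverse map resets the value at \<open>i\<close> to
  \<open>undefined\<close>.\<close>

lemma sum_inj_tuples_insert: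
  assumes "finite K" "finite Y" "i \<notin> K"
  shows "(\<Sum>x\<in>inj_tuples (insert i K) Y. \<phi> x) = (\<Sum>x\<in>inj_tuples K Y. \<Sum>y\<in>Y - x ` K. \<phi> (x(i := y)))"
proof -
  have bij: "bij_betw (\<lambda>(x, y). x(i := y)) (SIGMA x:inj_tuples K Y. Y - x ` K) (inj_tuples (insert i K) Y)"
  proof (rule bij_betwI[where g = "\<lambda>x. (x(i := undefined), x i)"])
    show "(\<lambda>(x, y). x(i := y)) \<in> (SIGMA x:inj_tuples K Y. Y - x ` K) \<rightarrow> inj_tuples (insert i K) Y"
    proof
      fix p assume "p \<in> (SIGMA x:inj_tuples K Y. Y - x ` K)"
      then obtain x y where p: "p = (x, y)" "x \<in> K \<rightarrow>\<^sub>E Y" "inj_on x K" "y \<in> Y" "y \<notin> x ` K"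
        by (auto simp: inj_tuples_def)
      have "inj_on (x(i := y)) (insert i K)"
        using p(3,5) assms(3) by (auto simp: inj_on_def)
      then show "(case p of (x, y) \<Rightarrow> x(i := y)) \<in> inj_tuples (insert i K) Y"
        using p by (auto simp: inj_tuples_def PiE_fun_upd)
    qed
    show "(\<lambda>x. (x(i := undefined), x i)) \<in> inj_tuples (insert i K) Y \<rightarrow> (SIGMA x:inj_tuples K Y. Y - x ` K)"
    proof
      fix x assume "x \<in> inj_tuples (insert i K) Y"
      then have x: "x \<in> insert i K \<rightarrow>\<^sub>E Y" "inj_on x (insert i K)" by (auto simp: inj_tuples_def)
      have 1: "x(i := undefined) \<in> K \<rightarrow>\<^sub>E Y" using x(1) assms(3) by (auto simp: PiE_iff extensional_def)
      have 2: "inj_on (x(i := undefined)) K" using x(2) assms(3) by (auto simp: inj_on_def)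
      have "(x(i := undefined)) ` K = x ` K" using assms(3) by (intro image_cong) auto
      moreover have "x i \<notin> x ` K" using x(2) assms(3) by (simp add: inj_on_insert)
      ultimately have 3: "x i \<in> Y - (x(i := undefined)) ` K" using x(1) by (simp add: PiE_iff)
      show "(x(i := undefined), x i) \<in> (SIGMA x:inj_tuples K Y. Y - x ` K)"
        using 1 2 3 by (simp add: inj_tuples_def)
    qed
    fix p assume "p \<in> (SIGMA x:inj_tuples K Y. Y - x ` K)"
    then obtain x y where p: "p = (x, y)" "x \<in> K \<rightarrow>\<^sub>E Y" by (auto simp: inj_tuples_def)
    then have "x i = undefined" using assms(3) by (auto simp: PiE_iff extensional_def)
    then show "((case p of (x, y) \<Rightarrow> x(i := y))(i := undefined), (case p of (x, y) \<Rightarrow> x(i := y)) i) = p"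
      using p by (auto simp: fun_eq_iff)
  qed auto
  have "(\<Sum>x\<in>inj_tuples (insert i K) Y. \<phi> x) = (\<Sum>(x, y)\<in>(SIGMA x:inj_tuples K Y. Y - x ` K). \<phi> (x(i := y)))"
    using sum.reindex_bij_betw[OF bij, of \<phi>] by (simp add: case_prod_unfold)
  also have "\<dots> = (\<Sum>x\<in>inj_tuples K Y. \<Sum>y\<in>Y - x ` K. \<phi> (x(i := y)))"
    using assms by (intro sum.Sigma[symmetric] finite_inj_tuples) auto
  finally show ?thesis .
qed

text \<open>Only tuples with all entries in \<open>D\<close> contribute, so the integral over a
  possibly infinite set of tuples is a finite sum.\<close>

lemma nn_integral_inj_tuples:
  assumes K: "finite K" and fin: "finite (Z \<inter> D)" and A: "\<And>i. i \<in> K \<Longrightarrow> A i \<subseteq> D"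
  shows "(\<integral>\<^sup>+x. (\<Prod>i\<in>K. indicator (A i) (x i)) \<partial>count_space {x \<in> K \<rightarrow>\<^sub>E Z. inj_on x K})
    = ennreal (\<Sum>x\<in>inj_tuples K (Z \<inter> D). \<Prod>i\<in>K. indicator (A i) (x i))"
proof -
  have "(\<integral>\<^sup>+x. (\<Prod>i\<in>K. indicator (A i) (x i)) \<partial>count_space {x \<in> K \<rightarrow>\<^sub>E Z. inj_on x K})
    = (\<Sum>x\<in>inj_tuples K (Z \<inter> D). \<Prod>i\<in>K. indicator (A i) (x i) :: ennreal)"
  proof (rule nn_integral_count_space')
    show "finite (inj_tuples K (Z \<inter> D))" using K fin by (rule finite_inj_tuples)
    fix x assume x: "x \<in> {x \<in> K \<rightarrow>\<^sub>E Z. inj_on x K}" "x \<notin> inj_tuples K (Z \<inter> D)"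
    then obtain i where "i \<in> K" "x i \<notin> D" by (auto simp: inj_tuples_def PiE_iff)
    then show "(\<Prod>i\<in>K. indicator (A i) (x i) :: ennreal) = 0"
      using A K by (intro prod_zero) (auto intro!: bexI[of _ i] simp: indicator_def)
  qed (auto simp: inj_tuples_def PiE_iff)
  also have "\<dots> = ennreal (\<Sum>x\<in>inj_tuples K (Z \<inter> D). \<Prod>i\<in>K. indicator (A i) (x i))"
    by (subst sum_ennreal[symmetric]) (auto simp: prod_ennreal[symmetric] prod_nonneg ennreal_indicator)
  finally show ?thesis .
qed

lemma sum_inj_tuples1:
  assumes "finite Y"
  shows "(\<Sum>x\<in>inj_tuples {i} Y. \<Prod>i\<in>{i}. indicator (A i) (x i)) = (\<Sum>x\<in>Y. indicator (A i) x :: real)"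
  using assms by (simp add: sum_inj_tuples_insert inj_tuples_empty)

lemma sum_inj_tuples2:
  assumes "finite Y" "i \<noteq> j"
  shows "(\<Sum>x\<in>inj_tuples {i, j} Y. \<Prod>i\<in>{i, j}. indicator (A i) (x i)) =
    dsum2 Y (\<lambda>(x, y). indicator (A i) x * indicator (A j) y :: real)"
proof -
  have eq: "{i, j} = insert j (insert i {})" by auto
  have ne: "i \<notin> {}" "j \<notin> insert i {}" "i \<noteq> j" using assms(2) by auto
  have fin: "finite {}" "finite (insert i {})" by auto
  show ?thesis
    unfolding eq sum_inj_tuples_insert[OF fin(2) assms(1) ne(2)] sum_inj_tuples_insert[OF fin(1) assms(1) ne(1)]
      inj_tuples_empty dsum2_def
    using ne(3) by (simp add: mult.commute del: sum_mult_indicator sum_indicator_mult)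
qed

lemma sum_inj_tuples3:
  assumes "finite Y" "distinct [i, j, k]"
  shows "(\<Sum>x\<in>inj_tuples {i, j, k} Y. \<Prod>i\<in>{i, j, k}. indicator (A i) (x i)) =
    dsum3 Y (\<lambda>(x, y, z). indicator (A i) x * indicator (A j) y * indicator (A k) z :: real)"
proof -
  have eq: "{i, j, k} = insert k (insert j (insert i {}))" by auto
  have ne: "i \<notin> {}" "j \<notin> insert i {}" "k \<notin> insert j (insert i {})" "i \<noteq> j" "i \<noteq> k" "j \<noteq> k" using assms(2) by auto
  have fin: "finite {}" "finite (insert i {})" "finite (insert j (insert i {}))" by auto
  show ?thesis
    unfolding eq sum_inj_tuples_insert[OF fin(3) assms(1) ne(3)] sum_inj_tuples_insert[OF fin(2) assms(1) ne(2)]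
      sum_inj_tuples_insert[OF fin(1) assms(1) ne(1)] inj_tuples_empty dsum3_def
    using ne(4-6) by (simp add: mult.assoc mult.commute mult.left_commute)
qed

lemma sum_inj_tuples4:
  assumes "finite Y" "distinct [i, j, k, l]"
  shows "(\<Sum>x\<in>inj_tuples {i, j, k, l} Y. \<Prod>i\<in>{i, j, k, l}. indicator (A i) (x i)) =
    dsum4 Y (\<lambda>(x, y, z, w). indicator (A i) x * indicator (A j) y * indicator (A k) z * indicator (A l) w :: real)"
proof -
  have eq: "{i, j, k, l} = insert l (insert k (insert j (insert i {})))" by auto
  have ne: "i \<notin> {}" "j \<notin> insert i {}" "k \<notin> insert j (insert i {})" "l \<notin> insert k (insert j (insert i {}))"
    "i \<noteq> j" "i \<noteq> k" "j \<noteq> k" "i \<noteq> l" "j \<noteq> l" "k \<noteq> l" using assms(2) by auto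
  have fin: "finite {}" "finite (insert i {})" "finite (insert j (insert i {}))"
    "finite (insert k (insert j (insert i {})))" by auto
  show ?thesis
    unfolding eq sum_inj_tuples_insert[OF fin(4) assms(1) ne(4)] sum_inj_tuples_insert[OF fin(3) assms(1) ne(3)]
      sum_inj_tuples_insert[OF fin(2) assms(1) ne(2)]
      sum_inj_tuples_insert[OF fin(1) assms(1) ne(1)] inj_tuples_empty dsum4_def
    using ne(5-10) by (simp add: mult.assoc mult.commute mult.left_commute)
qed

section \<open>Random sums over finite point sets\<close>

lemma sum_indicator_card: "finite Y \<Longrightarrow> (\<Sum>x\<in>Y. indicator A x :: real) = real (card (Y \<inter> A))"
  by (simp add: indicator_def sum.If_cases)

text \<open>By induction over bounded Borel functions it suffices to count points in boxes;
  truncation at level n then handles unbounded \<open>F\<close>.\<close>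

lemma point_sum_measurable:
  fixes Pt :: "'w \<Rightarrow> 'b::euclidean_space set"
  assumes fin: "\<And>\<omega>. \<omega> \<in> space M \<Longrightarrow> finite (Pt \<omega>)"
    and box: "\<And>a b. (\<lambda>\<omega>. real (card (Pt \<omega> \<inter> box a b))) \<in> borel_measurable M"
    and F: "F \<in> borel_measurable borel"
  shows "(\<lambda>\<omega>. \<Sum>p\<in>Pt \<omega>. F p :: real) \<in> borel_measurable M"
proof -
  have bdd: "(\<lambda>\<omega>. \<Sum>p\<in>Pt \<omega>. G p :: real) \<in> borel_measurable M" if "bdd_borel G" for G
    using that
  proof (induction rule: bdd_borel_induct)
    case (box a b)
    have "(\<Sum>p\<in>Pt \<omega>. indicator (box a b) p :: real) = real (card (Pt \<omega> \<inter> box a b))" if "\<omega> \<in> space M" for \<omega>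
      using fin[OF that] by (rule sum_indicator_card)
    then show ?case using assms(2)[of a b] by (subst measurable_cong) auto
  next
    case (lim H G C)
    show ?case
      by (rule borel_measurable_LIMSEQ_real[OF _ lim(4)], rule tendsto_sum, rule lim(3))
  qed (simp_all add: sum.distrib sum_distrib_left[symmetric])
  have lim: "(\<lambda>n. max (- real n) (min (real n) (F p))) \<longlonglongrightarrow> F p" for p
  proof (rule tendsto_eventually)
    obtain k :: nat where "\<bar>F p\<bar> \<le> real k" using real_arch_simple by blast
    then have "max (- real n) (min (real n) (F p)) = F p" if "n \<ge> k" for n
      using that of_nat_mono[OF that, where 'a = real] by (auto simp: min_def max_def)
    then show "\<forall>\<^sub>F n in sequentially. max (- real n) (min (real n) (F p)) = F p"
      using eventually_sequentially by blast
  qed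
  have "bdd_borel (\<lambda>p. max (- real n) (min (real n) (F p)))" for n
    using F by (intro bdd_borelI[where C = "real n"]) auto
  from borel_measurable_LIMSEQ_real[OF tendsto_sum[OF lim] bdd[OF this]] show ?thesis .
qed

text \<open>The integrable number of points dominates all sums that occur. The weight
  \<open>w\<close> is meant for the indicator of tuples with distinct entries.\<close>

lemma fnl_point_sum:
  fixes Pt :: "'w \<Rightarrow> 'b::euclidean_space set"
  assumes fin: "\<And>\<omega>. \<omega> \<in> space M \<Longrightarrow> finite (Pt \<omega>)"
    and box: "\<And>a b. (\<lambda>\<omega>. real (card (Pt \<omega> \<inter> box a b))) \<in> borel_measurable M"
    and int: "integrable M (\<lambda>\<omega>. real (card (Pt \<omega>)))"
    and w: "w \<in> borel_measurable borel" "\<And>p. \<bar>w p\<bar> \<le> 1"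
  shows "bdd_borel F \<Longrightarrow> integrable M (\<lambda>\<omega>. \<Sum>p\<in>Pt \<omega>. w p * F p)"
    and "fnl (\<lambda>F. \<integral>\<omega>. (\<Sum>p\<in>Pt \<omega>. w p * F p) \<partial>M)"
proof -
  have bnd: "\<bar>\<Sum>p\<in>Pt \<omega>. w p * F p\<bar> \<le> C * real (card (Pt \<omega>))" if "\<And>p. \<bar>F p\<bar> \<le> C" for F C \<omega>
  proof -
    have "\<bar>w p * F p\<bar> \<le> C" for p
      using mult_mono[OF w(2)[of p] that[of p]] by (simp add: abs_mult)
    then have "(\<Sum>p\<in>Pt \<omega>. \<bar>w p * F p\<bar>) \<le> (\<Sum>p\<in>Pt \<omega>. C)" by (intro sum_mono)
    also have "(\<Sum>p\<in>Pt \<omega>. C) = C * real (card (Pt \<omega>))" by simp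
    finally show ?thesis using sum_abs[of "\<lambda>p. w p * F p" "Pt \<omega>"] by (rule order_trans[rotated])
  qed
  have meas: "(\<lambda>\<omega>. \<Sum>p\<in>Pt \<omega>. w p * F p) \<in> borel_measurable M" if "F \<in> borel_measurable borel" for F
    using that w by (intro point_sum_measurable[OF fin box]) auto
  have I: "integrable M (\<lambda>\<omega>. \<Sum>p\<in>Pt \<omega>. w p * F p)" if F: "bdd_borel F" for F
  proof -
    obtain C where C: "C \<ge> 0" "\<And>p. \<bar>F p\<bar> \<le> C" using F by (rule bdd_borelE) blast
    have "integrable M (\<lambda>\<omega>. C * real (card (Pt \<omega>)))" using int by simp
    then show ?thesis
      by (rule Bochner_Integration.integrable_bound) (use meas[OF bdd_borelD[OF F]] bnd[OF C(2)] C(1) in auto)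
  qed
  then show "bdd_borel F \<Longrightarrow> integrable M (\<lambda>\<omega>. \<Sum>p\<in>Pt \<omega>. w p * F p)" .
  show "fnl (\<lambda>F. \<integral>\<omega>. (\<Sum>p\<in>Pt \<omega>. w p * F p) \<partial>M)"
  proof (rule fnlI)
    fix f g :: "'b \<Rightarrow> real" assume "bdd_borel f" "bdd_borel g"
    then show "(\<integral>\<omega>. (\<Sum>p\<in>Pt \<omega>. w p * (f p + g p)) \<partial>M) = (\<integral>\<omega>. (\<Sum>p\<in>Pt \<omega>. w p * f p) \<partial>M) + (\<integral>\<omega>. (\<Sum>p\<in>Pt \<omega>. w p * g p) \<partial>M)"
      using I by (simp add: distrib_left sum.distrib)
  next
    fix c and f :: "'b \<Rightarrow> real" assume "bdd_borel f"
    then show "(\<integral>\<omega>. (\<Sum>p\<in>Pt \<omega>. w p * (c * f p)) \<partial>M) = c * (\<integral>\<omega>. (\<Sum>p\<in>Pt \<omega>. w p * f p) \<partial>M)"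
      by (simp add: mult.left_commute[of _ c] sum_distrib_left[symmetric])
  next
    fix F :: "nat \<Rightarrow> 'b \<Rightarrow> real" and f C
    assume F: "\<And>n. F n \<in> borel_measurable borel" "\<And>n x. \<bar>F n x\<bar> \<le> C" "\<And>x. (\<lambda>n. F n x) \<longlonglongrightarrow> f x"
    show "(\<lambda>n. \<integral>\<omega>. (\<Sum>p\<in>Pt \<omega>. w p * F n p) \<partial>M) \<longlonglongrightarrow> (\<integral>\<omega>. (\<Sum>p\<in>Pt \<omega>. w p * f p) \<partial>M)"
    proof (rule integral_dominated_convergence[where w = "\<lambda>\<omega>. C * real (card (Pt \<omega>))"])
      show "(\<lambda>\<omega>. \<Sum>p\<in>Pt \<omega>. w p * f p) \<in> borel_measurable M"
        by (rule meas[OF bdd_borelD[OF bdd_borel_lim(1)[OF F]]])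
      show "AE \<omega> in M. (\<lambda>n. \<Sum>p\<in>Pt \<omega>. w p * F n p) \<longlonglongrightarrow> (\<Sum>p\<in>Pt \<omega>. w p * f p)"
        using F(3) by (intro AE_I2 tendsto_sum tendsto_mult_left)
    qed (use meas[OF F(1)] bnd[OF F(2)] int in auto)
  qed
qed

section \<open>Shifts of Lebesgue measure and coverings by unit cubes\<close>

lemma reflect_nn_integral:
  fixes f :: "'a::euclidean_space \<Rightarrow> ennreal"
  assumes "f \<in> borel_measurable borel"
  shows "(\<integral>\<^sup>+y. f (x - y) \<partial>lborel) = (\<integral>\<^sup>+y. f y \<partial>lborel)"
proof -
  have "(\<integral>\<^sup>+y. f y \<partial>lborel) = (\<integral>\<^sup>+y. f y \<partial>(distr lborel borel (\<lambda>y. x + (-1) *\<^sub>R y)))"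
    by (subst lborel_affine[of "-1" x]) (simp_all add: density_1)
  also have "\<dots> = (\<integral>\<^sup>+y. f (x - y) \<partial>lborel)"
    using assms by (subst nn_integral_distr) auto
  finally show ?thesis by simp
qed

lemma translate_nn_integral:
  fixes f :: "'a::euclidean_space \<Rightarrow> ennreal"
  assumes "f \<in> borel_measurable borel"
  shows "(\<integral>\<^sup>+y. f (x + y) \<partial>lborel) = (\<integral>\<^sup>+y. f y \<partial>lborel)"
proof -
  have "(\<integral>\<^sup>+y. f y \<partial>lborel) = (\<integral>\<^sup>+y. f y \<partial>(distr lborel borel (\<lambda>y. x + 1 *\<^sub>R y)))"
    by (subst lborel_affine[of 1 x]) (simp_all add: density_1)
  also have "\<dots> = (\<integral>\<^sup>+y. f (x + y) \<partial>lborel)"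
    using assms by (subst nn_integral_distr) auto
  finally show ?thesis by simp
qed

lemma borel_translation:
  fixes A :: "'a::euclidean_space set"
  assumes "A \<in> sets borel" shows "(\<lambda>y. y + x) ` A \<in> sets borel"
proof -
  have "(\<lambda>y. y + x) ` A = (\<lambda>y. y - x) -` A \<inter> space borel"
    by (auto intro!: image_eqI[of _ _ "_ - x"])
  also have "\<dots> \<in> sets borel" using assms by (intro measurable_sets[of _ borel borel]) auto
  finally show ?thesis .
qed

lemma unit_cube_borel [measurable]: "(unit_cube :: 'a::euclidean_space set) \<in> sets borel"
proof -
  have "(unit_cube :: 'a set) = (\<Inter>b\<in>Basis. {x. 0 \<le> x \<bullet> b} \<inter> {x. x \<bullet> b < 1})"
    by (auto simp: unit_cube_def)
  also have "\<dots> \<in> sets borel"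
    by (intro sets.finite_INT) (auto intro!: borel_closed borel_open closed_Collect_le open_Collect_less continuous_intros)
  finally show ?thesis .
qed

lemma box_subset_unit_cube: "box 0 One \<subseteq> (unit_cube :: 'a::euclidean_space set)"
  and unit_cube_subset_cbox: "(unit_cube :: 'a set) \<subseteq> cbox 0 One"
  by (auto simp: unit_cube_def mem_box less_imp_le)

lemma emeasure_unit_cube: "emeasure lborel (unit_cube :: 'a::euclidean_space set) = 1"
proof (rule antisym)
  have "emeasure lborel (unit_cube :: 'a set) \<le> emeasure lborel (cbox 0 One :: 'a set)"
    by (rule emeasure_mono[OF unit_cube_subset_cbox]) simp
  also have "\<dots> = 1" by (subst emeasure_lborel_cbox) auto
  finally show "emeasure lborel (unit_cube :: 'a set) \<le> 1" .
  have "1 = emeasure lborel (box 0 One :: 'a set)" by (subst emeasure_lborel_box) auto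
  also have "\<dots> \<le> emeasure lborel (unit_cube :: 'a set)"
    by (rule emeasure_mono[OF box_subset_unit_cube]) simp
  finally show "1 \<le> emeasure lborel (unit_cube :: 'a set)" .
qed

lemma bounded_unit_cube: "bounded (unit_cube :: 'a::euclidean_space set)"
  using unit_cube_subset_cbox bounded_cbox bounded_subset by blast

lemma bounded_translation_right: "bounded A \<Longrightarrow> bounded ((\<lambda>y::'a::real_normed_vector. y + x) ` A)"
  using bounded_translation[of A x] by (simp add: add.commute)

text \<open>A ball of radius 1/2 about \<open>c\<close> lies in the half-open unit cube with lower
  corner \<open>c - (1/2) *\<^sub>R One\<close>, and finitely many such balls cover the compact
  closure of \<open>D\<close>.\<close>

lemma cover_by_unit_cubes:
  fixes D :: "'a::euclidean_space set"
  assumes "bounded D"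
  obtains S where "finite S" "D \<subseteq> (\<Union>x\<in>S. (\<lambda>y. y + x) ` unit_cube)"
proof -
  have "compact (closure D)" using assms by (simp add: compact_eq_bounded_closed bounded_closure)
  moreover have "closure D \<subseteq> (\<Union>c\<in>UNIV. ball c (1/2))"
  proof
    fix x :: 'a
    show "x \<in> (\<Union>c\<in>UNIV. ball c (1/2))" by (rule UN_I[of x]) auto
  qed
  ultimately obtain S where S: "finite S" "closure D \<subseteq> (\<Union>c\<in>S. ball c (1/2))"
    using compactE_image[of "closure D" UNIV "\<lambda>c. ball c (1/2)"] open_ball by metis
  have "ball c (1/2) \<subseteq> (\<lambda>y. y + (c - (1/2) *\<^sub>R One)) ` unit_cube" for c :: 'a
  proof
    fix y assume y: "y \<in> ball c (1/2)"
    have "y - (c - (1/2) *\<^sub>R One) \<in> unit_cube"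
      unfolding unit_cube_def
    proof (intro CollectI ballI)
      fix b :: 'a assume b: "b \<in> Basis"
      have "\<bar>(y - c) \<bullet> b\<bar> \<le> norm (y - c)" using b by (rule Basis_le_norm)
      also have "\<dots> < 1/2" using y by (simp add: dist_norm norm_minus_commute)
      finally have "\<bar>(y - c) \<bullet> b\<bar> < 1 / 2" .
      then have "(y - c) \<bullet> b < 1 / 2" "- (1 / 2) < (y - c) \<bullet> b" unfolding abs_less_iff by linarith+
      moreover have "(y - (c - (1/2) *\<^sub>R One)) \<bullet> b = (y - c) \<bullet> b + 1 / 2"
        using b by (simp add: inner_diff_left)
      ultimately show "0 \<le> (y - (c - (1/2) *\<^sub>R One)) \<bullet> b \<and> (y - (c - (1/2) *\<^sub>R One)) \<bullet> b < 1"
        by simp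
    qed
    then show "y \<in> (\<lambda>y. y + (c - (1/2) *\<^sub>R One)) ` unit_cube"
      by (rule image_eqI[rotated]) simp
  qed
  then have "(\<Union>c\<in>S. ball c (1/2)) \<subseteq> (\<Union>c\<in>S. (\<lambda>y. y + (c - (1/2) *\<^sub>R One)) ` unit_cube)"
    by (intro UN_mono order_refl)
  also have "\<dots> = (\<Union>x\<in>(\<lambda>c. c - (1/2) *\<^sub>R One) ` S. (\<lambda>y. y + x) ` unit_cube)" by simp
  finally have "D \<subseteq> (\<Union>x\<in>(\<lambda>c. c - (1/2) *\<^sub>R One) ` S. (\<lambda>y. y + x) ` unit_cube)"
    using S(2) closure_subset[of D] by (rule_tac order_trans, rule_tac order_trans)
  then show thesis using S(1) by (intro that[of "(\<lambda>c. c - (1/2) *\<^sub>R One) ` S"]) auto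
qed

text \<open>For n \<ge> 4 each of n - 1, n - 2, n - 3 is at least n / 4, and smaller n are absorbed
  by the constant. This converts finite factorial moments, for which shift invariance is stated,
  into finite ordinary ones.\<close>

lemma power4_le_falling: "(n::nat) ^ 4 \<le> 256 + 256 * (n * (n - 1) * (n - 2) * (n - 3))"
proof (cases "n \<le> 3")
  case True
  then have "n ^ 4 \<le> 3 ^ 4" by (rule power_mono) simp
  then show ?thesis by simp
next
  case False
  then have n: "n \<le> 4 * (n - 1)" "n \<le> 4 * (n - 2)" "n \<le> 4 * (n - 3)" by auto
  have "n ^ 4 = n * n * n * n" by (simp only: power4_eq_xxxx)
  also have "\<dots> \<le> n * (4 * (n - 1)) * (4 * (n - 2)) * (4 * (n - 3))"
    by (intro mult_le_mono n order_refl)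
  also have "\<dots> = 64 * (n * (n - 1) * (n - 2) * (n - 3))"
  proof -
    have "n * (4 * a) * (4 * b) * (4 * c) = 64 * (n * a * b * c)" for a b c :: nat by simp
    then show ?thesis .
  qed
  finally show ?thesis by simp
qed

lemma dsum4_const:
  assumes "finite Y"
  shows "dsum4 Y (\<lambda>_. 1) = real (card Y * (card Y - 1) * (card Y - 2) * (card Y - 3))"
proof -
  have "(\<Sum>w\<in>Y - {x, y, z}. 1) = real (card Y - 3)" if "x \<in> Y" "y \<in> Y - {x}" "z \<in> Y - {x, y}" for x y z
  proof -
    have "card {x, y, z} = 3" using that by auto
    then show ?thesis using that assms by (simp add: card_Diff_subset)
  qed
  then have "dsum4 Y (\<lambda>_. 1) = (\<Sum>x\<in>Y. \<Sum>y\<in>Y - {x}. \<Sum>z\<in>Y - {x, y}. real (card Y - 3))"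
    unfolding dsum4_def by (intro sum.cong refl) auto
  also have "\<dots> = (\<Sum>x\<in>Y. \<Sum>y\<in>Y - {x}. real (card Y - 2) * real (card Y - 3))"
  proof (intro sum.cong refl)
    fix x y assume "x \<in> Y" "y \<in> Y - {x}"
    moreover from this have "card {x, y} = 2" by auto
    ultimately show "(\<Sum>z\<in>Y - {x, y}. real (card Y - 3)) = real (card Y - 2) * real (card Y - 3)"
      using assms by (simp add: card_Diff_subset)
  qed
  also have "\<dots> = (\<Sum>x\<in>Y. real (card Y - 1) * (real (card Y - 2) * real (card Y - 3)))"
    using assms by (intro sum.cong refl) (simp add: card_Diff_subset)
  finally show ?thesis by simp
qed

section \<open>Moments of a stationary process up to order four\<close>

locale stationary_point_process =
  fixes M :: "'w measure" and X :: "'w \<Rightarrow> 'a::euclidean_space set"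
  assumes spp: "simple_point_process M X" and stat: "kth_order_stationary 4 M X"
begin

sublocale prob_space M using spp by (simp add: simple_point_process_def)

abbreviation "lam \<equiv> intensity M X"

definition window :: "'a set \<Rightarrow> bool" where
  "window D \<longleftrightarrow> D \<in> sets borel \<and> bounded D"

lemma finite_points: "\<omega> \<in> space M \<Longrightarrow> window D \<Longrightarrow> finite (X \<omega> \<inter> D)"
  using spp by (auto simp: simple_point_process_def window_def)

lemma count_measurable: "window D \<Longrightarrow> (\<lambda>\<omega>. real (card (X \<omega> \<inter> D))) \<in> borel_measurable M"
proof -
  assume "window D"
  then have "point_count X D \<in> M \<rightarrow>\<^sub>M count_space UNIV"
    using spp by (auto simp: simple_point_process_def window_def)
  then have "(\<lambda>\<omega>. real (point_count X D \<omega>)) \<in> borel_measurable M"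
    by (rule measurable_compose) simp
  then show ?thesis by (simp add: point_count_def)
qed

lemma window_Int: "window D \<Longrightarrow> A \<in> sets borel \<Longrightarrow> window (A \<inter> D)" "window D \<Longrightarrow> A \<in> sets borel \<Longrightarrow> window (D \<inter> A)"
  by (auto simp: window_def)

text \<open>A box in a product space is a product of boxes, so the number of tuples in it is a
  product of numbers of points in windows.\<close>

lemma count_box_measurable:
  assumes D: "window D"
  shows "(\<lambda>\<omega>. real (card ((X \<omega> \<inter> D) \<inter> box a b))) \<in> borel_measurable M" (is ?A1)
    and "(\<lambda>\<omega>. real (card ((X \<omega> \<inter> D) \<times> (X \<omega> \<inter> D) \<inter> box p q))) \<in> borel_measurable M" (is ?A2)
    and "(\<lambda>\<omega>. real (card ((X \<omega> \<inter> D) \<times> (X \<omega> \<inter> D) \<times> (X \<omega> \<inter> D) \<inter> box r s))) \<in> borel_measurable M" (is ?A3)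
    and "(\<lambda>\<omega>. real (card ((X \<omega> \<inter> D) \<times> (X \<omega> \<inter> D) \<times> (X \<omega> \<inter> D) \<times> (X \<omega> \<inter> D) \<inter> box t u))) \<in> borel_measurable M" (is ?A4)
proof -
  have [measurable]: "(\<lambda>\<omega>. real (card ((X \<omega> \<inter> D) \<inter> box a b))) \<in> borel_measurable M" for a b
    using count_measurable[OF window_Int(2)[OF D, of "box a b"]] by (simp add: Int_assoc)
  show ?A1 by measurable
  show ?A2
    by (cases p; cases q) (simp add: box_Pair Times_Int_Times card_cartesian_product)
  show ?A3
    by (cases r; cases s) (simp add: box_Pair Times_Int_Times card_cartesian_product)
  show ?A4
    by (cases t; cases u) (simp add: box_Pair Times_Int_Times card_cartesian_product)
qed

lemma dsum_measurable:
  assumes D: "window D"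
  shows "f \<in> borel_measurable borel \<Longrightarrow> (\<lambda>\<omega>. sum f (X \<omega> \<inter> D) :: real) \<in> borel_measurable M"
    and "F \<in> borel_measurable borel \<Longrightarrow> (\<lambda>\<omega>. dsum2 (X \<omega> \<inter> D) F :: real) \<in> borel_measurable M"
    and "G \<in> borel_measurable borel \<Longrightarrow> (\<lambda>\<omega>. dsum3 (X \<omega> \<inter> D) G :: real) \<in> borel_measurable M"
    and "H \<in> borel_measurable borel \<Longrightarrow> (\<lambda>\<omega>. dsum4 (X \<omega> \<inter> D) H :: real) \<in> borel_measurable M"
proof -
  show "f \<in> borel_measurable borel \<Longrightarrow> (\<lambda>\<omega>. sum f (X \<omega> \<inter> D) :: real) \<in> borel_measurable M"
    by (rule point_sum_measurable) (use D in \<open>auto simp: finite_points count_box_measurable\<close>)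
  show "(\<lambda>\<omega>. dsum2 (X \<omega> \<inter> D) F :: real) \<in> borel_measurable M" if [measurable]: "F \<in> borel_measurable borel"
    by (subst measurable_cong[OF dsum2_eq[OF finite_points[OF _ D]]], assumption, rule point_sum_measurable)
      (use D in \<open>auto simp: finite_points count_box_measurable\<close>)
  show "(\<lambda>\<omega>. dsum3 (X \<omega> \<inter> D) G :: real) \<in> borel_measurable M" if [measurable]: "G \<in> borel_measurable borel"
    by (subst measurable_cong[OF dsum3_eq[OF finite_points[OF _ D]]], assumption, rule point_sum_measurable)
      (use D in \<open>auto simp: finite_points count_box_measurable\<close>)
  show "(\<lambda>\<omega>. dsum4 (X \<omega> \<inter> D) H :: real) \<in> borel_measurable M" if [measurable]: "H \<in> borel_measurable borel"
    by (subst measurable_cong[OF dsum4_eq[OF finite_points[OF _ D]]], assumption, rule point_sum_measurable)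
      (use D in \<open>auto simp: finite_points count_box_measurable\<close>)
qed

lemma fact_moment_eq:
  assumes "finite K" "window D" "\<And>i. i \<in> K \<Longrightarrow> A i \<subseteq> D"
  shows "fact_moment M X K A = (\<integral>\<^sup>+\<omega>. ennreal (\<Sum>x\<in>inj_tuples K (X \<omega> \<inter> D). \<Prod>i\<in>K. indicator (A i) (x i)) \<partial>M)"
  unfolding fact_moment_def
  using assms by (intro nn_integral_cong nn_integral_inj_tuples finite_points) auto

lemma fact_moment_first:
  assumes D: "window D"
  shows "fact_moment M X {..<1} (\<lambda>_. D) = (\<integral>\<^sup>+\<omega>. ennreal (real (card (X \<omega> \<inter> D))) \<partial>M)"
proof -
  have "{..<1::nat} = {0}" by auto
  then have "fact_moment M X {..<1} (\<lambda>_. D) = (\<integral>\<^sup>+\<omega>. ennreal (\<Sum>x\<in>inj_tuples {0} (X \<omega> \<inter> D). \<Prod>i\<in>{0::nat}. indicator D (x i)) \<partial>M)"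
    using fact_moment_eq[of "{..<1}" D "\<lambda>_. D"] D by simp
  also have "\<dots> = (\<integral>\<^sup>+\<omega>. ennreal (real (card (X \<omega> \<inter> D))) \<partial>M)"
  proof (intro nn_integral_cong)
    fix \<omega> assume "\<omega> \<in> space M"
    then have "finite (X \<omega> \<inter> D)" using D by (rule finite_points)
    then show "ennreal (\<Sum>x\<in>inj_tuples {0} (X \<omega> \<inter> D). \<Prod>i\<in>{0::nat}. indicator D (x i)) = ennreal (real (card (X \<omega> \<inter> D)))"
      by (subst sum_inj_tuples1) (auto simp: sum_indicator_card Int_absorb1)
  qed
  finally show ?thesis .
qed

lemma fact_moment_fourth:
  assumes D: "window D"
  shows "fact_moment M X {..<4} (\<lambda>_. D) = (\<integral>\<^sup>+\<omega>. ennreal (dsum4 (X \<omega> \<inter> D) (\<lambda>_. 1)) \<partial>M)"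
proof -
  have 4: "{..<4::nat} = {0, 1, 2, 3}" by auto
  have "fact_moment M X {..<4} (\<lambda>_. D) =
      (\<integral>\<^sup>+\<omega>. ennreal (\<Sum>x\<in>inj_tuples {0, 1, 2, 3} (X \<omega> \<inter> D). \<Prod>i\<in>{0, 1, 2, 3 :: nat}. indicator D (x i)) \<partial>M)"
    unfolding 4 using fact_moment_eq[of "{0, 1, 2, 3}" D "\<lambda>_. D"] D by simp
  also have "\<dots> = (\<integral>\<^sup>+\<omega>. ennreal (dsum4 (X \<omega> \<inter> D) (\<lambda>_. 1)) \<partial>M)"
  proof (intro nn_integral_cong)
    fix \<omega> assume "\<omega> \<in> space M"
    then have "finite (X \<omega> \<inter> D)" using D by (rule finite_points)
    then show "ennreal (\<Sum>x\<in>inj_tuples {0, 1, 2, 3} (X \<omega> \<inter> D). \<Prod>i\<in>{0, 1, 2, 3 :: nat}. indicator D (x i)) =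
        ennreal (dsum4 (X \<omega> \<inter> D) (\<lambda>_. 1))"
      by (subst sum_inj_tuples4) (auto simp: dsum4_def intro!: arg_cong[where f = ennreal] sum.cong)
  qed
  finally show ?thesis .
qed

text \<open>The hypothesis gives the ordinary fourth moment of the unit cube alone, while shift
  invariance is available for factorial moments. Hence the passage to the factorial moment, the
  shift, and the way back; finitely many cubes cover \<open>D\<close>, and (x + y)^4 \<le> 16 x^4 +
  16 y^4 joins them.\<close>

lemma fourth_moment_finite:
  assumes D: "window D"
  shows "(\<integral>\<^sup>+\<omega>. ennreal (real (card (X \<omega> \<inter> D)) ^ 4) \<partial>M) < \<infinity>"
proof -
  have [measurable]: "window C \<Longrightarrow> (\<lambda>\<omega>. real (card (X \<omega> \<inter> C))) \<in> borel_measurable M" for C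
    by (rule count_measurable)
  have dm: "window C \<Longrightarrow> (\<lambda>\<omega>. dsum4 (X \<omega> \<inter> C) (\<lambda>_. 1) :: real) \<in> borel_measurable M" for C
    by (rule dsum_measurable) auto
  have C0: "window (unit_cube :: 'a set)" by (simp add: window_def bounded_unit_cube)
  have Cx: "window ((\<lambda>y. y + x) ` (unit_cube :: 'a set))" for x
    using C0 unfolding window_def by (auto intro: borel_translation bounded_translation_right)
  have "fact_moment M X {..<4} (\<lambda>_. unit_cube) < \<infinity>"
  proof -
    have "fact_moment M X {..<4} (\<lambda>_. unit_cube) \<le> (\<integral>\<^sup>+\<omega>. of_nat (point_count X unit_cube \<omega>) ^ 4 \<partial>M)"
      unfolding fact_moment_fourth[OF C0]
    proof (rule nn_integral_mono)
      fix \<omega> assume "\<omega> \<in> space M"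
      then have f: "finite (X \<omega> \<inter> unit_cube)" using C0 by (rule finite_points)
      let ?n = "card (X \<omega> \<inter> unit_cube)"
      have "?n * (?n - 1) * (?n - 2) * (?n - 3) \<le> ?n * ?n * ?n * ?n" by (intro mult_mono) auto
      then have "dsum4 (X \<omega> \<inter> unit_cube) (\<lambda>_. 1) \<le> real (?n ^ 4)"
        unfolding dsum4_const[OF f] of_nat_le_iff power4_eq_xxxx .
      then have "ennreal (dsum4 (X \<omega> \<inter> unit_cube) (\<lambda>_. 1)) \<le> ennreal (real (?n ^ 4))" by (rule ennreal_leI)
      also have "\<dots> = of_nat (point_count X unit_cube \<omega>) ^ 4"
        by (simp add: point_count_def ennreal_of_nat_eq_real_of_nat ennreal_power)
      finally show "ennreal (dsum4 (X \<omega> \<inter> unit_cube) (\<lambda>_. 1)) \<le> of_nat (point_count X unit_cube \<omega>) ^ 4" .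
    qed
    also have "\<dots> < \<infinity>" using stat by (simp add: kth_order_stationary_def)
    finally show ?thesis .
  qed
  moreover have "fact_moment M X {..<4} (\<lambda>_. (\<lambda>y. y + x) ` unit_cube) = fact_moment M X {..<4} (\<lambda>_. unit_cube)" for x
  proof -
    have "\<forall>j\<in>{1..4}. \<forall>A x. (\<forall>i<j. A i \<in> sets borel) \<longrightarrow>
        fact_moment M X {..<j} (\<lambda>i. (\<lambda>y. y + x) ` A i) = fact_moment M X {..<j} A"
      using stat by (simp add: kth_order_stationary_def)
    from this[rule_format, of 4 "\<lambda>_. unit_cube" x] show ?thesis by simp
  qed
  ultimately have fin: "fact_moment M X {..<4} (\<lambda>_. (\<lambda>y. y + x) ` unit_cube) < \<infinity>" for x by simp
  have cube: "(\<integral>\<^sup>+\<omega>. ennreal (real (card (X \<omega> \<inter> (\<lambda>y. y + x) ` unit_cube)) ^ 4) \<partial>M) < \<infinity>" for x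
  proof -
    let ?C = "(\<lambda>y. y + x) ` unit_cube :: 'a set"
    have "(\<integral>\<^sup>+\<omega>. ennreal (real (card (X \<omega> \<inter> ?C)) ^ 4) \<partial>M) \<le> (\<integral>\<^sup>+\<omega>. 256 + 256 * ennreal (dsum4 (X \<omega> \<inter> ?C) (\<lambda>_. 1)) \<partial>M)"
    proof (rule nn_integral_mono)
      fix \<omega> assume "\<omega> \<in> space M"
      then have f: "finite (X \<omega> \<inter> ?C)" using Cx by (rule finite_points)
      have "real (card (X \<omega> \<inter> ?C) ^ 4) \<le> 256 + 256 * dsum4 (X \<omega> \<inter> ?C) (\<lambda>_. 1)"
        using power4_le_falling[of "card (X \<omega> \<inter> ?C)", THEN of_nat_mono[where 'a = real]] unfolding dsum4_const[OF f] by simp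
      then have "ennreal (real (card (X \<omega> \<inter> ?C)) ^ 4) \<le> ennreal (256 + 256 * dsum4 (X \<omega> \<inter> ?C) (\<lambda>_. 1))"
        by (intro ennreal_leI) simp
      also have "\<dots> = 256 + 256 * ennreal (dsum4 (X \<omega> \<inter> ?C) (\<lambda>_. 1))"
        by (simp add: ennreal_plus ennreal_mult dsum4_const[OF f])
      finally show "ennreal (real (card (X \<omega> \<inter> ?C)) ^ 4) \<le> 256 + 256 * ennreal (dsum4 (X \<omega> \<inter> ?C) (\<lambda>_. 1))" .
    qed
    also have "\<dots> = 256 + 256 * fact_moment M X {..<4} (\<lambda>_. ?C)"
      using dm[OF Cx[of x]] by (simp add: nn_integral_add nn_integral_cmult fact_moment_fourth[OF Cx] emeasure_space_1)
    also have "\<dots> < \<infinity>" using fin[of x] by (simp add: ennreal_mult_less_top)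
    finally show ?thesis .
  qed
  obtain S where S: "finite S" "D \<subseteq> (\<Union>x\<in>S. (\<lambda>y. y + x) ` unit_cube)"
    using cover_by_unit_cubes D unfolding window_def by blast
  define U where "U S = (\<Union>x\<in>S. (\<lambda>y. y + x) ` (unit_cube :: 'a set))" for S
  have U: "window (U S)" if "finite S" for S
    unfolding U_def window_def using that Cx by (auto simp: window_def)
  have "(\<integral>\<^sup>+\<omega>. ennreal (real (card (X \<omega> \<inter> U S)) ^ 4) \<partial>M) < \<infinity>"
    using S(1)
  proof (induction S rule: finite_induct)
    case empty
    show ?case by (simp add: U_def)
  next
    case (insert x S)
    let ?C = "(\<lambda>y. y + x) ` unit_cube :: 'a set"
    have "(\<integral>\<^sup>+\<omega>. ennreal (real (card (X \<omega> \<inter> U (insert x S))) ^ 4) \<partial>M) \<le>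
      (\<integral>\<^sup>+\<omega>. 16 * ennreal (real (card (X \<omega> \<inter> ?C)) ^ 4) + 16 * ennreal (real (card (X \<omega> \<inter> U S)) ^ 4) \<partial>M)"
    proof (rule nn_integral_mono)
      fix \<omega> assume \<omega>: "\<omega> \<in> space M"
      let ?a = "real (card (X \<omega> \<inter> ?C))" and ?b = "real (card (X \<omega> \<inter> U S))"
      have "X \<omega> \<inter> U (insert x S) = (X \<omega> \<inter> ?C) \<union> (X \<omega> \<inter> U S)" by (auto simp: U_def)
      then have "card (X \<omega> \<inter> U (insert x S)) \<le> card (X \<omega> \<inter> ?C) + card (X \<omega> \<inter> U S)"
        by (simp add: card_Un_le)
      then have "real (card (X \<omega> \<inter> U (insert x S))) \<le> 2 * max ?a ?b" by linarith
      then have "real (card (X \<omega> \<inter> U (insert x S))) ^ 4 \<le> (2 * max ?a ?b) ^ 4" by (intro power_mono) auto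
      also have "\<dots> = 16 * max ?a ?b ^ 4" by (simp add: power_mult_distrib)
      also have "\<dots> \<le> 16 * ?a ^ 4 + 16 * ?b ^ 4" by (auto simp: max_def)
      finally have "ennreal (real (card (X \<omega> \<inter> U (insert x S))) ^ 4) \<le> ennreal (16 * ?a ^ 4 + 16 * ?b ^ 4)" by (rule ennreal_leI)
      also have "\<dots> = 16 * ennreal (?a ^ 4) + 16 * ennreal (?b ^ 4)" by (simp add: ennreal_plus ennreal_mult)
      finally show "ennreal (real (card (X \<omega> \<inter> U (insert x S))) ^ 4) \<le> 16 * ennreal (?a ^ 4) + 16 * ennreal (?b ^ 4)" .
    qed
    also have "\<dots> = 16 * (\<integral>\<^sup>+\<omega>. ennreal (real (card (X \<omega> \<inter> ?C)) ^ 4) \<partial>M) + 16 * (\<integral>\<^sup>+\<omega>. ennreal (real (card (X \<omega> \<inter> U S)) ^ 4) \<partial>M)"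
      using Cx U[OF insert(1)] by (subst nn_integral_add) (auto simp: nn_integral_cmult)
    also have "\<dots> < \<infinity>" using cube[of x] insert.IH by (simp add: ennreal_mult_less_top)
    finally show ?case .
  qed
  moreover have "(\<integral>\<^sup>+\<omega>. ennreal (real (card (X \<omega> \<inter> D)) ^ 4) \<partial>M) \<le> (\<integral>\<^sup>+\<omega>. ennreal (real (card (X \<omega> \<inter> U S)) ^ 4) \<partial>M)"
  proof (intro nn_integral_mono ennreal_leI power_mono)
    fix \<omega> assume "\<omega> \<in> space M"
    then have "finite (X \<omega> \<inter> U S)" using U[OF S(1)] by (rule finite_points)
    then show "real (card (X \<omega> \<inter> D)) \<le> real (card (X \<omega> \<inter> U S))"
      using S(2) by (auto intro!: card_mono simp: U_def)
  qed auto
  ultimately show ?thesis by (rule order_le_less_trans[rotated])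
qed

lemma count_power_integrable:
  assumes D: "window D" and k: "k \<le> 4"
  shows "integrable M (\<lambda>\<omega>. real (card (X \<omega> \<inter> D)) ^ k)"
proof -
  have m: "(\<lambda>\<omega>. real (card (X \<omega> \<inter> D))) \<in> borel_measurable M" using D by (rule count_measurable)
  have "integrable M (\<lambda>\<omega>. real (card (X \<omega> \<inter> D)) ^ 4)"
    using m fourth_moment_finite[OF D] by (intro integrableI_nonneg) auto
  then have "integrable M (\<lambda>\<omega>. 1 + real (card (X \<omega> \<inter> D)) ^ 4)" by simp
  then show ?thesis
  proof (rule Bochner_Integration.integrable_bound)
    have "real n ^ k \<le> 1 + real n ^ 4" for n
    proof (cases "n = 0")
      case False
      then have "real n ^ k \<le> real n ^ 4" using k by (intro power_increasing) auto
      then show ?thesis by simp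
    qed (simp add: power_0_left)
    then show "AE \<omega> in M. norm (real (card (X \<omega> \<inter> D)) ^ k) \<le> norm (1 + real (card (X \<omega> \<inter> D)) ^ 4)"
      by (intro AE_I2) simp
  qed (use m in measurable)
qed

text \<open>\<open>E1\<close> to \<open>E4\<close> are the integrals against the factorial moment
  measures restricted to a window \<open>D\<close>. The restriction makes them finite for bounded
  integrands, so that they are functionals in the sense of \<open>fnl\<close>.\<close>

definition E1 :: "'a set \<Rightarrow> ('a \<Rightarrow> real) \<Rightarrow> real" where
  "E1 D f = (\<integral>\<omega>. sum f (X \<omega> \<inter> D) \<partial>M)"

definition E2 :: "'a set \<Rightarrow> ('a \<times> 'a \<Rightarrow> real) \<Rightarrow> real" where
  "E2 D F = (\<integral>\<omega>. dsum2 (X \<omega> \<inter> D) F \<partial>M)"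

definition E3 :: "'a set \<Rightarrow> ('a \<times> 'a \<times> 'a \<Rightarrow> real) \<Rightarrow> real" where
  "E3 D F = (\<integral>\<omega>. dsum3 (X \<omega> \<inter> D) F \<partial>M)"

definition E4 :: "'a set \<Rightarrow> ('a \<times> 'a \<times> 'a \<times> 'a \<Rightarrow> real) \<Rightarrow> real" where
  "E4 D F = (\<integral>\<omega>. dsum4 (X \<omega> \<inter> D) F \<partial>M)"

lemma E1_fnl:
  assumes D: "window D"
  shows "fnl (E1 D)" "bdd_borel f \<Longrightarrow> integrable M (\<lambda>\<omega>. sum f (X \<omega> \<inter> D))"
  using fnl_point_sum[of M "\<lambda>\<omega>. X \<omega> \<inter> D" "\<lambda>_. 1"] D count_power_integrable[OF D, of 1]
  unfolding E1_def[abs_def] by (auto simp: finite_points count_box_measurable)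

lemma E2_fnl:
  assumes D: "window D"
  shows "fnl (E2 D)" "bdd_borel F \<Longrightarrow> integrable M (\<lambda>\<omega>. dsum2 (X \<omega> \<inter> D) F)"
proof -
  have "integrable M (\<lambda>\<omega>. real (card ((X \<omega> \<inter> D) \<times> (X \<omega> \<inter> D))))"
    using count_power_integrable[OF D, of 2] by (simp add: card_cartesian_product power2_eq_square)
  note * = fnl_point_sum[OF _ count_box_measurable(2)[OF D] this, of "indicator distinct2"]
  have eq: "dsum2 (X \<omega> \<inter> D) F = (\<Sum>p\<in>(X \<omega> \<inter> D) \<times> (X \<omega> \<inter> D). indicator distinct2 p * F p)" if "\<omega> \<in> space M" for \<omega> and F :: "_ \<Rightarrow> real"
    using that D by (intro dsum2_eq finite_points)
  show "fnl (E2 D)"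
    unfolding E2_def[abs_def] using *(2) D
    by (subst Bochner_Integration.integral_cong[OF refl eq]) (auto simp: finite_points indicator_def)
  show "bdd_borel F \<Longrightarrow> integrable M (\<lambda>\<omega>. dsum2 (X \<omega> \<inter> D) F)"
    using *(1) D by (subst Bochner_Integration.integrable_cong[OF refl eq]) (auto simp: finite_points indicator_def)
qed

lemma E3_fnl:
  assumes D: "window D"
  shows "fnl (E3 D)" "bdd_borel F \<Longrightarrow> integrable M (\<lambda>\<omega>. dsum3 (X \<omega> \<inter> D) F)"
proof -
  have "integrable M (\<lambda>\<omega>. real (card ((X \<omega> \<inter> D) \<times> (X \<omega> \<inter> D) \<times> (X \<omega> \<inter> D))))"
    using count_power_integrable[OF D, of 3] by (simp add: card_cartesian_product power3_eq_cube mult.assoc)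
  note * = fnl_point_sum[OF _ count_box_measurable(3)[OF D] this, of "indicator distinct3"]
  have eq: "dsum3 (X \<omega> \<inter> D) F = (\<Sum>p\<in>(X \<omega> \<inter> D) \<times> (X \<omega> \<inter> D) \<times> (X \<omega> \<inter> D). indicator distinct3 p * F p)" if "\<omega> \<in> space M" for \<omega> and F :: "_ \<Rightarrow> real"
    using that D by (intro dsum3_eq finite_points)
  show "fnl (E3 D)"
    unfolding E3_def[abs_def] using *(2) D
    by (subst Bochner_Integration.integral_cong[OF refl eq]) (auto simp: finite_points indicator_def)
  show "bdd_borel F \<Longrightarrow> integrable M (\<lambda>\<omega>. dsum3 (X \<omega> \<inter> D) F)"
    using *(1) D by (subst Bochner_Integration.integrable_cong[OF refl eq]) (auto simp: finite_points indicator_def)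
qed

lemma E4_fnl:
  assumes D: "window D"
  shows "fnl (E4 D)" "bdd_borel F \<Longrightarrow> integrable M (\<lambda>\<omega>. dsum4 (X \<omega> \<inter> D) F)"
proof -
  have "integrable M (\<lambda>\<omega>. real (card ((X \<omega> \<inter> D) \<times> (X \<omega> \<inter> D) \<times> (X \<omega> \<inter> D) \<times> (X \<omega> \<inter> D))))"
    using count_power_integrable[OF D, of 4] by (simp add: card_cartesian_product power4_eq_xxxx mult.assoc)
  note * = fnl_point_sum[OF _ count_box_measurable(4)[OF D] this, of "indicator distinct4"]
  have eq: "dsum4 (X \<omega> \<inter> D) F = (\<Sum>p\<in>(X \<omega> \<inter> D) \<times> (X \<omega> \<inter> D) \<times> (X \<omega> \<inter> D) \<times> (X \<omega> \<inter> D). indicator distinct4 p * F p)" if "\<omega> \<in> space M" for \<omega> and F :: "_ \<Rightarrow> real"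
    using that D by (intro dsum4_eq finite_points)
  show "fnl (E4 D)"
    unfolding E4_def[abs_def] using *(2) D
    by (subst Bochner_Integration.integral_cong[OF refl eq]) (auto simp: finite_points indicator_def)
  show "bdd_borel F \<Longrightarrow> integrable M (\<lambda>\<omega>. dsum4 (X \<omega> \<inter> D) F)"
    using *(1) D by (subst Bochner_Integration.integrable_cong[OF refl eq]) (auto simp: finite_points indicator_def)
qed

lemma E1_indicator:
  assumes D: "window D" and A: "A \<in> sets borel" "A \<subseteq> D"
  shows "E1 D (indicator A) = (\<integral>\<omega>. real (card (X \<omega> \<inter> A)) \<partial>M)"
  unfolding E1_def
proof (rule Bochner_Integration.integral_cong[OF refl])
  fix \<omega> assume "\<omega> \<in> space M"
  then have f: "finite (X \<omega> \<inter> D)" using D by (rule finite_points)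
  have "X \<omega> \<inter> D \<inter> A = X \<omega> \<inter> A" using A by auto
  then show "sum (indicator A) (X \<omega> \<inter> D) = real (card (X \<omega> \<inter> A))"
    using sum_indicator_card[OF f, of A] by simp
qed

text \<open>Fubini's theorem applied to \<open>1\<^sub>A(x) 1\<^sub>C(x + y)\<close> with the unit cube \<open>C\<close>.\<close>

lemma mean_count:
  assumes A: "window A"
  shows "(\<integral>\<omega>. real (card (X \<omega> \<inter> A)) \<partial>M) = lam * measure lborel A"
proof -
  let ?C = "unit_cube :: 'a set"
  have "bounded (A \<union> ?C)" using A bounded_unit_cube by (simp add: window_def)
  then obtain r where r: "A \<union> ?C \<subseteq> cball 0 r" by (auto simp: bounded_iff subset_iff)
  define D where "D = cball (0::'a) r"
  have D: "window D" "A \<subseteq> D" "?C \<subseteq> D" using r by (auto simp: D_def window_def)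
  have Am [measurable]: "A \<in> sets borel" using A by (simp add: window_def)
  \<comment> \<open>The mean measure on a ball that contains both \<open>A\<close> and the unit
    cube; it is finite, and the two sets compared below stay inside the ball.\<close>
  obtain m where m: "finite_measure m" "sets m = sets borel"
    "\<And>A. A \<in> sets borel \<Longrightarrow> emeasure m A = ennreal (E1 D (indicator A))"
  proof (rule positive_fnl_measure[OF E1_fnl(1)[OF D(1)]])
    show "0 \<le> E1 D f" if "\<And>x. 0 \<le> f x" for f
      unfolding E1_def using that by (intro integral_nonneg_AE AE_I2 sum_nonneg) auto
  qed blast
  interpret m: finite_measure m by fact
  note [measurable_cong] = m(2)
  interpret P: pair_sigma_finite lborel m ..
  have int: "integrable M (\<lambda>\<omega>. real (card (X \<omega> \<inter> S)))" if "window S" for S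
    using count_power_integrable[OF that, of 1] by simp
  have em: "emeasure m S = fact_moment M X {..<1} (\<lambda>_. S)" if "S \<in> sets borel" "S \<subseteq> D" for S
  proof -
    have S: "window S" using that D(1) by (auto simp: window_def intro: bounded_subset)
    show ?thesis
      unfolding fact_moment_first[OF S] m(3)[OF that(1)] E1_indicator[OF D(1) that]
      by (rule nn_integral_eq_integral[symmetric, OF int[OF S]]) simp
  qed
  have inv: "fact_moment M X {..<1} (\<lambda>_. (\<lambda>y. y + x) ` S) = fact_moment M X {..<1} (\<lambda>_. S)" if "S \<in> sets borel" for x S
  proof -
    have "\<forall>j\<in>{1..4}. \<forall>A x. (\<forall>i<j. A i \<in> sets borel) \<longrightarrow>
        fact_moment M X {..<j} (\<lambda>i. (\<lambda>y. y + x) ` A i) = fact_moment M X {..<j} A"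
      using stat by (simp add: kth_order_stationary_def)
    from this[rule_format, of 1 "\<lambda>_. S" x] show ?thesis using that by simp
  qed
  \<comment> \<open>Stationarity enters here: the points x of the cube with x - y in
    \<open>A\<close> form the shift by y of the points x of \<open>A\<close> with x + y in the
    cube.\<close>
  have shift: "(\<integral>\<^sup>+x. indicator ?C x * indicator A (x - y) \<partial>m) = (\<integral>\<^sup>+x. indicator A x * indicator ?C (x + y) \<partial>m)" for y
  proof -
    have s1: "{x. x \<in> ?C \<and> x - y \<in> A} \<in> sets borel" and s2: "{x. x \<in> A \<and> x + y \<in> ?C} \<in> sets borel"
      by measurable
    have "(\<integral>\<^sup>+x. indicator ?C x * indicator A (x - y) \<partial>m) = (\<integral>\<^sup>+x. indicator {x. x \<in> ?C \<and> x - y \<in> A} x \<partial>m)"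
      by (intro nn_integral_cong) (auto simp: indicator_def)
    also have "\<dots> = emeasure m {x. x \<in> ?C \<and> x - y \<in> A}" using s1 m(2) by simp
    also have "\<dots> = fact_moment M X {..<1} (\<lambda>_. {x. x \<in> ?C \<and> x - y \<in> A})" by (rule em[OF s1]) (use D in auto)
    also have "{x. x \<in> ?C \<and> x - y \<in> A} = (\<lambda>x. x + y) ` {x. x \<in> A \<and> x + y \<in> ?C}"
      by (auto intro!: image_eqI[of _ _ "_ - y"])
    also have "fact_moment M X {..<1} (\<lambda>_. (\<lambda>x. x + y) ` {x. x \<in> A \<and> x + y \<in> ?C}) = emeasure m {x. x \<in> A \<and> x + y \<in> ?C}"
      unfolding inv[OF s2] by (rule em[OF s2, symmetric]) (use D in auto)
    also have "\<dots> = (\<integral>\<^sup>+x. indicator {x. x \<in> A \<and> x + y \<in> ?C} x \<partial>m)" using s2 m(2) by simp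
    also have "\<dots> = (\<integral>\<^sup>+x. indicator A x * indicator ?C (x + y) \<partial>m)"
      by (intro nn_integral_cong) (auto simp: indicator_def)
    finally show ?thesis .
  qed
  have "emeasure lborel A * emeasure m ?C = (\<integral>\<^sup>+x. indicator ?C x * (\<integral>\<^sup>+y. indicator A (x - y) \<partial>lborel) \<partial>m)"
    using m(2) by (subst reflect_nn_integral) (auto simp: nn_integral_multc mult.commute)
  also have "\<dots> = (\<integral>\<^sup>+x. \<integral>\<^sup>+y. indicator ?C x * indicator A (x - y) \<partial>lborel \<partial>m)"
    by (intro nn_integral_cong nn_integral_cmult[symmetric]) measurable
  also have "\<dots> = (\<integral>\<^sup>+y. \<integral>\<^sup>+x. indicator ?C x * indicator A (x - y) \<partial>m \<partial>lborel)"
    by (rule P.Fubini') measurable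
  also have "\<dots> = (\<integral>\<^sup>+y. \<integral>\<^sup>+x. indicator A x * indicator ?C (x + y) \<partial>m \<partial>lborel)"
    by (simp only: shift)
  also have "\<dots> = (\<integral>\<^sup>+x. \<integral>\<^sup>+y. indicator A x * indicator ?C (x + y) \<partial>lborel \<partial>m)"
    by (rule P.Fubini'[symmetric]) measurable
  also have "\<dots> = (\<integral>\<^sup>+x. indicator A x * (\<integral>\<^sup>+y. indicator ?C (x + y) \<partial>lborel) \<partial>m)"
    by (intro nn_integral_cong nn_integral_cmult) measurable
  also have "\<dots> = emeasure m A"
    using m(2) by (subst translate_nn_integral) (auto simp: emeasure_unit_cube)
  finally have eq: "emeasure m A = emeasure lborel A * emeasure m ?C" by simp
  have finA: "emeasure lborel A < \<infinity>" using A emeasure_bounded_finite unfolding window_def by blast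
  have "enn2real (emeasure m A) = measure lborel A * enn2real (emeasure m ?C)"
    unfolding eq by (simp add: enn2real_mult measure_def)
  moreover have "enn2real (emeasure m S) = (\<integral>\<omega>. real (card (X \<omega> \<inter> S)) \<partial>M)" if "S \<in> sets borel" "S \<subseteq> D" for S
    unfolding m(3)[OF that(1)] E1_indicator[OF D(1) that] by (simp add: integral_nonneg_AE)
  ultimately show ?thesis
    using D by (simp add: intensity_def point_count_def mult.commute)
qed

text \<open>Campbell's formula: both sides are functionals, and on boxes it is the mean number of
  points in a window.\<close>

lemma E1_eq:
  assumes D: "window D" and f: "bdd_borel f"
  shows "E1 D f = lam * (\<integral>x. indicator D x * f x \<partial>lborel)"
proof (rule fnl_eqI[OF f E1_fnl(1)[OF D]])
  have Dm [measurable]: "D \<in> sets borel" and fin: "emeasure lborel D < \<infinity>"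
    using D emeasure_bounded_finite unfolding window_def by blast+
  have fm: "finite_measure (restrict_space lborel D)"
    using fin by (intro finite_measureI) (simp add: emeasure_restrict_space space_restrict_space)
  have "fnl (\<lambda>f. \<integral>x. 1 * f x \<partial>restrict_space lborel D)"
    by (rule fnl_integral[OF fm]) (auto intro: measurable_restrict_space1)
  also have "(\<lambda>f :: 'a \<Rightarrow> real. \<integral>x. 1 * f x \<partial>restrict_space lborel D) = (\<lambda>f. \<integral>x. indicator D x * f x \<partial>lborel)"
    by (intro ext, subst integral_restrict_space) auto
  finally show "fnl (\<lambda>f. lam * (\<integral>x. indicator D x * f x \<partial>lborel))" by (rule fnl_cmult)
  fix a b
  have "E1 D (indicator (box a b)) = E1 D (indicator (D \<inter> box a b))"
    unfolding E1_def by (intro Bochner_Integration.integral_cong sum.cong refl) (auto simp: indicator_def)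
  also have "\<dots> = lam * measure lborel (D \<inter> box a b)"
    using D by (subst E1_indicator) (auto simp: mean_count window_Int)
  also have "measure lborel (D \<inter> box a b) = (\<integral>x. indicator D x * indicator (box a b) x \<partial>lborel)"
    by (simp add: indicator_inter_arith[symmetric])
  finally show "E1 D (indicator (box a b)) = lam * (\<integral>x. indicator D x * indicator (box a b) x \<partial>lborel)" .
qed

lemma lam_nonneg: "lam \<ge> 0"
  by (simp add: intensity_def)

end

section \<open>Factorial cumulants of low order\<close>

text \<open>A partition of \<open>insert a A\<close> arises by adding \<open>a\<close> to a block of a partition of \<open>A\<close>, or to the
  empty block.\<close>

lemma sum_partitions_insert:
  assumes a: "a \<notin> A" and fin: "finite A"
  shows "(\<Sum>P | partition_on (insert a A) P. \<phi> P) =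
    (\<Sum>Q | partition_on A Q. \<phi> (insert {a} Q) + (\<Sum>B\<in>Q. \<phi> (insert (insert a B) (Q - {B}))))"
proof -
  \<comment> \<open>The inverse map. The union over the blocks containing \<open>a\<close> merely
    selects the single such block \<open>C\<close>; removing the empty set accounts for
    \<open>C = {a}\<close>, whose remainder is the empty block.\<close>
  define g where "g P = (let C = \<Union>{B \<in> P. a \<in> B} in (insert (C - {a}) (P - {C}) - {{}}, C - {a}))" for P
  have bij: "bij_betw (\<lambda>(Q, B). insert (insert a B) (Q - {B}))
      (SIGMA Q:{Q. partition_on A Q}. insert {} Q) {P. partition_on (insert a A) P}"
  proof (rule bij_betwI[where g = g])
    show "(\<lambda>(Q, B). insert (insert a B) (Q - {B})) \<in>
        (SIGMA Q:{Q. partition_on A Q}. insert {} Q) \<rightarrow> {P. partition_on (insert a A) P}"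
    proof
      fix p assume "p \<in> (SIGMA Q:{Q. partition_on A Q}. insert {} Q)"
      then obtain Q B where p: "p = (Q, B)" and Q: "partition_on A Q" and B: "B = {} \<or> B \<in> Q" by auto
      have U: "\<Union>Q = A" and d: "\<And>C E. C \<in> Q \<Longrightarrow> E \<in> Q \<Longrightarrow> C \<noteq> E \<Longrightarrow> C \<inter> E = {}" and ne: "{} \<notin> Q"
        using Q by (auto simp: partition_on_def disjoint_def)
      have "partition_on (insert a A) (insert (insert a B) (Q - {B}))"
      proof (rule partition_onI)
        show "\<Union>(insert (insert a B) (Q - {B})) = insert a A" using U B by auto
        show "{} \<notin> insert (insert a B) (Q - {B})" using ne by auto
        fix C E assume C: "C \<in> insert (insert a B) (Q - {B})" "E \<in> insert (insert a B) (Q - {B})" "C \<noteq> E"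
        have *: "insert a B \<inter> E = {}" if "E \<in> Q - {B}" for E
          using that U a B d[of E B] by auto
        from C consider "C = insert a B" "E \<in> Q - {B}" | "E = insert a B" "C \<in> Q - {B}" | "C \<in> Q" "E \<in> Q" by blast
        then show "disjnt C E"
        proof cases
          case 1 then show ?thesis using *[of E] unfolding disjnt_def by simp
        next
          case 2 then show ?thesis using *[of C] unfolding disjnt_def by auto
        next
          case 3 then show ?thesis using d[of C E] C(3) unfolding disjnt_def by simp
        qed
      qed
      then show "(case p of (Q, B) \<Rightarrow> insert (insert a B) (Q - {B})) \<in> {P. partition_on (insert a A) P}"
        using p by simp
    qed
  next
    show "g \<in> {P. partition_on (insert a A) P} \<rightarrow> (SIGMA Q:{Q. partition_on A Q}. insert {} Q)"
    proof
      fix P assume "P \<in> {P. partition_on (insert a A) P}"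
      then have U: "\<Union>P = insert a A" and d: "\<And>C E. C \<in> P \<Longrightarrow> E \<in> P \<Longrightarrow> C \<noteq> E \<Longrightarrow> C \<inter> E = {}" and ne: "{} \<notin> P"
        by (auto simp: partition_on_def disjoint_def)
      obtain C where C: "C \<in> P" "a \<in> C" using U by blast
      then have "{B \<in> P. a \<in> B} = {C}" using d by blast
      then have g: "g P = (insert (C - {a}) (P - {C}) - {{}}, C - {a})" by (simp add: g_def)
      have "partition_on A (insert (C - {a}) (P - {C}) - {{}})"
      proof (rule partition_onI)
        have aE: "a \<notin> E" if "E \<in> P - {C}" for E using d[of E C] that C by auto
        have PC: "P = insert C (P - {C})" using C(1) by auto
        have "\<Union>(insert (C - {a}) (P - {C}) - {{}}) = (C - {a}) \<union> \<Union>(P - {C})" by auto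
        also have "\<dots> = (C \<union> \<Union>(P - {C})) - {a}" using aE by auto
        also have "C \<union> \<Union>(P - {C}) = \<Union>P" using C(1) by auto
        also have "\<Union>P - {a} = A" using U a by simp
        finally show "\<Union>(insert (C - {a}) (P - {C}) - {{}}) = A" .
        fix E F assume E: "E \<in> insert (C - {a}) (P - {C}) - {{}}" "F \<in> insert (C - {a}) (P - {C}) - {{}}" "E \<noteq> F"
        then consider "E = C - {a}" "F \<in> P - {C}" | "F = C - {a}" "E \<in> P - {C}" | "E \<in> P" "F \<in> P" by blast
        then show "disjnt E F"
        proof cases
          case 1 then show ?thesis using d[of C F] C(1) unfolding disjnt_def by auto
        next
          case 2 then show ?thesis using d[of C E] C(1) unfolding disjnt_def by auto
        next
          case 3 then show ?thesis using d[of E F] E(3) unfolding disjnt_def by simp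
        qed
      qed simp
      then show "g P \<in> (SIGMA Q:{Q. partition_on A Q}. insert {} Q)" unfolding g by auto
    qed
  next
    fix p assume "p \<in> (SIGMA Q:{Q. partition_on A Q}. insert {} Q)"
    then obtain Q B where p: "p = (Q, B)" and Q: "partition_on A Q" and B: "B = {} \<or> B \<in> Q" by auto
    have U: "\<Union>Q = A" and d: "\<And>C E. C \<in> Q \<Longrightarrow> E \<in> Q \<Longrightarrow> C \<noteq> E \<Longrightarrow> C \<inter> E = {}" and ne: "{} \<notin> Q"
      using Q by (auto simp: partition_on_def disjoint_def)
    have aQ: "E \<in> Q \<Longrightarrow> a \<notin> E" for E using U a by auto
    have aB: "a \<notin> B" using B aQ by auto
    have "{E \<in> insert (insert a B) (Q - {B}). a \<in> E} = {insert a B}" using aQ by auto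
    moreover have "Q - {B} - {insert a B} = Q - {B}" using aQ by auto
    moreover have "insert a B - {a} = B" using aB by auto
    ultimately have "g (insert (insert a B) (Q - {B})) = (insert B (Q - {B}) - {{}}, B)"
      by (simp add: g_def)
    also have "insert B (Q - {B}) - {{}} = Q" using B ne by auto
    finally show "g (case p of (Q, B) \<Rightarrow> insert (insert a B) (Q - {B})) = p" using p by simp
  next
    fix P assume "P \<in> {P. partition_on (insert a A) P}"
    then have U: "\<Union>P = insert a A" and d: "\<And>C E. C \<in> P \<Longrightarrow> E \<in> P \<Longrightarrow> C \<noteq> E \<Longrightarrow> C \<inter> E = {}" and ne: "{} \<notin> P"
      by (auto simp: partition_on_def disjoint_def)
    obtain C where C: "C \<in> P" "a \<in> C" using U by blast
    then have "{B \<in> P. a \<in> B} = {C}" using d by blast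
    then have g: "g P = (insert (C - {a}) (P - {C}) - {{}}, C - {a})" by (simp add: g_def)
    have "C - {a} \<notin> P - {C}"
    proof
      assume "C - {a} \<in> P - {C}"
      then have "C - {a} = {}" using d[of "C - {a}" C] C by auto
      then show False using \<open>C - {a} \<in> P - {C}\<close> ne by (metis DiffD1)
    qed
    then have "insert (C - {a}) (P - {C}) - {{}} - {C - {a}} = P - {C}" using ne by auto
    moreover have "insert a (C - {a}) = C" using C by auto
    ultimately show "(case g P of (Q, B) \<Rightarrow> insert (insert a B) (Q - {B})) = P" using g C(1) by auto
  qed
  have finQ: "finite {Q. partition_on A Q}" "\<And>Q. partition_on A Q \<Longrightarrow> finite Q"
    using fin finitely_many_partition_on finite_elements by blast+
  have "(\<Sum>P | partition_on (insert a A) P. \<phi> P) =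
      (\<Sum>(Q, B)\<in>(SIGMA Q:{Q. partition_on A Q}. insert {} Q). \<phi> (insert (insert a B) (Q - {B})))"
    using sum.reindex_bij_betw[OF bij, of \<phi>] by (simp add: case_prod_unfold)
  also have "\<dots> = (\<Sum>Q | partition_on A Q. \<Sum>B\<in>insert {} Q. \<phi> (insert (insert a B) (Q - {B})))"
    using finQ by (intro sum.Sigma[symmetric]) auto
  also have "\<dots> = (\<Sum>Q | partition_on A Q. \<phi> (insert {a} Q) + (\<Sum>B\<in>Q. \<phi> (insert (insert a B) (Q - {B}))))"
  proof (intro sum.cong refl)
    fix Q assume "Q \<in> {Q. partition_on A Q}"
    then have "{} \<notin> Q" "finite Q" using finQ by (auto simp: partition_on_def)
    then show "(\<Sum>B\<in>insert {} Q. \<phi> (insert (insert a B) (Q - {B}))) =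
        \<phi> (insert {a} Q) + (\<Sum>B\<in>Q. \<phi> (insert (insert a B) (Q - {B})))" by simp
  qed
  finally show ?thesis .
qed

lemma sum_partitions_empty: "(\<Sum>P | partition_on {} P. \<phi> P) = \<phi> {}"
  by (simp add: partition_on_empty)

text \<open>\<open>fact_cumulant\<close> with the moments replaced by an arbitrary set function, so
  that the expansions below are pure algebra.\<close>

definition cumulant_sum :: "nat set \<Rightarrow> (nat set \<Rightarrow> real) \<Rightarrow> real" where
  "cumulant_sum K f = (\<Sum>P | partition_on K P. (-1) ^ (card P - 1) * fact (card P - 1) * (\<Prod>L\<in>P. f L))"

lemma sum_partitions_1: "(\<Sum>P | partition_on {0} P. \<phi> P) = \<phi> {{0::nat}}"
  by (subst sum_partitions_insert) (simp_all add: sum_partitions_empty)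

lemma sum_partitions_2: "(\<Sum>P | partition_on {0, 1} P. \<phi> P) = \<phi> {{0}, {1}} + \<phi> {{0, 1::nat}}"
proof -
  have "{0, 1} = insert 1 {0::nat}" by auto
  then have "(\<Sum>P | partition_on {0, 1} P. \<phi> P) =
      (\<Sum>Q | partition_on {0} Q. \<phi> (insert {1} Q) + (\<Sum>B\<in>Q. \<phi> (insert (insert 1 B) (Q - {B}))))"
    by (simp only: sum_partitions_insert[of 1 "{0::nat}"] finite.intros singleton_iff one_neq_zero not_False_eq_True)
  also have "\<dots> = \<phi> {{1}, {0}} + \<phi> {{1, 0}}" by (subst sum_partitions_1) simp
  also have "{{1}, {0}} = {{0}, {1::nat}}" by auto
  also have "{1, 0} = {0, 1::nat}" by auto
  finally show ?thesis .
qed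

lemma sum_partitions_3:
  "(\<Sum>P | partition_on {0, 1, 2} P. \<phi> P) =
    \<phi> {{0}, {1}, {2}} + \<phi> {{0, 2}, {1}} + \<phi> {{0}, {1, 2}} + \<phi> {{0, 1}, {2}} + \<phi> {{0, 1, 2::nat}}"
proof -
  have e: "{0, 1, 2} = insert 2 {0, 1::nat}" "insert {2} {{0}, {1}} = {{0}, {1}, {2::nat}}"
    "{{0}, {1::nat}} - {{0}} = {{1}}" "{{0}, {1::nat}} - {{1}} = {{0}}" "insert 2 {0} = {0, 2::nat}" "insert 2 {1} = {1, 2::nat}"
    "insert {1, 2} {{0}} = {{0}, {1, 2::nat}}" "insert {2} {{0, 1}} = {{0, 1}, {2::nat}}" "insert 2 {0, 1} = {0, 1, 2::nat}"
    by auto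
  have "(\<Sum>P | partition_on {0, 1, 2} P. \<phi> P) =
      (\<Sum>Q | partition_on {0, 1} Q. \<phi> (insert {2} Q) + (\<Sum>B\<in>Q. \<phi> (insert (insert 2 B) (Q - {B}))))"
    unfolding e(1) by (rule sum_partitions_insert) auto
  also have "\<dots> = \<phi> {{0}, {1}, {2}} + (\<phi> {{0, 2}, {1}} + \<phi> {{0}, {1, 2}}) + (\<phi> {{0, 1}, {2}} + \<phi> {{0, 1, 2}})"
  proof -
    have "(\<Sum>B\<in>{{0}, {1}}. \<phi> (insert (insert 2 B) ({{0}, {1}} - {B}))) = \<phi> {{0, 2}, {1}} + \<phi> {{0}, {1, 2}}"
      by (subst sum.insert) (simp_all add: e(3-7) del: One_nat_def)
    moreover have "(\<Sum>B\<in>{{0, 1}}. \<phi> (insert (insert 2 B) ({{0, 1}} - {B}))) = \<phi> {{0, 1, 2}}"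
      using e(9) by (simp del: One_nat_def)
    ultimately show ?thesis by (simp only: sum_partitions_2 e(2,8))
  qed
  finally show ?thesis by (simp only: add.assoc)
qed

text \<open>Fifteen is the fourth Bell number. The terms come in the order in which the element 3 is
  added to the five partitions of {0, 1, 2}.\<close>

lemma sum_partitions_4:
  "(\<Sum>P | partition_on {0, 1, 2, 3} P. \<phi> P) =
    \<phi> {{0}, {1}, {2}, {3}} + \<phi> {{0, 3}, {1}, {2}} + \<phi> {{0}, {1, 3}, {2}} + \<phi> {{0}, {1}, {2, 3}}
    + \<phi> {{0, 2}, {1}, {3}} + \<phi> {{0, 2, 3}, {1}} + \<phi> {{0, 2}, {1, 3}}
    + \<phi> {{0}, {1, 2}, {3}} + \<phi> {{0, 3}, {1, 2}} + \<phi> {{0}, {1, 2, 3}}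
    + \<phi> {{0, 1}, {2}, {3}} + \<phi> {{0, 1, 3}, {2}} + \<phi> {{0, 1}, {2, 3}}
    + \<phi> {{0, 1, 2}, {3}} + \<phi> {{0, 1, 2, 3::nat}}"
proof -
  have e: "{0, 1, 2, 3} = insert 3 {0, 1, 2::nat}" by auto
  have r: "insert 3 {0} = {0, 3::nat}" "insert 3 {1} = {1, 3::nat}" "insert 3 {2} = {2, 3::nat}"
    "insert 3 {0, 2} = {0, 2, 3::nat}" "insert 3 {1, 2} = {1, 2, 3::nat}" "insert 3 {0, 1} = {0, 1, 3::nat}"
    "insert 3 {0, 1, 2} = {0, 1, 2, 3::nat}"
    by auto
  have 1: "(\<Sum>B\<in>{{0}, {1}, {2}}. \<phi> (insert (insert 3 B) ({{0}, {1}, {2}} - {B}))) =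
      \<phi> {{0, 3}, {1}, {2}} + \<phi> {{0}, {1, 3}, {2}} + \<phi> {{0}, {1}, {2, 3}}"
  proof -
    have "{{0}, {1}, {2::nat}} - {{0}} = {{1}, {2}}" "{{0}, {1}, {2::nat}} - {{1}} = {{0}, {2}}"
      "{{0}, {1}, {2::nat}} - {{2}} = {{0}, {1}}" by auto
    moreover have "insert {1, 3} {{0}, {2}} = {{0}, {1, 3}, {2::nat}}" "insert {2, 3} {{0}, {1}} = {{0}, {1}, {2, 3::nat}}" by auto
    ultimately show ?thesis by (simp add: r add.assoc del: One_nat_def)
  qed
  have 2: "(\<Sum>B\<in>{{0, 2}, {1}}. \<phi> (insert (insert 3 B) ({{0, 2}, {1}} - {B}))) = \<phi> {{0, 2, 3}, {1}} + \<phi> {{0, 2}, {1, 3}}"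
  proof -
    have "{{0, 2}, {1::nat}} - {{0, 2}} = {{1}}" "{{0, 2}, {1::nat}} - {{1}} = {{0, 2}}" "{0, 2} \<noteq> {1::nat}" by auto
    moreover have "insert {1, 3} {{0, 2}} = {{0, 2}, {1, 3::nat}}" by auto
    ultimately show ?thesis by (simp add: r add.assoc del: One_nat_def)
  qed
  have 3: "(\<Sum>B\<in>{{0}, {1, 2}}. \<phi> (insert (insert 3 B) ({{0}, {1, 2}} - {B}))) = \<phi> {{0, 3}, {1, 2}} + \<phi> {{0}, {1, 2, 3}}"
  proof -
    have "{{0}, {1, 2::nat}} - {{0}} = {{1, 2}}" "{{0}, {1, 2::nat}} - {{1, 2}} = {{0}}" "{0} \<noteq> {1, 2::nat}" by auto
    moreover have "insert {1, 2, 3} {{0}} = {{0}, {1, 2, 3::nat}}" by auto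
    ultimately show ?thesis by (simp add: r add.assoc del: One_nat_def)
  qed
  have 4: "(\<Sum>B\<in>{{0, 1}, {2}}. \<phi> (insert (insert 3 B) ({{0, 1}, {2}} - {B}))) = \<phi> {{0, 1, 3}, {2}} + \<phi> {{0, 1}, {2, 3}}"
  proof -
    have "{{0, 1}, {2::nat}} - {{0, 1}} = {{2}}" "{{0, 1}, {2::nat}} - {{2}} = {{0, 1}}" "{0, 1} \<noteq> {2::nat}" by auto
    moreover have "insert {2, 3} {{0, 1}} = {{0, 1}, {2, 3::nat}}" by auto
    ultimately show ?thesis by (simp add: r add.assoc del: One_nat_def)
  qed
  have 5: "(\<Sum>B\<in>{{0, 1, 2}}. \<phi> (insert (insert 3 B) ({{0, 1, 2}} - {B}))) = \<phi> {{0, 1, 2, 3}}"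
    by (simp add: r add.assoc del: One_nat_def)
  have s: "insert {3} {{0}, {1}, {2}} = {{0}, {1}, {2}, {3::nat}}" "insert {3} {{0, 2}, {1}} = {{0, 2}, {1}, {3::nat}}"
    "insert {3} {{0}, {1, 2}} = {{0}, {1, 2}, {3::nat}}" "insert {3} {{0, 1}, {2}} = {{0, 1}, {2}, {3::nat}}"
    "insert {3} {{0, 1, 2}} = {{0, 1, 2}, {3::nat}}" by auto
  have "(\<Sum>P | partition_on {0, 1, 2, 3} P. \<phi> P) =
      (\<Sum>Q | partition_on {0, 1, 2} Q. \<phi> (insert {3} Q) + (\<Sum>B\<in>Q. \<phi> (insert (insert 3 B) (Q - {B}))))"
    unfolding e by (rule sum_partitions_insert) auto
  then show ?thesis by (simp only: sum_partitions_3 1 2 3 4 5 s add.assoc)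
qed

lemma cumulant_sum_2: "cumulant_sum {0, 1} f = f {0, 1} - f {0} * f {1}"
  unfolding cumulant_sum_def sum_partitions_2 by simp

lemma cumulant_sum_3:
  "cumulant_sum {0, 1, 2} f = f {0, 1, 2} - f {0, 1} * f {2} - f {0, 2} * f {1} - f {1, 2} * f {0}
     + 2 * f {0} * f {1} * f {2}"
  unfolding cumulant_sum_def sum_partitions_3 by (simp add: set_eq_subset fact_numeral)

lemma cumulant_sum_4:
  "cumulant_sum {0, 1, 2, 3} f = f {0, 1, 2, 3}
     - f {0, 1, 2} * f {3} - f {0, 1, 3} * f {2} - f {0, 2, 3} * f {1} - f {1, 2, 3} * f {0}
     - f {0, 1} * f {2, 3} - f {0, 2} * f {1, 3} - f {0, 3} * f {1, 2}
     + 2 * (f {0, 1} * f {2} * f {3} + f {0, 2} * f {1} * f {3} + f {0, 3} * f {1} * f {2}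
       + f {1, 2} * f {0} * f {3} + f {1, 3} * f {0} * f {2} + f {2, 3} * f {0} * f {1})
     - 6 * f {0} * f {1} * f {2} * f {3}"
  unfolding cumulant_sum_def sum_partitions_4 by (simp add: set_eq_subset fact_numeral algebra_simps)

section \<open>Moment formulas in terms of cumulant measures\<close>

lemma fst_borel [measurable]: "fst \<in> borel_measurable (borel :: ('a::second_countable_topology \<times> 'b::second_countable_topology) measure)"
  and snd_borel [measurable]: "snd \<in> borel_measurable (borel :: ('a \<times> 'b) measure)"
  by (intro borel_measurable_continuous_onI continuous_intros)+

text \<open>Serves to permute the arguments of \<open>F\<close>, since the variable that is
  integrated out may stand in any place.\<close>

lemma fnl_compose:
  assumes \<Phi>: "fnl \<Phi>" and \<pi>: "\<pi> \<in> borel \<rightarrow>\<^sub>M borel"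
  shows "fnl (\<lambda>F. \<Phi> (\<lambda>p. F (\<pi> p)))"
proof (rule fnlI)
  fix F :: "nat \<Rightarrow> 'b \<Rightarrow> real" and f C
  assume F: "\<And>n. F n \<in> borel_measurable borel" "\<And>n x. \<bar>F n x\<bar> \<le> C" "\<And>x. (\<lambda>n. F n x) \<longlonglongrightarrow> f x"
  show "(\<lambda>n. \<Phi> (\<lambda>p. F n (\<pi> p))) \<longlonglongrightarrow> \<Phi> (\<lambda>p. f (\<pi> p))"
    by (rule fnl_limD[OF \<Phi>]) (use F measurable_compose[OF \<pi> F(1)] in auto)
qed (simp_all add: fnl_addD[OF \<Phi>] fnl_cmultD[OF \<Phi>] bdd_borel_compose[OF _ \<pi>])

section \<open>Factorial moments of rectangles as values of functionals\<close>

context stationary_point_process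
begin

text \<open>The intensity measure on \<open>D\<close>. Integrating one argument against it is what
  the centring of a point subtracts.\<close>

definition leb :: "'a set \<Rightarrow> 'a measure" where
  "leb D = density lborel (\<lambda>x. ennreal (lam * indicator D x))"

lemma sets_leb [simp, measurable_cong]: "sets (leb D) = sets borel"
  by (simp add: leb_def)

lemma space_leb [simp]: "space (leb D) = UNIV"
  by (simp add: leb_def)

lemma finite_leb: "window D \<Longrightarrow> finite_measure (leb D)"
proof -
  assume D: "window D"
  then have Dm: "D \<in> sets borel" and fin: "emeasure lborel D < \<infinity>"
    using emeasure_bounded_finite unfolding window_def by blast+
  have "emeasure (leb D) UNIV = (\<integral>\<^sup>+x. ennreal lam * indicator D x \<partial>lborel)"
    unfolding leb_def using Dm lam_nonneg
    by (subst emeasure_density) (auto simp: ennreal_mult ennreal_indicator)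
  also have "\<dots> = ennreal lam * emeasure lborel D" using Dm by (simp add: nn_integral_cmult)
  finally show ?thesis using fin by (intro finite_measureI) (simp add: ennreal_mult_less_top less_top[symmetric] ennreal_mult_eq_top_iff)
qed

lemma integral_leb:
  assumes "window D" "f \<in> borel_measurable borel"
  shows "(\<integral>x. f x \<partial>leb D) = lam * (\<integral>x. indicator D x * f x \<partial>lborel)"
  unfolding leb_def using assms lam_nonneg
  by (subst integral_density) (auto simp: window_def mult.assoc)

lemma E1_leb: "window D \<Longrightarrow> bdd_borel f \<Longrightarrow> E1 D f = (\<integral>x. f x \<partial>leb D)"
  by (simp add: E1_eq integral_leb bdd_borelD)

lemma leb_fnl: "window D \<Longrightarrow> fnl (\<lambda>f. \<integral>x. f x \<partial>leb D)"
  using fnl_integral[OF finite_leb, of D "\<lambda>x. x" "\<lambda>_. 1" 1] by (simp add: measurable_ident_sets)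

lemma E2_scale: "E2 D (\<lambda>p. c * F p) = c * E2 D F"
  by (simp add: E2_def dsum2_def sum_distrib_left[symmetric])

lemma E3_scale: "E3 D (\<lambda>p. c * F p) = c * E3 D F"
  by (simp add: E3_def dsum3_def sum_distrib_left[symmetric])

text \<open>Bridges two notions of integral: factorial moments are nonnegative extended integrals,
  \<open>E1\<close> to \<open>E4\<close> are Bochner integrals.\<close>

lemma moment_value:
  assumes D: "window D" and fin: "finite K" and AK: "\<And>i. i \<in> K \<Longrightarrow> A i \<subseteq> D"
    and f: "\<And>\<omega>. \<omega> \<in> space M \<Longrightarrow> f \<omega> = (\<Sum>x\<in>inj_tuples K (X \<omega> \<inter> D). \<Prod>i\<in>K. indicator (A i) (x i))"
    and int: "integrable M f"
  shows "enn2real (fact_moment M X K A) = (\<integral>\<omega>. f \<omega> \<partial>M)"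
proof -
  have "fact_moment M X K A = (\<integral>\<^sup>+\<omega>. ennreal (f \<omega>) \<partial>M)"
    using AK by (subst fact_moment_eq[OF fin D]) (auto simp: f intro!: nn_integral_cong)
  also have "\<dots> = ennreal (\<integral>\<omega>. f \<omega> \<partial>M)"
    by (rule nn_integral_eq_integral[OF int]) (auto simp: f intro!: AE_I2 sum_nonneg prod_nonneg)
  finally show ?thesis
    using f by (simp add: integral_nonneg_AE AE_I2 sum_nonneg prod_nonneg)
qed

lemma bdd_borel_tensor2:
  fixes f g :: "'a \<Rightarrow> real"
  assumes "bdd_borel f" "bdd_borel g"
  shows "bdd_borel (\<lambda>(x, y). f x * g y)"
  unfolding case_prod_unfold
  by (rule bdd_borel_mult[OF bdd_borel_compose[OF assms(1) fst_borel] bdd_borel_compose[OF assms(2) snd_borel]])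

lemma bdd_borel_tensor3:
  fixes f g h :: "'a \<Rightarrow> real"
  assumes "bdd_borel f" "bdd_borel g" "bdd_borel h"
  shows "bdd_borel (\<lambda>(x, y, z). f x * g y * h z)"
proof -
  have "bdd_borel (\<lambda>p. f (fst p) * (\<lambda>(y, z). g y * h z) (snd p))"
    by (rule bdd_borel_mult[OF bdd_borel_compose[OF assms(1) fst_borel]
        bdd_borel_compose[OF bdd_borel_tensor2[OF assms(2,3)] snd_borel]])
  then show ?thesis by (simp add: case_prod_unfold mult.assoc)
qed

lemma bdd_borel_tensor4:
  fixes f g h k :: "'a \<Rightarrow> real"
  assumes "bdd_borel f" "bdd_borel g" "bdd_borel h" "bdd_borel k"
  shows "bdd_borel (\<lambda>(x, y, z, w). f x * g y * h z * k w)"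
proof -
  have "bdd_borel (\<lambda>p. f (fst p) * (\<lambda>(y, z, w). g y * h z * k w) (snd p))"
    by (rule bdd_borel_mult[OF bdd_borel_compose[OF assms(1) fst_borel]
        bdd_borel_compose[OF bdd_borel_tensor3[OF assms(2-4)] snd_borel]])
  then show ?thesis by (simp add: case_prod_unfold mult.assoc)
qed

context
  fixes D :: "'a set" and B :: "nat \<Rightarrow> 'a set"
  assumes D: "window D" and B: "\<And>i. B i \<in> sets borel"
begin

private abbreviation "fm K \<equiv> enn2real (fact_moment M X K (\<lambda>i. B i \<inter> D))"

text \<open>This and the next three lemmas evaluate the functionals on products of indicators. The
  sides become \<open>B i \<inter> D\<close> because only points in \<open>D\<close> are
  summed.\<close>

lemma moment1: "(\<integral>x. indicator (B i) x \<partial>leb D) = fm {i}"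
proof -
  have "fm {i} = (\<integral>\<omega>. sum (indicator (B i)) (X \<omega> \<inter> D) \<partial>M)"
  proof (rule moment_value[OF D])
    show "integrable M (\<lambda>\<omega>. sum (indicator (B i)) (X \<omega> \<inter> D) :: real)"
      by (rule E1_fnl(2)[OF D bdd_borel_indicator[OF B]])
    fix \<omega> assume "\<omega> \<in> space M"
    then have fin: "finite (X \<omega> \<inter> D)" using D by (rule finite_points)
    show "sum (indicator (B i)) (X \<omega> \<inter> D) = (\<Sum>x\<in>inj_tuples {i} (X \<omega> \<inter> D). \<Prod>i\<in>{i}. indicator (B i \<inter> D) (x i) :: real)"
      unfolding sum_inj_tuples1[OF fin] by (intro sum.cong) (auto simp: indicator_def)
  qed auto
  then show ?thesis using E1_leb[OF D bdd_borel_indicator[OF B], of i] by (simp add: E1_def)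
qed

lemma moment2:
  assumes "i \<noteq> j"
  shows "E2 D (\<lambda>(x, y). indicator (B i) x * indicator (B j) y) = fm {i, j}"
  unfolding E2_def
proof (rule moment_value[OF D, symmetric])
  show "integrable M (\<lambda>\<omega>. dsum2 (X \<omega> \<inter> D) (\<lambda>(x, y). indicator (B i) x * indicator (B j) y) :: real)"
    by (intro E2_fnl(2)[OF D] bdd_borel_tensor2 bdd_borel_indicator B)
  fix \<omega> assume "\<omega> \<in> space M"
  then have fin: "finite (X \<omega> \<inter> D)" using D by (rule finite_points)
  show "dsum2 (X \<omega> \<inter> D) (\<lambda>(x, y). indicator (B i) x * indicator (B j) y) =
      (\<Sum>x\<in>inj_tuples {i, j} (X \<omega> \<inter> D). \<Prod>i\<in>{i, j}. indicator (B i \<inter> D) (x i) :: real)"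
    unfolding sum_inj_tuples2[OF fin assms] dsum2_def by (intro sum.cong refl) (auto simp: indicator_def)
qed auto

lemma moment3:
  assumes "distinct [i, j, k]"
  shows "E3 D (\<lambda>(x, y, z). indicator (B i) x * indicator (B j) y * indicator (B k) z) = fm {i, j, k}"
  unfolding E3_def
proof (rule moment_value[OF D, symmetric])
  show "integrable M (\<lambda>\<omega>. dsum3 (X \<omega> \<inter> D) (\<lambda>(x, y, z). indicator (B i) x * indicator (B j) y * indicator (B k) z) :: real)"
    by (intro E3_fnl(2)[OF D] bdd_borel_tensor3 bdd_borel_indicator B)
  fix \<omega> assume "\<omega> \<in> space M"
  then have fin: "finite (X \<omega> \<inter> D)" using D by (rule finite_points)
  show "dsum3 (X \<omega> \<inter> D) (\<lambda>(x, y, z). indicator (B i) x * indicator (B j) y * indicator (B k) z) =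
      (\<Sum>x\<in>inj_tuples {i, j, k} (X \<omega> \<inter> D). \<Prod>i\<in>{i, j, k}. indicator (B i \<inter> D) (x i) :: real)"
    unfolding sum_inj_tuples3[OF fin assms] dsum3_def by (intro sum.cong refl) (auto simp: indicator_def)
qed auto

lemma moment4:
  assumes "distinct [i, j, k, l]"
  shows "E4 D (\<lambda>(x, y, z, w). indicator (B i) x * indicator (B j) y * indicator (B k) z * indicator (B l) w) = fm {i, j, k, l}"
  unfolding E4_def
proof (rule moment_value[OF D, symmetric])
  show "integrable M (\<lambda>\<omega>. dsum4 (X \<omega> \<inter> D) (\<lambda>(x, y, z, w). indicator (B i) x * indicator (B j) y * indicator (B k) z * indicator (B l) w) :: real)"
    by (intro E4_fnl(2)[OF D] bdd_borel_tensor4 bdd_borel_indicator B)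
  fix \<omega> assume "\<omega> \<in> space M"
  then have fin: "finite (X \<omega> \<inter> D)" using D by (rule finite_points)
  show "dsum4 (X \<omega> \<inter> D) (\<lambda>(x, y, z, w). indicator (B i) x * indicator (B j) y * indicator (B k) z * indicator (B l) w) =
      (\<Sum>x\<in>inj_tuples {i, j, k, l} (X \<omega> \<inter> D). \<Prod>i\<in>{i, j, k, l}. indicator (B i \<inter> D) (x i) :: real)"
    unfolding sum_inj_tuples4[OF fin assms] dsum4_def by (intro sum.cong refl) (auto simp: indicator_def)
qed auto

end

end

text \<open>The reduced cumulant measures enter through their variations \<open>Q\<^sub>j\<close>, transported to tuples, and
  signs \<open>s\<^sub>j\<close>.\<close>

definition tup1 :: "'a \<Rightarrow> nat \<Rightarrow> 'a" where
  "tup1 y = (\<lambda>i\<in>{..<1}. y)"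

definition tup2 :: "'a \<times> 'a \<Rightarrow> nat \<Rightarrow> 'a" where
  "tup2 p = (\<lambda>i\<in>{..<2}. if i = 0 then fst p else snd p)"

definition tup3 :: "'a \<times> 'a \<times> 'a \<Rightarrow> nat \<Rightarrow> 'a" where
  "tup3 p = (\<lambda>i\<in>{..<3}. if i = 0 then fst p else if i = 1 then fst (snd p) else snd (snd p))"

lemma tup_measurable:
  "tup1 \<in> borel \<rightarrow>\<^sub>M PiM {..<1} (\<lambda>_. borel)"
  "(tup2 :: 'a::second_countable_topology \<times> 'a \<Rightarrow> _) \<in> borel \<rightarrow>\<^sub>M PiM {..<2} (\<lambda>_. borel)"
  "(tup3 :: 'a \<times> 'a \<times> 'a \<Rightarrow> _) \<in> borel \<rightarrow>\<^sub>M PiM {..<3} (\<lambda>_. borel)"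
  unfolding tup1_def[abs_def] tup2_def[abs_def] tup3_def[abs_def]
  by (intro measurable_restrict; measurable)+

lemma indicator_tup:
  "indicator (Pi\<^sub>E {..<1} A) (tup1 y) = (indicator (A 0) y :: real)"
  "indicator (Pi\<^sub>E {..<2} A) (tup2 p) = (indicator (A 0) (fst p) * indicator (A 1) (snd p) :: real)"
  "indicator (Pi\<^sub>E {..<3} A) (tup3 q) =
    (indicator (A 0) (fst q) * indicator (A 1) (fst (snd q)) * indicator (A 2) (snd (snd q)) :: real)"
proof -
  have "{..<1} = {0::nat}" "{..<2} = {0, 1::nat}" "{..<3} = {0, 1, 2::nat}" by auto
  then show "indicator (Pi\<^sub>E {..<1} A) (tup1 y) = (indicator (A 0) y :: real)"
    "indicator (Pi\<^sub>E {..<2} A) (tup2 p) = (indicator (A 0) (fst p) * indicator (A 1) (snd p) :: real)"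
    "indicator (Pi\<^sub>E {..<3} A) (tup3 q) =
      (indicator (A 0) (fst q) * indicator (A 1) (fst (snd q)) * indicator (A 2) (snd (snd q)) :: real)"
    by (auto simp: tup1_def tup2_def tup3_def indicator_def PiE_iff)
qed

locale cumulant_process = stationary_point_process M X
  for M :: "'w measure" and X :: "'w \<Rightarrow> 'a::euclidean_space set" +
  fixes \<gamma> :: "nat \<Rightarrow> (nat \<Rightarrow> 'a) signed_measure"
    and Q2 :: "'a measure" and s2 :: "'a \<Rightarrow> real"
    and Q3 :: "('a \<times> 'a) measure" and s3 :: "'a \<times> 'a \<Rightarrow> real"
    and Q4 :: "('a \<times> 'a \<times> 'a) measure" and s4 :: "'a \<times> 'a \<times> 'a \<Rightarrow> real"
  assumes mixing: "Bk_mixing 4 M X \<gamma>"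
    and Q2: "finite_measure Q2" "sets Q2 = sets borel" "s2 \<in> borel_measurable borel" "\<And>y. \<bar>s2 y\<bar> \<le> 1"
      "\<And>A. A \<in> sets (PiM {..<1} (\<lambda>_. borel)) \<Longrightarrow> signed_value (\<gamma> 2) A = (\<integral>y. s2 y * indicator A (tup1 y) \<partial>Q2)"
    and Q3: "finite_measure Q3" "sets Q3 = sets borel" "s3 \<in> borel_measurable borel" "\<And>y. \<bar>s3 y\<bar> \<le> 1"
      "\<And>A. A \<in> sets (PiM {..<2} (\<lambda>_. borel)) \<Longrightarrow> signed_value (\<gamma> 3) A = (\<integral>y. s3 y * indicator A (tup2 y) \<partial>Q3)"
    and Q4: "finite_measure Q4" "sets Q4 = sets borel" "s4 \<in> borel_measurable borel" "\<And>y. \<bar>s4 y\<bar> \<le> 1"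
      "\<And>A. A \<in> sets (PiM {..<3} (\<lambda>_. borel)) \<Longrightarrow> signed_value (\<gamma> 4) A = (\<integral>y. s4 y * indicator A (tup3 y) \<partial>Q4)"
begin

lemmas [measurable_cong] = Q2(2) Q3(2) Q4(2)
lemmas [measurable] = Q2(3) Q3(3) Q4(3)

text \<open>The integral of \<open>F\<close> against the second factorial cumulant measure on D
  \<times> D, by disintegration. The last argument is the reference point \<open>x\<close>, the
  other one is \<open>y + x\<close> with \<open>y\<close> governed by the signed measure with
  density \<open>s2\<close> with respect to \<open>Q2\<close>; the indicator keeps that point in
  \<open>D\<close> as well. \<open>G3\<close> and \<open>G4\<close> follow the same pattern.\<close>

definition G2 :: "'a set \<Rightarrow> ('a \<times> 'a \<Rightarrow> real) \<Rightarrow> real" where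
  "G2 D F = (\<integral>x. (\<integral>y. (s2 y * indicator D (y + x)) * F (y + x, x) \<partial>Q2) \<partial>leb D)"

definition G3 :: "'a set \<Rightarrow> ('a \<times> 'a \<times> 'a \<Rightarrow> real) \<Rightarrow> real" where
  "G3 D F = (\<integral>x. (\<integral>p. (s3 p * (indicator D (fst p + x) * indicator D (snd p + x)))
     * F (fst p + x, snd p + x, x) \<partial>Q3) \<partial>leb D)"

definition G4 :: "'a set \<Rightarrow> ('a \<times> 'a \<times> 'a \<times> 'a \<Rightarrow> real) \<Rightarrow> real" where
  "G4 D F = (\<integral>x. (\<integral>p. (s4 p * (indicator D (fst p + x) * indicator D (fst (snd p) + x) * indicator D (snd (snd p) + x)))
     * F (fst p + x, fst (snd p) + x, snd (snd p) + x, x) \<partial>Q4) \<partial>leb D)"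

lemma G2_scale: "G2 D (\<lambda>p. c * F p) = c * G2 D F"
  by (simp add: G2_def mult.left_commute[of _ c])

lemma weight_le: "\<bar>s\<bar> \<le> 1 \<Longrightarrow> \<bar>s * (indicator A x * indicator B y * indicator C z)\<bar> \<le> (1::real)"
  "\<bar>s\<bar> \<le> 1 \<Longrightarrow> \<bar>s * (indicator A x * indicator B y)\<bar> \<le> (1::real)" "\<bar>s\<bar> \<le> 1 \<Longrightarrow> \<bar>s * indicator A x\<bar> \<le> (1::real)"
  by (auto simp: indicator_def)

text \<open>\<open>G2\<close> in two arguments with the others frozen, as needed for integrals
  against a product of two cumulant measures or of a cumulant measure with the intensity
  measure.\<close>

lemma G2_param_fnl:
  fixes \<Phi> :: "('c::second_countable_topology \<Rightarrow> real) \<Rightarrow> real"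
  assumes \<Phi>: "fnl \<Phi>" and D: "window D"
  shows "fnl (\<lambda>F. \<Phi> (\<lambda>c. G2 D (\<lambda>p. F (c, p))))"
proof -
  have [measurable]: "D \<in> sets borel" using D by (simp add: window_def)
  have "fnl (\<lambda>F. \<Phi> (\<lambda>c. \<integral>x. 1 * F (c, x) \<partial>leb D))"
    by (rule fnl_comp(1)[OF \<Phi> finite_leb[OF D], of "\<lambda>z. z" "\<lambda>_. 1" 1])
      (auto intro!: measurable_ident_sets simp: borel_prod[symmetric] sets_pair_measure_cong)
  from fnl_comp(1)[OF this Q2(1), of "\<lambda>z. (fst (fst z), snd z + snd (fst z), snd (fst z))"
      "\<lambda>z. s2 (snd z) * indicator D (snd z + snd (fst z))" 1]
  show ?thesis using Q2(4) by (simp add: G2_def weight_le)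
qed

lemma G2_fnl:
  assumes D: "window D" shows "fnl (G2 D)"
proof -
  have [measurable]: "D \<in> sets borel" using D by (simp add: window_def)
  show ?thesis
    using fnl_comp(1)[OF leb_fnl[OF D] Q2(1), of "\<lambda>z. (snd z + fst z, fst z)" "\<lambda>z. s2 (snd z) * indicator D (snd z + fst z)" 1]
      Q2(4) by (simp add: G2_def[abs_def] weight_le)
qed

lemma G3_fnl:
  assumes D: "window D" shows "fnl (G3 D)"
proof -
  have [measurable]: "D \<in> sets borel" using D by (simp add: window_def)
  show ?thesis
    using fnl_comp(1)[OF leb_fnl[OF D] Q3(1), of "\<lambda>z. (fst (snd z) + fst z, snd (snd z) + fst z, fst z)"
        "\<lambda>z. s3 (snd z) * (indicator D (fst (snd z) + fst z) * indicator D (snd (snd z) + fst z))" 1]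
      Q3(4) by (simp add: G3_def[abs_def] weight_le)
qed

lemma G4_fnl:
  assumes D: "window D" shows "fnl (G4 D)"
proof -
  have [measurable]: "D \<in> sets borel" using D by (simp add: window_def)
  show ?thesis
    using fnl_comp(1)[OF leb_fnl[OF D] Q4(1), of "\<lambda>z. (fst (snd z) + fst z, fst (snd (snd z)) + fst z, snd (snd (snd z)) + fst z, fst z)"
        "\<lambda>z. s4 (snd z) * (indicator D (fst (snd z) + fst z) * indicator D (fst (snd (snd z)) + fst z) * indicator D (snd (snd (snd z)) + fst z))" 1]
      Q4(4) by (simp add: G4_def[abs_def] weight_le)
qed

lemma reduced_cumulant: "j \<in> {2..4} \<Longrightarrow> (\<And>i. i < j \<Longrightarrow> window (A i)) \<Longrightarrow> fact_cumulant M X {..<j} A =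
    lam * (\<integral>x. indicator (A (j - 1)) x * signed_value (\<gamma> j) (\<Pi>\<^sub>E i\<in>{..<j-1}. (\<lambda>y. y - x) ` A i) \<partial>lborel)"
  using mixing by (auto simp: Bk_mixing_def reduced_cumulant_measure_def window_def set_lebesgue_integral_def)

lemma PiE_shift_sets:
  fixes m :: nat
  assumes "\<And>i. i < m \<Longrightarrow> A i \<in> sets (borel :: 'a measure)"
  shows "(\<Pi>\<^sub>E i\<in>{..<m}. (\<lambda>y. y - x) ` A i) \<in> sets (PiM {..<m} (\<lambda>_. borel))"
proof (rule sets_PiM_I_finite)
  show "(\<lambda>y. y - x) ` A i \<in> sets borel" if "i \<in> {..<m}" for i
    using borel_translation[of "A i" "- x"] assms that by simp
qed simp

lemma indicator_shift: "indicator ((\<lambda>y. y - x) ` A) y = (indicator A (y + x) :: real)" for x y :: 'a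
  by (auto simp: indicator_def intro!: image_eqI[of _ _ "y + x"])

text \<open>The disintegration of the cumulant measure: a point y of the shifted set A - x
  corresponds to the point y + x of A. The orders three and four repeat the computation.\<close>

lemma G2_value:
  assumes D: "window D" and B: "\<And>i. B i \<in> sets borel"
  shows "G2 D (\<lambda>(x, y). indicator (B 0) x * indicator (B 1) y) = fact_cumulant M X {..<2} (\<lambda>i. B i \<inter> D)"
proof -
  have [measurable]: "D \<in> sets borel" "\<And>i. B i \<in> sets borel" using D B by (simp_all add: window_def)
  interpret Q: finite_measure Q2 by (rule Q2)
  have 1: "fact_cumulant M X {..<2} (\<lambda>i. B i \<inter> D) =
      lam * (\<integral>x. indicator (B 1 \<inter> D) x * signed_value (\<gamma> 2) (\<Pi>\<^sub>E i\<in>{..<1}. (\<lambda>y. y - x) ` (B i \<inter> D)) \<partial>lborel)"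
    using reduced_cumulant[of 2 "\<lambda>i. B i \<inter> D"] D B by (simp add: window_Int)
  have 2: "(\<integral>x. indicator (B 1 \<inter> D) x * signed_value (\<gamma> 2) (\<Pi>\<^sub>E i\<in>{..<1}. (\<lambda>y. y - x) ` (B i \<inter> D)) \<partial>lborel) = (\<integral>x. indicator D x * (\<integral>y. (s2 y * indicator D (y + x)) * (indicator (B 0) (y + x) * indicator (B 1) x) \<partial>Q2) \<partial>lborel)"
  proof (intro Bochner_Integration.integral_cong refl)
    fix x
    have a: "signed_value (\<gamma> 2) (\<Pi>\<^sub>E i\<in>{..<1}. (\<lambda>y. y - x) ` (B i \<inter> D)) = (\<integral>y. s2 y * indicator (B 0 \<inter> D) (y + x) \<partial>Q2)"
      using Q2(5)[OF PiE_shift_sets[of 1 "\<lambda>i. B i \<inter> D" x]] D B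
      by (simp add: indicator_tup indicator_shift del: One_nat_def)
    have b: "indicator (B 1 \<inter> D) x * (\<integral>y. s2 y * indicator (B 0 \<inter> D) (y + x) \<partial>Q2) = indicator D x * (\<integral>y. (s2 y * indicator D (y + x)) * (indicator (B 0) (y + x) * indicator (B 1) x) \<partial>Q2)"
      unfolding integral_mult_right_zero[symmetric]
      by (intro Bochner_Integration.integral_cong refl) (auto simp: indicator_def)
    show "indicator (B 1 \<inter> D) x * signed_value (\<gamma> 2) (\<Pi>\<^sub>E i\<in>{..<1}. (\<lambda>y. y - x) ` (B i \<inter> D)) =
        indicator D x * (\<integral>y. (s2 y * indicator D (y + x)) * (indicator (B 0) (y + x) * indicator (B 1) x) \<partial>Q2)"
      unfolding a by (rule b)
  qed
  have 3: "G2 D (\<lambda>(x, y). indicator (B 0) x * indicator (B 1) y) = lam * (\<integral>x. indicator D x * (\<integral>y. (s2 y * indicator D (y + x)) * (indicator (B 0) (y + x) * indicator (B 1) x) \<partial>Q2) \<partial>lborel)"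
    unfolding G2_def by (subst integral_leb[OF D]) (simp_all, measurable)
  show ?thesis unfolding 1 2 3 ..
qed

lemma G3_value:
  assumes D: "window D" and B: "\<And>i. B i \<in> sets borel"
  shows "G3 D (\<lambda>(x, y, z). indicator (B 0) x * indicator (B 1) y * indicator (B 2) z) = fact_cumulant M X {..<3} (\<lambda>i. B i \<inter> D)"
proof -
  have [measurable]: "D \<in> sets borel" "\<And>i. B i \<in> sets borel" using D B by (simp_all add: window_def)
  interpret Q: finite_measure Q3 by (rule Q3)
  let ?J = "\<lambda>x. \<integral>p. (s3 p * (indicator D (fst p + x) * indicator D (snd p + x))) *
      (indicator (B 0) (fst p + x) * indicator (B 1) (snd p + x) * indicator (B 2) x) \<partial>Q3"
  have 1: "fact_cumulant M X {..<3} (\<lambda>i. B i \<inter> D) =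
      lam * (\<integral>x. indicator (B 2 \<inter> D) x * signed_value (\<gamma> 3) (\<Pi>\<^sub>E i\<in>{..<2}. (\<lambda>y. y - x) ` (B i \<inter> D)) \<partial>lborel)"
    using reduced_cumulant[of 3 "\<lambda>i. B i \<inter> D"] D B by (simp add: window_Int)
  have 2: "(\<integral>x. indicator (B 2 \<inter> D) x * signed_value (\<gamma> 3) (\<Pi>\<^sub>E i\<in>{..<2}. (\<lambda>y. y - x) ` (B i \<inter> D)) \<partial>lborel) = (\<integral>x. indicator D x * ?J x \<partial>lborel)"
  proof (intro Bochner_Integration.integral_cong refl)
    fix x
    have a: "signed_value (\<gamma> 3) (\<Pi>\<^sub>E i\<in>{..<2}. (\<lambda>y. y - x) ` (B i \<inter> D)) =
        (\<integral>p. s3 p * (indicator (B 0 \<inter> D) (fst p + x) * indicator (B 1 \<inter> D) (snd p + x)) \<partial>Q3)"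
      using Q3(5)[OF PiE_shift_sets[of 2 "\<lambda>i. B i \<inter> D" x]] by (simp add: indicator_tup indicator_shift)
    have b: "indicator (B 2 \<inter> D) x * (\<integral>p. s3 p * (indicator (B 0 \<inter> D) (fst p + x) * indicator (B 1 \<inter> D) (snd p + x)) \<partial>Q3) = indicator D x * ?J x"
      unfolding integral_mult_right_zero[symmetric]
      by (intro Bochner_Integration.integral_cong refl) (auto simp: indicator_def)
    show "indicator (B 2 \<inter> D) x * signed_value (\<gamma> 3) (\<Pi>\<^sub>E i\<in>{..<2}. (\<lambda>y. y - x) ` (B i \<inter> D)) = indicator D x * ?J x"
      unfolding a by (rule b)
  qed
  have 3: "G3 D (\<lambda>(x, y, z). indicator (B 0) x * indicator (B 1) y * indicator (B 2) z) = lam * (\<integral>x. indicator D x * ?J x \<partial>lborel)"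
    unfolding G3_def by (subst integral_leb[OF D]) (simp_all, measurable)
  show ?thesis unfolding 1 2 3 ..
qed

lemma G4_value:
  assumes D: "window D" and B: "\<And>i. B i \<in> sets borel"
  shows "G4 D (\<lambda>(x, y, z, w). indicator (B 0) x * indicator (B 1) y * indicator (B 2) z * indicator (B 3) w)
    = fact_cumulant M X {..<4} (\<lambda>i. B i \<inter> D)"
proof -
  have [measurable]: "D \<in> sets borel" "\<And>i. B i \<in> sets borel" using D B by (simp_all add: window_def)
  interpret Q: finite_measure Q4 by (rule Q4)
  let ?J = "\<lambda>x. \<integral>p. (s4 p * (indicator D (fst p + x) * indicator D (fst (snd p) + x) * indicator D (snd (snd p) + x))) *
      (indicator (B 0) (fst p + x) * indicator (B 1) (fst (snd p) + x) * indicator (B 2) (snd (snd p) + x) * indicator (B 3) x) \<partial>Q4"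
  have 1: "fact_cumulant M X {..<4} (\<lambda>i. B i \<inter> D) =
      lam * (\<integral>x. indicator (B 3 \<inter> D) x * signed_value (\<gamma> 4) (\<Pi>\<^sub>E i\<in>{..<3}. (\<lambda>y. y - x) ` (B i \<inter> D)) \<partial>lborel)"
    using reduced_cumulant[of 4 "\<lambda>i. B i \<inter> D"] D B by (simp add: window_Int)
  have 2: "(\<integral>x. indicator (B 3 \<inter> D) x * signed_value (\<gamma> 4) (\<Pi>\<^sub>E i\<in>{..<3}. (\<lambda>y. y - x) ` (B i \<inter> D)) \<partial>lborel) = (\<integral>x. indicator D x * ?J x \<partial>lborel)"
  proof (intro Bochner_Integration.integral_cong refl)
    fix x
    have a: "signed_value (\<gamma> 4) (\<Pi>\<^sub>E i\<in>{..<3}. (\<lambda>y. y - x) ` (B i \<inter> D)) =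
        (\<integral>p. s4 p * (indicator (B 0 \<inter> D) (fst p + x) * indicator (B 1 \<inter> D) (fst (snd p) + x) * indicator (B 2 \<inter> D) (snd (snd p) + x)) \<partial>Q4)"
      using Q4(5)[OF PiE_shift_sets[of 3 "\<lambda>i. B i \<inter> D" x]] by (simp add: indicator_tup indicator_shift)
    have b: "indicator (B 3 \<inter> D) x * (\<integral>p. s4 p * (indicator (B 0 \<inter> D) (fst p + x) * indicator (B 1 \<inter> D) (fst (snd p) + x) * indicator (B 2 \<inter> D) (snd (snd p) + x)) \<partial>Q4) = indicator D x * ?J x"
      unfolding integral_mult_right_zero[symmetric]
      by (intro Bochner_Integration.integral_cong refl) (auto simp: indicator_def)
    show "indicator (B 3 \<inter> D) x * signed_value (\<gamma> 4) (\<Pi>\<^sub>E i\<in>{..<3}. (\<lambda>y. y - x) ` (B i \<inter> D)) = indicator D x * ?J x"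
      unfolding a by (rule b)
  qed
  have 3: "G4 D (\<lambda>(x, y, z, w). indicator (B 0) x * indicator (B 1) y * indicator (B 2) z * indicator (B 3) w) = lam * (\<integral>x. indicator D x * ?J x \<partial>lborel)"
    unfolding G4_def by (subst integral_leb[OF D]) (simp_all, measurable)
  show ?thesis unfolding 1 2 3 ..
qed

lemma fact_cumulant_sum: "fact_cumulant M X K A = cumulant_sum K (\<lambda>L. enn2real (fact_moment M X L A))"
  by (simp add: fact_cumulant_def cumulant_sum_def)

text \<open>On a box this is the definition of the second cumulant solved for the moment.\<close>

lemma E2_cumulant:
  assumes D: "window D" and F: "bdd_borel F"
  shows "E2 D F = G2 D F + (\<integral>x. (\<integral>y. F (x, y) \<partial>leb D) \<partial>leb D)"
proof (rule fnl_eqI[OF F])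
  show "fnl (E2 D)" by (rule E2_fnl[OF D])
  have "fnl (\<lambda>F. \<integral>x. (\<integral>y. 1 * F (x, y) \<partial>leb D) \<partial>leb D)"
    by (rule fnl_comp(1)[OF leb_fnl[OF D] finite_leb[OF D], of "\<lambda>z. z" "\<lambda>_. 1" 1])
      (auto intro!: measurable_ident_sets simp: borel_prod[symmetric] sets_pair_measure_cong)
  then show "fnl (\<lambda>F. G2 D F + (\<integral>x. (\<integral>y. F (x, y) \<partial>leb D) \<partial>leb D))"
    by (intro fnl_add G2_fnl[OF D]) simp
  fix a b :: "'a \<times> 'a"
  define B where "B i = (if i = 0 then box (fst a) (fst b) else box (snd a) (snd b))" for i :: nat
  have B: "B i \<in> sets borel" for i by (simp add: B_def)
  have ind: "indicator (box a b) = (\<lambda>(x, y). indicator (B 0) x * indicator (B 1) y :: real)"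
    by (cases a; cases b) (auto simp: B_def box_Pair indicator_times)
  have 2: "{..<2} = {0, 1::nat}" by auto
  have "G2 D (indicator (box a b)) = E2 D (indicator (box a b))
      - (\<integral>x. indicator (B 0) x \<partial>leb D) * (\<integral>x. indicator (B 1) x \<partial>leb D)"
    unfolding ind G2_value[where B = B, OF D B] fact_cumulant_sum 2 cumulant_sum_2
    using moment2[where D = D and B = B and i = 0 and j = 1] moment1[where D = D and B = B and i = 0]
      moment1[where D = D and B = B and i = 1] D B by simp
  then show "E2 D (indicator (box a b)) = G2 D (indicator (box a b)) + (\<integral>x. (\<integral>y. indicator (box a b) (x, y) \<partial>leb D) \<partial>leb D)"
    unfolding ind by simp
qed

end

section \<open>Products of sums over distinct points\<close>

lemma sum_split2:
  fixes f :: "'a \<Rightarrow> real"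
  assumes "finite Y" "x \<in> Y" "w \<in> Y - {x}"
  shows "sum f Y = f x + f w + sum f (Y - {x, w})"
proof -
  have "Y - {x} - {w} = Y - {x, w}" by auto
  then show ?thesis using assms sum.remove[of Y x f] sum.remove[of "Y - {x}" w f] by simp
qed

lemma dsum2_swap:
  assumes "finite Y" shows "dsum2 Y (\<lambda>p. F (snd p, fst p) :: real) = dsum2 Y F"
  unfolding dsum2_eq[OF assms] sum.cartesian_product'
  by (subst sum.swap) (auto simp: distinct2_def indicator_def intro!: sum.cong)

lemma dsum3_swap:
  assumes "finite Y" shows "dsum3 Y (\<lambda>(x, y, z). F (y, x, z) :: real) = dsum3 Y F"
  unfolding dsum3_eq[OF assms] sum_Times3
  by (subst sum.swap) (auto simp: distinct3_def indicator_def intro!: sum.cong)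

lemma dsum3_swap':
  assumes "finite Y" shows "dsum3 Y (\<lambda>(x, y, z). F (x, z, y) :: real) = dsum3 Y F"
  unfolding dsum3_eq[OF assms] sum_Times3
  by (rule sum.cong[OF refl], subst sum.swap) (auto simp: distinct3_def indicator_def intro!: sum.cong)

lemma dsum4_rotate:
  assumes "finite Y" shows "dsum4 Y (\<lambda>(x, w, y, z). F (x, y, z, w) :: real) = dsum4 Y F"
proof -
  have "(\<Sum>w\<in>Y. \<Sum>y\<in>Y. \<Sum>z\<in>Y. indicator distinct4 (x, w, y, z) * F (x, y, z, w)) =
      (\<Sum>y\<in>Y. \<Sum>z\<in>Y. \<Sum>w\<in>Y. indicator distinct4 (x, y, z, w) * F (x, y, z, w))" for x
  proof -
    have "(\<Sum>w\<in>Y. \<Sum>y\<in>Y. \<Sum>z\<in>Y. indicator distinct4 (x, w, y, z) * F (x, y, z, w)) =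
        (\<Sum>y\<in>Y. \<Sum>w\<in>Y. \<Sum>z\<in>Y. indicator distinct4 (x, w, y, z) * F (x, y, z, w))"
      by (rule sum.swap)
    also have "\<dots> = (\<Sum>y\<in>Y. \<Sum>z\<in>Y. \<Sum>w\<in>Y. indicator distinct4 (x, w, y, z) * F (x, y, z, w))"
      by (intro sum.cong refl sum.swap)
    also have "\<dots> = (\<Sum>y\<in>Y. \<Sum>z\<in>Y. \<Sum>w\<in>Y. indicator distinct4 (x, y, z, w) * F (x, y, z, w))"
      by (intro sum.cong refl) (auto simp: distinct4_def indicator_def)
    finally show ?thesis .
  qed
  then show ?thesis unfolding dsum4_eq[OF assms] sum_Times4 by simp
qed

lemma sum_square: "finite Y \<Longrightarrow> (sum H Y :: real)\<^sup>2 = dsum2 Y (\<lambda>p. H (fst p) * H (snd p)) + (\<Sum>x\<in>Y. (H x)\<^sup>2)"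
proof -
  assume fin: "finite Y"
  have "(sum H Y)\<^sup>2 = (\<Sum>x\<in>Y. H x * sum H Y)" by (simp add: power2_eq_square sum_distrib_right)
  also have "\<dots> = (\<Sum>x\<in>Y. H x * H x + (\<Sum>y\<in>Y - {x}. H x * H y))"
    using fin by (intro sum.cong refl) (simp add: sum.remove[of Y _ H] distrib_left sum_distrib_left)
  finally show ?thesis by (simp add: dsum2_def sum.distrib power2_eq_square)
qed

text \<open>The point of the single sum is either new or one of the two points of the pair; the two
  coincidences contribute equally by symmetry.\<close>

lemma dsum2_times_sum:
  fixes g :: "'a \<times> 'a \<Rightarrow> real"
  assumes fin: "finite Y" and sym: "\<And>x y. g (x, y) = g (y, x)"
  shows "dsum2 Y g * sum H Y = dsum3 Y (\<lambda>p. g (fst p, fst (snd p)) * H (snd (snd p))) + 2 * dsum2 Y (\<lambda>p. g p * H (snd p))"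
proof -
  have "dsum2 Y g * sum H Y = (\<Sum>x\<in>Y. \<Sum>y\<in>Y - {x}. g (x, y) * sum H Y)"
    by (simp add: dsum2_def sum_distrib_right)
  also have "\<dots> = (\<Sum>x\<in>Y. \<Sum>y\<in>Y - {x}. g (x, y) * H x + g (x, y) * H y + (\<Sum>z\<in>Y - {x, y}. g (x, y) * H z))"
    by (intro sum.cong refl) (simp add: sum_split2[OF fin] distrib_left sum_distrib_left)
  also have "\<dots> = dsum2 Y (\<lambda>p. g p * H (fst p)) + dsum2 Y (\<lambda>p. g p * H (snd p))
      + dsum3 Y (\<lambda>p. g (fst p, fst (snd p)) * H (snd (snd p)))"
    by (simp add: dsum2_def dsum3_def sum.distrib)
  also have "dsum2 Y (\<lambda>p. g p * H (fst p)) = dsum2 Y (\<lambda>p. g p * H (snd p))"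
    using dsum2_swap[OF fin, of "\<lambda>p. g p * H (fst p)"] sym by (simp add: dsum2_def)
  finally show ?thesis by simp
qed

text \<open>Two ordered pairs of distinct points share no point, exactly one (in four ways) or both
  (in two ways). In the triple the shared point is put last, because the cumulant measures take the
  last point as reference.\<close>

lemma dsum2_square:
  fixes g :: "'a \<times> 'a \<Rightarrow> real"
  assumes fin: "finite Y" and sym: "\<And>x y. g (x, y) = g (y, x)"
  shows "(dsum2 Y g)\<^sup>2 = dsum4 Y (\<lambda>(x, y, z, w). g (x, w) * g (y, z))
    + 4 * dsum3 Y (\<lambda>(x, y, z). g (x, z) * g (y, z)) + 2 * dsum2 Y (\<lambda>p. (g p)\<^sup>2)"
proof -
  \<comment> \<open>The whole sum sorted by its coincidences with a fixed pair \<open>x\<close>,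
    \<open>w\<close>.\<close>
  have S: "dsum2 Y g = 2 * g (x, w) + 2 * (\<Sum>z\<in>Y - {x, w}. g (x, z)) + 2 * (\<Sum>z\<in>Y - {x, w}. g (z, w))
      + (\<Sum>y\<in>Y - {x, w}. \<Sum>z\<in>Y - {x, w, y}. g (y, z))" if xw: "x \<in> Y" "w \<in> Y - {x}" for x w
  proof -
    have "(\<Sum>z\<in>Y - {x}. g (x, z)) = g (x, w) + (\<Sum>z\<in>Y - {x, w}. g (x, z))"
    proof -
      have "Y - {x} - {w} = Y - {x, w}" by auto
      then show ?thesis using sum.remove[of "Y - {x}" w "\<lambda>z. g (x, z)"] fin xw by simp
    qed
    moreover have "(\<Sum>z\<in>Y - {w}. g (w, z)) = g (w, x) + (\<Sum>z\<in>Y - {x, w}. g (w, z))"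
    proof -
      have "Y - {w} - {x} = Y - {x, w}" by auto
      then show ?thesis using sum.remove[of "Y - {w}" x "\<lambda>z. g (w, z)"] fin xw by auto
    qed
    moreover have "(\<Sum>z\<in>Y - {y}. g (y, z)) = g (y, x) + g (y, w) + (\<Sum>z\<in>Y - {x, w, y}. g (y, z))"
      if "y \<in> Y - {x, w}" for y
    proof -
      have "Y - {y} - {x, w} = Y - {x, w, y}" by auto
      then show ?thesis using sum_split2[of "Y - {y}" x w "\<lambda>z. g (y, z)"] fin xw that by auto
    qed
    ultimately have "dsum2 Y g = g (x, w) + (\<Sum>z\<in>Y - {x, w}. g (x, z)) + (g (w, x) + (\<Sum>z\<in>Y - {x, w}. g (w, z)))
        + (\<Sum>y\<in>Y - {x, w}. g (y, x) + g (y, w) + (\<Sum>z\<in>Y - {x, w, y}. g (y, z)))"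
      unfolding dsum2_def by (subst sum_split2[OF fin xw]) simp
    moreover have "g (w, x) = g (x, w)" "\<And>z. g (w, z) = g (z, w)" "\<And>z. g (z, x) = g (x, z)" using sym by auto
    ultimately show ?thesis by (simp add: sum.distrib)
  qed
  have "(dsum2 Y g)\<^sup>2 = (\<Sum>x\<in>Y. \<Sum>w\<in>Y - {x}. g (x, w) * dsum2 Y g)"
    unfolding power2_eq_square by (subst (1) dsum2_def) (simp add: sum_distrib_right)
  also have "\<dots> = (\<Sum>x\<in>Y. \<Sum>w\<in>Y - {x}. 2 * (g (x, w))\<^sup>2 + 2 * (\<Sum>z\<in>Y - {x, w}. g (x, w) * g (x, z))
      + 2 * (\<Sum>z\<in>Y - {x, w}. g (x, w) * g (z, w)) + (\<Sum>y\<in>Y - {x, w}. \<Sum>z\<in>Y - {x, w, y}. g (x, w) * g (y, z)))"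
    by (intro sum.cong refl) (simp add: S sum_distrib_left algebra_simps power2_eq_square)
  also have "\<dots> = 2 * dsum2 Y (\<lambda>p. (g p)\<^sup>2) + 2 * dsum3 Y (\<lambda>(x, w, z). g (x, w) * g (x, z))
      + 2 * dsum3 Y (\<lambda>(x, w, z). g (x, w) * g (z, w)) + dsum4 Y (\<lambda>(x, w, y, z). g (x, w) * g (y, z))"
    by (simp add: dsum2_def dsum3_def dsum4_def sum.distrib sum_distrib_left)
  also have "dsum3 Y (\<lambda>(x, w, z). g (x, w) * g (z, w)) = dsum3 Y (\<lambda>(x, y, z). g (x, z) * g (y, z))"
    using dsum3_swap'[OF fin, of "\<lambda>(x, y, z). g (x, z) * g (y, z)"] by (simp add: case_prod_unfold)
  also have "dsum3 Y (\<lambda>(x, w, z). g (x, w) * g (x, z)) = dsum3 Y (\<lambda>(x, y, z). g (x, z) * g (y, z))"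
  proof -
    have "dsum3 Y (\<lambda>(x, w, z). g (x, w) * g (x, z)) = dsum3 Y (\<lambda>(x, w, z). g (w, x) * g (w, z))"
      using dsum3_swap[OF fin, of "\<lambda>(x, w, z). g (x, w) * g (x, z)"] by (simp add: case_prod_unfold)
    also have "(\<lambda>(x, w, z). g (w, x) * g (w, z)) = (\<lambda>(x, w, z). g (x, w) * g (z, w))"
      using sym by (auto simp: fun_eq_iff)
    also have "dsum3 Y (\<lambda>(x, w, z). g (x, w) * g (z, w)) = dsum3 Y (\<lambda>(x, y, z). g (x, z) * g (y, z))"
      using dsum3_swap'[OF fin, of "\<lambda>(x, y, z). g (x, z) * g (y, z)"] by (simp add: case_prod_unfold)
    finally show ?thesis .
  qed
  also have "dsum4 Y (\<lambda>(x, w, y, z). g (x, w) * g (y, z)) = dsum4 Y (\<lambda>(x, y, z, w). g (x, w) * g (y, z))"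
    using dsum4_rotate[OF fin, of "\<lambda>(x, y, z, w). g (x, w) * g (y, z)"] by (simp add: case_prod_unfold)
  finally show ?thesis by simp
qed

section \<open>Centred moments of order three and four\<close>

context cumulant_process
begin

lemma leb_param_fnl:
  fixes \<Phi> :: "('c::second_countable_topology \<Rightarrow> real) \<Rightarrow> real"
  assumes \<Phi>: "fnl \<Phi>" and D: "window D"
  shows "fnl (\<lambda>F. \<Phi> (\<lambda>c. \<integral>x. F (c, x) \<partial>leb D))"
proof -
  have "(\<lambda>z :: 'c \<times> 'a. (fst z, snd z)) \<in> borel \<Otimes>\<^sub>M leb D \<rightarrow>\<^sub>M borel" by measurable
  from fnl_comp(1)[OF \<Phi> finite_leb[OF D] this, of "\<lambda>_. 1" 1] show ?thesis by simp
qed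

lemma measure_leb:
  assumes "window D" "\<And>i. B i \<in> sets borel"
  shows "measure (leb D) (B i) = enn2real (fact_moment M X {i} (\<lambda>i. B i \<inter> D))"
  using moment1[where D = D and B = B and i = i] assms by simp

text \<open>Only the first two arguments are centred. When the third moment is expanded into
  cumulants, every term in which the first or the second point forms a block of its own cancels. The
  third cumulant remains, and the block of the first two points with the third one free. Squaring a
  pair sum leads to this form.\<close>

lemma E3_cumulant:
  assumes D: "window D" and F: "bdd_borel F"
  shows "E3 D F - E2 D (\<lambda>p. \<integral>y. F (fst p, y, snd p) \<partial>leb D) - E2 D (\<lambda>p. \<integral>y. F (y, fst p, snd p) \<partial>leb D)
      + (\<integral>z. (\<integral>y. (\<integral>x. F (x, y, z) \<partial>leb D) \<partial>leb D) \<partial>leb D)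
    = G3 D F + (\<integral>z. G2 D (\<lambda>p. F (fst p, snd p, z)) \<partial>leb D)"
proof (rule fnl_eqI[OF F])
  have m: "(\<lambda>q. (fst (fst q), snd q, snd (fst q))) \<in> borel \<rightarrow>\<^sub>M (borel :: ('a \<times> 'a \<times> 'a) measure)"
    "(\<lambda>q. (snd q, fst (fst q), snd (fst q))) \<in> borel \<rightarrow>\<^sub>M (borel :: ('a \<times> 'a \<times> 'a) measure)"
    "(\<lambda>q. (snd q, snd (fst q), fst (fst q))) \<in> borel \<rightarrow>\<^sub>M (borel :: ('a \<times> 'a \<times> 'a) measure)"
    "(\<lambda>q. (fst (snd q), snd (snd q), fst q)) \<in> borel \<rightarrow>\<^sub>M (borel :: ('a \<times> 'a \<times> 'a) measure)"
    by measurable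
  have f1: "fnl (\<lambda>F. E2 D (\<lambda>p. \<integral>y. F (fst p, y, snd p) \<partial>leb D))"
    using fnl_compose[OF leb_param_fnl[OF E2_fnl(1)[OF D] D] m(1)] by simp
  have f2: "fnl (\<lambda>F. E2 D (\<lambda>p. \<integral>y. F (y, fst p, snd p) \<partial>leb D))"
    using fnl_compose[OF leb_param_fnl[OF E2_fnl(1)[OF D] D] m(2)] by simp
  have f3: "fnl (\<lambda>F. \<integral>z. (\<integral>y. (\<integral>x. F (x, y, z) \<partial>leb D) \<partial>leb D) \<partial>leb D)"
    using fnl_compose[OF leb_param_fnl[OF leb_param_fnl[OF leb_fnl[OF D] D] D] m(3)] by simp
  have f4: "fnl (\<lambda>F. \<integral>z. G2 D (\<lambda>p. F (fst p, snd p, z)) \<partial>leb D)"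
    using fnl_compose[OF G2_param_fnl[OF leb_fnl[OF D] D] m(4)] by simp
  show "fnl (\<lambda>F. E3 D F - E2 D (\<lambda>p. \<integral>y. F (fst p, y, snd p) \<partial>leb D) - E2 D (\<lambda>p. \<integral>y. F (y, fst p, snd p) \<partial>leb D)
      + (\<integral>z. (\<integral>y. (\<integral>x. F (x, y, z) \<partial>leb D) \<partial>leb D) \<partial>leb D))"
    by (intro fnl_add fnl_diff f1 f2 f3 E3_fnl(1)[OF D])
  show "fnl (\<lambda>F. G3 D F + (\<integral>z. G2 D (\<lambda>p. F (fst p, snd p, z)) \<partial>leb D))"
    by (intro fnl_add f4 G3_fnl[OF D])
  fix a b :: "'a \<times> 'a \<times> 'a"
  define B where "B i = (if i = 0 then box (fst a) (fst b) else if i = 1 then box (fst (snd a)) (fst (snd b))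
    else box (snd (snd a)) (snd (snd b)))" for i :: nat
  have B: "B i \<in> sets borel" for i by (simp add: B_def)
  have ind: "indicator (box a b) = (\<lambda>(x, y, z). indicator (B 0) x * indicator (B 1) y * indicator (B 2) z :: real)"
    by (cases a; cases b) (auto simp: B_def box_Pair indicator_times)
  have 3: "{..<3} = {0, 1, 2::nat}" by auto
  let ?m = "\<lambda>K. enn2real (fact_moment M X K (\<lambda>i. B i \<inter> D))"
  have l: "measure (leb D) (B i) = ?m {i}" for i by (rule measure_leb[where B = B, OF D B])
  have e2: "E2 D (\<lambda>p. c * (indicator (B i) (fst p) * indicator (B j) (snd p))) = c * ?m {i, j}" if "i \<noteq> j" for c i j
    using moment2[where D = D and B = B and i = i and j = j] D B that unfolding E2_scale by (simp add: case_prod_unfold)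
  have g2: "G2 D (\<lambda>p. indicator (B i) (fst p) * indicator (B j) (snd p)) = ?m {i, j} - ?m {i} * ?m {j}" if "i \<noteq> j" for i j
  proof -
    have "bdd_borel (\<lambda>p. indicator (B i) (fst p) * indicator (B j) (snd p))"
      using bdd_borel_tensor2[OF bdd_borel_indicator[OF B] bdd_borel_indicator[OF B]] by (simp add: case_prod_unfold)
    from E2_cumulant[OF D this] show ?thesis using e2[OF that, of 1] by (simp add: l)
  qed
  have g2c: "G2 D (\<lambda>p. c * (indicator (B i) (fst p) * indicator (B j) (snd p))) = c * (?m {i, j} - ?m {i} * ?m {j})" if "i \<noteq> j" for c i j
    unfolding G2_scale g2[OF that] ..
  have t1: "E2 D (\<lambda>p. \<integral>y. indicator (box a b) (fst p, y, snd p) \<partial>leb D) = ?m {1} * ?m {0, 2}"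
    using e2[of 0 2 "?m {1}"] unfolding ind by (simp add: l case_prod_beta ac_simps del: One_nat_def)
  have t2: "E2 D (\<lambda>p. \<integral>y. indicator (box a b) (y, fst p, snd p) \<partial>leb D) = ?m {0} * ?m {1, 2}"
    using e2[of 1 2 "?m {0}"] unfolding ind by (simp add: l case_prod_beta ac_simps del: One_nat_def)
  have t3: "(\<integral>z. (\<integral>y. (\<integral>x. indicator (box a b) (x, y, z) \<partial>leb D) \<partial>leb D) \<partial>leb D) = ?m {0} * ?m {1} * ?m {2}"
    unfolding ind by (simp add: l)
  have t4: "(\<integral>z. G2 D (\<lambda>p. indicator (box a b) (fst p, snd p, z)) \<partial>leb D) = (?m {0, 1} - ?m {0} * ?m {1}) * ?m {2}"
  proof -
    have "G2 D (\<lambda>p. indicator (box a b) (fst p, snd p, z)) = indicator (B 2) z * (?m {0, 1} - ?m {0} * ?m {1})" for z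
      using g2c[of 0 1 "indicator (B 2) z"] unfolding ind
      by (simp add: case_prod_beta ac_simps del: One_nat_def)
    then show ?thesis by (simp add: l)
  qed
  have t5: "E3 D (indicator (box a b)) = ?m {0, 1, 2}"
    unfolding ind by (rule moment3[where B = B, OF D B]) simp
  have t6: "G3 D (indicator (box a b)) = ?m {0, 1, 2} - ?m {0, 1} * ?m {2} - ?m {0, 2} * ?m {1} - ?m {1, 2} * ?m {0}
     + 2 * ?m {0} * ?m {1} * ?m {2}"
    unfolding ind G3_value[where B = B, OF D B] fact_cumulant_sum 3 by (rule cumulant_sum_3)
  show "E3 D (indicator (box a b)) - E2 D (\<lambda>p. \<integral>y. indicator (box a b) (fst p, y, snd p) \<partial>leb D)
      - E2 D (\<lambda>p. \<integral>y. indicator (box a b) (y, fst p, snd p) \<partial>leb D)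
      + (\<integral>z. (\<integral>y. (\<integral>x. indicator (box a b) (x, y, z) \<partial>leb D) \<partial>leb D) \<partial>leb D)
    = G3 D (indicator (box a b)) + (\<integral>z. G2 D (\<lambda>p. indicator (box a b) (fst p, snd p, z)) \<partial>leb D)"
    unfolding t1 t2 t3 t4 t5 t6 by (simp add: algebra_simps)
qed

text \<open>The four-point identity on a rectangle: \<open>q\<close>, \<open>t\<close>,
  \<open>m\<close>, \<open>l\<close> are moments of order four, three, two and one, with indices
  naming the sides. The first parenthesis on the right is the fourth cumulant, the three final
  products are the pairings.\<close>

lemma fourth_cumulant_algebra:
  fixes q :: real
  shows "q - t123 * l0 - t012 * l3 - t023 * l1 - t013 * l2
    + l2 * l3 * m01 + l1 * l3 * m02 + l0 * l2 * m13 + l0 * l1 * m23 + l1 * l2 * m03 + l0 * l3 * m12 - 3 * (l0 * l1 * l2 * l3)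
    = (q - t012 * l3 - t013 * l2 - t023 * l1 - t123 * l0 - m01 * m23 - m02 * m13 - m03 * m12
     + 2 * (m01 * l2 * l3 + m02 * l1 * l3 + m03 * l1 * l2 + m12 * l0 * l3 + m13 * l0 * l2 + m23 * l0 * l1)
     - 6 * l0 * l1 * l2 * l3)
     + (m03 - l0 * l3) * (m12 - l1 * l2) + (m01 - l0 * l1) * (m23 - l2 * l3) + (m02 - l0 * l2) * (m13 - l1 * l3)"
  by algebra

text \<open>All four arguments are centred, so every partition with a singleton block cancels, and
  the fourth cumulant and the three pairings survive. The coefficient -3 is 1 - 4, from centring all
  four points and from centring three of them. The argument order in the four \<open>E3\<close>
  terms makes these equal for \<open>F (x, y, z, w) = g (x, w) * g (y, z)\<close> with symmetric
  \<open>g\<close>.\<close>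

lemma E4_cumulant:
  assumes D: "window D" and F: "bdd_borel F"
  shows "E4 D F - E3 D (\<lambda>p. \<integral>w. F (w, fst p, fst (snd p), snd (snd p)) \<partial>leb D)
     - E3 D (\<lambda>p. \<integral>w. F (snd (snd p), fst p, fst (snd p), w) \<partial>leb D)
     - E3 D (\<lambda>p. \<integral>w. F (fst p, w, snd (snd p), fst (snd p)) \<partial>leb D)
     - E3 D (\<lambda>p. \<integral>w. F (fst p, snd (snd p), w, fst (snd p)) \<partial>leb D)
     + E2 D (\<lambda>p. \<integral>z. \<integral>w. F (fst p, snd p, z, w) \<partial>leb D \<partial>leb D)
     + E2 D (\<lambda>p. \<integral>z. \<integral>w. F (fst p, z, snd p, w) \<partial>leb D \<partial>leb D)
     + E2 D (\<lambda>p. \<integral>z. \<integral>w. F (z, fst p, w, snd p) \<partial>leb D \<partial>leb D)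
     + E2 D (\<lambda>p. \<integral>z. \<integral>w. F (z, w, fst p, snd p) \<partial>leb D \<partial>leb D)
     + E2 D (\<lambda>p. \<integral>z. \<integral>w. F (fst p, z, w, snd p) \<partial>leb D \<partial>leb D)
     + E2 D (\<lambda>p. \<integral>z. \<integral>w. F (z, fst p, snd p, w) \<partial>leb D \<partial>leb D)
     - 3 * (\<integral>x. \<integral>y. \<integral>z. \<integral>w. F (x, y, z, w) \<partial>leb D \<partial>leb D \<partial>leb D \<partial>leb D)
   = G4 D F + G2 D (\<lambda>p. G2 D (\<lambda>q. F (fst p, fst q, snd q, snd p)))
     + G2 D (\<lambda>p. G2 D (\<lambda>q. F (fst p, snd p, fst q, snd q)))
     + G2 D (\<lambda>p. G2 D (\<lambda>q. F (fst p, fst q, snd p, snd q)))" (is "?L F = ?R F")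
proof (rule fnl_eqI[OF F, where \<Phi> = ?L and \<Psi> = ?R])
  note c31 = fnl_compose[OF leb_param_fnl[OF E3_fnl(1)[OF D] D]]
  note c22 = fnl_compose[OF leb_param_fnl[OF leb_param_fnl[OF E2_fnl(1)[OF D] D] D]]
  note cG = fnl_compose[OF G2_param_fnl[OF G2_fnl[OF D] D]]
  have a1: "fnl (\<lambda>F. E3 D (\<lambda>p. \<integral>w. F (w, fst p, fst (snd p), snd (snd p)) \<partial>leb D))"
    using c31[of "\<lambda>q. (snd q, fst (fst q), fst (snd (fst q)), snd (snd (fst q)))"] by simp
  have a2: "fnl (\<lambda>F. E3 D (\<lambda>p. \<integral>w. F (snd (snd p), fst p, fst (snd p), w) \<partial>leb D))"
    using c31[of "\<lambda>q. (snd (snd (fst q)), fst (fst q), fst (snd (fst q)), snd q)"] by simp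
  have a3: "fnl (\<lambda>F. E3 D (\<lambda>p. \<integral>w. F (fst p, w, snd (snd p), fst (snd p)) \<partial>leb D))"
    using c31[of "\<lambda>q. (fst (fst q), snd q, snd (snd (fst q)), fst (snd (fst q)))"] by simp
  have a4: "fnl (\<lambda>F. E3 D (\<lambda>p. \<integral>w. F (fst p, snd (snd p), w, fst (snd p)) \<partial>leb D))"
    using c31[of "\<lambda>q. (fst (fst q), snd (snd (fst q)), snd q, fst (snd (fst q)))"] by simp
  have b1: "fnl (\<lambda>F. E2 D (\<lambda>p. \<integral>z. \<integral>w. F (fst p, snd p, z, w) \<partial>leb D \<partial>leb D))"
    using c22[of "\<lambda>q. (fst (fst (fst q)), snd (fst (fst q)), snd (fst q), snd q)"] by simp
  have b2: "fnl (\<lambda>F. E2 D (\<lambda>p. \<integral>z. \<integral>w. F (fst p, z, snd p, w) \<partial>leb D \<partial>leb D))"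
    using c22[of "\<lambda>q. (fst (fst (fst q)), snd (fst q), snd (fst (fst q)), snd q)"] by simp
  have b3: "fnl (\<lambda>F. E2 D (\<lambda>p. \<integral>z. \<integral>w. F (z, fst p, w, snd p) \<partial>leb D \<partial>leb D))"
    using c22[of "\<lambda>q. (snd (fst q), fst (fst (fst q)), snd q, snd (fst (fst q)))"] by simp
  have b4: "fnl (\<lambda>F. E2 D (\<lambda>p. \<integral>z. \<integral>w. F (z, w, fst p, snd p) \<partial>leb D \<partial>leb D))"
    using c22[of "\<lambda>q. (snd (fst q), snd q, fst (fst (fst q)), snd (fst (fst q)))"] by simp
  have b5: "fnl (\<lambda>F. E2 D (\<lambda>p. \<integral>z. \<integral>w. F (fst p, z, w, snd p) \<partial>leb D \<partial>leb D))"
    using c22[of "\<lambda>q. (fst (fst (fst q)), snd (fst q), snd q, snd (fst (fst q)))"] by simp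
  have b6: "fnl (\<lambda>F. E2 D (\<lambda>p. \<integral>z. \<integral>w. F (z, fst p, snd p, w) \<partial>leb D \<partial>leb D))"
    using c22[of "\<lambda>q. (snd (fst q), fst (fst (fst q)), snd (fst (fst q)), snd q)"] by simp
  have l4: "fnl (\<lambda>F. \<integral>x. \<integral>y. \<integral>z. \<integral>w. F (x, y, z, w) \<partial>leb D \<partial>leb D \<partial>leb D \<partial>leb D)"
    using fnl_compose[OF leb_param_fnl[OF leb_param_fnl[OF leb_param_fnl[OF leb_fnl[OF D] D] D] D],
        of "\<lambda>q. (fst (fst (fst q)), snd (fst (fst q)), snd (fst q), snd q)"] by simp
  have g1: "fnl (\<lambda>F. G2 D (\<lambda>p. G2 D (\<lambda>q. F (fst p, fst q, snd q, snd p))))"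
    using cG[of "\<lambda>r. (fst (fst r), fst (snd r), snd (snd r), snd (fst r))"] by simp
  have g2: "fnl (\<lambda>F. G2 D (\<lambda>p. G2 D (\<lambda>q. F (fst p, snd p, fst q, snd q))))"
    using cG[of "\<lambda>r. (fst (fst r), snd (fst r), fst (snd r), snd (snd r))"] by simp
  have g3: "fnl (\<lambda>F. G2 D (\<lambda>p. G2 D (\<lambda>q. F (fst p, fst q, snd p, snd q))))"
    using cG[of "\<lambda>r. (fst (fst r), fst (snd r), snd (fst r), snd (snd r))"] by simp
  show "fnl ?L" by (intro fnl_add fnl_diff fnl_cmult a1 a2 a3 a4 b1 b2 b3 b4 b5 b6 l4 E4_fnl(1)[OF D])
  show "fnl ?R" by (intro fnl_add G4_fnl[OF D] g1 g2 g3)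
  fix a b :: "'a \<times> 'a \<times> 'a \<times> 'a"
  define B where "B i = (if i = 0 then box (fst a) (fst b) else if i = 1 then box (fst (snd a)) (fst (snd b))
    else if i = 2 then box (fst (snd (snd a))) (fst (snd (snd b)))
    else box (snd (snd (snd a))) (snd (snd (snd b))))" for i :: nat
  have B: "B i \<in> sets borel" for i by (simp add: B_def)
  have ind: "indicator (box a b) = (\<lambda>(x, y, z, w). indicator (B 0) x * indicator (B 1) y * indicator (B 2) z * indicator (B 3) w :: real)"
    by (cases a; cases b) (auto simp: B_def box_Pair indicator_times)
  have 4: "{..<4} = {0, 1, 2, 3::nat}" by auto
  let ?m = "\<lambda>K. enn2real (fact_moment M X K (\<lambda>i. B i \<inter> D))"
  have l: "measure (leb D) (B i) = ?m {i}" for i by (rule measure_leb[where B = B, OF D B])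
  have e2: "E2 D (\<lambda>p. c * (indicator (B i) (fst p) * indicator (B j) (snd p))) = c * ?m {i, j}" if "i \<noteq> j" for c i j
    using moment2[where D = D and B = B and i = i and j = j] D B that unfolding E2_scale by (simp add: case_prod_unfold)
  have e3: "E3 D (\<lambda>p. c * (indicator (B i) (fst p) * indicator (B j) (fst (snd p)) * indicator (B k) (snd (snd p)))) = c * ?m {i, j, k}"
    if "distinct [i, j, k]" for c i j k
    using moment3[where D = D and B = B and i = i and j = j and k = k] D B that unfolding E3_scale by (simp add: case_prod_unfold)
  have gg: "G2 D (\<lambda>p. indicator (B i) (fst p) * indicator (B j) (snd p)) = ?m {i, j} - ?m {i} * ?m {j}" if "i \<noteq> j" for i j
  proof -
    have "bdd_borel (\<lambda>p. indicator (B i) (fst p) * indicator (B j) (snd p))"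
      using bdd_borel_tensor2[OF bdd_borel_indicator[OF B] bdd_borel_indicator[OF B]] by (simp add: case_prod_unfold)
    from E2_cumulant[OF D this] show ?thesis using e2[OF that, of 1] by (simp add: l)
  qed
  have gg2: "G2 D (\<lambda>p. G2 D (\<lambda>q. (indicator (B i) (fst p) * indicator (B j) (snd p)) * (indicator (B k) (fst q) * indicator (B n) (snd q))))
      = (?m {i, j} - ?m {i} * ?m {j}) * (?m {k, n} - ?m {k} * ?m {n})" if "i \<noteq> j" "k \<noteq> n" for i j k n
    unfolding G2_scale gg[OF that(2)] using G2_scale[of D "?m {k, n} - ?m {k} * ?m {n}"] gg[OF that(1)]
    by (simp add: mult.commute[of _ "?m {k, n} - ?m {k} * ?m {n}"])
  have sets: "{1, 2, 0} = {0, 1, 2::nat}" "{0, 3, 2} = {0, 2, 3::nat}" "{0, 3, 1} = {0, 1, 3::nat}" by auto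
  let ?i = "\<lambda>n. indicat_real (B n)"
  have v1: "E3 D (\<lambda>p. \<integral>w. indicator (box a b) (w, fst p, fst (snd p), snd (snd p)) \<partial>leb D) = ?m {1, 2, 3} * ?m {0}"
    using e3[of 1 2 3 "?m {0}"] unfolding ind by (simp add: l case_prod_beta ac_simps del: One_nat_def)
  have v2: "E3 D (\<lambda>p. \<integral>w. indicator (box a b) (snd (snd p), fst p, fst (snd p), w) \<partial>leb D) = ?m {0, 1, 2} * ?m {3}"
    using e3[of 1 2 0 "?m {3}"] unfolding ind sets by (simp add: l case_prod_beta ac_simps del: One_nat_def)
  have v3: "E3 D (\<lambda>p. \<integral>w. indicator (box a b) (fst p, w, snd (snd p), fst (snd p)) \<partial>leb D) = ?m {0, 2, 3} * ?m {1}"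
    using e3[of 0 3 2 "?m {1}"] unfolding ind sets by (simp add: l case_prod_beta ac_simps del: One_nat_def)
  have v4: "E3 D (\<lambda>p. \<integral>w. indicator (box a b) (fst p, snd (snd p), w, fst (snd p)) \<partial>leb D) = ?m {0, 1, 3} * ?m {2}"
    using e3[of 0 3 1 "?m {2}"] unfolding ind sets by (simp add: l case_prod_beta ac_simps del: One_nat_def)
  have w1: "E2 D (\<lambda>p. \<integral>z. \<integral>w. indicator (box a b) (fst p, snd p, z, w) \<partial>leb D \<partial>leb D) = ?m {2} * ?m {3} * ?m {0, 1}"
    using e2[of 0 1 "?m {2} * ?m {3}"] unfolding ind by (simp add: l case_prod_beta ac_simps del: One_nat_def)
  have w2: "E2 D (\<lambda>p. \<integral>z. \<integral>w. indicator (box a b) (fst p, z, snd p, w) \<partial>leb D \<partial>leb D) = ?m {1} * ?m {3} * ?m {0, 2}"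
    using e2[of 0 2 "?m {1} * ?m {3}"] unfolding ind by (simp add: l case_prod_beta ac_simps del: One_nat_def)
  have w3: "E2 D (\<lambda>p. \<integral>z. \<integral>w. indicator (box a b) (z, fst p, w, snd p) \<partial>leb D \<partial>leb D) = ?m {0} * ?m {2} * ?m {1, 3}"
    using e2[of 1 3 "?m {0} * ?m {2}"] unfolding ind by (simp add: l case_prod_beta ac_simps del: One_nat_def)
  have w4: "E2 D (\<lambda>p. \<integral>z. \<integral>w. indicator (box a b) (z, w, fst p, snd p) \<partial>leb D \<partial>leb D) = ?m {0} * ?m {1} * ?m {2, 3}"
    using e2[of 2 3 "?m {0} * ?m {1}"] unfolding ind by (simp add: l case_prod_beta ac_simps del: One_nat_def)
  have w5: "E2 D (\<lambda>p. \<integral>z. \<integral>w. indicator (box a b) (fst p, z, w, snd p) \<partial>leb D \<partial>leb D) = ?m {1} * ?m {2} * ?m {0, 3}"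
    using e2[of 0 3 "?m {1} * ?m {2}"] unfolding ind by (simp add: l case_prod_beta ac_simps del: One_nat_def)
  have w6: "E2 D (\<lambda>p. \<integral>z. \<integral>w. indicator (box a b) (z, fst p, snd p, w) \<partial>leb D \<partial>leb D) = ?m {0} * ?m {3} * ?m {1, 2}"
    using e2[of 1 2 "?m {0} * ?m {3}"] unfolding ind by (simp add: l case_prod_beta ac_simps del: One_nat_def)
  have u: "(\<integral>x. \<integral>y. \<integral>z. \<integral>w. indicator (box a b) (x, y, z, w) \<partial>leb D \<partial>leb D \<partial>leb D \<partial>leb D) = ?m {0} * ?m {1} * ?m {2} * ?m {3}"
    unfolding ind by (simp add: l del: One_nat_def)
  have h1: "G2 D (\<lambda>p. G2 D (\<lambda>q. indicator (box a b) (fst p, fst q, snd q, snd p))) = (?m {0, 3} - ?m {0} * ?m {3}) * (?m {1, 2} - ?m {1} * ?m {2})"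
    using gg2[of 0 3 1 2] unfolding ind by (simp add: case_prod_beta ac_simps del: One_nat_def)
  have h2: "G2 D (\<lambda>p. G2 D (\<lambda>q. indicator (box a b) (fst p, snd p, fst q, snd q))) = (?m {0, 1} - ?m {0} * ?m {1}) * (?m {2, 3} - ?m {2} * ?m {3})"
    using gg2[of 0 1 2 3] unfolding ind by (simp add: case_prod_beta ac_simps del: One_nat_def)
  have h3: "G2 D (\<lambda>p. G2 D (\<lambda>q. indicator (box a b) (fst p, fst q, snd p, snd q))) = (?m {0, 2} - ?m {0} * ?m {2}) * (?m {1, 3} - ?m {1} * ?m {3})"
    using gg2[of 0 2 1 3] unfolding ind by (simp add: case_prod_beta ac_simps del: One_nat_def)
  have e4: "E4 D (indicator (box a b)) = ?m {0, 1, 2, 3}"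
    unfolding ind by (rule moment4[where B = B, OF D B]) simp
  have g4: "G4 D (indicator (box a b)) = ?m {0, 1, 2, 3}
     - ?m {0, 1, 2} * ?m {3} - ?m {0, 1, 3} * ?m {2} - ?m {0, 2, 3} * ?m {1} - ?m {1, 2, 3} * ?m {0}
     - ?m {0, 1} * ?m {2, 3} - ?m {0, 2} * ?m {1, 3} - ?m {0, 3} * ?m {1, 2}
     + 2 * (?m {0, 1} * ?m {2} * ?m {3} + ?m {0, 2} * ?m {1} * ?m {3} + ?m {0, 3} * ?m {1} * ?m {2}
       + ?m {1, 2} * ?m {0} * ?m {3} + ?m {1, 3} * ?m {0} * ?m {2} + ?m {2, 3} * ?m {0} * ?m {1})
     - 6 * ?m {0} * ?m {1} * ?m {2} * ?m {3}"
    unfolding ind G4_value[where B = B, OF D B] fact_cumulant_sum 4 by (rule cumulant_sum_4)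
  show "?L (indicator (box a b)) = ?R (indicator (box a b))"
    unfolding v1 v2 v3 v4 w1 w2 w3 w4 w5 w6 u h1 h2 h3 e4 g4 by (rule fourth_cumulant_algebra)
qed

lemma leb_param_bdd:
  fixes F :: "'c::second_countable_topology \<times> 'a \<Rightarrow> real"
  assumes D: "window D" and F: "bdd_borel F"
  shows "bdd_borel (\<lambda>c. \<integral>x. F (c, x) \<partial>leb D)"
proof -
  have \<Phi>: "fnl (\<lambda>h :: 'c \<Rightarrow> real. 0)" by (rule fnlI) auto
  have "(\<lambda>z :: 'c \<times> 'a. (fst z, snd z)) \<in> borel \<Otimes>\<^sub>M leb D \<rightarrow>\<^sub>M borel" by measurable
  from fnl_comp(2)[OF \<Phi> finite_leb[OF D] this, of "\<lambda>_. 1" 1] F show ?thesis by simp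
qed

text \<open>\<open>U\<close> is the pair sum with both points centred, the second order term of a
  Hoeffding decomposition. Its square is a sum over four, three and two distinct points, evaluated
  by the centred cumulant formulas. The square of the mean stands as a separate summand, hence it
  drops out of the variance.\<close>

lemma centred_pair_sum_moments:
  fixes g :: "'a \<times> 'a \<Rightarrow> real"
  assumes D: "window D" and g: "bdd_borel g" and sym: "\<And>x y. g (x, y) = g (y, x)"
  defines "H \<equiv> \<lambda>x. \<integral>y. g (x, y) \<partial>leb D"
  defines "U \<equiv> \<lambda>\<omega>. dsum2 (X \<omega> \<inter> D) g - 2 * sum H (X \<omega> \<inter> D) + (\<integral>x. H x \<partial>leb D)"
  shows "integrable M U" "integrable M (\<lambda>\<omega>. (U \<omega>)\<^sup>2)" "(\<integral>\<omega>. U \<omega> \<partial>M) = G2 D g"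
    "(\<integral>\<omega>. (U \<omega>)\<^sup>2 \<partial>M) = (G2 D g)\<^sup>2 + G4 D (\<lambda>(x, y, z, w). g (x, w) * g (y, z))
      + 2 * G2 D (\<lambda>p. G2 D (\<lambda>q. g (fst p, snd q) * g (snd p, fst q)))
      + 4 * G3 D (\<lambda>(x, y, z). g (x, z) * g (y, z))
      + 4 * (\<integral>z. G2 D (\<lambda>p. g (fst p, z) * g (snd p, z)) \<partial>leb D) + 2 * E2 D (\<lambda>p. (g p)\<^sup>2)"
proof -
  define c where "c = (\<integral>x. H x \<partial>leb D)"
  have H: "bdd_borel H" unfolding H_def by (rule leb_param_bdd[OF D g])
  have hl: "(\<integral>w. g (z, w) \<partial>leb D) = H z" and hr: "(\<integral>w. g (w, z) \<partial>leb D) = H z" for z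
    using sym by (simp_all add: H_def)
  have [measurable]: "g \<in> borel_measurable borel" "H \<in> borel_measurable borel" using g H by (simp_all add: bdd_borelD)
  note gc = bdd_borel_compose[OF g] and Hc = bdd_borel_compose[OF H]
  define F4 where "F4 = (\<lambda>q :: 'a \<times> 'a \<times> 'a \<times> 'a. g (fst q, snd (snd (snd q))) * g (fst (snd q), fst (snd (snd q))))"
  define F3 where "F3 = (\<lambda>q :: 'a \<times> 'a \<times> 'a. g (fst q, snd (snd q)) * g (fst (snd q), snd (snd q)))"
  define K3 where "K3 = (\<lambda>p :: 'a \<times> 'a \<times> 'a. g (fst p, fst (snd p)) * H (snd (snd p)))"
  define K2 where "K2 = (\<lambda>p. g p * H (snd p))"
  define HH where "HH = (\<lambda>p. H (fst p) * H (snd p))"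
  have bF4: "bdd_borel F4" unfolding F4_def by (rule bdd_borel_mult[OF gc gc]) measurable
  have bF3: "bdd_borel F3" unfolding F3_def by (rule bdd_borel_mult[OF gc gc]) measurable
  have bK3: "bdd_borel K3" unfolding K3_def by (rule bdd_borel_mult[OF gc Hc]) measurable
  have bK2: "bdd_borel K2" unfolding K2_def by (rule bdd_borel_mult[OF g Hc]) measurable
  have bHH: "bdd_borel HH" unfolding HH_def by (rule bdd_borel_mult[OF Hc Hc]) measurable
  have bg2: "bdd_borel (\<lambda>p. (g p)\<^sup>2)" unfolding power2_eq_square by (rule bdd_borel_mult[OF g g])
  have bH2: "bdd_borel (\<lambda>p. (H p)\<^sup>2)" unfolding power2_eq_square by (rule bdd_borel_mult[OF H H])
  note I = E4_fnl(2)[OF D bF4] E3_fnl(2)[OF D bF3] E2_fnl(2)[OF D bg2] E2_fnl(2)[OF D bHH] E1_fnl(2)[OF D bH2]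
    E3_fnl(2)[OF D bK3] E2_fnl(2)[OF D bK2] E2_fnl(2)[OF D g] E1_fnl(2)[OF D H]
  \<comment> \<open>The square of a - 2 b + c, with a the pair sum, b the linear sum and c the
    constant; each product is resolved into sums over distinct points.\<close>
  have U2: "(U \<omega>)\<^sup>2 = dsum4 (X \<omega> \<inter> D) F4 + 4 * dsum3 (X \<omega> \<inter> D) F3 + 2 * dsum2 (X \<omega> \<inter> D) (\<lambda>p. (g p)\<^sup>2)
      + 4 * dsum2 (X \<omega> \<inter> D) HH + 4 * sum (\<lambda>p. (H p)\<^sup>2) (X \<omega> \<inter> D) + c\<^sup>2
      - 4 * dsum3 (X \<omega> \<inter> D) K3 - 8 * dsum2 (X \<omega> \<inter> D) K2
      + 2 * c * dsum2 (X \<omega> \<inter> D) g - 4 * c * sum H (X \<omega> \<inter> D)" if "\<omega> \<in> space M" for \<omega>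
  proof -
    have fin: "finite (X \<omega> \<inter> D)" using that D by (rule finite_points)
    have alg: "(a - 2 * b + c)\<^sup>2 = a\<^sup>2 + 4 * b\<^sup>2 + c\<^sup>2 - 4 * (a * b) + 2 * c * a - 4 * c * b" for a b :: real
      by (simp add: power2_eq_square algebra_simps)
    show ?thesis
      unfolding U_def c_def[symmetric] alg dsum2_square[where g = g, OF fin sym] sum_square[OF fin]
        dsum2_times_sum[where g = g, OF fin sym]
        F4_def F3_def K3_def K2_def HH_def case_prod_beta
      by (simp add: algebra_simps)
  qed
  show iU: "integrable M U" unfolding U_def using I by (intro Bochner_Integration.integrable_add Bochner_Integration.integrable_diff integrable_mult_right) auto
  show "integrable M (\<lambda>\<omega>. (U \<omega>)\<^sup>2)"
    by (subst Bochner_Integration.integrable_cong[OF refl U2], assumption)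
      (intro Bochner_Integration.integrable_add Bochner_Integration.integrable_diff integrable_mult_right I integrable_const)
  have EH: "(\<integral>\<omega>. sum H (X \<omega> \<inter> D) \<partial>M) = c" "(\<integral>\<omega>. sum (\<lambda>p. (H p)\<^sup>2) (X \<omega> \<inter> D) \<partial>M) = (\<integral>z. (H z)\<^sup>2 \<partial>leb D)"
    using E1_leb[OF D H] E1_leb[OF D bH2] by (simp_all add: E1_def c_def)
  have E2g: "E2 D g = G2 D g + c" using E2_cumulant[OF D g] by (simp add: hl c_def)
  have "(\<integral>\<omega>. U \<omega> \<partial>M) = E2 D g - 2 * c + c"
    unfolding U_def c_def[symmetric] using I by (simp add: EH E2_def prob_space)
  then show "(\<integral>\<omega>. U \<omega> \<partial>M) = G2 D g" by (simp add: E2g)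
  have EU2: "(\<integral>\<omega>. (U \<omega>)\<^sup>2 \<partial>M) = E4 D F4 + 4 * E3 D F3 + 2 * E2 D (\<lambda>p. (g p)\<^sup>2) + 4 * E2 D HH + 4 * (\<integral>z. (H z)\<^sup>2 \<partial>leb D) + c\<^sup>2
      - 4 * E3 D K3 - 8 * E2 D K2 + 2 * c * E2 D g - 4 * c * c"
    by (subst Bochner_Integration.integral_cong[OF refl U2], assumption)
      (use I in \<open>simp add: EH E2_def E3_def E4_def prob_space\<close>)
  \<comment> \<open>The ten terms of the second moment split exactly into a four-point part with all
    points centred, treated here, a three-point part with two points centred, treated next, and the
    plain two-point term. The constants c^2 - 4 c^2 supply the coefficient -3 of the fourth order
    formula.\<close>
  have c4: "E4 D F4 - 4 * E3 D K3 + 4 * E2 D HH + 2 * c * E2 D g - 3 * c\<^sup>2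
      = G4 D F4 + (G2 D g)\<^sup>2 + 2 * G2 D (\<lambda>p. G2 D (\<lambda>q. g (fst p, snd q) * g (snd p, fst q)))"
  proof -
    have e: "E2 D (\<lambda>p. g p * c) = c * E2 D g" "E2 D (\<lambda>p. c * g p) = c * E2 D g"
      using E2_scale[of D c g] by (simp_all add: mult.commute)
    have gG: "G2 D (\<lambda>p. G2 D (\<lambda>q. g p * g q)) = (G2 D g)\<^sup>2"
      unfolding G2_scale using G2_scale[of D "G2 D g" g] by (simp add: mult.commute power2_eq_square)
    have X2: "G2 D (\<lambda>p. G2 D (\<lambda>q. g (fst p, snd q) * g (fst q, snd p))) = G2 D (\<lambda>p. G2 D (\<lambda>q. g (fst p, snd q) * g (snd p, fst q)))"
      by (intro arg_cong[where f = "G2 D"] ext arg_cong2[where f = "(*)"] refl sym)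
    have hh: "E2 D (\<lambda>p. H (snd p) * H (fst p)) = E2 D HH" "E2 D (\<lambda>p. H (fst p) * H (snd p)) = E2 D HH"
      by (simp_all add: HH_def mult.commute)
    have kk: "E3 D (\<lambda>p. H (snd (snd p)) * g (fst p, fst (snd p))) = E3 D K3"
      "E3 D (\<lambda>p. g (fst p, fst (snd p)) * H (snd (snd p))) = E3 D K3"
      by (simp_all add: K3_def mult.commute)
    show ?thesis
      using E4_cumulant[OF D bF4]
      by (simp add: F4_def hl hr hh kk c_def[symmetric] e gG X2 power2_eq_square)
  qed
  have c3: "E3 D F3 - 2 * E2 D K2 + (\<integral>z. (H z)\<^sup>2 \<partial>leb D) = G3 D F3 + (\<integral>z. G2 D (\<lambda>p. g (fst p, z) * g (snd p, z)) \<partial>leb D)"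
  proof -
    have kk: "E2 D (\<lambda>p. H (snd p) * g p) = E2 D K2" by (simp add: K2_def mult.commute)
    show ?thesis
      using E3_cumulant[OF D bF3] by (simp add: F3_def hl hr K2_def kk power2_eq_square)
  qed
  have r: "(\<lambda>(x, y, z, w). g (x, w) * g (y, z)) = F4" "(\<lambda>(x, y, z). g (x, z) * g (y, z)) = F3"
    by (auto simp: F4_def F3_def fun_eq_iff)
  show "(\<integral>\<omega>. (U \<omega>)\<^sup>2 \<partial>M) = (G2 D g)\<^sup>2 + G4 D (\<lambda>(x, y, z, w). g (x, w) * g (y, z))
      + 2 * G2 D (\<lambda>p. G2 D (\<lambda>q. g (fst p, snd q) * g (snd p, fst q)))
      + 4 * G3 D (\<lambda>(x, y, z). g (x, z) * g (y, z))
      + 4 * (\<integral>z. G2 D (\<lambda>p. g (fst p, z) * g (snd p, z)) \<partial>leb D) + 2 * E2 D (\<lambda>p. (g p)\<^sup>2)"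
    unfolding EU2 r using c4 c3 by (simp add: power2_eq_square)
qed

end

section \<open>Second moment bounds\<close>

text \<open>Holds for every \<open>f\<close>, as the Bochner integral of a function that is not
  integrable is 0. The bounds on cumulant integrals can therefore be derived without discussing
  integrability.\<close>

lemma ennreal_abs_integral_le: "ennreal \<bar>\<integral>x. f x \<partial>M\<bar> \<le> (\<integral>\<^sup>+x. ennreal \<bar>f x\<bar> \<partial>M)"
proof (cases "integrable M f")
  case True
  then show ?thesis using integral_norm_bound_ennreal[of M f] by simp
qed (simp add: not_integrable_integral_eq)

lemma emeasure_lborel_shift:
  fixes A :: "'a::euclidean_space set"
  assumes "A \<in> sets borel" shows "emeasure lborel {u. c + u \<in> A} = emeasure lborel A"
proof -
  have "emeasure lborel A = emeasure (distr lborel borel ((+) c)) A" by (simp add: lborel_distr_plus)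
  also have "\<dots> = emeasure lborel ((+) c -` A \<inter> space lborel)" using assms by (intro emeasure_distr) auto
  also have "(+) c -` A \<inter> space lborel = {u. c + u \<in> A}" by auto
  finally show ?thesis by simp
qed

context stationary_point_process
begin

lemma nn_integral_leb:
  assumes "D \<in> sets borel" "f \<in> borel_measurable borel"
  shows "(\<integral>\<^sup>+x. f x \<partial>leb D) = ennreal lam * (\<integral>\<^sup>+x. indicator D x * f x \<partial>lborel)"
proof -
  have "(\<integral>\<^sup>+x. f x \<partial>leb D) = (\<integral>\<^sup>+x. ennreal lam * (indicator D x * f x) \<partial>lborel)"
    unfolding leb_def using assms lam_nonneg
    by (subst nn_integral_density) (auto simp: ennreal_mult ennreal_indicator mult.assoc)
  then show ?thesis using assms by (simp add: nn_integral_cmult)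
qed

lemma emeasure_leb:
  assumes "window D" shows "emeasure (leb D) UNIV = ennreal (lam * measure lborel D)"
proof -
  have D: "D \<in> sets borel" "emeasure lborel D < \<infinity>"
    using assms emeasure_bounded_finite unfolding window_def by blast+
  have "emeasure (leb D) UNIV = (\<integral>\<^sup>+x. 1 \<partial>leb D)" by simp
  also have "\<dots> = ennreal lam * emeasure lborel D"
    using D by (subst nn_integral_leb) auto
  finally show ?thesis using D lam_nonneg by (simp add: ennreal_mult emeasure_eq_ennreal_measure)
qed

end

section \<open>Bounds for integrals against cumulant measures\<close>

context cumulant_process
begin

abbreviation "q2 \<equiv> measure Q2 UNIV"

lemma space_Q [simp]: "space Q2 = UNIV" "space Q3 = UNIV" "space Q4 = UNIV"
  using Q2(2) Q3(2) Q4(2) by (auto dest: sets_eq_imp_space_eq)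

lemma emeasure_Q: "emeasure Q2 S = ennreal (measure Q2 S)" "emeasure Q3 T = ennreal (measure Q3 T)" "emeasure Q4 R = ennreal (measure Q4 R)"
  using Q2(1) Q3(1) Q4(1) by (simp_all add: finite_measure.emeasure_eq_measure)

text \<open>The majorant depends on the differences \<open>p\<close> to the reference point only.
  Integrating over \<open>p\<close> gives the variation of \<open>S\<close>, and the reference point
  contributes its mean number in \<open>D\<close>.\<close>

lemma G4_bound:
  assumes D: "window D" and S: "S \<in> sets borel" and C: "0 \<le> C"
    and F: "\<And>x p. \<bar>F (fst p + x, fst (snd p) + x, snd (snd p) + x, x)\<bar> \<le> C * indicator S p"
  shows "\<bar>G4 D F\<bar> \<le> C * measure Q4 S * (lam * measure lborel D)"
proof -
  let ?w = "\<lambda>p x. s4 p * (indicator D (fst p + x) * indicator D (fst (snd p) + x) * indicator D (snd (snd p) + x))"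
  let ?F = "\<lambda>p x. F (fst p + x, fst (snd p) + x, snd (snd p) + x, x)"
  have *: "\<bar>?w p x * ?F p x\<bar> \<le> C * indicator S p" for p x
    using mult_mono[OF weight_le(1)[OF Q4(4)] F[of p x]] by (simp add: abs_mult)
  have "ennreal \<bar>?w p x * ?F p x\<bar> \<le> ennreal C * indicator S p" for p x
    using ennreal_leI[OF *[of p x]] by (cases "p \<in> S") auto
  then have "ennreal \<bar>G4 D F\<bar> \<le> (\<integral>\<^sup>+x. \<integral>\<^sup>+p. ennreal C * indicator S p \<partial>Q4 \<partial>leb D)"
    unfolding G4_def
    by (intro order_trans[OF ennreal_abs_integral_le] nn_integral_mono)
  also have "\<dots> = ennreal (C * measure Q4 S * (lam * measure lborel D))"
    using S Q4(2) C lam_nonneg by (simp add: nn_integral_cmult_indicator emeasure_Q emeasure_leb[OF D] ennreal_mult)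
  finally show ?thesis using C lam_nonneg by (simp add: ennreal_le_iff)
qed

lemma G3_bound:
  assumes D: "window D" and S: "S \<in> sets borel" and C: "0 \<le> C"
    and F: "\<And>x p. \<bar>F (fst p + x, snd p + x, x)\<bar> \<le> C * indicator S p"
  shows "\<bar>G3 D F\<bar> \<le> C * measure Q3 S * (lam * measure lborel D)"
proof -
  let ?w = "\<lambda>p x. s3 p * (indicator D (fst p + x) * indicator D (snd p + x))"
  let ?F = "\<lambda>p x. F (fst p + x, snd p + x, x)"
  have *: "\<bar>?w p x * ?F p x\<bar> \<le> C * indicator S p" for p x
    using mult_mono[OF weight_le(2)[OF Q3(4)] F[of p x]] by (simp add: abs_mult)
  have "ennreal \<bar>?w p x * ?F p x\<bar> \<le> ennreal C * indicator S p" for p x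
    using ennreal_leI[OF *[of p x]] by (cases "p \<in> S") auto
  then have "ennreal \<bar>G3 D F\<bar> \<le> (\<integral>\<^sup>+x. \<integral>\<^sup>+p. ennreal C * indicator S p \<partial>Q3 \<partial>leb D)"
    unfolding G3_def
    by (intro order_trans[OF ennreal_abs_integral_le] nn_integral_mono)
  also have "\<dots> = ennreal (C * measure Q3 S * (lam * measure lborel D))"
    using S Q3(2) C lam_nonneg by (simp add: nn_integral_cmult_indicator emeasure_Q emeasure_leb[OF D] ennreal_mult)
  finally show ?thesis using C lam_nonneg by (simp add: ennreal_le_iff)
qed

text \<open>In contrast to the orders three and four, the localisation is in the reference point:
  the variation enters with its full mass \<open>q2\<close>, and the volume of \<open>S\<close> is
  gained.\<close>

lemma G2_bound:
  assumes D: "window D" and S: "window S" and C: "0 \<le> C"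
    and F: "\<And>x y. \<bar>F (y, x)\<bar> \<le> C * indicator S x"
  shows "\<bar>G2 D F\<bar> \<le> C * q2 * (lam * measure lborel S)"
proof -
  have Dm: "D \<in> sets borel" and Sm: "S \<in> sets borel" and Sf: "emeasure lborel S < \<infinity>"
    using D S emeasure_bounded_finite unfolding window_def by blast+
  have *: "\<bar>s2 y * indicator D (y + x) * F (y + x, x)\<bar> \<le> C * indicator S x" for x y
    using mult_mono[OF weight_le(3)[OF Q2(4)] F[of "y + x" x]] by (simp add: abs_mult)
  have "ennreal \<bar>s2 y * indicator D (y + x) * F (y + x, x)\<bar> \<le> ennreal C * indicator S x" for x y
    using ennreal_leI[OF *[of y x]] by (cases "x \<in> S") auto
  then have "ennreal \<bar>G2 D F\<bar> \<le> (\<integral>\<^sup>+x. \<integral>\<^sup>+y. ennreal C * indicator S x \<partial>Q2 \<partial>leb D)"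
    unfolding G2_def
    by (intro order_trans[OF ennreal_abs_integral_le] nn_integral_mono)
  also have "\<dots> = ennreal (C * q2) * (\<integral>\<^sup>+x. indicator S x \<partial>leb D)"
    using Sm C by (subst nn_integral_cmult[symmetric]) (auto simp: emeasure_Q ennreal_mult ac_simps)
  also have "(\<integral>\<^sup>+x. indicator S x \<partial>leb D) \<le> ennreal lam * emeasure lborel S"
  proof -
    have "(\<integral>\<^sup>+x. indicator D x * indicator S x \<partial>lborel) \<le> (\<integral>\<^sup>+x. indicator S x \<partial>lborel)"
      by (intro nn_integral_mono) (auto simp: indicator_def)
    then show ?thesis using Dm Sm by (subst nn_integral_leb) (auto intro: mult_left_mono)
  qed
  also have "ennreal (C * q2) * (ennreal lam * emeasure lborel S) = ennreal (C * q2 * (lam * measure lborel S))"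
    using Sf C lam_nonneg by (simp add: emeasure_eq_ennreal_measure ennreal_mult)
  finally show ?thesis using C lam_nonneg by (simp add: ennreal_le_iff mult_left_mono)
qed

text \<open>The variance is the integral of f^2 plus a covariance term. By 2 |f(x) f(y)| \<le>
  f(x)^2 + f(y)^2 the latter is at most \<open>q2\<close> times the same integral; the half with the
  shifted argument is treated by Tonelli and translation invariance, the indicator of
  \<open>D\<close> keeping the shifted point in the window.\<close>

lemma linear_statistic_variance:
  assumes D: "window D" and f: "bdd_borel f"
  shows "integrable M (\<lambda>\<omega>. (sum f (X \<omega> \<inter> D) - (\<integral>x. f x \<partial>leb D))\<^sup>2)"
    and "(\<integral>\<omega>. (sum f (X \<omega> \<inter> D) - (\<integral>x. f x \<partial>leb D))\<^sup>2 \<partial>M) \<le> (1 + q2) * (\<integral>x. (f x)\<^sup>2 \<partial>leb D)"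
proof -
  define c where "c = (\<integral>x. f x \<partial>leb D)"
  have [measurable]: "f \<in> borel_measurable borel" "D \<in> sets borel" using f D by (simp_all add: bdd_borelD window_def)
  interpret L: finite_measure "leb D" by (rule finite_leb[OF D])
  interpret Q: finite_measure Q2 by (rule Q2(1))
  interpret P: pair_sigma_finite "leb D" Q2 ..
  have bff: "bdd_borel (\<lambda>p. f (fst p) * f (snd p))"
    by (rule bdd_borel_mult[OF bdd_borel_compose[OF f] bdd_borel_compose[OF f]]) measurable
  have bf2: "bdd_borel (\<lambda>x. (f x)\<^sup>2)" unfolding power2_eq_square by (rule bdd_borel_mult[OF f f])
  have eq: "(sum f (X \<omega> \<inter> D) - c)\<^sup>2 = dsum2 (X \<omega> \<inter> D) (\<lambda>p. f (fst p) * f (snd p)) + sum (\<lambda>x. (f x)\<^sup>2) (X \<omega> \<inter> D)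
      - 2 * c * sum f (X \<omega> \<inter> D) + c\<^sup>2" if "\<omega> \<in> space M" for \<omega>
  proof -
    have alg: "(a - c)\<^sup>2 = a\<^sup>2 - 2 * c * a + c\<^sup>2" for a by (simp add: power2_eq_square algebra_simps)
    show ?thesis unfolding alg sum_square[OF finite_points[OF that D]] by simp
  qed
  note I = E2_fnl(2)[OF D bff] E1_fnl(2)[OF D bf2] E1_fnl(2)[OF D f]
  show "integrable M (\<lambda>\<omega>. (sum f (X \<omega> \<inter> D) - (\<integral>x. f x \<partial>leb D))\<^sup>2)"
    unfolding c_def[symmetric]
    by (subst Bochner_Integration.integrable_cong[OF refl eq], assumption)
      (intro Bochner_Integration.integrable_add Bochner_Integration.integrable_diff integrable_mult_right I integrable_const)
  have "(\<integral>\<omega>. (sum f (X \<omega> \<inter> D) - c)\<^sup>2 \<partial>M) = E2 D (\<lambda>p. f (fst p) * f (snd p)) + (\<integral>x. (f x)\<^sup>2 \<partial>leb D) - c\<^sup>2"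
    by (subst Bochner_Integration.integral_cong[OF refl eq], assumption)
      (use I E1_leb[OF D f] E1_leb[OF D bf2] in \<open>simp add: E1_def E2_def prob_space c_def power2_eq_square\<close>)
  also have "\<dots> = G2 D (\<lambda>p. f (fst p) * f (snd p)) + (\<integral>x. (f x)\<^sup>2 \<partial>leb D)"
    using E2_cumulant[OF D bff] by (simp add: c_def power2_eq_square)
  also have "G2 D (\<lambda>p. f (fst p) * f (snd p)) \<le> q2 * (\<integral>x. (f x)\<^sup>2 \<partial>leb D)"
  proof -
    define h where "h = (1/2 :: real)"
    have h: "0 \<le> h" "h + h = 1" by (simp_all add: h_def)
    have nonneg: "0 \<le> (\<integral>x. (f x)\<^sup>2 \<partial>leb D)" by simp
    have int2: "integrable (leb D) (\<lambda>x. (f x)\<^sup>2)"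
      using integrable_bdd_borel[OF finite_leb[OF D], of "\<lambda>x. x" "\<lambda>_. 1" 1 "\<lambda>x. (f x)\<^sup>2"] bf2 by (simp add: measurable_ident_sets)
    have nn2: "(\<integral>\<^sup>+x. ennreal ((f x)\<^sup>2) \<partial>leb D) = ennreal (\<integral>x. (f x)\<^sup>2 \<partial>leb D)"
      by (rule nn_integral_eq_integral[OF int2]) simp
    have pw: "ennreal \<bar>s2 y * indicator D (y + x) * (f (y + x) * f x)\<bar> \<le>
        ennreal h * (indicator D (y + x) * ennreal ((f (y + x))\<^sup>2) + ennreal ((f x)\<^sup>2))" for x y
    proof -
      have "\<bar>s2 y * indicator D (y + x) * (f (y + x) * f x)\<bar> \<le> indicator D (y + x) * \<bar>f (y + x) * f x\<bar>"
        using Q2(4)[of y] by (auto simp: indicator_def abs_mult intro!: mult_left_le_one_le)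
      also have "\<dots> \<le> indicator D (y + x) * (h * ((f (y + x))\<^sup>2 + (f x)\<^sup>2))"
      proof (rule mult_left_mono)
        have "0 \<le> (\<bar>f (y + x)\<bar> - \<bar>f x\<bar>)\<^sup>2" by simp
        then show "\<bar>f (y + x) * f x\<bar> \<le> h * ((f (y + x))\<^sup>2 + (f x)\<^sup>2)"
          by (simp add: power2_diff abs_mult h_def)
      qed simp
      also have "\<dots> \<le> h * (indicator D (y + x) * (f (y + x))\<^sup>2 + (f x)\<^sup>2)"
        using h(1) by (auto simp: indicator_def)
      finally have "ennreal \<bar>s2 y * indicator D (y + x) * (f (y + x) * f x)\<bar> \<le> ennreal \<dots>" by (rule ennreal_leI)
      also have "\<dots> = ennreal h * (indicator D (y + x) * ennreal ((f (y + x))\<^sup>2) + ennreal ((f x)\<^sup>2))"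
        by (cases "y + x \<in> D") (simp_all add: ennreal_mult' ennreal_plus h(1))
      finally show ?thesis .
    qed
    have "ennreal \<bar>G2 D (\<lambda>p. f (fst p) * f (snd p))\<bar> \<le>
        (\<integral>\<^sup>+x. \<integral>\<^sup>+y. ennreal h * (indicator D (y + x) * ennreal ((f (y + x))\<^sup>2) + ennreal ((f x)\<^sup>2)) \<partial>Q2 \<partial>leb D)"
      unfolding G2_def using pw
      by (intro order_trans[OF ennreal_abs_integral_le] nn_integral_mono) simp
    also have "\<dots> = ennreal h * ((\<integral>\<^sup>+x. \<integral>\<^sup>+y. indicator D (y + x) * ennreal ((f (y + x))\<^sup>2) \<partial>Q2 \<partial>leb D)
        + (\<integral>\<^sup>+x. \<integral>\<^sup>+y. ennreal ((f x)\<^sup>2) \<partial>Q2 \<partial>leb D))"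
    proof -
      have "(\<integral>\<^sup>+y. ennreal h * (indicator D (y + x) * ennreal ((f (y + x))\<^sup>2) + ennreal ((f x)\<^sup>2)) \<partial>Q2) =
          ennreal h * ((\<integral>\<^sup>+y. indicator D (y + x) * ennreal ((f (y + x))\<^sup>2) \<partial>Q2) + (\<integral>\<^sup>+y. ennreal ((f x)\<^sup>2) \<partial>Q2))" for x
        by (subst nn_integral_cmult) (auto simp: nn_integral_add)
      then show ?thesis by (simp add: nn_integral_cmult nn_integral_add)
    qed
    also have "(\<integral>\<^sup>+x. \<integral>\<^sup>+y. ennreal ((f x)\<^sup>2) \<partial>Q2 \<partial>leb D) = ennreal q2 * ennreal (\<integral>x. (f x)\<^sup>2 \<partial>leb D)"
      unfolding nn2[symmetric] by (simp add: emeasure_Q nn_integral_cmult mult.commute)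
    also have "(\<integral>\<^sup>+x. \<integral>\<^sup>+y. indicator D (y + x) * ennreal ((f (y + x))\<^sup>2) \<partial>Q2 \<partial>leb D) \<le> ennreal q2 * ennreal (\<integral>x. (f x)\<^sup>2 \<partial>leb D)"
    proof -
      have "(\<integral>\<^sup>+x. indicator D (y + x) * ennreal ((f (y + x))\<^sup>2) \<partial>leb D) \<le> ennreal (\<integral>x. (f x)\<^sup>2 \<partial>leb D)" for y
      proof -
        have "(\<integral>\<^sup>+x. indicator D (y + x) * ennreal ((f (y + x))\<^sup>2) \<partial>leb D) \<le>
            ennreal lam * (\<integral>\<^sup>+x. indicator D (y + x) * ennreal ((f (y + x))\<^sup>2) \<partial>lborel)"
        proof -
          have "(\<integral>\<^sup>+x. indicator D x * (indicator D (y + x) * ennreal ((f (y + x))\<^sup>2)) \<partial>lborel) \<le>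
              (\<integral>\<^sup>+x. indicator D (y + x) * ennreal ((f (y + x))\<^sup>2) \<partial>lborel)"
            by (intro nn_integral_mono) (auto simp: indicator_def)
          then show ?thesis by (subst nn_integral_leb) (auto intro: mult_left_mono)
        qed
        also have "(\<integral>\<^sup>+x. indicator D (y + x) * ennreal ((f (y + x))\<^sup>2) \<partial>lborel) = (\<integral>\<^sup>+x. indicator D x * ennreal ((f x)\<^sup>2) \<partial>lborel)"
          by (rule translate_nn_integral) measurable
        also have "ennreal lam * \<dots> = ennreal (\<integral>x. (f x)\<^sup>2 \<partial>leb D)"
          unfolding nn2[symmetric] by (rule nn_integral_leb[symmetric]) measurable
        finally show ?thesis .
      qed
      then have "(\<integral>\<^sup>+y. \<integral>\<^sup>+x. indicator D (y + x) * ennreal ((f (y + x))\<^sup>2) \<partial>leb D \<partial>Q2) \<le> (\<integral>\<^sup>+y. ennreal (\<integral>x. (f x)\<^sup>2 \<partial>leb D) \<partial>Q2)"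
        by (intro nn_integral_mono)
      also have "\<dots> = ennreal q2 * ennreal (\<integral>x. (f x)\<^sup>2 \<partial>leb D)" by (simp add: emeasure_Q mult.commute)
      finally show ?thesis by (subst P.Fubini'[symmetric]) measurable
    qed
    also have "ennreal h * (ennreal q2 * ennreal (\<integral>x. (f x)\<^sup>2 \<partial>leb D) + ennreal q2 * ennreal (\<integral>x. (f x)\<^sup>2 \<partial>leb D))
        = ennreal (q2 * (\<integral>x. (f x)\<^sup>2 \<partial>leb D))"
    proof -
      have half: "ennreal h * (ennreal t + ennreal t) = ennreal t" if "0 \<le> t" for t
      proof -
        have "ennreal h * (ennreal t + ennreal t) = ennreal (h * (t + t))"
          by (subst ennreal_mult'[OF h(1)], subst ennreal_plus[OF that that]) simp
        also have "h * (t + t) = (h + h) * t" by (simp add: algebra_simps)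
        finally show ?thesis using h by simp
      qed
      show ?thesis unfolding ennreal_mult'[OF measure_nonneg, symmetric] using nonneg by (intro half) simp
    qed
    finally have "\<bar>G2 D (\<lambda>p. f (fst p) * f (snd p))\<bar> \<le> q2 * (\<integral>x. (f x)\<^sup>2 \<partial>leb D)"
      using nonneg by (simp add: ennreal_le_iff add_mono mult_left_mono)
    then show ?thesis by linarith
  qed
  finally show "(\<integral>\<omega>. (sum f (X \<omega> \<inter> D) - (\<integral>x. f x \<partial>leb D))\<^sup>2 \<partial>M) \<le> (1 + q2) * (\<integral>x. (f x)\<^sup>2 \<partial>leb D)"
    unfolding c_def by (simp add: distrib_right)
qed

end

section \<open>The reduced second moment measure and the edge-corrected kernel\<close>

locale k_process = cumulant_process M X \<gamma> Q2 s2 Q3 s3 Q4 s4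
  for M :: "'w measure" and X :: "'w \<Rightarrow> 'a::euclidean_space set" and \<gamma> Q2 s2 Q3 s3 Q4 s4 +
  fixes \<mu>1 :: "'a measure" and a0 :: real
  assumes sets_\<mu>1: "sets \<mu>1 = sets borel"
    and \<mu>1: "\<And>A0 A1. A0 \<in> sets borel \<Longrightarrow> A1 \<in> sets borel \<Longrightarrow> fact_moment M X {0, 1} (\<lambda>i. if i = 0 then A0 else A1) =
      ennreal lam * (\<integral>\<^sup>+x. indicator A1 x * emeasure \<mu>1 {y. y + x \<in> A0} \<partial>lborel)"
    and a0: "a0 > 0" "\<And>A. window A \<Longrightarrow> emeasure \<mu>1 A \<le> ennreal a0 * emeasure lborel A"
begin

lemmas [measurable_cong] = sets_\<mu>1

lemma \<mu>1_finite: "window A \<Longrightarrow> emeasure \<mu>1 A < \<infinity>" "window A \<Longrightarrow> measure \<mu>1 A \<le> a0 * measure lborel A"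
proof -
  assume A: "window A"
  then have fin: "emeasure lborel A < \<infinity>" using emeasure_bounded_finite unfolding window_def by blast
  then show 1: "emeasure \<mu>1 A < \<infinity>"
    using a0(2)[OF A] by (auto simp: ennreal_mult_less_top intro: order_le_less_trans)
  have "ennreal (measure \<mu>1 A) \<le> ennreal (a0 * measure lborel A)"
    using a0 a0(2)[OF A] fin 1 by (simp add: emeasure_eq_ennreal_measure ennreal_mult)
  then show "measure \<mu>1 A \<le> a0 * measure lborel A" using a0 by (simp add: ennreal_le_iff)
qed

text \<open>\<open>\<mu>1\<close> is controlled on bounded sets only. Cutting it to a window makes
  it finite, as the calculus of functionals requires.\<close>

definition \<mu>r :: "'a set \<Rightarrow> 'a measure" where
  "\<mu>r S = density \<mu>1 (indicator S)"

lemma sets_\<mu>r [simp, measurable_cong]: "sets (\<mu>r S) = sets borel"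
  by (simp add: \<mu>r_def sets_\<mu>1)

lemma emeasure_\<mu>r: "S \<in> sets borel \<Longrightarrow> A \<in> sets borel \<Longrightarrow> emeasure (\<mu>r S) A = emeasure \<mu>1 (S \<inter> A)"
  unfolding \<mu>r_def by (subst emeasure_density) (auto simp: sets_\<mu>1 indicator_inter_arith[symmetric])

lemma finite_\<mu>r:
  assumes S: "window S" shows "finite_measure (\<mu>r S)"
proof (rule finite_measureI)
  have "space (\<mu>r S) = UNIV" using sets_eq_imp_space_eq[OF sets_\<mu>r[of S]] by simp
  then show "emeasure (\<mu>r S) (space (\<mu>r S)) \<noteq> \<infinity>"
    using S \<mu>1_finite(1)[OF S] by (simp add: emeasure_\<mu>r window_def)
qed

text \<open>\<open>S\<close> contains all differences of points of \<open>D\<close>, so that cutting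
  \<open>\<mu>1\<close> to \<open>S\<close> loses nothing.\<close>

lemma E2_reduced:
  assumes D: "window D" and S: "window S" and DS: "\<And>x y. x \<in> D \<Longrightarrow> y + x \<in> D \<Longrightarrow> y \<in> S" and F: "bdd_borel F"
  shows "E2 D F = (\<integral>x. (\<integral>y. indicator D (y + x) * F (y + x, x) \<partial>\<mu>r S) \<partial>leb D)"
proof (rule fnl_eqI[OF F E2_fnl(1)[OF D]])
  have Dm [measurable]: "D \<in> sets borel" and Sm [measurable]: "S \<in> sets borel" using D S by (simp_all add: window_def)
  interpret mu: finite_measure "\<mu>r S" by (rule finite_\<mu>r[OF S])
  show "fnl (\<lambda>F. \<integral>x. (\<integral>y. indicator D (y + x) * F (y + x, x) \<partial>\<mu>r S) \<partial>leb D)"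
    using fnl_comp(1)[OF leb_fnl[OF D] finite_\<mu>r[OF S], of "\<lambda>z. (snd z + fst z, fst z)" "\<lambda>z. indicator D (snd z + fst z)" 1]
    by simp
  fix a b :: "'a \<times> 'a"
  define B where "B i = (if i = 0 then box (fst a) (fst b) else box (snd a) (snd b))" for i :: nat
  have B [measurable]: "B i \<in> sets borel" for i by (simp add: B_def)
  have ind: "indicator (box a b) = (\<lambda>(x, y). indicator (B 0) x * indicator (B 1) y :: real)"
    by (cases a; cases b) (auto simp: B_def box_Pair indicator_times)
  have 1: "E2 D (indicator (box a b)) = enn2real (fact_moment M X {0, 1} (\<lambda>i. B i \<inter> D))"
    unfolding ind using moment2[where D = D and B = B and i = 0 and j = 1] D B by simp
  have 2: "fact_moment M X {0, 1} (\<lambda>i. B i \<inter> D) = fact_moment M X {0, 1} (\<lambda>i. if i = 0 then B 0 \<inter> D else B 1 \<inter> D)"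
    unfolding fact_moment_def by (intro nn_integral_cong) simp
  have 3: "fact_moment M X {0, 1} (\<lambda>i. if i = 0 then B 0 \<inter> D else B 1 \<inter> D) =
      ennreal lam * (\<integral>\<^sup>+x. indicator (B 1 \<inter> D) x * emeasure \<mu>1 {y. y + x \<in> B 0 \<inter> D} \<partial>lborel)"
    by (rule \<mu>1) measurable
  have 4: "(\<integral>\<^sup>+x. indicator (B 1 \<inter> D) x * emeasure \<mu>1 {y. y + x \<in> B 0 \<inter> D} \<partial>lborel) =
      (\<integral>\<^sup>+x. indicator D x * ennreal (\<integral>y. indicator D (y + x) * (indicator (B 0) (y + x) * indicator (B 1) x) \<partial>\<mu>r S) \<partial>lborel)"
  proof (intro nn_integral_cong)
    fix x
    have "emeasure \<mu>1 {y. y + x \<in> B 0 \<inter> D} = ennreal (\<integral>y. indicator D (y + x) * indicator (B 0) (y + x) \<partial>\<mu>r S)" if "x \<in> D"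
    proof -
      have "{y. y + x \<in> B 0 \<inter> D} = S \<inter> {y. y + x \<in> B 0 \<inter> D}" using DS[OF that] by auto
      then have "emeasure \<mu>1 {y. y + x \<in> B 0 \<inter> D} = emeasure (\<mu>r S) {y. y + x \<in> B 0 \<inter> D}"
        by (subst emeasure_\<mu>r) (auto intro: measurable_sets_borel)
      also have "\<dots> = ennreal (\<integral>y. indicator {y. y + x \<in> B 0 \<inter> D} y \<partial>\<mu>r S)"
        by (simp add: mu.emeasure_eq_measure)
      also have "(\<integral>y. indicat_real {y. y + x \<in> B 0 \<inter> D} y \<partial>\<mu>r S) = (\<integral>y. indicator D (y + x) * indicator (B 0) (y + x) \<partial>\<mu>r S)"
        by (intro Bochner_Integration.integral_cong) (auto simp: indicator_def)
      finally show ?thesis .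
    qed
    then show "indicator (B 1 \<inter> D) x * emeasure \<mu>1 {y. y + x \<in> B 0 \<inter> D} =
        indicator D x * ennreal (\<integral>y. indicator D (y + x) * (indicator (B 0) (y + x) * indicator (B 1) x) \<partial>\<mu>r S)"
      by (cases "x \<in> D"; cases "x \<in> B 1") simp_all
  qed
  let ?J = "\<lambda>x. \<integral>y. indicator D (y + x) * (indicator (B 0) (y + x) * indicator (B 1) x) \<partial>\<mu>r S :: real"
  have nnJ: "0 \<le> ?J x" for x by (intro integral_nonneg_AE AE_I2) simp
  have "bdd_borel ?J"
    using fnl_comp(2)[OF leb_fnl[OF D] finite_\<mu>r[OF S], of "\<lambda>z. (snd z + fst z, fst z)" "\<lambda>z. indicator D (snd z + fst z)" 1
        "indicator (box a b)"] bdd_borel_indicator[of "box a b"] unfolding ind by simp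
  then have intJ: "integrable (leb D) ?J"
    using integrable_bdd_borel[OF finite_leb[OF D], of "\<lambda>x. x" "\<lambda>_. 1" 1 ?J] by (simp add: measurable_ident_sets)
  have "fact_moment M X {0, 1} (\<lambda>i. B i \<inter> D) = (\<integral>\<^sup>+x. ennreal (?J x) \<partial>leb D)"
    unfolding 2 3 4 by (rule nn_integral_leb[symmetric, OF Dm]) measurable
  also have "\<dots> = ennreal (\<integral>x. ?J x \<partial>leb D)" by (rule nn_integral_eq_integral[OF intJ]) (simp add: nnJ)
  finally show "E2 D (indicator (box a b)) = (\<integral>x. (\<integral>y. indicator D (y + x) * indicator (box a b) (y + x, x) \<partial>\<mu>r S) \<partial>leb D)"
    unfolding 1 using nnJ by (simp add: ind integral_nonneg_AE)
qed

text \<open>The set covariance, or covariogram, of \<open>D\<close>: the volume of the intersection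
  of \<open>D\<close> with \<open>D - z\<close>.\<close>

definition overlap :: "'a set \<Rightarrow> 'a \<Rightarrow> real" where
  "overlap D z = measure lborel (D \<inter> {x. x + z \<in> D})"

text \<open>The summand of the estimator as a kernel. \<open>A\<close> will be a dilated body, or
  the shell between two of them for an increment. Division by a vanishing overlap gives 0, in
  agreement with the estimator.\<close>

definition gker :: "'a set \<Rightarrow> 'a set \<Rightarrow> 'a \<times> 'a \<Rightarrow> real" where
  "gker D A p = indicator D (fst p) * indicator D (snd p) * indicator A (snd p - fst p) / overlap D (snd p - fst p)"

lemma overlap_sym:
  assumes "D \<in> sets borel" shows "overlap D (- z) = overlap D z"
proof -
  have m: "D \<inter> {x. x + z \<in> D} \<in> sets borel" using assms by measurable
  have "D \<inter> {x. x + - z \<in> D} = {u. - z + u \<in> D \<inter> {x. x + z \<in> D}}" by auto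
  then show ?thesis unfolding overlap_def measure_def using emeasure_lborel_shift[OF m, of "- z"] by simp
qed

lemma overlap_eq_integral:
  assumes "window D" shows "overlap D z = (\<integral>x. indicator D x * indicator D (x + z) \<partial>lborel)"
proof -
  have [measurable]: "D \<in> sets borel" using assms by (simp add: window_def)
  have "overlap D z = (\<integral>x. indicator (D \<inter> {x. x + z \<in> D}) x \<partial>lborel)"
    by (simp add: overlap_def)
  also have "\<dots> = (\<integral>x. indicator D x * indicator D (x + z) \<partial>lborel)"
    by (intro Bochner_Integration.integral_cong) (auto simp: indicator_def)
  finally show ?thesis .
qed

lemma overlap_measurable:
  assumes "window D" shows "overlap D \<in> borel_measurable borel"
proof -
  have [measurable]: "D \<in> sets borel" using assms by (simp add: window_def)
  have "(\<lambda>z. \<integral>x. indicator D x * indicator D (x + z) \<partial>lborel :: real) \<in> borel_measurable borel"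
    by (rule lborel.borel_measurable_lebesgue_integral) measurable
  then show ?thesis using overlap_eq_integral[OF assms] by (simp add: fun_eq_iff[symmetric] cong: measurable_cong)
qed

section \<open>Moments of the edge-corrected kernel\<close>

context
  fixes D A :: "'a set" and \<eta> :: real
  assumes D: "window D" and A: "window A" and symA: "\<And>z. z \<in> A \<Longrightarrow> - z \<in> A"
    and w0: "0 < measure lborel D" and \<eta>: "0 \<le> \<eta>" "\<eta> \<le> 1/2"
    and deficit: "\<And>z. z \<in> A \<Longrightarrow> measure lborel D - overlap D z \<le> \<eta> * measure lborel D"
begin

private abbreviation "w \<equiv> measure lborel D"
private abbreviation "a \<equiv> measure lborel A"
private abbreviation "g \<equiv> gker D A"

private lemma Dm: "D \<in> sets borel" and Am: "A \<in> sets borel"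
  and Df: "emeasure lborel D < \<infinity>" and Af: "emeasure lborel A < \<infinity>"
  using D A emeasure_bounded_finite unfolding window_def by blast+

private lemma symA_iff: "- z \<in> A \<longleftrightarrow> z \<in> A"
  using symA[of z] symA[of "- z"] by auto

text \<open>\<eta> \<le> 1/2 leaves at least half of the volume, whence the constant 2 / w in all
  bounds on the kernel.\<close>

private lemma overlap_bounds:
  assumes "z \<in> A"
  shows "w / 2 \<le> overlap D z" "overlap D z \<le> w" "1 / w \<le> 1 / overlap D z" "1 / overlap D z \<le> 2 / w" "0 < overlap D z"
proof -
  have "\<eta> * w \<le> 1/2 * w" using \<eta> w0 by (intro mult_right_mono) auto
  then show 1: "w / 2 \<le> overlap D z" using deficit[OF assms] by simp
  then show 2: "0 < overlap D z" using w0 by simp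
  show 3: "overlap D z \<le> w"
    unfolding overlap_def using Dm Df by (intro measure_mono_fmeasurable) (auto simp: fmeasurable_def)
  show "1 / w \<le> 1 / overlap D z" using 2 3 by (intro divide_left_mono) auto
  have "1 / overlap D z \<le> 1 / (w / 2)" using 1 2 w0 by (intro divide_left_mono) auto
  then show "1 / overlap D z \<le> 2 / w" by simp
qed

lemma gker_measurable: "g \<in> borel_measurable borel"
proof -
  note [measurable] = Dm Am overlap_measurable[OF D]
  show ?thesis unfolding gker_def[abs_def] by measurable
qed

lemma gker_nonneg: "0 \<le> g p"
  by (simp add: gker_def overlap_def)

lemma gker_le_A: "g (x, y) \<le> 2 / w * indicator A (y - x)"
  using overlap_bounds(4)[of "y - x"] w0 by (auto simp: gker_def indicator_def)

lemma gker_le_const: "g p \<le> 2 / w"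
proof -
  have "2 / w * indicator A (snd p - fst p) \<le> 2 / w" using w0 by (simp add: indicator_def)
  then show ?thesis using gker_le_A[of "fst p" "snd p"] by simp
qed

lemma gker_bdd: "bdd_borel g"
  using gker_measurable gker_nonneg gker_le_const by (intro bdd_borelI[where C = "2 / w"]) auto

lemma gker_sym: "g (x, y) = g (y, x)"
  using symA_iff[of "y - x"] overlap_sym[OF Dm, of "y - x"] by (simp add: gker_def indicator_def)

private lemma prod_le:
  assumes "g (x, y) \<le> 2 / w * s" "g (x', y') \<le> 2 / w * t" "0 \<le> s"
  shows "\<bar>g (x, y) * g (x', y')\<bar> \<le> 4 / w\<^sup>2 * (s * t)"
proof -
  have "g (x, y) * g (x', y') \<le> (2 / w * s) * (2 / w * t)"
    using assms gker_nonneg w0 by (intro mult_mono) auto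
  also have "\<dots> = 4 / w\<^sup>2 * (s * t)" by (simp add: power2_eq_square)
  finally show ?thesis using gker_nonneg by simp
qed

private lemma K0: "0 \<le> 4 / w\<^sup>2"
  by simp

private lemma measure_shift_A: "window {u. u - c \<in> A}" "measure lborel {u. u - c \<in> A} = a"
proof -
  have eq: "{u. u - c \<in> A} = (\<lambda>y. y + c) ` A" by (auto intro!: image_eqI[of _ _ "_ - c"])
  show "window {u. u - c \<in> A}"
    unfolding eq using A by (simp add: window_def borel_translation bounded_translation_right)
  have "{u. u - c \<in> A} = {u. - c + u \<in> A}" by simp
  then show "measure lborel {u. u - c \<in> A} = a"
    unfolding measure_def using emeasure_lborel_shift[OF Am, of "- c"] by simp
qed

text \<open>With the last point as reference, one kernel forces the first difference into
  \<open>A\<close>, and the other forces the difference of the remaining two into \<open>A\<close>.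
  The variation of this set is kept as it stands, since it is the quantity that improves under a
  density assumption.\<close>

lemma gker_G4: "\<bar>G4 D (\<lambda>(x, y, z, v). g (x, v) * g (y, z))\<bar> \<le>
    4 / w\<^sup>2 * measure Q4 {p. fst p \<in> A \<and> fst (snd p) - snd (snd p) \<in> A} * (lam * w)"
proof (rule G4_bound[OF D _ K0])
  show "{p. fst p \<in> A \<and> fst (snd p) - snd (snd p) \<in> A} \<in> sets borel" using Am by measurable
  fix x :: 'a and p :: "'a \<times> 'a \<times> 'a"
  have "\<bar>g (fst p + x, x) * g (fst (snd p) + x, snd (snd p) + x)\<bar> \<le>
      4 / w\<^sup>2 * (indicator A (x - (fst p + x)) * indicator A (snd (snd p) + x - (fst (snd p) + x)))"
    by (rule prod_le[OF gker_le_A gker_le_A]) simp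
  also have "indicator A (x - (fst p + x)) * indicator A (snd (snd p) + x - (fst (snd p) + x)) =
      indicat_real {p. fst p \<in> A \<and> fst (snd p) - snd (snd p) \<in> A} p"
    using symA_iff[of "fst p"] symA_iff[of "fst (snd p) - snd (snd p)"] by (auto simp: indicator_def)
  finally show "\<bar>case (fst p + x, fst (snd p) + x, snd (snd p) + x, x) of (x, y, z, v) \<Rightarrow> g (x, v) * g (y, z)\<bar> \<le>
      4 / w\<^sup>2 * indicator {p. fst p \<in> A \<and> fst (snd p) - snd (snd p) \<in> A} p" by simp
qed

lemma gker_G3: "\<bar>G3 D (\<lambda>(x, y, z). g (x, z) * g (y, z))\<bar> \<le> 4 / w\<^sup>2 * measure Q3 (A \<times> A) * (lam * w)"
proof (rule G3_bound[OF D _ K0])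
  show "A \<times> A \<in> sets borel" using Am by (simp add: borel_Times)
  fix x :: 'a and p :: "'a \<times> 'a"
  have "\<bar>g (fst p + x, x) * g (snd p + x, x)\<bar> \<le> 4 / w\<^sup>2 * (indicator A (x - (fst p + x)) * indicator A (x - (snd p + x)))"
    by (rule prod_le[OF gker_le_A gker_le_A]) simp
  also have "indicator A (x - (fst p + x)) * indicator A (x - (snd p + x)) = indicat_real (A \<times> A) p"
    using symA_iff[of "fst p"] symA_iff[of "snd p"] by (cases p) (auto simp: indicator_def)
  finally show "\<bar>case (fst p + x, snd p + x, x) of (x, y, z) \<Rightarrow> g (x, z) * g (y, z)\<bar> \<le> 4 / w\<^sup>2 * indicator (A \<times> A) p" by simp
qed

text \<open>One kernel confines the inner reference point to a shift of \<open>A\<close>, the other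
  is bounded by 2 / w; the outer reference point ranges over \<open>D\<close>. Hence one factor |A|
  and one factor |D|.\<close>

lemma gker_G22: "\<bar>G2 D (\<lambda>p. G2 D (\<lambda>q. g (fst p, snd q) * g (snd p, fst q)))\<bar> \<le> 4 / w\<^sup>2 * (lam * q2\<^sup>2 * a) * (lam * w)"
proof -
  have inner: "\<bar>G2 D (\<lambda>q. g (c, snd q) * g (d, fst q))\<bar> \<le> 4 / w\<^sup>2 * q2 * (lam * a) * indicator D d" for c d
  proof (cases "d \<in> D")
    case True
    have "\<bar>G2 D (\<lambda>q. g (c, snd q) * g (d, fst q))\<bar> \<le> 4 / w\<^sup>2 * q2 * (lam * measure lborel {u. u - c \<in> A})"
    proof (rule G2_bound[OF D measure_shift_A(1) K0])
      fix x y
      have "g (d, y) \<le> 2 / w * 1" using gker_le_const by simp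
      from prod_le[of c x "indicator A (x - c)" d y 1, OF gker_le_A this] show "\<bar>g (c, snd (y, x)) * g (d, fst (y, x))\<bar> \<le> 4 / w\<^sup>2 * indicator {u. u - c \<in> A} x"
        by (simp add: indicator_def)
    qed
    then show ?thesis using True by (simp add: measure_shift_A)
  next
    case False
    then have "(\<lambda>q. g (c, snd q) * g (d, fst q)) = (\<lambda>q. 0)" by (simp add: gker_def fun_eq_iff)
    then show ?thesis using False G2_scale[of D 0] by simp
  qed
  have "\<bar>G2 D (\<lambda>p. G2 D (\<lambda>q. g (fst p, snd q) * g (snd p, fst q)))\<bar> \<le> 4 / w\<^sup>2 * q2 * (lam * a) * q2 * (lam * w)"
  proof (rule G2_bound[OF D D])
    show "0 \<le> 4 / w\<^sup>2 * q2 * (lam * a)" using lam_nonneg by simp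
    show "\<bar>G2 D (\<lambda>q. g (fst (y, x), snd q) * g (snd (y, x), fst q))\<bar> \<le> 4 / w\<^sup>2 * q2 * (lam * a) * indicator D x" for x y
      using inner[of y x] by simp
  qed
  then show ?thesis by (simp add: power2_eq_square ac_simps)
qed

lemma gker_LG2: "\<bar>\<integral>z. G2 D (\<lambda>p. g (fst p, z) * g (snd p, z)) \<partial>leb D\<bar> \<le> 4 / w\<^sup>2 * (lam * q2 * a) * (lam * w)"
proof -
  have inner: "\<bar>G2 D (\<lambda>p. g (fst p, z) * g (snd p, z))\<bar> \<le> 4 / w\<^sup>2 * q2 * (lam * a)" for z
  proof -
    have "\<bar>G2 D (\<lambda>p. g (fst p, z) * g (snd p, z))\<bar> \<le> 4 / w\<^sup>2 * q2 * (lam * measure lborel {u. u - z \<in> A})"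
    proof (rule G2_bound[OF D measure_shift_A(1) K0])
      fix x y
      have "g (y, z) \<le> 2 / w * 1" using gker_le_const by simp
      moreover have "g (x, z) \<le> 2 / w * indicator A (x - z)" using gker_le_A[of z x] gker_sym[of x z] by simp
      ultimately show "\<bar>g (fst (y, x), z) * g (snd (y, x), z)\<bar> \<le> 4 / w\<^sup>2 * indicator {u. u - z \<in> A} x"
        using prod_le[of y z 1 x z "indicator A (x - z)"] by (simp add: indicator_def)
    qed
    then show ?thesis by (simp add: measure_shift_A)
  qed
  have "ennreal \<bar>\<integral>z. G2 D (\<lambda>p. g (fst p, z) * g (snd p, z)) \<partial>leb D\<bar> \<le> (\<integral>\<^sup>+z. ennreal (4 / w\<^sup>2 * q2 * (lam * a)) \<partial>leb D)"
    using inner by (intro order_trans[OF ennreal_abs_integral_le] nn_integral_mono ennreal_leI)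
  also have "\<dots> = ennreal (4 / w\<^sup>2 * q2 * (lam * a)) * ennreal (lam * w)"
    by (simp add: emeasure_leb[OF D])
  also have "\<dots> = ennreal (4 / w\<^sup>2 * q2 * (lam * a) * (lam * w))"
    using lam_nonneg by (intro ennreal_mult'[symmetric]) simp
  finally show ?thesis using lam_nonneg by (simp add: ennreal_le_iff ac_simps)
qed

private lemma big_window:
  obtains S where "window S" "A \<subseteq> S" "\<And>x y. x \<in> D \<Longrightarrow> y + x \<in> D \<Longrightarrow> y \<in> S"
proof -
  have "bounded (D \<union> A)" using D A by (simp add: window_def)
  then obtain r where r: "\<And>x. x \<in> D \<union> A \<Longrightarrow> norm x \<le> r" by (auto simp: bounded_iff)
  have "norm y \<le> 2 * \<bar>r\<bar>" if "x \<in> D" "y + x \<in> D" for x y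
    using r[of x] r[of "y + x"] that norm_triangle_ineq4[of "y + x" x] by simp
  moreover have "norm y \<le> 2 * \<bar>r\<bar>" if "y \<in> A" for y using r[of y] that by simp
  ultimately show thesis by (intro that[of "cball 0 (2 * \<bar>r\<bar>)"]) (auto simp: window_def)
qed

text \<open>The two-point term is not centred; the bound \<open>a0\<close> on the reduced moment
  measure makes it proportional to |A|.\<close>

lemma gker_E2_square: "E2 D (\<lambda>p. (g p)\<^sup>2) \<le> 4 / w\<^sup>2 * (a0 * a) * (lam * w)"
proof -
  obtain S where S: "window S" "A \<subseteq> S" "\<And>x y. x \<in> D \<Longrightarrow> y + x \<in> D \<Longrightarrow> y \<in> S" by (rule big_window) blast
  have b: "bdd_borel (\<lambda>p. (g p)\<^sup>2)" unfolding power2_eq_square by (rule bdd_borel_mult[OF gker_bdd gker_bdd])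
  have pw: "ennreal \<bar>indicator D (y + x) * (g (y + x, x))\<^sup>2\<bar> \<le> ennreal (4 / w\<^sup>2) * indicator A y" for x y
  proof -
    have "g (y + x, x) \<le> 2 / w * indicator A y" using gker_le_A[of "y + x" x] symA_iff[of y] by (simp add: indicator_def)
    then have "\<bar>g (y + x, x) * g (y + x, x)\<bar> \<le> 4 / w\<^sup>2 * (indicator A y * indicator A y)" by (intro prod_le) auto
    then have "\<bar>indicator D (y + x) * (g (y + x, x))\<^sup>2\<bar> \<le> 4 / w\<^sup>2 * indicator A y"
      by (auto simp: indicator_def power2_eq_square split: if_splits)
    from ennreal_leI[OF this] show ?thesis by (cases "y \<in> A") auto
  qed
  have "ennreal \<bar>E2 D (\<lambda>p. (g p)\<^sup>2)\<bar> \<le> (\<integral>\<^sup>+x. \<integral>\<^sup>+y. ennreal (4 / w\<^sup>2) * indicator A y \<partial>\<mu>r S \<partial>leb D)"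
    by (subst E2_reduced[OF D S(1) S(3) b], assumption, assumption)
      (use pw in \<open>intro order_trans[OF ennreal_abs_integral_le] nn_integral_mono\<close>)
  also have "\<dots> = ennreal (4 / w\<^sup>2) * emeasure \<mu>1 A * ennreal (lam * w)"
    using Am S by (simp add: nn_integral_cmult_indicator emeasure_leb[OF D] emeasure_\<mu>r window_def Int_absorb1)
  also have "\<dots> \<le> ennreal (4 / w\<^sup>2) * (ennreal a0 * emeasure lborel A) * ennreal (lam * w)"
    using a0(2)[OF A] by (intro mult_right_mono mult_left_mono) auto
  also have "\<dots> = ennreal (4 / w\<^sup>2 * (a0 * a) * (lam * w))"
  proof -
    have "ennreal K * (ennreal a0 * emeasure lborel A) * ennreal (lam * w) = ennreal (K * (a0 * a) * (lam * w))" if "0 \<le> K" for K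
      using Af a0 lam_nonneg that by (simp add: emeasure_eq_ennreal_measure ennreal_mult)
    from this[OF K0] show ?thesis .
  qed
  finally show ?thesis using a0 lam_nonneg by (simp add: ennreal_le_iff)
qed

text \<open>The edge correction is exactly unbiased: for a fixed difference y in \<open>A\<close>
  the admissible positions of the reference point fill a set of volume \<open>overlap D y\<close>,
  which cancels the denominator.\<close>

lemma gker_mean: "E2 D g = lam * measure \<mu>1 A"
proof -
  obtain S where S: "window S" "A \<subseteq> S" "\<And>x y. x \<in> D \<Longrightarrow> y + x \<in> D \<Longrightarrow> y \<in> S" by (rule big_window) blast
  have Sm: "S \<in> sets borel" using S(1) by (simp add: window_def)
  note [measurable] = Dm Am Sm overlap_measurable[OF D] gker_measurable
  interpret mu: finite_measure "\<mu>r S" by (rule finite_\<mu>r[OF S(1)])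
  interpret L: finite_measure "leb D" by (rule finite_leb[OF D])
  interpret P: pair_sigma_finite "leb D" "\<mu>r S" ..
  have fm: "finite_measure (leb D \<Otimes>\<^sub>M \<mu>r S)" by (rule finite_measure_pair_measure) unfold_locales
  have int: "integrable (leb D \<Otimes>\<^sub>M \<mu>r S) (\<lambda>(x, y). indicator D (y + x) * g (y + x, x))"
  proof (rule finite_measure.integrable_const_bound[OF fm, where B = "2 / w"])
    show "AE p in leb D \<Otimes>\<^sub>M \<mu>r S. norm (case p of (x, y) \<Rightarrow> indicator D (y + x) * g (y + x, x)) \<le> 2 / w"
      using gker_nonneg gker_le_const w0 by (intro AE_I2) (auto simp: indicator_def)
  qed measurable
  have "E2 D g = (\<integral>y. (\<integral>x. indicator D (y + x) * g (y + x, x) \<partial>leb D) \<partial>\<mu>r S)"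
    by (subst E2_reduced[OF D S(1) S(3) gker_bdd], assumption, assumption) (rule P.Fubini_integral[symmetric, OF int])
  also have "\<dots> = (\<integral>y. lam * indicator A y \<partial>\<mu>r S)"
  proof (intro Bochner_Integration.integral_cong refl)
    fix y
    have "indicator D x * (indicator D (y + x) * g (y + x, x)) = (indicator A y / overlap D y) * (indicator D x * indicator D (x + y))" for x
      using symA_iff[of y] overlap_sym[OF Dm, of y] by (auto simp: gker_def indicator_def add.commute)
    then have 1: "(\<integral>x. indicator D x * (indicator D (y + x) * g (y + x, x)) \<partial>lborel) = (indicator A y / overlap D y) * overlap D y"
      unfolding overlap_eq_integral[OF D, of y] by (simp only: integral_mult_right_zero)
    have "(\<lambda>x. (y + x, x)) \<in> borel_measurable borel" by measurable
    from measurable_compose[OF this gker_measurable] have [measurable]: "(\<lambda>x. g (y + x, x)) \<in> borel_measurable borel" .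
    have "(\<lambda>x. indicator D (y + x) :: real) \<in> borel_measurable borel"
      by (rule measurable_compose[of "\<lambda>x. y + x" borel borel]) (simp_all add: Dm)
    then have 2: "(\<lambda>x. indicator D (y + x) * g (y + x, x)) \<in> borel_measurable borel" by simp
    have "(\<integral>x. indicator D (y + x) * g (y + x, x) \<partial>leb D) = lam * ((indicator A y / overlap D y) * overlap D y)"
      unfolding integral_leb[OF D 2] 1 ..
    also have "\<dots> = lam * indicator A y" using overlap_bounds(5)[of y] by (auto simp: indicator_def)
    finally show "(\<integral>x. indicator D (y + x) * g (y + x, x) \<partial>leb D) = lam * indicator A y" .
  qed
  also have "\<dots> = lam * measure \<mu>1 A"
    using emeasure_\<mu>r[OF Sm Am] S(2) by (simp add: measure_def Int_absorb1)
  finally show ?thesis .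
qed

text \<open>On the overlap the integrand is 1 / overlap - 1 / w, on the rest of \<open>D\<close> it
  is 1 / w. Each part integrates to (w - overlap) / w, hence twice the relative deficit.\<close>

private lemma deficit_integral:
  assumes z: "z \<in> A"
  shows "(\<integral>\<^sup>+x. indicator D x * ennreal \<bar>indicator D (x + z) / overlap D z - 1 / w\<bar> \<partial>lborel) \<le> ennreal (2 * \<eta>)"
proof -
  let ?O = "D \<inter> {x. x + z \<in> D}"
  have Om: "?O \<in> sets borel" using Dm by measurable
  note ob = overlap_bounds[OF z]
  have d0: "0 \<le> 1 / overlap D z - 1 / w" and w1: "0 \<le> 1 / w" using ob w0 by auto
  have "(\<integral>\<^sup>+x. indicator D x * ennreal \<bar>indicator D (x + z) / overlap D z - 1 / w\<bar> \<partial>lborel)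
      = (\<integral>\<^sup>+x. ennreal (1 / overlap D z - 1 / w) * indicator ?O x + ennreal (1 / w) * indicator (D - ?O) x \<partial>lborel)"
    using d0 w1 by (intro nn_integral_cong) (auto simp: indicator_def)
  also have "\<dots> = ennreal (1 / overlap D z - 1 / w) * emeasure lborel ?O + ennreal (1 / w) * emeasure lborel (D - ?O)"
    using Om Dm by (subst nn_integral_add) (auto simp: nn_integral_cmult_indicator)
  also have "emeasure lborel ?O = ennreal (overlap D z)"
  proof -
    have "emeasure lborel ?O \<le> emeasure lborel D" using Dm by (intro emeasure_mono) auto
    then have "emeasure lborel ?O < \<infinity>" using Df by (rule order_le_less_trans)
    then show ?thesis by (simp add: overlap_def emeasure_eq_ennreal_measure)
  qed
  also have "emeasure lborel (D - ?O) = ennreal (w - overlap D z)"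
  proof -
    have "emeasure lborel (D - ?O) \<le> emeasure lborel D" using Dm by (intro emeasure_mono) auto
    then have "emeasure lborel (D - ?O) < \<infinity>" using Df by (rule order_le_less_trans)
    moreover have "measure lborel (D - ?O) = w - overlap D z"
      unfolding overlap_def using Df Om Dm by (intro measure_Diff) auto
    ultimately show ?thesis by (simp add: emeasure_eq_ennreal_measure)
  qed
  also have "ennreal (1 / overlap D z - 1 / w) * ennreal (overlap D z) + ennreal (1 / w) * ennreal (w - overlap D z)
      = ennreal ((1 / overlap D z - 1 / w) * overlap D z + 1 / w * (w - overlap D z))"
  proof -
    have "0 \<le> (1 / overlap D z - 1 / w) * overlap D z" "0 \<le> 1 / w * (w - overlap D z)"
      using d0 w1 ob by (auto intro!: mult_nonneg_nonneg)
    then show ?thesis by (simp only: ennreal_plus ennreal_mult'[OF d0] ennreal_mult'[OF w1])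
  qed
  also have "\<dots> \<le> ennreal (2 * \<eta>)"
  proof (rule ennreal_leI)
    have "(1 / overlap D z - 1 / w) * overlap D z + 1 / w * (w - overlap D z) = 2 * ((w - overlap D z) / w)"
      using ob(5) w0 by (simp add: field_simps)
    also have "(w - overlap D z) / w \<le> \<eta>" using deficit[OF z] w0 by (simp add: divide_le_eq)
    finally show "(1 / overlap D z - 1 / w) * overlap D z + 1 / w * (w - overlap D z) \<le> 2 * \<eta>" by simp
  qed
  finally show ?thesis .
qed

text \<open>\<open>f\<close> compares the kernel seen from \<open>x\<close> with the constant 1 / w
  that it would have without a boundary. On \<open>A\<close> it is at most 1 / w in modulus, because
  1 / overlap lies between 1 / w and 2 / w; this gives a bound uniform in \<open>x\<close>.\<close>

private lemma edge_profile:
  fixes x :: 'a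
  defines "f \<equiv> \<lambda>z. indicator A z * (indicator D (x + z) / overlap D z - 1 / w)"
  shows "integrable lborel f" "(\<integral>z. \<bar>f z\<bar> \<partial>lborel) \<le> a / w"
    "x \<in> D \<Longrightarrow> 2 * (\<integral>y. g (x, y) \<partial>leb D) - 2 * lam * a / w = 2 * lam * (\<integral>z. f z \<partial>lborel)"
proof -
  note [measurable] = Dm Am overlap_measurable[OF D] gker_measurable
  have intA: "integrable lborel (\<lambda>z. indicator A z * (1 / w))"
    using Am Af by (intro integrable_mult_left integrable_real_indicator) auto
  have fb: "\<bar>f z\<bar> \<le> indicator A z * (1 / w)" for z
  proof (cases "z \<in> A")
    case True
    note ob = overlap_bounds[OF True]
    have "\<bar>indicator D (x + z) / overlap D z - 1 / w\<bar> \<le> 1 / w"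
      using ob(3,4,5) w0 by (cases "x + z \<in> D") (auto simp: abs_le_iff)
    then show ?thesis using True by (simp add: f_def)
  qed (simp add: f_def)
  have fm: "f \<in> borel_measurable lborel" unfolding f_def by measurable
  show intf: "integrable lborel f"
    by (rule Bochner_Integration.integrable_bound[OF intA fm]) (use fb w0 in \<open>auto simp: abs_mult\<close>)
  have "(\<integral>z. \<bar>f z\<bar> \<partial>lborel) \<le> (\<integral>z. indicator A z * (1 / w) \<partial>lborel)"
    using intf intA fb by (intro integral_mono) auto
  then show "(\<integral>z. \<bar>f z\<bar> \<partial>lborel) \<le> a / w" by simp
  assume x: "x \<in> D"
  have gxm: "(\<lambda>y. g (x, y)) \<in> borel_measurable borel" by measurable
  have eq: "indicator D (x + z) * g (x, x + z) = f z + indicator A z * (1 / w)" for z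
    using x by (auto simp: gker_def f_def indicator_def)
  have "(\<integral>y. g (x, y) \<partial>leb D) = lam * (\<integral>y. indicator D y * g (x, y) \<partial>lborel)"
    by (rule integral_leb[OF D gxm])
  also have "(\<integral>y. indicator D y * g (x, y) \<partial>lborel) = (\<integral>y. indicator D y * g (x, y) \<partial>distr lborel borel ((+) x))"
    by (simp add: lborel_distr_plus)
  also have "\<dots> = (\<integral>z. indicator D (x + z) * g (x, x + z) \<partial>lborel)"
    by (rule integral_distr) measurable
  also have "\<dots> = (\<integral>z. f z \<partial>lborel) + a / w"
    unfolding eq using intf intA by simp
  finally show "2 * (\<integral>y. g (x, y) \<partial>leb D) - 2 * lam * a / w = 2 * lam * (\<integral>z. f z \<partial>lborel)"
    by (simp add: algebra_simps)
qed

text \<open>Integration over \<open>x\<close> gains the factor \<eta> that the uniform bound lacks: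
  for each difference only the points close to the boundary see a deficit.\<close>

private lemma edge_profile_total:
  "(\<integral>\<^sup>+x. indicator D x * ennreal (\<integral>z. \<bar>indicator A z * (indicator D (x + z) / overlap D z - 1 / w)\<bar> \<partial>lborel) \<partial>lborel)
    \<le> ennreal (2 * \<eta> * a)"
proof -
  note [measurable] = Dm Am overlap_measurable[OF D]
  let ?d = "\<lambda>x z. ennreal \<bar>indicator D (x + z) / overlap D z - 1 / w\<bar>"
  have "(\<integral>\<^sup>+x. indicator D x * ennreal (\<integral>z. \<bar>indicator A z * (indicator D (x + z) / overlap D z - 1 / w)\<bar> \<partial>lborel) \<partial>lborel)
      = (\<integral>\<^sup>+x. \<integral>\<^sup>+z. indicator D x * (indicator A z * ?d x z) \<partial>lborel \<partial>lborel)"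
  proof (intro nn_integral_cong)
    fix x
    have "ennreal (\<integral>z. \<bar>indicator A z * (indicator D (x + z) / overlap D z - 1 / w)\<bar> \<partial>lborel)
        = (\<integral>\<^sup>+z. ennreal \<bar>indicator A z * (indicator D (x + z) / overlap D z - 1 / w)\<bar> \<partial>lborel)"
      by (rule nn_integral_eq_integral[symmetric]) (auto intro: integrable_abs edge_profile(1))
    also have "\<dots> = (\<integral>\<^sup>+z. indicator A z * ?d x z \<partial>lborel)"
      by (intro nn_integral_cong) (auto simp: indicator_def)
    also have "indicator D x * \<dots> = (\<integral>\<^sup>+z. indicator D x * (indicator A z * ?d x z) \<partial>lborel)"
      by (rule nn_integral_cmult[symmetric]) measurable
    finally show "indicator D x * ennreal (\<integral>z. \<bar>indicator A z * (indicator D (x + z) / overlap D z - 1 / w)\<bar> \<partial>lborel)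
        = (\<integral>\<^sup>+z. indicator D x * (indicator A z * ?d x z) \<partial>lborel)" .
  qed
  also have "\<dots> = (\<integral>\<^sup>+z. \<integral>\<^sup>+x. indicator D x * (indicator A z * ?d x z) \<partial>lborel \<partial>lborel)"
    by (rule lborel_pair.Fubini') measurable
  also have "\<dots> \<le> (\<integral>\<^sup>+z. ennreal (2 * \<eta>) * indicator A z \<partial>lborel)"
  proof (rule nn_integral_mono)
    fix z
    show "(\<integral>\<^sup>+x. indicator D x * (indicator A z * ?d x z) \<partial>lborel) \<le> ennreal (2 * \<eta>) * indicator A z"
      using deficit_integral[of z] by (cases "z \<in> A") auto
  qed
  also have "\<dots> = ennreal (2 * \<eta> * a)"
    using Am Af \<eta> by (simp add: nn_integral_cmult_indicator emeasure_eq_ennreal_measure ennreal_mult)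
  finally show ?thesis .
qed

text \<open>The square is estimated by the uniform bound times the integrated bound; the latter
  brings the factor \<eta>. The constant subtracted in \<open>\<psi>\<close> is the one that yields
  the point count term of the pair sum.\<close>

lemma linear_part_bound:
  defines "\<psi> \<equiv> \<lambda>x. 2 * (\<integral>y. g (x, y) \<partial>leb D) - 2 * lam * a / w"
  shows "bdd_borel \<psi>" "(\<integral>x. (\<psi> x)\<^sup>2 \<partial>leb D) \<le> 8 * lam ^ 3 * \<eta> * a\<^sup>2 / w"
proof -
  note [measurable] = Dm Am overlap_measurable[OF D]
  define k where "k x = (\<integral>z. \<bar>indicator A z * (indicator D (x + z) / overlap D z - 1 / w)\<bar> \<partial>lborel)" for x
  have km [measurable]: "k \<in> borel_measurable borel"
    unfolding k_def[abs_def] by (rule lborel.borel_measurable_lebesgue_integral) measurable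
  show b: "bdd_borel \<psi>"
    unfolding \<psi>_def by (intro bdd_borel_diff bdd_borel_cmult leb_param_bdd[OF D gker_bdd] bdd_borel_const)
  have [measurable]: "\<psi> \<in> borel_measurable borel" by (rule bdd_borelD[OF b])
  have b2: "bdd_borel (\<lambda>x. (\<psi> x)\<^sup>2)" unfolding power2_eq_square by (rule bdd_borel_mult[OF b b])
  have int2: "integrable (leb D) (\<lambda>x. (\<psi> x)\<^sup>2)"
    using integrable_bdd_borel[OF finite_leb[OF D], of "\<lambda>x. x" "\<lambda>_. 1" 1 "\<lambda>x. (\<psi> x)\<^sup>2"] b2 by (simp add: measurable_ident_sets)
  have pw: "(\<psi> x)\<^sup>2 \<le> (4 * lam\<^sup>2 * (a / w)) * k x" if "x \<in> D" for x
  proof -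
    have "\<bar>\<psi> x\<bar> \<le> 2 * lam * k x"
    proof -
      have "\<bar>\<integral>z. indicator A z * (indicator D (x + z) / overlap D z - 1 / w) \<partial>lborel\<bar> \<le> k x"
        unfolding k_def by (rule integral_abs_bound)
      then have "(2 * lam) * \<bar>\<integral>z. indicator A z * (indicator D (x + z) / overlap D z - 1 / w) \<partial>lborel\<bar> \<le> 2 * lam * k x"
        using lam_nonneg by (intro mult_left_mono) auto
      then show ?thesis
        unfolding \<psi>_def edge_profile(3)[OF that] abs_mult[of "2 * lam"] using lam_nonneg by simp
    qed
    moreover have k: "k x \<le> a / w" "0 \<le> k x" unfolding k_def by (rule edge_profile(2)) simp
    ultimately have "\<bar>\<psi> x\<bar> * \<bar>\<psi> x\<bar> \<le> (2 * lam * (a / w)) * (2 * lam * k x)"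
      using lam_nonneg by (intro mult_mono order_trans[of "\<bar>\<psi> x\<bar>" "2 * lam * k x" "2 * lam * (a / w)"] mult_left_mono) auto
    then show ?thesis by (simp add: power2_eq_square mult.assoc mult.left_commute abs_mult_self_eq)
  qed
  define C where "C = 4 * lam\<^sup>2 * (a / w)"
  have C: "0 \<le> C" using w0 by (simp add: C_def)
  have "ennreal (\<integral>x. (\<psi> x)\<^sup>2 \<partial>leb D) = (\<integral>\<^sup>+x. ennreal ((\<psi> x)\<^sup>2) \<partial>leb D)"
    by (rule nn_integral_eq_integral[symmetric, OF int2]) simp
  also have "\<dots> = ennreal lam * (\<integral>\<^sup>+x. indicator D x * ennreal ((\<psi> x)\<^sup>2) \<partial>lborel)"
    by (rule nn_integral_leb[OF Dm]) measurable
  also have "\<dots> \<le> ennreal lam * (\<integral>\<^sup>+x. ennreal C * (indicator D x * ennreal (k x)) \<partial>lborel)"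
  proof (intro mult_left_mono nn_integral_mono)
    fix x
    show "indicator D x * ennreal ((\<psi> x)\<^sup>2) \<le> ennreal C * (indicator D x * ennreal (k x))"
      using ennreal_leI[OF pw[of x]] ennreal_mult'[OF C, of "k x"] by (cases "x \<in> D") (auto simp: C_def)
  qed simp
  also have "\<dots> = ennreal lam * (ennreal C * (\<integral>\<^sup>+x. indicator D x * ennreal (k x) \<partial>lborel))"
    by (subst nn_integral_cmult) measurable
  also have "\<dots> \<le> ennreal lam * (ennreal C * ennreal (2 * \<eta> * a))"
    using edge_profile_total by (intro mult_left_mono) (auto simp: k_def)
  also have "\<dots> = ennreal (lam * (C * (2 * \<eta> * a)))"
    using lam_nonneg C \<eta> by (simp add: ennreal_mult)
  finally have "(\<integral>x. (\<psi> x)\<^sup>2 \<partial>leb D) \<le> lam * (C * (2 * \<eta> * a))"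
    using lam_nonneg C \<eta> by (subst (asm) ennreal_le_iff) auto
  also have "\<dots> = 8 * lam ^ 3 * \<eta> * a\<^sup>2 / w"
    by (simp add: C_def power2_eq_square power3_eq_cube)
  finally show "(\<integral>x. (\<psi> x)\<^sup>2 \<partial>leb D) \<le> 8 * lam ^ 3 * \<eta> * a\<^sup>2 / w" .
qed

text \<open>A Hoeffding decomposition: \<open>T\<close> is the doubly centred pair sum
  \<open>U\<close> minus its mean, plus the centred linear statistic of \<open>\<psi>\<close>, where
  \<open>\<psi>\<close> is the deviation of the doubled projection of the kernel from a constant.
  The inequality (x + y)^2 \<le> 2 x^2 + 2 y^2 doubles the constants 4 and 8 of the two
  parts.\<close>

lemma pair_increment_bound:
  defines "T \<equiv> \<lambda>\<omega>. dsum2 (X \<omega> \<inter> D) g - lam * measure \<mu>1 A - 2 * lam * a / w * (real (card (X \<omega> \<inter> D)) - lam * w)"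
  shows "integrable M (\<lambda>\<omega>. (T \<omega>)\<^sup>2)"
    and "(\<integral>\<omega>. (T \<omega>)\<^sup>2 \<partial>M) \<le> 8 * lam / w * (measure Q4 {p. fst p \<in> A \<and> fst (snd p) - snd (snd p) \<in> A}
      + 4 * measure Q3 (A \<times> A) + (2 * lam * q2\<^sup>2 + 4 * lam * q2 + 2 * a0) * a) + 16 * (1 + q2) * lam ^ 3 * \<eta> * a\<^sup>2 / w"
proof -
  define H where "H = (\<lambda>x. \<integral>y. g (x, y) \<partial>leb D)"
  define U where "U = (\<lambda>\<omega>. dsum2 (X \<omega> \<inter> D) g - 2 * sum H (X \<omega> \<inter> D) + (\<integral>x. H x \<partial>leb D))"
  define b where "b = 2 * lam * a / w"
  define \<psi> where "\<psi> = (\<lambda>x. 2 * H x - b)"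
  define V where "V = (\<lambda>\<omega>. sum \<psi> (X \<omega> \<inter> D) - (\<integral>x. \<psi> x \<partial>leb D))"
  define m where "m = G2 D g"
  interpret L: finite_measure "leb D" by (rule finite_leb[OF D])
  note cp0 = centred_pair_sum_moments[OF D gker_bdd gker_sym]
  have cp: "integrable M U" "integrable M (\<lambda>\<omega>. (U \<omega>)\<^sup>2)" "(\<integral>\<omega>. U \<omega> \<partial>M) = m"
    unfolding U_def H_def m_def by (rule cp0(1), rule cp0(2), rule cp0(3))
  have cp4: "(\<integral>\<omega>. (U \<omega>)\<^sup>2 \<partial>M) = m\<^sup>2 + G4 D (\<lambda>(x, y, z, w). g (x, w) * g (y, z))
      + 2 * G2 D (\<lambda>p. G2 D (\<lambda>q. g (fst p, snd q) * g (snd p, fst q)))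
      + 4 * G3 D (\<lambda>(x, y, z). g (x, z) * g (y, z))
      + 4 * (\<integral>z. G2 D (\<lambda>p. g (fst p, z) * g (snd p, z)) \<partial>leb D) + 2 * E2 D (\<lambda>p. (g p)\<^sup>2)"
    unfolding U_def H_def m_def by (rule cp0(4))
  have \<psi>: "bdd_borel \<psi>" "(\<integral>x. (\<psi> x)\<^sup>2 \<partial>leb D) \<le> 8 * lam ^ 3 * \<eta> * a\<^sup>2 / w"
    using linear_part_bound by (simp_all add: \<psi>_def H_def b_def)
  have lv: "integrable M (\<lambda>\<omega>. (V \<omega>)\<^sup>2)" "(\<integral>\<omega>. (V \<omega>)\<^sup>2 \<partial>M) \<le> (1 + q2) * (\<integral>x. (\<psi> x)\<^sup>2 \<partial>leb D)"
    unfolding V_def by (rule linear_statistic_variance[OF D \<psi>(1)])+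
  have Hb: "bdd_borel H" unfolding H_def by (rule leb_param_bdd[OF D gker_bdd])
  have intH: "integrable (leb D) H"
    using integrable_bdd_borel[OF finite_leb[OF D], of "\<lambda>x. x" "\<lambda>_. 1" 1 H] Hb by (simp add: measurable_ident_sets)
  have mw: "measure (leb D) UNIV = lam * w"
    using emeasure_leb[OF D] lam_nonneg by (simp add: measure_def)
  have int\<psi>: "(\<integral>x. \<psi> x \<partial>leb D) = 2 * (\<integral>x. H x \<partial>leb D) - b * (lam * w)"
    unfolding \<psi>_def using intH mw by simp
  have mean: "lam * measure \<mu>1 A = m + (\<integral>x. H x \<partial>leb D)"
    using E2_cumulant[OF D gker_bdd] gker_mean by (simp add: H_def m_def)
  have T: "T \<omega> = (U \<omega> - m) + V \<omega>" for \<omega>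
    unfolding T_def b_def[symmetric] mean U_def V_def int\<psi>
    by (simp add: \<psi>_def sum_subtractf sum_distrib_left algebra_simps)
  have iU: "integrable M (\<lambda>\<omega>. (U \<omega> - m)\<^sup>2)"
    using cp(1,2) by (simp add: power2_diff)
  \<comment> \<open>Passing to the variance removes the square of \<open>G2 D g\<close>.\<close>
  have vU: "(\<integral>\<omega>. (U \<omega> - m)\<^sup>2 \<partial>M) = (\<integral>\<omega>. (U \<omega>)\<^sup>2 \<partial>M) - m\<^sup>2"
  proof -
    have "(U \<omega> - m)\<^sup>2 = (U \<omega>)\<^sup>2 - 2 * m * U \<omega> + m\<^sup>2" for \<omega> by (simp add: power2_eq_square algebra_simps)
    then have "(\<integral>\<omega>. (U \<omega> - m)\<^sup>2 \<partial>M) = (\<integral>\<omega>. (U \<omega>)\<^sup>2 \<partial>M) - 2 * m * m + m\<^sup>2"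
      using cp by (simp add: prob_space)
    then show ?thesis by (simp add: power2_eq_square)
  qed
  have i2: "integrable M (\<lambda>\<omega>. 2 * (U \<omega> - m)\<^sup>2 + 2 * (V \<omega>)\<^sup>2)" using iU lv(1) by simp
  have le: "(T \<omega>)\<^sup>2 \<le> 2 * (U \<omega> - m)\<^sup>2 + 2 * (V \<omega>)\<^sup>2" for \<omega>
    unfolding T using sum_squares_bound[of "U \<omega> - m" "V \<omega>"] by (simp add: power2_sum)
  have Um: "U \<in> borel_measurable M" using cp(1) by simp
  have "(\<lambda>\<omega>. sum \<psi> (X \<omega> \<inter> D)) \<in> borel_measurable M"
    using E1_fnl(2)[OF D \<psi>(1)] by (rule borel_measurable_integrable)
  then have Vm: "V \<in> borel_measurable M" unfolding V_def by measurable
  note [measurable] = Um Vm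
  show iT: "integrable M (\<lambda>\<omega>. (T \<omega>)\<^sup>2)"
  proof (rule Bochner_Integration.integrable_bound[OF i2])
    show "(\<lambda>\<omega>. (T \<omega>)\<^sup>2) \<in> borel_measurable M" unfolding T by measurable
    show "AE \<omega> in M. norm ((T \<omega>)\<^sup>2) \<le> norm (2 * (U \<omega> - m)\<^sup>2 + 2 * (V \<omega>)\<^sup>2)" using le by (intro AE_I2) simp
  qed
  have "(\<integral>\<omega>. (T \<omega>)\<^sup>2 \<partial>M) \<le> (\<integral>\<omega>. 2 * (U \<omega> - m)\<^sup>2 + 2 * (V \<omega>)\<^sup>2 \<partial>M)"
    by (rule integral_mono[OF iT i2 le])
  also have "\<dots> = 2 * (\<integral>\<omega>. (U \<omega> - m)\<^sup>2 \<partial>M) + 2 * (\<integral>\<omega>. (V \<omega>)\<^sup>2 \<partial>M)" using iU lv(1) by simp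
  finally have 1: "(\<integral>\<omega>. (T \<omega>)\<^sup>2 \<partial>M) \<le> 2 * (\<integral>\<omega>. (U \<omega> - m)\<^sup>2 \<partial>M) + 2 * (\<integral>\<omega>. (V \<omega>)\<^sup>2 \<partial>M)" .
  have 2: "(\<integral>\<omega>. (V \<omega>)\<^sup>2 \<partial>M) \<le> (1 + q2) * (8 * lam ^ 3 * \<eta> * a\<^sup>2 / w)"
    by (rule order_trans[OF lv(2) mult_left_mono[OF \<psi>(2)]]) simp
  define K where "K = 4 / w\<^sup>2"
  have "(\<integral>\<omega>. (U \<omega> - m)\<^sup>2 \<partial>M) \<le> K * measure Q4 {p. fst p \<in> A \<and> fst (snd p) - snd (snd p) \<in> A} * (lam * w)
      + 2 * (K * (lam * q2\<^sup>2 * a) * (lam * w)) + 4 * (K * measure Q3 (A \<times> A) * (lam * w))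
      + 4 * (K * (lam * q2 * a) * (lam * w)) + 2 * (K * (a0 * a) * (lam * w))"
    unfolding vU cp4
    using gker_G4[folded K_def] gker_G3[folded K_def] gker_G22[folded K_def] gker_LG2[folded K_def] gker_E2_square[folded K_def]
    by linarith
  also have "\<dots> = K * (lam * w) * (measure Q4 {p. fst p \<in> A \<and> fst (snd p) - snd (snd p) \<in> A}
      + 4 * measure Q3 (A \<times> A) + (2 * lam * q2\<^sup>2 + 4 * lam * q2 + 2 * a0) * a)"
    by (simp add: algebra_simps)
  also have "K * (lam * w) = 4 * lam / w" using w0 by (simp add: K_def power2_eq_square)
  finally have 3: "(\<integral>\<omega>. (U \<omega> - m)\<^sup>2 \<partial>M) \<le> 4 * lam / w * (measure Q4 {p. fst p \<in> A \<and> fst (snd p) - snd (snd p) \<in> A}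
      + 4 * measure Q3 (A \<times> A) + (2 * lam * q2\<^sup>2 + 4 * lam * q2 + 2 * a0) * a)" .
  have arith: "t \<le> 8 * lam / w * Z + 16 * (1 + q2) * lam ^ 3 * \<eta> * a\<^sup>2 / w"
    if "t \<le> 2 * u + 2 * v" "u \<le> 4 * lam / w * Z" "v \<le> (1 + q2) * (8 * lam ^ 3 * \<eta> * a\<^sup>2 / w)" for t u v Z
  proof -
    have "2 * ((1 + q2) * (8 * lam ^ 3 * \<eta> * a\<^sup>2 / w)) = 16 * (1 + q2) * lam ^ 3 * \<eta> * a\<^sup>2 / w" by simp
    moreover have "2 * (4 * lam / w * Z) = 8 * lam / w * Z" by simp
    ultimately show ?thesis using that by linarith
  qed
  show "(\<integral>\<omega>. (T \<omega>)\<^sup>2 \<partial>M) \<le> 8 * lam / w * (measure Q4 {p. fst p \<in> A \<and> fst (snd p) - snd (snd p) \<in> A}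
      + 4 * measure Q3 (A \<times> A) + (2 * lam * q2\<^sup>2 + 4 * lam * q2 + 2 * a0) * a) + 16 * (1 + q2) * lam ^ 3 * \<eta> * a\<^sup>2 / w"
    by (rule arith[OF 1 3 2])
qed

end

end

section \<open>Weak convergence in the Skorohod space\<close>

lemma skorohod_dist_uniform:
  assumes "0 \<le> e" "\<And>t. t \<in> {0..R} \<Longrightarrow> \<bar>f t - g t\<bar> \<le> e"
  shows "skorohod_dist R f g \<le> e"
  using assms time_changes_id[of R]
  by (intro skorohod_dist_leI) (auto simp: skorohod_close_def intro!: bexI[of _ "\<lambda>t. t"])

lemma topspace_skorohod [simp]: "topspace (skorohod_topology R) = cadlag R"
  unfolding skorohod_topology_def
  by (rule Metric_space.topspace_mtopology[OF Metric_space_skorohod])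

lemma openin_skorohod:
  "openin (skorohod_topology R) U \<longleftrightarrow>
     U \<subseteq> cadlag R \<and> (\<forall>f\<in>U. \<exists>r>0. \<forall>g\<in>cadlag R. skorohod_dist R f g < r \<longrightarrow> g \<in> U)"
proof -
  have "Metric_space.mball (cadlag R) (skorohod_dist R) f r \<subseteq> U \<longleftrightarrow>
      (\<forall>g\<in>cadlag R. skorohod_dist R f g < r \<longrightarrow> g \<in> U)" if "f \<in> cadlag R" for f r
    using that Metric_space.in_mball[OF Metric_space_skorohod] by blast
  then show ?thesis
    unfolding skorohod_topology_def Metric_space.openin_mtopology[OF Metric_space_skorohod] Ball_def[of U]
    by (intro conj_cong refl all_cong) (auto simp: subset_iff)
qed

lemma skorohod_dist_nonneg: "0 \<le> skorohod_dist R f g"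
  by (rule Metric_space.nonneg[OF Metric_space_skorohod])

lemma skorohod_dist_commute: "skorohod_dist R f g = skorohod_dist R g f"
  by (rule Metric_space.commute[OF Metric_space_skorohod])

lemma skorohod_dist_triangle:
  "f \<in> cadlag R \<Longrightarrow> g \<in> cadlag R \<Longrightarrow> h \<in> cadlag R \<Longrightarrow>
    skorohod_dist R f h \<le> skorohod_dist R f g + skorohod_dist R g h"
  by (rule Metric_space.triangle[OF Metric_space_skorohod])

lemma continuous_map_skorohodD:
  assumes F: "continuous_map (skorohod_topology R) euclideanreal F" and f: "f \<in> cadlag R" and e: "0 < e"
  obtains r where "r > 0" "\<And>g. g \<in> cadlag R \<Longrightarrow> skorohod_dist R f g < r \<Longrightarrow> \<bar>F g - F f\<bar> < e"
proof -
  have "openin (skorohod_topology R) {g \<in> topspace (skorohod_topology R). F g \<in> ball (F f) e}"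
    by (rule openin_continuous_map_preimage[OF F]) auto
  then obtain r where "r > 0" "\<And>g. g \<in> cadlag R \<Longrightarrow> skorohod_dist R f g < r \<Longrightarrow> F g \<in> ball (F f) e"
    unfolding openin_skorohod using f e by force
  then show thesis by (intro that[of r]) (auto simp: dist_real_def abs_minus_commute)
qed

text \<open>The step function with value \<open>a k\<close> on [k/N, (k+1)/N), restricted to [0, R].
  It depends on finitely many of the values \<open>a k\<close>, which reduces measurability to
  finitely many coordinates.\<close>

definition grid_path :: "real \<Rightarrow> real \<Rightarrow> (int \<Rightarrow> real) \<Rightarrow> real \<Rightarrow> real" where
  "grid_path R N a = (\<lambda>t\<in>{0..R}. a \<lfloor>N * t\<rfloor>)"

lemma grid_path_cadlag:
  assumes "N > 0" "R > 0"
  shows "grid_path R N a \<in> cadlag R"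
  unfolding cadlag_def
proof (intro CollectI conjI ballI)
  show "grid_path R N a \<in> extensional {0..R}" by (simp add: grid_path_def)
next
  fix t assume t: "t \<in> {0..<R}"
  have "eventually (\<lambda>s. s < min R ((real_of_int \<lfloor>N * t\<rfloor> + 1) / N)) (at_right t)"
    using t assms floor_correct[of "N * t"] by (intro order_tendstoD[OF tendsto_ident_at]) (simp add: field_simps; linarith)
  then have "eventually (\<lambda>s. grid_path R N a s = grid_path R N a t) (at_right t)"
    using eventually_at_right_less[of t]
  proof eventually_elim
    case (elim s)
    then have "N * t \<le> N * s" "N * s < real_of_int \<lfloor>N * t\<rfloor> + 1"
      using assms by (auto simp: field_simps)
    then have "\<lfloor>N * s\<rfloor> = \<lfloor>N * t\<rfloor>" by linarith
    then show ?case using elim t by (simp add: grid_path_def)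
  qed
  then show "(grid_path R N a \<longlongrightarrow> grid_path R N a t) (at_right t)" by (rule tendsto_eventually)
next
  fix t assume t: "t \<in> {0<..R}"
  \<comment> \<open>The cell to the left of \<open>t\<close> has index \<lceil>N t\<rceil> - 1, also
    when N t is an integer and \<open>t\<close> starts a new cell.\<close>
  have "eventually (\<lambda>s. max 0 ((real_of_int \<lceil>N * t\<rceil> - 1) / N) < s) (at_left t)"
    using t assms by (intro order_tendstoD[OF tendsto_ident_at])
      (simp add: field_simps, use ceiling_correct[of "N * t"] in \<open>simp add: field_simps\<close>)
  then have "eventually (\<lambda>s. grid_path R N a s = a (\<lceil>N * t\<rceil> - 1)) (at_left t)"
    using eventually_at_left_real[of "t - 1" t, simplified]
  proof eventually_elim
    case (elim s)
    then have "N * s < N * t" "real_of_int \<lceil>N * t\<rceil> - 1 < N * s"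
      using assms by (auto simp: field_simps)
    then have "\<lfloor>N * s\<rfloor> = \<lceil>N * t\<rceil> - 1" by linarith
    then show ?case using elim t by (simp add: grid_path_def)
  qed
  then show "\<exists>l. (grid_path R N a \<longlongrightarrow> l) (at_left t)" using tendsto_eventually by blast
qed

text \<open>Chains of this relation, that is its reflexive transitive closure, encode finite
  partitions with oscillation at most \<open>e\<close> on each half-open piece.\<close>

definition osc_step :: "(real \<Rightarrow> real) \<Rightarrow> real \<Rightarrow> real \<Rightarrow> real \<Rightarrow> bool" where
  "osc_step f e a b \<longleftrightarrow> a < b \<and> (\<forall>s\<in>{a..<b}. \<forall>t\<in>{a..<b}. \<bar>f s - f t\<bar> \<le> e)"

text \<open>Bisection: next to each point the left limit and the right limit provide one piece on
  either side, and chains concatenate. The point itself belongs to the piece on its right, where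
  right continuity is used.\<close>

lemma cadlag_osc_partition:
  assumes f: "f \<in> cadlag R" and R: "0 < R" and e: "0 < e"
  shows "(osc_step f e)\<^sup>*\<^sup>* 0 R"
proof -
  have "0 \<le> (0::real) \<longrightarrow> R \<le> R \<longrightarrow> (osc_step f e)\<^sup>*\<^sup>* 0 R"
  proof (rule Bolzano[where P = "\<lambda>a b. 0 \<le> a \<longrightarrow> b \<le> R \<longrightarrow> (osc_step f e)\<^sup>*\<^sup>* a b"])
    show "0 \<le> R" using R by simp
  next
    fix a b c :: real
    assume "0 \<le> a \<longrightarrow> b \<le> R \<longrightarrow> (osc_step f e)\<^sup>*\<^sup>* a b" "0 \<le> b \<longrightarrow> c \<le> R \<longrightarrow> (osc_step f e)\<^sup>*\<^sup>* b c"
      and "a \<le> b" "b \<le> c"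
    then show "0 \<le> a \<longrightarrow> c \<le> R \<longrightarrow> (osc_step f e)\<^sup>*\<^sup>* a c"
      by (meson order_trans rtranclp_trans)
  next
    fix x assume x: "0 \<le> x" "x \<le> R"
    have "\<exists>d>0. \<forall>b. x < b \<and> b \<le> R \<and> b - x < d \<longrightarrow> osc_step f e x b"
    proof (cases "x < R")
      case True
      then have "(f \<longlongrightarrow> f x) (at_right x)" using f x by (auto simp: cadlag_def)
      then have "eventually (\<lambda>t. dist (f t) (f x) < e / 2) (at_right x)" by (rule tendstoD) (use e in simp)
      then obtain c where c: "c > x" "\<And>y. x < y \<Longrightarrow> y < c \<Longrightarrow> dist (f y) (f x) < e / 2"
        by (auto simp: eventually_at_right_field)
      have "osc_step f e x b" if "x < b" "b - x < c - x" for b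
        unfolding osc_step_def
      proof (intro conjI ballI)
        fix s t assume "s \<in> {x..<b}" "t \<in> {x..<b}"
        then have "\<bar>f s - f x\<bar> \<le> e / 2" "\<bar>f t - f x\<bar> \<le> e / 2"
          using c(2)[of s] c(2)[of t] that e by (cases "s = x"; cases "t = x"; force simp: dist_real_def)+
        then show "\<bar>f s - f t\<bar> \<le> e" by linarith
      qed (use that in simp)
      then show ?thesis using c(1) by (intro exI[of _ "c - x"]) auto
    qed (auto intro!: exI[of _ 1])
    then obtain d1 where d1: "d1 > 0" "\<And>b. x < b \<Longrightarrow> b \<le> R \<Longrightarrow> b - x < d1 \<Longrightarrow> osc_step f e x b" by blast
    have "\<exists>d>0. \<forall>a. a < x \<and> 0 \<le> a \<and> x - a < d \<longrightarrow> osc_step f e a x"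
    proof (cases "0 < x")
      case True
      then have "x \<in> {0<..R}" using x by simp
      then obtain l where "(f \<longlongrightarrow> l) (at_left x)" using f unfolding cadlag_def by blast
      then have "eventually (\<lambda>t. dist (f t) l < e / 2) (at_left x)" by (rule tendstoD) (use e in simp)
      then obtain c where c: "c < x" "\<And>y. c < y \<Longrightarrow> y < x \<Longrightarrow> dist (f y) l < e / 2"
        by (auto simp: eventually_at_left_field)
      have "osc_step f e a x" if "a < x" "x - a < x - c" for a
        unfolding osc_step_def
      proof (intro conjI ballI)
        fix s t assume "s \<in> {a..<x}" "t \<in> {a..<x}"
        then have "\<bar>f s - l\<bar> \<le> e / 2" "\<bar>f t - l\<bar> \<le> e / 2"
          using c(2)[of s] c(2)[of t] that by (force simp: dist_real_def)+
        then show "\<bar>f s - f t\<bar> \<le> e" by linarith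
      qed (use that in simp)
      then show ?thesis using c(1) by (intro exI[of _ "x - c"]) auto
    qed (auto intro!: exI[of _ 1])
    then obtain d2 where d2: "d2 > 0" "\<And>a. a < x \<Longrightarrow> 0 \<le> a \<Longrightarrow> x - a < d2 \<Longrightarrow> osc_step f e a x" by blast
    show "\<exists>d>0. \<forall>a b. a \<le> x \<and> x \<le> b \<and> b - a < d \<longrightarrow> (0 \<le> a \<longrightarrow> b \<le> R \<longrightarrow> (osc_step f e)\<^sup>*\<^sup>* a b)"
    proof (intro exI[of _ "min d1 d2"] conjI allI impI)
      fix a b assume ab: "a \<le> x \<and> x \<le> b \<and> b - a < min d1 d2" "0 \<le> a" "b \<le> R"
      have "(osc_step f e)\<^sup>*\<^sup>* a x" using d2(2)[of a] ab by (cases "a = x") auto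
      moreover have "(osc_step f e)\<^sup>*\<^sup>* x b" using d1(2)[of b] ab by (cases "b = x") auto
      ultimately show "(osc_step f e)\<^sup>*\<^sup>* a b" by (rule rtranclp_trans)
    qed (use d1 d2 in simp)
  qed
  then show ?thesis by simp
qed

text \<open>The time change maps every partition point to the next grid point.\<close>

lemma grid_time_change:
  assumes "(osc_step f e)\<^sup>*\<^sup>* 0 b"
  shows "eventually (\<lambda>N::real. \<exists>\<phi>. strict_mono_on {0..b} \<phi> \<and> \<phi> ` {0..b} = {0..\<lceil>N * b\<rceil> / N} \<and>
    (\<forall>t\<in>{0..b}. t \<le> \<phi> t \<and> \<phi> t \<le> t + 1 / N) \<and>
    (\<forall>t\<in>{0..<b}. \<bar>f (\<lfloor>N * \<phi> t\<rfloor> / N) - f t\<bar> \<le> e)) at_top \<and> 0 \<le> b"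
  using assms
proof (induction rule: rtranclp_induct)
  case base
  have *: "\<exists>\<phi>. strict_mono_on {0..0::real} \<phi> \<and> \<phi> ` {0..0} = {0..\<lceil>N * 0\<rceil> / N} \<and>
    (\<forall>t\<in>{0..0}. t \<le> \<phi> t \<and> \<phi> t \<le> t + 1 / N) \<and>
    (\<forall>t\<in>{0..<0}. \<bar>f (\<lfloor>N * \<phi> t\<rfloor> / N) - f t\<bar> \<le> e)" if "N > 0" for N :: real
    using that by (intro exI[of _ "\<lambda>t. t"]) (auto simp: strict_mono_on_def)
  show ?case
    by (rule conjI, rule eventually_mono[OF eventually_gt_at_top[of 0]], erule *, simp)
next
  case (step b c)
  then have bc: "b < c" and osc: "\<And>s t. s \<in> {b..<c} \<Longrightarrow> t \<in> {b..<c} \<Longrightarrow> \<bar>f s - f t\<bar> \<le> e" and b0: "0 \<le> b"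
    by (auto simp: osc_step_def)
  have "eventually (\<lambda>N::real. \<exists>\<phi>. strict_mono_on {0..c} \<phi> \<and> \<phi> ` {0..c} = {0..\<lceil>N * c\<rceil> / N} \<and>
    (\<forall>t\<in>{0..c}. t \<le> \<phi> t \<and> \<phi> t \<le> t + 1 / N) \<and>
    (\<forall>t\<in>{0..<c}. \<bar>f (\<lfloor>N * \<phi> t\<rfloor> / N) - f t\<bar> \<le> e)) at_top"
    using eventually_gt_at_top[of "max 0 (1 / (c - b))"] conjunct1[OF step.IH]
  proof eventually_elim
    case (elim N)
    \<comment> \<open>A mesh below c - b puts the image \<lceil>N b\<rceil> / N of b strictly below
      c, so that the new piece of the time change is strictly increasing.\<close>
    then have N: "N > 0" "1 / (c - b) < N" by auto
    then have Nbc: "N * b + 1 < N * c" using bc by (simp add: field_simps)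
    obtain \<phi> where \<phi>: "strict_mono_on {0..b} \<phi>" "\<phi> ` {0..b} = {0..\<lceil>N * b\<rceil> / N}"
      "\<And>t. t \<in> {0..b} \<Longrightarrow> t \<le> \<phi> t \<and> \<phi> t \<le> t + 1 / N"
      "\<And>t. t \<in> {0..<b} \<Longrightarrow> \<bar>f (\<lfloor>N * \<phi> t\<rfloor> / N) - f t\<bar> \<le> e"
      using elim(2) by blast
    define B where "B = \<lceil>N * b\<rceil> / N"
    define C where "C = \<lceil>N * c\<rceil> / N"
    have B: "b \<le> B" "B \<le> b + 1 / N" and C: "c \<le> C" "C \<le> c + 1 / N"
      using N ceiling_correct[of "N * b"] ceiling_correct[of "N * c"]
      unfolding B_def C_def by (auto simp: field_simps)
    have BC: "B < c"
      using N Nbc ceiling_correct[of "N * b"] by (simp add: B_def field_simps)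
    \<comment> \<open>Linear interpolation that takes b to B and c to C.\<close>
    define l where "l t = B + (C - B) * ((t - b) / (c - b))" for t
    define \<psi> where "\<psi> t = (if t \<le> b then \<phi> t else l t)" for t
    have CB: "0 < (C - B) / (c - b)" using BC C bc by simp
    have lmono: "l s < l t" if "s < t" for s t
      using that bc BC C by (simp add: l_def divide_strict_right_mono mult_strict_left_mono)
    have lb: "l b = B" "l c = C" using bc by (simp_all add: l_def)
    have phib: "\<phi> t \<le> B" if "t \<in> {0..b}" for t using \<phi>(2) that unfolding B_def by auto
    have "strict_mono_on {0..c} \<psi>"
    proof (rule strict_mono_onI)
      fix s t assume st: "s \<in> {0..c}" "t \<in> {0..c}" "s < t"
      consider "t \<le> b" | "s \<le> b" "b < t" | "b < s" by linarith
      then show "\<psi> s < \<psi> t"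
      proof cases
        case 1 then show ?thesis using strict_mono_onD[OF \<phi>(1), of s t] st by (simp add: \<psi>_def)
      next
        case 2
        then have "\<phi> s \<le> B" using phib st by auto
        also have "B < l t" using lmono[of b t] 2 lb by simp
        finally show ?thesis using 2 by (simp add: \<psi>_def)
      next
        case 3 then show ?thesis using lmono[of s t] st by (simp add: \<psi>_def)
      qed
    qed
    moreover have "\<psi> ` {0..c} = {0..C}"
    proof (intro set_eqI iffI)
      fix y assume "y \<in> \<psi> ` {0..c}"
      then obtain t where t: "t \<in> {0..c}" "y = \<psi> t" by blast
      show "y \<in> {0..C}"
      proof (cases "t \<le> b")
        case True
        then have "\<phi> t \<in> {0..B}" using \<phi>(2) t unfolding B_def by auto
        then show ?thesis using t True BC C by (simp add: \<psi>_def)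
      next
        case False
        then have "B \<le> l t" "l t \<le> C" using lmono[of b t] lmono[of t c] lb t by (cases "t = c"; simp)+
        then show ?thesis using t False B b0 by (simp add: \<psi>_def)
      qed
    next
      fix y assume y: "y \<in> {0..C}"
      show "y \<in> \<psi> ` {0..c}"
      proof (cases "y \<le> B")
        case True
        then have "y \<in> \<phi> ` {0..b}" using \<phi>(2) y unfolding B_def by simp
        then obtain t where "t \<in> {0..b}" "y = \<phi> t" by blast
        then show ?thesis using bc by (auto simp: \<psi>_def intro!: image_eqI[of _ _ t])
      next
        case False
        define t where "t = b + (y - B) * ((c - b) / (C - B))"
        have "b < t" using False bc BC C by (simp add: t_def)
        moreover have "t \<le> c"
        proof -
          have "(y - B) * ((c - b) / (C - B)) \<le> (C - B) * ((c - b) / (C - B))"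
            using y bc BC C by (intro mult_right_mono) auto
          then show ?thesis using BC C by (simp add: t_def)
        qed
        moreover have "l t = y" using bc BC C by (simp add: t_def l_def)
        ultimately show ?thesis using b0 by (auto simp: \<psi>_def intro!: image_eqI[of _ _ t])
      qed
    qed
    moreover have "t \<le> \<psi> t \<and> \<psi> t \<le> t + 1 / N" if t: "t \<in> {0..c}" for t
    proof (cases "t \<le> b")
      case True then show ?thesis using \<phi>(3) t by (simp add: \<psi>_def)
    next
      case False
      \<comment> \<open>The displacement at \<open>t\<close> is a convex combination of B - b and C
        - c, both of which lie in [0, 1/N].\<close>
      define u where "u = (t - b) / (c - b)"
      have u: "0 \<le> u" "u \<le> 1" using False t bc by (auto simp: u_def)
      have "t = b + (c - b) * u" using bc by (simp add: u_def)
      then have tt: "l t - t = (1 - u) * (B - b) + u * (C - c)"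
        unfolding l_def u_def[symmetric] by (simp add: algebra_simps)
      have "0 \<le> (1 - u) * (B - b) + u * (C - c)" using u B C by simp
      moreover have "(1 - u) * (B - b) + u * (C - c) \<le> (1 - u) * (1 / N) + u * (1 / N)"
        using u B C by (intro add_mono mult_left_mono) auto
      moreover have "(1 - u) * (1 / N) + u * (1 / N) = 1 / N" unfolding distrib_right[symmetric] by simp
      ultimately show ?thesis using tt False by (simp add: \<psi>_def)
    qed
    moreover have "\<bar>f (\<lfloor>N * \<psi> t\<rfloor> / N) - f t\<bar> \<le> e" if t: "t \<in> {0..<c}" for t
    proof (cases "t < b")
      case True then show ?thesis using \<phi>(4) t by (simp add: \<psi>_def)
    next
      case False
      have "\<phi> b = B" if "t = b"
      proof -
        have "B \<in> \<phi> ` {0..b}" using \<phi>(2) b0 B(1) unfolding B_def by simp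
        then obtain s where s: "s \<in> {0..b}" "\<phi> s = B" by auto
        then have "B \<le> \<phi> b" using strict_mono_on_leD[OF \<phi>(1), of s b] b0 by auto
        then show ?thesis using phib[of b] b0 by simp
      qed
      then have "\<psi> t = l t" using False lb by (cases "t = b") (auto simp: \<psi>_def)
      then have "B \<le> \<psi> t" "\<psi> t < C"
        using False lmono[of b t] lmono[of t c] lb t by (cases "t = b"; simp)+
      \<comment> \<open>The grid point to the left of \<open>\<psi> t\<close> lies in [b, c), the
        piece that contains \<open>t\<close>, so the oscillation bound applies. Rounding the
        partition points up, and not down, is what makes this work.\<close>
      then have "real_of_int \<lceil>N * b\<rceil> \<le> N * \<psi> t" "N * \<psi> t < real_of_int \<lceil>N * c\<rceil>"
        using N by (simp_all add: B_def C_def field_simps)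
      then have "\<lceil>N * b\<rceil> \<le> \<lfloor>N * \<psi> t\<rfloor>" "\<lfloor>N * \<psi> t\<rfloor> < \<lceil>N * c\<rceil>"
        by (simp_all add: le_floor_iff floor_less_iff)
      then have "N * b \<le> real_of_int \<lfloor>N * \<psi> t\<rfloor>" "real_of_int \<lfloor>N * \<psi> t\<rfloor> < N * c"
        by (simp_all add: ceiling_le_iff less_ceiling_iff)
      then have "real_of_int \<lfloor>N * \<psi> t\<rfloor> / N \<in> {b..<c}" using N by (simp add: field_simps)
      then show ?thesis using osc t False by auto
    qed
    ultimately show ?case unfolding C_def by blast
  qed
  then show ?case using bc b0 by simp
qed

text \<open>The grids N = (n + 1) / R make N R an integer. The time change constructed above then
  maps [0, R] onto itself, and the value at R, the one point outside the half-open pieces, is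
  reproduced exactly.\<close>

lemma grid_path_tendsto:
  assumes f: "f \<in> cadlag R" and R: "0 < R"
  shows "(\<lambda>n. skorohod_dist R f (grid_path R (real (Suc n) / R) (\<lambda>k. f (real_of_int k / (real (Suc n) / R))))) \<longlonglongrightarrow> 0"
proof (rule LIMSEQ_I)
  fix r :: real assume r: "0 < r"
  define N where "N n = real (Suc n) / R" for n
  have N: "N n > 0" for n using R by (simp add: N_def)
  have "filterlim (\<lambda>n. real (Suc n)) at_top sequentially"
    by (rule filterlim_compose[OF filterlim_real_sequentially filterlim_Suc])
  then have lim: "filterlim N at_top sequentially"
    using filterlim_tendsto_pos_mult_at_top[OF tendsto_const[of "1 / R"]] R by (simp add: N_def[abs_def])
  have "eventually (\<lambda>n. 2 / r < N n) sequentially"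
    using lim by (simp add: filterlim_at_top_dense)
  moreover note eventually_compose_filterlim[OF conjunct1[OF grid_time_change[OF cadlag_osc_partition[OF f R half_gt_zero[OF r]]]] lim]
  ultimately have "eventually (\<lambda>n. skorohod_dist R f (grid_path R (N n) (\<lambda>k. f (real_of_int k / N n))) < r) sequentially"
  proof eventually_elim
    case (elim n)
    have NR: "N n * R = real_of_int (int (Suc n))" using R by (simp add: N_def)
    have cR: "\<lceil>N n * R\<rceil> / N n = R" unfolding NR ceiling_of_int using R by (simp add: N_def)
    obtain \<phi> where \<phi>: "strict_mono_on {0..R} \<phi>" "\<phi> ` {0..R} = {0..R}"
      "\<And>t. t \<in> {0..R} \<Longrightarrow> t \<le> \<phi> t \<and> \<phi> t \<le> t + 1 / N n"
      "\<And>t. t \<in> {0..<R} \<Longrightarrow> \<bar>f (\<lfloor>N n * \<phi> t\<rfloor> / N n) - f t\<bar> \<le> r / 2"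
      using elim(2) r unfolding cR by auto
    have tc: "\<phi> \<in> time_changes R" using \<phi> by (simp add: time_changes_def)
    have "skorohod_close R f (grid_path R (N n) (\<lambda>k. f (real_of_int k / N n))) (r / 2)"
      unfolding skorohod_close_def
    proof (intro conjI bexI[OF _ tc] ballI)
      fix t assume t: "t \<in> {0..R}"
      have "1 / N n < r / 2" using elim(1) N[of n] r by (simp add: field_simps)
      then show "\<bar>\<phi> t - t\<bar> \<le> r / 2" using \<phi>(3)[OF t] by linarith
      have m: "\<phi> t \<in> {0..R}" by (rule time_changes_maps[OF tc t])
      show "\<bar>f t - grid_path R (N n) (\<lambda>k. f (real_of_int k / N n)) (\<phi> t)\<bar> \<le> r / 2"
      proof (cases "t = R")
        case True
        have "\<phi> R = R" using time_changes_end[OF tc] R by simp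
        moreover have "real_of_int \<lfloor>N n * R\<rfloor> / N n = R" unfolding NR floor_of_int using R by (simp add: N_def)
        ultimately show ?thesis using True R r by (simp add: grid_path_def)
      next
        case False
        then show ?thesis using \<phi>(4)[of t] t m by (simp add: grid_path_def abs_minus_commute)
      qed
    qed (use r in simp)
    then show ?case using skorohod_dist_leI r by fastforce
  qed
  then show "\<exists>no. \<forall>n\<ge>no. norm (skorohod_dist R f (grid_path R (real (Suc n) / R) (\<lambda>k. f (real_of_int k / (real (Suc n) / R)))) - 0) < r"
    unfolding N_def[symmetric] eventually_sequentially by (simp add: skorohod_dist_nonneg)
qed

text \<open>Only the coordinates in the finite set \<open>K\<close> matter, and the Skorohod
  distance is at most the uniform one, so the preimage of an open set is open in the product
  topology on \<open>int \<Rightarrow> real\<close>.\<close>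

lemma measurable_grid_path:
  assumes R: "0 < R" and N: "0 < N" and a: "\<And>k. (\<lambda>w. a w k) \<in> borel_measurable M"
    and U: "openin (skorohod_topology R) U"
  shows "{w \<in> space M. grid_path R N (a w) \<in> U} \<in> sets M"
proof -
  have "open {b::int \<Rightarrow> real. grid_path R N b \<in> U}"
    unfolding open_subopen[of "{b. grid_path R N b \<in> U}"]
  proof (intro ballI)
    fix b assume "b \<in> {b. grid_path R N b \<in> U}"
    then obtain r where r: "r > 0" "\<And>g. g \<in> cadlag R \<Longrightarrow> skorohod_dist R (grid_path R N b) g < r \<Longrightarrow> g \<in> U"
      using U unfolding openin_skorohod by blast
    define K where "K = {0..\<lfloor>N * R\<rfloor>}"
    have K: "\<lfloor>N * t\<rfloor> \<in> K" if "t \<in> {0..R}" for t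
      using that N unfolding K_def by (auto intro!: floor_mono)
    have "open (\<Inter>k\<in>K. {c::int \<Rightarrow> real. \<bar>c k - b k\<bar> < r / 2})"
      by (intro open_INT ballI open_Collect_less continuous_intros) (auto simp: K_def)
    moreover have "grid_path R N c \<in> U" if c: "\<And>k. k \<in> K \<Longrightarrow> \<bar>c k - b k\<bar> < r / 2" for c
    proof (rule r(2)[OF grid_path_cadlag[OF N R]])
      have "skorohod_dist R (grid_path R N b) (grid_path R N c) \<le> r / 2"
        using c[OF K] r by (intro skorohod_dist_uniform) (auto simp: grid_path_def abs_minus_commute less_imp_le)
      then show "skorohod_dist R (grid_path R N b) (grid_path R N c) < r" using r by simp
    qed
    ultimately show "\<exists>T. open T \<and> b \<in> T \<and> T \<subseteq> {b. grid_path R N b \<in> U}"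
      using r by (intro exI[of _ "\<Inter>k\<in>K. {c::int \<Rightarrow> real. \<bar>c k - b k\<bar> < r / 2}"]) auto
  qed
  then have "{b::int \<Rightarrow> real. grid_path R N b \<in> U} \<in> sets borel" by simp
  moreover have "a \<in> borel_measurable M" by (rule measurable_coordinatewise_then_product[OF a])
  ultimately have "a -` {b. grid_path R N b \<in> U} \<inter> space M \<in> sets M" by (rule measurable_sets[rotated])
  moreover have "a -` {b. grid_path R N b \<in> U} \<inter> space M = {w \<in> space M. grid_path R N (a w) \<in> U}" by auto
  ultimately show ?thesis by simp
qed

text \<open>Measurable evaluations suffice for Borel measurability: each path is the limit of its
  sampled step functions, and membership in an open set can be decided along this sequence.\<close>

lemma measurable_skorohod:
  assumes R: "0 < R" and Y: "\<And>w. w \<in> space M \<Longrightarrow> Y w \<in> cadlag R"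
    and m: "\<And>t. t \<in> {0..R} \<Longrightarrow> (\<lambda>w. Y w t) \<in> borel_measurable M"
  shows "Y \<in> M \<rightarrow>\<^sub>M borel_of_top (skorohod_topology R)"
  unfolding borel_of_top_def
proof (rule measurable_measure_of)
  show "{U. openin (skorohod_topology R) U} \<subseteq> Pow (topspace (skorohod_topology R))"
    using openin_subset by blast
  show "Y \<in> space M \<rightarrow> topspace (skorohod_topology R)" using Y by simp
  fix U assume "U \<in> {U. openin (skorohod_topology R) U}"
  then have U: "openin (skorohod_topology R) U" by simp
  define N where "N n = real (Suc n) / R" for n
  \<comment> \<open>Clamping to [0, R] does not change the step function on this interval, and it
    makes every coordinate an evaluation at a point where measurability is assumed.\<close>
  define Yn where "Yn n w = grid_path R (N n) (\<lambda>k. Y w (max 0 (min R (real_of_int k / N n))))" for n w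
  have N: "N n > 0" for n using R by (simp add: N_def)
  have Ync: "Yn n w \<in> cadlag R" for n w unfolding Yn_def by (rule grid_path_cadlag[OF N R])
  have eq: "Yn n w = grid_path R (N n) (\<lambda>k. Y w (real_of_int k / N n))" for n w
  proof -
    have "real_of_int \<lfloor>N n * t\<rfloor> / N n \<in> {0..R}" if "t \<in> {0..R}" for t
    proof -
      have "real_of_int \<lfloor>N n * t\<rfloor> / N n \<le> N n * t / N n" using N[of n] by (intro divide_right_mono) auto
      then show ?thesis using that N[of n] by auto
    qed
    then show ?thesis by (auto simp: Yn_def grid_path_def fun_eq_iff)
  qed
  have conv: "(\<lambda>n. skorohod_dist R (Y w) (Yn n w)) \<longlonglongrightarrow> 0" if "w \<in> space M" for w
    using grid_path_tendsto[OF Y[OF that] R] unfolding eq N_def by simp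
  \<comment> \<open>Paths that have a ball of radius larger than 1 / (k + 1) inside
    \<open>U\<close>. The margin lets membership in \<open>U\<close> pass from the approximations to
    their limit, and each \<open>V k\<close> is still open.\<close>
  define V where "V k = {f \<in> cadlag R. \<exists>r>1 / real (Suc k). \<forall>g\<in>cadlag R. skorohod_dist R f g < r \<longrightarrow> g \<in> U}" for k
  have V: "openin (skorohod_topology R) (V k)" for k
    unfolding openin_skorohod
  proof (intro conjI ballI)
    show "V k \<subseteq> cadlag R" by (auto simp: V_def)
    fix f assume "f \<in> V k"
    then obtain r where f: "f \<in> cadlag R" and r: "r > 1 / real (Suc k)"
      "\<And>g. g \<in> cadlag R \<Longrightarrow> skorohod_dist R f g < r \<Longrightarrow> g \<in> U" by (auto simp: V_def)
    define d where "d = (r - 1 / real (Suc k)) / 2"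
    have mid: "0 < (r - q) / 2 \<and> q < r - (r - q) / 2" if "q < r" for q r :: real
      using that by (simp add: field_simps)
    have d: "d > 0" "r - d > 1 / real (Suc k)" using mid[OF r(1)] unfolding d_def by auto
    have "g \<in> V k" if g: "g \<in> cadlag R" "skorohod_dist R f g < d" for g
    proof -
      have "h \<in> U" if "h \<in> cadlag R" "skorohod_dist R g h < r - d" for h
        using skorohod_dist_triangle[OF f g(1) that(1)] g(2) that r(2)[of h] by simp
      then show ?thesis using d(2) g(1) unfolding V_def by blast
    qed
    then show "\<exists>r>0. \<forall>g\<in>cadlag R. skorohod_dist R f g < r \<longrightarrow> g \<in> V k" using d(1) by blast
  qed
  have "Y -` U \<inter> space M = (\<Union>k. \<Union>n0. \<Inter>n\<in>{n0..}. {w \<in> space M. Yn n w \<in> V k})"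
  proof (intro set_eqI iffI)
    fix w assume "w \<in> Y -` U \<inter> space M"
    then have w: "w \<in> space M" "Y w \<in> U" by auto
    obtain r where r: "r > 0" "\<And>g. g \<in> cadlag R \<Longrightarrow> skorohod_dist R (Y w) g < r \<Longrightarrow> g \<in> U"
      using U w(2) unfolding openin_skorohod by blast
    obtain k where k: "1 / real (Suc k) < r / 2"
      using reals_Archimedean[OF half_gt_zero[OF r(1)]] unfolding inverse_eq_divide by blast
    obtain n0 where n0: "\<And>n. n \<ge> n0 \<Longrightarrow> skorohod_dist R (Y w) (Yn n w) < r / 2"
      using LIMSEQ_D[OF conv[OF w(1)], of "r / 2"] r by (auto simp: skorohod_dist_nonneg)
    have "Yn n w \<in> V k" if "n \<ge> n0" for n
    proof -
      have "g \<in> U" if "g \<in> cadlag R" "skorohod_dist R (Yn n w) g < r / 2" for g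
        using skorohod_dist_triangle[OF Y[OF w(1)] Ync that(1), of n w] n0[OF \<open>n \<ge> n0\<close>] that r(2) by simp
      then show ?thesis using k Ync unfolding V_def by blast
    qed
    then show "w \<in> (\<Union>k. \<Union>n0. \<Inter>n\<in>{n0..}. {w \<in> space M. Yn n w \<in> V k})" using w by auto
  next
    fix w assume "w \<in> (\<Union>k. \<Union>n0. \<Inter>n\<in>{n0..}. {w \<in> space M. Yn n w \<in> V k})"
    then obtain k n0 where kn: "\<And>n. n \<ge> n0 \<Longrightarrow> w \<in> space M \<and> Yn n w \<in> V k" by auto
    then have w: "w \<in> space M" by blast
    obtain n1 where "\<And>n. n \<ge> n1 \<Longrightarrow> skorohod_dist R (Y w) (Yn n w) < 1 / real (Suc k)"
      using LIMSEQ_D[OF conv[OF w], of "1 / real (Suc k)"] by (auto simp: skorohod_dist_nonneg)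
    then have "skorohod_dist R (Yn (max n0 n1) w) (Y w) < 1 / real (Suc k)"
      by (simp add: skorohod_dist_commute del: of_nat_Suc)
    moreover have "Yn (max n0 n1) w \<in> V k" using kn by simp
    ultimately have "Y w \<in> U" using Y[OF w] less_trans unfolding V_def by blast
    then show "w \<in> Y -` U \<inter> space M" using w by simp
  qed
  also have "\<dots> \<in> sets M"
  proof -
    have "{w \<in> space M. Yn n w \<in> V k} \<in> sets M" for n k
      unfolding Yn_def by (rule measurable_grid_path[OF R N m V]) (use R in auto)
    then have "(\<Inter>n\<in>{n0..}. {w \<in> space M. Yn n w \<in> V k}) \<in> sets M" for k n0
      by (intro sets.countable_INT) auto
    then show ?thesis by (intro sets.countable_UN image_subsetI)
  qed
  finally show "Y -` U \<inter> space M \<in> sets M" .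
qed

section \<open>Tightness on the line and convergence to a random curve\<close>

lemma real_distribution_tight:
  assumes "real_distribution N" "0 < e"
  obtains K where "K > 0" "measure N {z. \<bar>z\<bar> > K} < e"
proof -
  interpret real_distribution N by fact
  have "(\<lambda>n. measure N {z. \<bar>z\<bar> > real n}) \<longlonglongrightarrow> measure N (\<Inter>n. {z. \<bar>z\<bar> > real n})"
    by (rule finite_Lim_measure_decseq) (auto simp: decseq_def)
  moreover have "(\<Inter>n. {z. \<bar>z\<bar> > real n}) = {}"
  proof (intro equals0I)
    fix x assume x: "x \<in> (\<Inter>n. {z. \<bar>z\<bar> > real n})"
    obtain n where "\<bar>x\<bar> < real n" using reals_Archimedean2 by blast
    moreover have "real n < \<bar>x\<bar>" using x by simp
    ultimately show False by simp
  qed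
  ultimately have "(\<lambda>n. measure N {z. \<bar>z\<bar> > real n}) \<longlonglongrightarrow> 0" by simp
  then have "eventually (\<lambda>n. measure N {z. \<bar>z\<bar> > real n} < e) sequentially" using assms(2) by (rule order_tendstoD)
  then obtain n where "measure N {z. \<bar>z\<bar> > real n} < e" "n > 0"
    using eventually_happens[OF eventually_conj[OF _ eventually_gt_at_top[of 0]]] by auto
  then show thesis by (intro that[of "real n"]) auto
qed

text \<open>A continuous function between the indicators of |z| > K + 1 and |z| > K carries the tail
  bound of the limit over to all large n, at the cost of enlarging K by 1.\<close>

lemma weak_conv_imp_tight:
  assumes "\<And>n. real_distribution (\<mu> n)" "real_distribution N" "weak_conv_m \<mu> N" "0 < e"
  obtains K where "K > 0" "eventually (\<lambda>n. measure (\<mu> n) {z. \<bar>z\<bar> > K} < e) sequentially"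
proof -
  interpret N: real_distribution N by fact
  obtain K where K: "K > 0" "measure N {z. \<bar>z\<bar> > K} < e" using real_distribution_tight[OF assms(2,4)] by blast
  define f where "f z = min 1 (max 0 (\<bar>z\<bar> - K))" for z :: real
  have [measurable]: "f \<in> borel_measurable borel" unfolding f_def[abs_def] by measurable
  have f: "0 \<le> f z" "f z \<le> 1" "indicator {z. \<bar>z\<bar> > K + 1} z \<le> f z" "f z \<le> indicator {z. \<bar>z\<bar> > K} z" for z
    by (auto simp: f_def indicator_def)
  have cont: "isCont f z" for z unfolding f_def[abs_def] by (intro continuous_intros)
  have "(\<lambda>n. integral\<^sup>L (\<mu> n) f) \<longlonglongrightarrow> integral\<^sup>L N f"
    by (rule weak_conv_imp_integral_bdd_continuous_conv[OF assms(1,2,3) cont, of 1]) (use f in auto)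
  moreover have "integral\<^sup>L N f \<le> measure N {z. \<bar>z\<bar> > K}"
  proof -
    have "integral\<^sup>L N f \<le> integral\<^sup>L N (indicator {z. \<bar>z\<bar> > K})"
      using f by (intro integral_mono N.integrable_const_bound[of _ 1]) (auto simp: indicator_def)
    then show ?thesis by simp
  qed
  ultimately have "eventually (\<lambda>n. integral\<^sup>L (\<mu> n) f < e) sequentially"
    using K(2) order_tendstoD(2) le_less_trans by blast
  then have "eventually (\<lambda>n. measure (\<mu> n) {z. \<bar>z\<bar> > K + 1} < e) sequentially"
  proof eventually_elim
    case (elim n)
    interpret P: real_distribution "\<mu> n" by fact
    have "integral\<^sup>L (\<mu> n) (indicator {z. \<bar>z\<bar> > K + 1}) \<le> integral\<^sup>L (\<mu> n) f"
      using f by (intro integral_mono P.integrable_const_bound[of _ 1]) (auto simp: indicator_def)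
    then show ?case using elim by simp
  qed
  then show thesis using K(1) by (intro that[of "K + 1"]) auto
qed

lemma continuous_map_linear_path:
  assumes R: "0 < R" and p: "continuous_on {0..R} p"
  shows "(\<lambda>r\<in>{0..R}. p r * z) \<in> cadlag R"
    and "\<exists>C>0. \<forall>y z. skorohod_dist R (\<lambda>r\<in>{0..R}. p r * y) (\<lambda>r\<in>{0..R}. p r * z) \<le> C * \<bar>y - z\<bar>"
proof -
  show "(\<lambda>r\<in>{0..R}. p r * z) \<in> cadlag R"
    unfolding cadlag_def
  proof (intro CollectI conjI ballI)
    have lim: "(p \<longlongrightarrow> p t) (at t within {0..R})" if "t \<in> {0..R}" for t
      using p that by (auto simp: continuous_on_def)
    fix t assume t: "t \<in> {0..<R}"
    have "at_right t \<le> at t within {0..R}"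
    proof -
      have "at_right t = at t within {t<..R}"
        using t by (intro at_within_nhd[of _ "{..<R}"]) auto
      then show ?thesis using t by (simp, intro at_le) auto
    qed
    then have "((\<lambda>r. p r * z) \<longlongrightarrow> p t * z) (at_right t)"
      using lim[of t] t by (intro tendsto_intros) (auto elim: tendsto_mono)
    moreover have "eventually (\<lambda>s. s \<in> {0..R}) (at_right t)"
      using t eventually_at_right_real[of t R] by (auto elim!: eventually_mono)
    ultimately show "((\<lambda>r\<in>{0..R}. p r * z) \<longlongrightarrow> (\<lambda>r\<in>{0..R}. p r * z) t) (at_right t)"
      using t by (subst tendsto_cong[where g = "\<lambda>r. p r * z"]) (auto elim!: eventually_mono)
  next
    have lim: "(p \<longlongrightarrow> p t) (at t within {0..R})" if "t \<in> {0..R}" for t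
      using p that by (auto simp: continuous_on_def)
    fix t assume t: "t \<in> {0<..R}"
    have "at_left t \<le> at t within {0..R}"
    proof -
      have "at_left t = at t within {0..<t}"
        using t by (intro at_within_nhd[of _ "{0<..}"]) auto
      then show ?thesis using t by (simp, intro at_le) auto
    qed
    then have "((\<lambda>r. p r * z) \<longlongrightarrow> p t * z) (at_left t)"
      using lim[of t] t by (intro tendsto_intros) (auto elim: tendsto_mono)
    moreover have "eventually (\<lambda>s. s \<in> {0..R}) (at_left t)"
      using t eventually_at_left_real[of 0 t] by (auto elim!: eventually_mono)
    ultimately have "((\<lambda>r\<in>{0..R}. p r * z) \<longlongrightarrow> p t * z) (at_left t)"
      using t by (subst tendsto_cong[where g = "\<lambda>r. p r * z"]) (auto elim!: eventually_mono)
    then show "\<exists>l. ((\<lambda>r\<in>{0..R}. p r * z) \<longlongrightarrow> l) (at_left t)" by blast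
  qed simp
  have "bounded (p ` {0..R})" using compact_continuous_image[OF p compact_Icc] by (rule compact_imp_bounded)
  then obtain C where C: "C > 0" "\<And>r. r \<in> {0..R} \<Longrightarrow> \<bar>p r\<bar> \<le> C" by (auto simp: bounded_pos)
  have "skorohod_dist R (\<lambda>r\<in>{0..R}. p r * y) (\<lambda>r\<in>{0..R}. p r * z) \<le> C * \<bar>y - z\<bar>" for y z
  proof (rule skorohod_dist_uniform)
    fix t assume t: "t \<in> {0..R}"
    have "\<bar>p t * y - p t * z\<bar> = \<bar>p t\<bar> * \<bar>y - z\<bar>" by (simp add: abs_mult[symmetric] right_diff_distrib)
    then show "\<bar>(\<lambda>r\<in>{0..R}. p r * y) t - (\<lambda>r\<in>{0..R}. p r * z) t\<bar> \<le> C * \<bar>y - z\<bar>"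
      using t C(2)[OF t] by (simp add: mult_right_mono)
  qed (use C in auto)
  then show "\<exists>C>0. \<forall>y z. skorohod_dist R (\<lambda>r\<in>{0..R}. p r * y) (\<lambda>r\<in>{0..R}. p r * z) \<le> C * \<bar>y - z\<bar>"
    using C(1) by blast
qed

text \<open>Heine's argument on the compact set of curves with |z| \<le> K, whereas the nearby paths
  are arbitrary: a sequence of counterexamples would have parameters accumulating at some y, and
  continuity of \<open>F\<close> at the curve of y excludes this.\<close>

lemma continuous_map_uniform_near_curve:
  assumes R: "0 < R" and p: "continuous_on {0..R} p"
    and F: "continuous_map (skorohod_topology R) euclideanreal F" and e: "0 < e"
  obtains d where "d > 0" "\<And>z f. \<bar>z\<bar> \<le> K \<Longrightarrow> f \<in> cadlag R \<Longrightarrow>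
    skorohod_dist R (\<lambda>r\<in>{0..R}. p r * z) f < d \<Longrightarrow> \<bar>F f - F (\<lambda>r\<in>{0..R}. p r * z)\<bar> < e"
proof (rule ccontr)
  define G where "G z = (\<lambda>r\<in>{0..R}. p r * z)" for z
  have Gc: "G z \<in> cadlag R" for z unfolding G_def by (rule continuous_map_linear_path(1)[OF R p])
  obtain C where C: "C > 0" "\<And>y z. skorohod_dist R (G y) (G z) \<le> C * \<bar>y - z\<bar>"
    using continuous_map_linear_path(2)[OF R p] unfolding G_def by blast
  assume "\<not> thesis"
  then have "\<exists>z f. \<bar>z\<bar> \<le> K \<and> f \<in> cadlag R \<and> skorohod_dist R (G z) f < inverse (real (Suc n)) \<and> \<not> \<bar>F f - F (G z)\<bar> < e" for n
    using that[of "inverse (real (Suc n))"] unfolding G_def by force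
  then obtain z :: "nat \<Rightarrow> real" and f where zf: "\<And>n. \<bar>z n\<bar> \<le> K" "\<And>n. f n \<in> cadlag R"
    "\<And>n. skorohod_dist R (G (z n)) (f n) < inverse (real (Suc n))" "\<And>n. \<not> \<bar>F (f n) - F (G (z n))\<bar> < e" by metis
  have "compact {-K..K}" by simp
  moreover have "\<forall>n. z n \<in> {-K..K}" using zf(1) by (simp add: abs_le_iff) (metis minus_le_iff)
  ultimately obtain y and r :: "nat \<Rightarrow> nat" where y: "strict_mono r" "(z \<circ> r) \<longlonglongrightarrow> y"
    unfolding compact_def by blast
  obtain d where d: "d > 0" "\<And>g. g \<in> cadlag R \<Longrightarrow> skorohod_dist R (G y) g < d \<Longrightarrow> \<bar>F g - F (G y)\<bar> < e / 2"
    using continuous_map_skorohodD[OF F Gc, of "e / 2"] e by auto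
  have "eventually (\<lambda>n. \<bar>y - z (r n)\<bar> < d / (2 * C)) sequentially"
    using tendstoD[OF y(2), of "d / (2 * C)"] d C by (simp add: dist_real_def abs_minus_commute)
  moreover have "eventually (\<lambda>n. inverse (real (Suc (r n))) < d / 2) sequentially"
    using order_tendstoD(2)[OF LIMSEQ_subseq_LIMSEQ[OF LIMSEQ_inverse_real_of_nat y(1)], of "d / 2"] d by (simp add: comp_def)
  ultimately have "eventually (\<lambda>n. False) sequentially"
  proof eventually_elim
    case (elim n)
    have "skorohod_dist R (G y) (G (z (r n))) \<le> C * \<bar>y - z (r n)\<bar>" by (rule C(2))
    also have "\<dots> < d / 2" using elim(1) C(1) by (simp add: field_simps)
    finally have 1: "skorohod_dist R (G y) (G (z (r n))) < d / 2" .
    then have "skorohod_dist R (G y) (f (r n)) < d"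
      using skorohod_dist_triangle[OF Gc[of y] Gc[of "z (r n)"] zf(2)[of "r n"]] zf(3)[of "r n"] elim(2) by simp
    then have "\<bar>F (f (r n)) - F (G y)\<bar> < e / 2" "\<bar>F (G (z (r n))) - F (G y)\<bar> < e / 2"
      using d(2)[OF zf(2)] d(2)[OF Gc] 1 d(1) by auto
    then show False using zf(4)[of "r n"] by linarith
  qed
  then show False by simp
qed

text \<open>A Slutsky argument. Outside the events |Z| > L and E \<ge> d the path is within d of the
  random curve, and there \<open>F\<close> varies by less than e / 4. The limit for the curve itself
  is continuous mapping, as the curve depends on z in a Lipschitz way.\<close>

theorem converges_in_distribution_linear_path:
  assumes R: "0 < R" and M: "prob_space M"
    and Y: "\<And>n w. w \<in> space M \<Longrightarrow> Y n w \<in> cadlag R"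
    and Ym: "\<And>n t. t \<in> {0..R} \<Longrightarrow> (\<lambda>w. Y n w t) \<in> borel_measurable M"
    and Z [measurable]: "\<And>n. Z n \<in> borel_measurable M"
    and N: "real_distribution N" and conv: "weak_conv_m (\<lambda>n. distr M borel (Z n)) N"
    and p: "continuous_on {0..R} p"
    and E [measurable]: "\<And>n. E n \<in> borel_measurable M"
    and E0: "\<And>e. e > 0 \<Longrightarrow> (\<lambda>n. measure M {w \<in> space M. E n w \<ge> e}) \<longlonglongrightarrow> 0"
    and YE: "eventually (\<lambda>n. \<forall>w\<in>space M. \<forall>r\<in>{0..R}. \<bar>Y n w r - p r * Z n w\<bar> \<le> E n w) sequentially"
  shows "converges_in_distribution (skorohod_topology R) M Y N (\<lambda>z. \<lambda>r\<in>{0..R}. p r * z)"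
  unfolding converges_in_distribution_def
proof (intro conjI allI impI)
  interpret prob_space M by fact
  interpret N: real_distribution N by fact
  define G where "G z = (\<lambda>r\<in>{0..R}. p r * z)" for z
  have Gc: "G z \<in> cadlag R" for z unfolding G_def by (rule continuous_map_linear_path(1)[OF R p])
  obtain C where C: "C > 0" "\<And>y z. skorohod_dist R (G y) (G z) \<le> C * \<bar>y - z\<bar>"
    using continuous_map_linear_path(2)[OF R p] unfolding G_def by blast
  show Ymeas: "Y n \<in> M \<rightarrow>\<^sub>M borel_of_top (skorohod_topology R)" for n
    by (rule measurable_skorohod[OF R Y Ym])
  show "(\<lambda>z. \<lambda>r\<in>{0..R}. p r * z) \<in> N \<rightarrow>\<^sub>M borel_of_top (skorohod_topology R)"
    using Gc unfolding G_def by (intro measurable_skorohod[OF R]) auto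
  fix F assume F: "continuous_map (skorohod_topology R) euclideanreal F \<and> bounded (F ` topspace (skorohod_topology R))"
  then obtain K where K: "K > 0" "\<And>f. f \<in> cadlag R \<Longrightarrow> \<bar>F f\<bar> \<le> K" by (auto simp: bounded_pos)
  have Fm: "F \<in> borel_measurable (borel_of_top (skorohod_topology R))"
  proof (rule borel_measurableI)
    fix S :: "real set" assume "open S"
    then have "openin (skorohod_topology R) {f \<in> topspace (skorohod_topology R). F f \<in> S}"
      using F by (intro openin_continuous_map_preimage[where Y = euclideanreal]) auto
    then have "{f \<in> cadlag R. F f \<in> S} \<in> sets (borel_of_top (skorohod_topology R))"
      unfolding borel_of_top_def by (subst sets_measure_of) (use openin_subset in fastforce, auto)
    moreover have "F -` S \<inter> space (borel_of_top (skorohod_topology R)) = {f \<in> cadlag R. F f \<in> S}"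
      unfolding borel_of_top_def by (subst space_measure_of) (use openin_subset in fastforce, auto)
    ultimately show "F -` S \<inter> space (borel_of_top (skorohod_topology R)) \<in> sets (borel_of_top (skorohod_topology R))" by simp
  qed
  have FYm [measurable]: "(\<lambda>w. F (Y n w)) \<in> borel_measurable M" for n by (rule measurable_compose[OF Ymeas Fm])
  have FG: "isCont (\<lambda>z. F (G z)) z" for z
    unfolding continuous_at_eps_delta
  proof (intro allI impI)
    fix e :: real assume "0 < e"
    then obtain d where d: "d > 0" "\<And>g. g \<in> cadlag R \<Longrightarrow> skorohod_dist R (G z) g < d \<Longrightarrow> \<bar>F g - F (G z)\<bar> < e"
      using continuous_map_skorohodD[of R F "G z" e] F Gc by blast
    show "\<exists>d>0. \<forall>x. dist x z < d \<longrightarrow> dist (F (G x)) (F (G z)) < e"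
    proof (intro exI[of _ "d / C"] conjI allI impI)
      fix x assume "dist x z < d / C"
      then have "C * \<bar>z - x\<bar> < d" using C(1) by (simp add: dist_real_def abs_minus_commute field_simps)
      then have "skorohod_dist R (G z) (G x) < d" using C(2)[of z x] by simp
      then show "dist (F (G x)) (F (G z)) < e" using d(2)[OF Gc] by (simp add: dist_real_def)
    qed (use d C in simp)
  qed
  have FGm [measurable]: "(\<lambda>z. F (G z)) \<in> borel_measurable borel"
    using FG by (intro borel_measurable_continuous_onI continuous_at_imp_continuous_on) auto
  have rd: "real_distribution (distr M borel (Z n))" for n by (simp add: real_distribution_distr)
  have lim1: "(\<lambda>n. \<integral>w. F (G (Z n w)) \<partial>M) \<longlonglongrightarrow> (\<integral>z. F (G z) \<partial>N)"
    using weak_conv_imp_integral_bdd_continuous_conv[OF rd N conv FG, of K] K(2)[OF Gc]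
    by (simp add: integral_distr)
  have "(\<lambda>n. (\<integral>w. F (Y n w) \<partial>M) - (\<integral>w. F (G (Z n w)) \<partial>M)) \<longlonglongrightarrow> 0"
  proof (rule LIMSEQ_I)
    fix e :: real assume e: "0 < e"
    \<comment> \<open>Two exceptional events of probability below q, each costing at most 2 K
      because |F| \<le> K: together e / 2.\<close>
    define q where "q = e / (8 * K)"
    have q: "q > 0" using e K by (simp add: q_def)
    obtain L where L: "L > 0" "eventually (\<lambda>n. measure (distr M borel (Z n)) {z. \<bar>z\<bar> > L} < q) sequentially"
      using weak_conv_imp_tight[OF rd N conv q] by blast
    obtain d where d: "d > 0" "\<And>z f. \<bar>z\<bar> \<le> L \<Longrightarrow> f \<in> cadlag R \<Longrightarrow>
        skorohod_dist R (G z) f < d \<Longrightarrow> \<bar>F f - F (G z)\<bar> < e / 4"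
      using continuous_map_uniform_near_curve[OF R p, of F "e / 4" L] F e unfolding G_def by auto
    have "eventually (\<lambda>n. measure M {w \<in> space M. E n w \<ge> d} < q) sequentially"
      using order_tendstoD(2)[OF E0[OF d(1)] q] .
    with L(2) YE have "eventually (\<lambda>n. norm ((\<integral>w. F (Y n w) \<partial>M) - (\<integral>w. F (G (Z n w)) \<partial>M) - 0) < e) sequentially"
    proof eventually_elim
      case (elim n)
      define A where "A = {w \<in> space M. \<bar>Z n w\<bar> > L}"
      define B where "B = {w \<in> space M. E n w \<ge> d}"
      have [measurable]: "A \<in> sets M" "B \<in> sets M" unfolding A_def B_def by measurable
      have A: "prob A < q" using elim(1) by (subst (asm) measure_distr) (auto simp: A_def vimage_def Int_def conj_commute)
      have i1: "integrable M (\<lambda>w. F (Y n w))"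
        using K(2)[OF Y] by (intro integrable_const_bound[of _ K]) auto
      have i2: "integrable M (\<lambda>w. F (G (Z n w)))"
        using K(2)[OF Gc] by (intro integrable_const_bound[of _ K]) auto
      have iA: "integrable M (\<lambda>w. e / 4 + 2 * K * indicator A w + 2 * K * indicator B w)"
        by (intro Bochner_Integration.integrable_add integrable_mult_right integrable_real_indicator integrable_const) (auto simp: emeasure_eq_measure)
      have "\<bar>\<integral>w. F (Y n w) - F (G (Z n w)) \<partial>M\<bar> \<le> (\<integral>w. \<bar>F (Y n w) - F (G (Z n w))\<bar> \<partial>M)"
        by (rule integral_abs_bound)
      also have "\<dots> \<le> (\<integral>w. e / 4 + 2 * K * indicator A w + 2 * K * indicator B w \<partial>M)"
      proof (rule integral_mono[OF _ iA])
        fix w assume w: "w \<in> space M"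
        show "\<bar>F (Y n w) - F (G (Z n w))\<bar> \<le> e / 4 + 2 * K * indicator A w + 2 * K * indicator B w"
        proof (cases "w \<in> A \<or> w \<in> B")
          case True
          have "\<bar>F (Y n w) - F (G (Z n w))\<bar> \<le> 2 * K"
            using K(2)[OF Y[OF w], of n] K(2)[OF Gc, of "Z n w"] by linarith
          moreover have "2 * K \<le> 2 * K * indicator A w + 2 * K * indicator B w"
            using True K(1) by (auto simp: indicator_def)
          ultimately show ?thesis using e by linarith
        next
          case False
          then have "\<bar>Z n w\<bar> \<le> L" "E n w < d" using w by (auto simp: A_def B_def)
          moreover have "skorohod_dist R (G (Z n w)) (Y n w) \<le> E n w"
          proof (rule skorohod_dist_uniform)
            fix r assume "r \<in> {0..R}"
            then show "\<bar>G (Z n w) r - Y n w r\<bar> \<le> E n w"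
              using elim(2) w by (simp add: G_def abs_minus_commute)
          next
            have "0 \<in> {0..R}" using R by simp
            then have "\<bar>Y n w 0 - p 0 * Z n w\<bar> \<le> E n w" using elim(2) w by blast
            then show "0 \<le> E n w" by linarith
          qed
          ultimately have "\<bar>F (Y n w) - F (G (Z n w))\<bar> < e / 4" using d(2)[OF _ Y[OF w]] by auto
          then show ?thesis using K(1) by (simp add: add_increasing2)
        qed
      qed (use i1 i2 in auto)
      also have "\<dots> = e / 4 + 2 * K * prob A + 2 * K * prob B"
        by (subst Bochner_Integration.integral_add)+ (auto simp: emeasure_eq_measure prob_space)
      also have "\<dots> < e / 4 + 2 * K * q + 2 * K * q"
        using A elim(3) K(1) unfolding B_def[symmetric] by (intro add_strict_mono add_le_less_mono mult_strict_left_mono) auto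
      also have "\<dots> \<le> e" using K(1) e by (simp add: q_def field_simps)
      finally show ?case using i1 i2 by (simp add: Bochner_Integration.integral_diff)
    qed
    then show "\<exists>no. \<forall>n\<ge>no. norm ((\<integral>w. F (Y n w) \<partial>M) - (\<integral>w. F (G (Z n w)) \<partial>M) - 0) < e"
      by (simp add: eventually_sequentially)
  qed
  from tendsto_add[OF this lim1] show "(\<lambda>n. \<integral>w. F (Y n w) \<partial>M) \<longlonglongrightarrow> (\<integral>z. F (\<lambda>r\<in>{0..R}. p r * z) \<partial>N)"
    by (simp add: G_def)
qed

section \<open>Chaining along dyadic grids\<close>

lemma sum_inverse_squares_le: "(\<Sum>l\<le>J. 1 / (real l + 1)\<^sup>2) \<le> 2 - 1 / (real J + 1)"
proof (induction J)
  case (Suc J)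
  have "1 / (real (Suc J) + 1)\<^sup>2 \<le> 1 / (real J + 1) - 1 / (real (Suc J) + 1)"
  proof -
    have "1 / (real J + 1) - 1 / (real (Suc J) + 1) = 1 / ((real J + 1) * (real J + 2))"
      by (simp add: divide_simps)
    moreover have "(real J + 1) * (real J + 2) \<le> (real (Suc J) + 1)\<^sup>2"
      by (simp add: power2_eq_square algebra_simps)
    ultimately show ?thesis by (simp add: frac_le)
  qed
  then show ?case using Suc by simp
qed simp

text \<open>The closed form shows that the series is bounded by 12, the constant behind the
  quadratic part of the increment bound.\<close>

lemma sum_squares_over_powers: "(\<Sum>l\<le>J. (real l + 1)\<^sup>2 / 2 ^ l) = 12 - ((real J)\<^sup>2 + 6 * real J + 11) / 2 ^ J"
proof (induction J)
  case (Suc J)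
  then show ?case by (simp add: field_simps power2_eq_square)
qed simp

definition dyadic_incr :: "real \<Rightarrow> (real \<Rightarrow> real) \<Rightarrow> nat \<Rightarrow> nat \<Rightarrow> real" where
  "dyadic_incr R f l i = f (real (Suc i) * R / 2 ^ l) - f (real i * R / 2 ^ l)"

text \<open>One increment per level is enough: an even index already belongs to the coarser grid,
  and an odd one is reached from its left neighbour. The root of the sum of squares dominates the
  largest increment of a level and is accessible through second moments.\<close>

lemma dyadic_chain:
  assumes f0: "f 0 = 0" and "i \<le> 2 ^ j"
  shows "\<bar>f (real i * R / 2 ^ j)\<bar> \<le> (\<Sum>l\<le>j. sqrt (\<Sum>i<2 ^ l. (dyadic_incr R f l i)\<^sup>2))"
  using assms(2)
proof (induction j arbitrary: i)
  have inc: "\<bar>dyadic_incr R f l i\<bar> \<le> sqrt (\<Sum>i<2 ^ l. (dyadic_incr R f l i)\<^sup>2)" if "i < 2 ^ l" for l i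
  proof -
    have "(dyadic_incr R f l i)\<^sup>2 \<le> (\<Sum>i<2 ^ l. (dyadic_incr R f l i)\<^sup>2)"
      using that by (intro member_le_sum) auto
    then have "sqrt ((dyadic_incr R f l i)\<^sup>2) \<le> sqrt (\<Sum>i<2 ^ l. (dyadic_incr R f l i)\<^sup>2)" by (rule real_sqrt_le_mono)
    then show ?thesis by simp
  qed
  {
    case 0
    then show ?case using inc[of 0 0] f0 by (cases i) (auto simp: dyadic_incr_def)
  next
    case (Suc j)
    define S where "S = (\<Sum>l\<le>j. sqrt (\<Sum>i<2 ^ l. (dyadic_incr R f l i)\<^sup>2))"
    define m where "m = sqrt (\<Sum>i<2 ^ Suc j. (dyadic_incr R f (Suc j) i)\<^sup>2)"
    have m: "m \<ge> 0" by (simp add: m_def sum_nonneg)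
    have "\<bar>f (real i * R / 2 ^ Suc j)\<bar> \<le> S + m"
    proof (cases "even i")
      case True
      then obtain k where k: "i = 2 * k" by (elim evenE)
      have "\<bar>f (real k * R / 2 ^ j)\<bar> \<le> S" unfolding S_def by (rule Suc.IH) (use Suc.prems k in simp)
      moreover have "real i * R / 2 ^ Suc j = real k * R / 2 ^ j" by (simp add: k)
      ultimately show ?thesis using m by simp
    next
      case False
      then obtain k where k: "i = 2 * k + 1" by (elim oddE)
      have "\<bar>f (real k * R / 2 ^ j)\<bar> \<le> S" unfolding S_def by (rule Suc.IH) (use Suc.prems k in simp)
      moreover have "real (2 * k) * R / 2 ^ Suc j = real k * R / 2 ^ j" by simp
      moreover have "\<bar>dyadic_incr R f (Suc j) (2 * k)\<bar> \<le> m"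
        unfolding m_def by (rule inc) (use Suc.prems k in simp)
      ultimately show ?thesis by (simp add: dyadic_incr_def k)
    qed
    then show ?case by (simp add: S_def m_def)
  }
qed

text \<open>Cauchy-Schwarz with weights 1 / (l + 1), whose squares sum to at most 2; the price is
  the factor (l + 1)^2 on level l.\<close>

lemma dyadic_chain_square:
  assumes f0: "f 0 = 0" and "i \<le> 2 ^ J"
  shows "(f (real i * R / 2 ^ J))\<^sup>2 \<le> 2 * (\<Sum>l\<le>J. (real l + 1)\<^sup>2 * (\<Sum>i<2 ^ l. (dyadic_incr R f l i)\<^sup>2))"
proof -
  define m where "m l = sqrt (\<Sum>i<2 ^ l. (dyadic_incr R f l i)\<^sup>2)" for l :: nat
  have "\<bar>f (real i * R / 2 ^ J)\<bar> \<le> (\<Sum>l\<le>J. m l)"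
    using dyadic_chain[of f i J R] assms by (simp add: m_def)
  then have "\<bar>f (real i * R / 2 ^ J)\<bar>\<^sup>2 \<le> (\<Sum>l\<le>J. m l)\<^sup>2" by (intro power_mono) auto
  also have "(\<Sum>l\<le>J. m l) = (\<Sum>l\<le>J. (1 / (real l + 1)) * ((real l + 1) * m l))"
    by (intro sum.cong) (auto simp: field_simps)
  also have "\<dots>\<^sup>2 \<le> (\<Sum>l\<le>J. (1 / (real l + 1))\<^sup>2) * (\<Sum>l\<le>J. ((real l + 1) * m l)\<^sup>2)"
    by (rule Cauchy_Schwarz_ineq_sum)
  also have "\<dots> \<le> 2 * (\<Sum>l\<le>J. ((real l + 1) * m l)\<^sup>2)"
  proof (intro mult_right_mono sum_nonneg)
    have "1 / (real J + 1) \<ge> 0" by simp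
    then show "(\<Sum>l\<le>J. (1 / (real l + 1))\<^sup>2) \<le> 2"
      using sum_inverse_squares_le[of J] by (simp add: power_one_over del: divide_nonneg_nonneg; linarith)
  qed auto
  also have "(\<Sum>l\<le>J. ((real l + 1) * m l)\<^sup>2) = (\<Sum>l\<le>J. (real l + 1)\<^sup>2 * (\<Sum>i<2 ^ l. (dyadic_incr R f l i)\<^sup>2))"
    by (simp add: power_mult_distrib m_def sum_nonneg)
  finally show ?thesis by simp
qed

text \<open>Level l has 2^l increments of length R / 2^l. Hence the constant \<open>a\<close> is
  dominated by the finest level, \<open>b\<close> contributes alike on all levels, and the
  contribution of \<open>c\<close> is summable.\<close>

lemma chaining_second_moment:
  assumes "0 \<le> a" "0 \<le> b" "0 \<le> c" "0 < R"
    and int: "\<And>s r. 0 \<le> s \<Longrightarrow> s \<le> r \<Longrightarrow> r \<le> R \<Longrightarrow> integrable M (\<lambda>w. (e w r - e w s)\<^sup>2 :: real)"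
    and bnd: "\<And>s r. 0 \<le> s \<Longrightarrow> s \<le> r \<Longrightarrow> r \<le> R \<Longrightarrow>
      (\<integral>w. (e w r - e w s)\<^sup>2 \<partial>M) \<le> a + b * (r - s) + c * (r - s)\<^sup>2"
  shows "integrable M (\<lambda>w. 2 * (\<Sum>l\<le>J. (real l + 1)\<^sup>2 * (\<Sum>i<2 ^ l. (dyadic_incr R (e w) l i)\<^sup>2)))"
    and "(\<integral>w. 2 * (\<Sum>l\<le>J. (real l + 1)\<^sup>2 * (\<Sum>i<2 ^ l. (dyadic_incr R (e w) l i)\<^sup>2)) \<partial>M)
      \<le> 4 * (real J + 1) ^ 2 * 2 ^ J * a + 2 * (real J + 1) ^ 3 * R * b + 24 * R\<^sup>2 * c"
proof -
  have st: "0 \<le> real i * R / 2 ^ l" "real i * R / 2 ^ l \<le> real (Suc i) * R / 2 ^ l" "real (Suc i) * R / 2 ^ l \<le> R"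
    if "i < 2 ^ l" for i l
  proof -
    have "real (Suc i) \<le> 2 ^ l" using that by (metis Suc_leI of_nat_le_iff of_nat_numeral of_nat_power)
    then show "real (Suc i) * R / 2 ^ l \<le> R" using \<open>0 < R\<close> by (simp add: divide_le_eq)
  qed (use \<open>0 < R\<close> in \<open>auto intro!: divide_right_mono mult_right_mono\<close>)
  have I: "integrable M (\<lambda>w. (dyadic_incr R (e w) l i)\<^sup>2)" if "i < 2 ^ l" for l i
    unfolding dyadic_incr_def using int[OF st[OF that]] .
  have B: "(\<integral>w. (dyadic_incr R (e w) l i)\<^sup>2 \<partial>M) \<le> a + b * (R / 2 ^ l) + c * (R / 2 ^ l)\<^sup>2" if "i < 2 ^ l" for l i
  proof -
    have "real (Suc i) * R / 2 ^ l - real i * R / 2 ^ l = R / 2 ^ l" by (simp add: field_simps)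
    then show ?thesis unfolding dyadic_incr_def using bnd[OF st[OF that]] by simp
  qed
  show "integrable M (\<lambda>w. 2 * (\<Sum>l\<le>J. (real l + 1)\<^sup>2 * (\<Sum>i<2 ^ l. (dyadic_incr R (e w) l i)\<^sup>2)))"
    using I by (intro integrable_mult_right Bochner_Integration.integrable_sum) auto
  have "(\<integral>w. 2 * (\<Sum>l\<le>J. (real l + 1)\<^sup>2 * (\<Sum>i<2 ^ l. (dyadic_incr R (e w) l i)\<^sup>2)) \<partial>M)
      = 2 * (\<Sum>l\<le>J. (real l + 1)\<^sup>2 * (\<Sum>i<2 ^ l. \<integral>w. (dyadic_incr R (e w) l i)\<^sup>2 \<partial>M))"
    unfolding integral_mult_right_zero using I
    by (subst Bochner_Integration.integral_sum) (auto intro!: Bochner_Integration.integrable_sum)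
  also have "\<dots> \<le> 2 * (\<Sum>l\<le>J. (real l + 1)\<^sup>2 * (\<Sum>i<(2::nat) ^ l. a + b * (R / 2 ^ l) + c * (R / 2 ^ l)\<^sup>2))"
    using B by (intro mult_left_mono sum_mono) auto
  also have "\<dots> = (\<Sum>l\<le>J. 2 * (real l + 1)\<^sup>2 * 2 ^ l * a + 2 * (real l + 1)\<^sup>2 * (R * b) + 2 * (R\<^sup>2 * c) * ((real l + 1)\<^sup>2 / 2 ^ l))"
    unfolding sum_distrib_left by (intro sum.cong refl) (simp add: field_simps power2_eq_square)
  also have "\<dots> \<le> (\<Sum>l\<le>J. 2 * (real J + 1)\<^sup>2 * 2 ^ l * a + 2 * (real J + 1)\<^sup>2 * (R * b) + 2 * (R\<^sup>2 * c) * ((real l + 1)\<^sup>2 / 2 ^ l))"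
    using assms by (intro sum_mono add_mono mult_right_mono mult_left_mono power_mono) auto
  also have "\<dots> = 2 * (real J + 1)\<^sup>2 * (\<Sum>l\<le>J. 2 ^ l) * a + 2 * (real J + 1) ^ 3 * R * b
      + 2 * (R\<^sup>2 * c) * (\<Sum>l\<le>J. (real l + 1)\<^sup>2 / 2 ^ l)"
    by (simp add: sum.distrib sum_distrib_left sum_distrib_right power3_eq_cube power2_eq_square algebra_simps)
  also have "\<dots> \<le> 2 * (real J + 1)\<^sup>2 * (2 * 2 ^ J) * a + 2 * (real J + 1) ^ 3 * R * b + 2 * (R\<^sup>2 * c) * 12"
  proof (intro add_mono mult_left_mono mult_right_mono order_refl)
    have "(\<Sum>l\<le>J. 2 ^ l :: real) = 2 * 2 ^ J - 1"
      by (induction J) auto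
    then show "(\<Sum>l\<le>J. 2 ^ l :: real) \<le> 2 * 2 ^ J" by simp
    show "(\<Sum>l\<le>J. (real l + 1)\<^sup>2 / 2 ^ l) \<le> 12" unfolding sum_squares_over_powers by simp
  qed (use assms in auto)
  finally show "(\<integral>w. 2 * (\<Sum>l\<le>J. (real l + 1)\<^sup>2 * (\<Sum>i<2 ^ l. (dyadic_incr R (e w) l i)\<^sup>2)) \<partial>M)
      \<le> 4 * (real J + 1) ^ 2 * 2 ^ J * a + 2 * (real J + 1) ^ 3 * R * b + 24 * R\<^sup>2 * c" by simp
qed

text \<open>Between neighbouring grid points s \<le> r \<le> t monotonicity traps V(r) between V(s)
  and V(t); \<open>k\<close> and \<open>q\<close> are the oscillations of the mean and of the limit
  profile over one cell.\<close>

lemma monotone_sandwich: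
  fixes V m p :: "real \<Rightarrow> real"
  assumes R: "0 < R" and V: "mono_on {0..R} V" and m: "mono_on {0..R} m" and p: "mono_on {0..R} p"
    and E: "\<And>i. i \<le> 2 ^ J \<Longrightarrow> \<bar>V (real i * R / 2 ^ J) - m (real i * R / 2 ^ J) - p (real i * R / 2 ^ J) * z\<bar> \<le> E"
    and k: "\<And>s t. 0 \<le> s \<Longrightarrow> s \<le> t \<Longrightarrow> t \<le> R \<Longrightarrow> t - s \<le> R / 2 ^ J \<Longrightarrow> m t - m s \<le> k"
    and q: "\<And>s t. 0 \<le> s \<Longrightarrow> s \<le> t \<Longrightarrow> t \<le> R \<Longrightarrow> t - s \<le> R / 2 ^ J \<Longrightarrow> p t - p s \<le> q"
    and r: "r \<in> {0..R}"
  shows "\<bar>V r - m r - p r * z\<bar> \<le> E + k + q * \<bar>z\<bar>"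
proof (cases "r = R")
  case True
  have "0 \<le> k" using k[of 0 0] R by simp
  moreover have "0 \<le> q * \<bar>z\<bar>" using q[of 0 0] R by simp
  ultimately show ?thesis using E[of "2 ^ J"] True by simp
next
  case False
  define i where "i = nat \<lfloor>r * 2 ^ J / R\<rfloor>"
  have nn: "0 \<le> r * 2 ^ J / R" using r R by simp
  have i: "real i \<le> r * 2 ^ J / R" "r * 2 ^ J / R < real i + 1"
    using nn unfolding i_def by linarith+
  have "r * 2 ^ J / R < 2 ^ J" using r R False by (simp add: field_simps)
  then have "real i < 2 ^ J" using i by linarith
  then have i2: "Suc i \<le> 2 ^ J" by (metis Suc_leI of_nat_less_iff of_nat_numeral of_nat_power)
  define s where "s = real i * R / 2 ^ J"
  define t where "t = real (Suc i) * R / 2 ^ J"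
  have "real (Suc i) \<le> 2 ^ J" using i2 by (metis of_nat_le_iff of_nat_numeral of_nat_power)
  then have "real (Suc i) * R \<le> 2 ^ J * R" using R by (intro mult_right_mono) auto
  then have "t \<le> R" by (simp add: t_def divide_le_eq mult.commute)
  moreover have "t - s = R / 2 ^ J" by (simp add: s_def t_def diff_divide_distrib[symmetric] distrib_right)
  moreover have "s \<le> r" "r \<le> t" "0 \<le> s"
    using i R by (simp_all add: s_def t_def divide_le_eq le_divide_eq pos_le_divide_eq pos_divide_less_eq mult.commute add.commute)
  ultimately have st: "0 \<le> s" "s \<le> r" "r \<le> t" "t \<le> R" "t - s = R / 2 ^ J" by auto
  have Vm: "V s \<le> V r" "V r \<le> V t" "m s \<le> m r" "m r \<le> m t" "p s \<le> p r" "p r \<le> p t"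
    using mono_onD[OF V, of s r] mono_onD[OF V, of r t] mono_onD[OF m, of s r] mono_onD[OF m, of r t]
      mono_onD[OF p, of s r] mono_onD[OF p, of r t] st by auto
  have mk: "m t - m s \<le> k" and pq: "p t - p s \<le> q" using k[of s t] q[of s t] st by auto
  have Es: "\<bar>V s - m s - p s * z\<bar> \<le> E" and Et: "\<bar>V t - m t - p t * z\<bar> \<le> E"
    using E[of i] E[of "Suc i"] i2 unfolding s_def t_def by auto
  have "\<bar>(p t - p r) * z\<bar> \<le> q * \<bar>z\<bar>" "\<bar>(p r - p s) * z\<bar> \<le> q * \<bar>z\<bar>"
    using Vm pq by (auto simp: abs_mult intro!: mult_right_mono)
  then have "\<bar>p t * z - p r * z\<bar> \<le> q * \<bar>z\<bar>" "\<bar>p r * z - p s * z\<bar> \<le> q * \<bar>z\<bar>" by (simp_all add: left_diff_distrib)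
  then show ?thesis using Vm mk Es Et by linarith
qed

section \<open>Convex windows\<close>

lemma measure_lborel_affine_image:
  fixes S :: "'a::euclidean_space set"
  assumes "S \<in> sets borel" "(\<lambda>x. c *\<^sub>R x + v) ` S \<in> sets borel"
  shows "measure lborel ((\<lambda>x. c *\<^sub>R x + v) ` S) = \<bar>c\<bar> ^ DIM('a) * measure lborel S"
  using measure_lebesgue_affine[of c v S] assms by (simp add: measure_completion)

lemma measure_lborel_scaleR_compact:
  fixes S :: "'a::euclidean_space set"
  assumes "compact S"
  shows "measure lborel ((*\<^sub>R) c ` S) = \<bar>c\<bar> ^ DIM('a) * measure lborel S"
  using measure_lborel_affine_image[of S c 0] assms compact_scaling[OF assms, of c]
  by (simp add: borel_compact)

text \<open>\<open>Sup {}\<close> is an unspecified real, so the second assumption is what shows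
  that there are admissible radii at all; it holds for large n because the inradius tends to
  infinity. Taking half of the inradius avoids the question whether the supremum is
  attained.\<close>

lemma inradius_cball:
  fixes W :: "'a::euclidean_space set"
  assumes "inradius W > 0" "inradius W > Sup {}"
  obtains p where "cball p (inradius W / 2) \<subseteq> W" "p \<in> W"
proof -
  define S where "S = {r. 0 < r \<and> (\<exists>x\<in>W. cball x r \<subseteq> W)}"
  have "S \<noteq> {}" using assms(2) unfolding inradius_def S_def[symmetric] by auto
  moreover have "inradius W / 2 < Sup S" using assms(1) unfolding inradius_def S_def[symmetric] by simp
  ultimately obtain r where "r \<in> S" "inradius W / 2 < r" using less_cSupD by blast
  then obtain p where "p \<in> W" "cball p r \<subseteq> W" by (auto simp: S_def)
  then show thesis using \<open>inradius W / 2 < r\<close> by (intro that[of p]) (auto simp: subset_iff)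
qed

text \<open>The contraction of \<open>W\<close> by the factor 1 - \<theta> towards \<open>p\<close>,
  with \<theta> = |z| / \<rho>, lies in \<open>W\<close> and in \<open>W - z\<close>: adding z to an
  image point amounts to contracting towards p + z / \<theta> instead, which is a point of the
  ball.\<close>

lemma convex_translate_overlap:
  fixes W :: "'a::euclidean_space set"
  assumes W: "convex W" "compact W" and p: "cball p \<rho> \<subseteq> W" "0 < \<rho>" and z: "norm z \<le> \<rho>"
  shows "(1 - norm z / \<rho>) ^ DIM('a) * measure lborel W \<le> measure lborel (W \<inter> (\<lambda>w. w - z) ` W)"
proof -
  define \<theta> where "\<theta> = norm z / \<rho>"
  have \<theta>: "0 \<le> \<theta>" "\<theta> \<le> 1" using z p by (auto simp: \<theta>_def)
  have cW: "compact (W \<inter> (\<lambda>w. w - z) ` W)"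
    using W(2) compact_translation_subtract[OF W(2), of z] by (intro compact_Int) auto
  have img: "(\<lambda>x. (1 - \<theta>) *\<^sub>R x + \<theta> *\<^sub>R p) ` W \<subseteq> W \<inter> (\<lambda>w. w - z) ` W"
  proof
    fix y assume "y \<in> (\<lambda>x. (1 - \<theta>) *\<^sub>R x + \<theta> *\<^sub>R p) ` W"
    then obtain w where w: "w \<in> W" "y = (1 - \<theta>) *\<^sub>R w + \<theta> *\<^sub>R p" by blast
    have pW: "p \<in> W" using p by (auto simp: subset_iff)
    have "y \<in> W" using convexD[OF W(1) w(1) pW, of "1 - \<theta>" \<theta>] \<theta> w by simp
    moreover have "y + z \<in> W"
    proof (cases "\<theta> = 0")
      case True
      then show ?thesis using w p(2) by (simp add: \<theta>_def)
    next
      case False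
      have "norm (z /\<^sub>R \<theta>) \<le> \<rho>" using False \<theta> p(2) by (simp add: \<theta>_def)
      then have "p + z /\<^sub>R \<theta> \<in> W" using p(1) by (auto simp: subset_iff dist_norm)
      then have "(1 - \<theta>) *\<^sub>R w + \<theta> *\<^sub>R (p + z /\<^sub>R \<theta>) \<in> W"
        using convexD[OF W(1) w(1), of _ "1 - \<theta>" \<theta>] \<theta> by simp
      then show ?thesis using False w by (simp add: scaleR_add_right add.assoc)
    qed
    ultimately show "y \<in> W \<inter> (\<lambda>w. w - z) ` W" by (auto intro!: image_eqI[of _ _ "y + z"])
  qed
  have ci: "compact ((\<lambda>x. (1 - \<theta>) *\<^sub>R x + \<theta> *\<^sub>R p) ` W)"
    by (intro compact_continuous_image W continuous_intros)
  have "(1 - \<theta>) ^ DIM('a) * measure lborel W = measure lborel ((\<lambda>x. (1 - \<theta>) *\<^sub>R x + \<theta> *\<^sub>R p) ` W)"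
    using \<theta> ci W by (subst measure_lborel_affine_image) (auto intro: borel_compact)
  also have "\<dots> \<le> measure lborel (W \<inter> (\<lambda>w. w - z) ` W)"
    using img ci cW by (intro measure_mono_fmeasurable) (auto intro: borel_compact simp: fmeasurable_compact)
  finally show ?thesis by (simp add: \<theta>_def)
qed

lemma convex_overlap_deficit:
  fixes W :: "'a::euclidean_space set"
  assumes W: "convex W" "compact W" and p: "cball p \<rho> \<subseteq> W" "0 < \<rho>" and z: "norm z \<le> \<rho>"
  shows "measure lborel W - measure lborel (W \<inter> (\<lambda>w. w - z) ` W) \<le> DIM('a) * (norm z / \<rho>) * measure lborel W"
proof -
  have "1 + real DIM('a) * (- (norm z / \<rho>)) \<le> (1 + (- (norm z / \<rho>))) ^ DIM('a)"
    using z p by (intro Bernoulli_inequality) simp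
  then have "(1 - DIM('a) * (norm z / \<rho>)) * measure lborel W \<le> (1 - norm z / \<rho>) ^ DIM('a) * measure lborel W"
    by (intro mult_right_mono) auto
  also have "\<dots> \<le> measure lborel (W \<inter> (\<lambda>w. w - z) ` W)" by (rule convex_translate_overlap[OF assms])
  finally show ?thesis by (simp add: left_diff_distrib)
qed

text \<open>The window contains a ball with half the inradius as radius, and for radii at least 1
  the volume of a ball grows at least linearly.\<close>

lemma averaging_sequence_volume:
  fixes W :: "nat \<Rightarrow> 'a::euclidean_space set"
  assumes W: "convex_averaging_sequence W"
  shows "filterlim (\<lambda>n. measure lborel (W n)) at_top sequentially"
proof (rule filterlim_at_top_mono)
  have inr: "filterlim (\<lambda>n. inradius (W n)) at_top sequentially"
    using W by (simp add: convex_averaging_sequence_def)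
  define v where "v = unit_ball_vol (real DIM('a))"
  have v: "v > 0" by (simp add: v_def)
  have "filterlim (\<lambda>n. v / 2 * inradius (W n)) at_top sequentially"
    using v by (intro filterlim_tendsto_pos_mult_at_top[OF tendsto_const _ inr]) simp
  then show "filterlim (\<lambda>n. v * (inradius (W n) / 2)) at_top sequentially" by simp
  have "eventually (\<lambda>n. inradius (W n) \<ge> max 2 (1 + Sup {})) sequentially"
    using inr unfolding filterlim_at_top by blast
  then show "eventually (\<lambda>n. v * (inradius (W n) / 2) \<le> measure lborel (W n)) sequentially"
  proof eventually_elim
    case (elim n)
    obtain p where p: "cball p (inradius (W n) / 2) \<subseteq> W n" using inradius_cball[of "W n"] elim by auto
    have "inradius (W n) / 2 \<le> (inradius (W n) / 2) ^ DIM('a)"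
      using elim by (intro self_le_power) (auto simp: Suc_le_eq)
    then have "v * (inradius (W n) / 2) \<le> v * (inradius (W n) / 2) ^ DIM('a)"
      using v by (intro mult_left_mono) auto
    also have "\<dots> = measure lborel (cball p (inradius (W n) / 2))"
      using content_cball[of "inradius (W n) / 2" p] elim by (simp add: v_def)
    also have "\<dots> \<le> measure lborel (W n)"
      using p W by (intro measure_mono_fmeasurable)
        (auto intro: borel_compact simp: fmeasurable_compact convex_averaging_sequence_def)
    finally show ?case .
  qed
qed

section \<open>Dilations of a convex body\<close>

lemma scaled_body_mono:
  fixes B :: "'a::real_vector set"
  assumes "convex B" "0 \<in> B" "0 \<le> s" "s \<le> r"
  shows "(*\<^sub>R) s ` B \<subseteq> (*\<^sub>R) r ` B"
proof
  fix y assume "y \<in> (*\<^sub>R) s ` B"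
  then obtain b where b: "b \<in> B" "y = s *\<^sub>R b" by blast
  show "y \<in> (*\<^sub>R) r ` B"
  proof (cases "r = 0")
    case True
    then show ?thesis using b assms by (intro image_eqI[of _ _ b]) auto
  next
    case False
    then have "(s / r) *\<^sub>R b \<in> B"
      using convexD[OF assms(1) b(1) assms(2), of "s / r" "1 - s / r"] assms by (simp add: divide_le_eq)
    then show ?thesis using False b by (intro image_eqI[of _ _ "(s / r) *\<^sub>R b"]) auto
  qed
qed

text \<open>The source of right continuity of the estimator. If z is in r B, monotonicity keeps it
  in t B; if not, closedness of B keeps it out for t slightly above r. At r = 0 division by r is
  impossible, and boundedness of B takes over.\<close>

lemma scaled_body_right:
  fixes B :: "'a::real_normed_vector set"
  assumes B: "compact B" "convex B" "0 \<in> B" and r: "0 \<le> r"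
  shows "\<forall>\<^sub>F t in at_right r. z \<in> (*\<^sub>R) t ` B \<longleftrightarrow> z \<in> (*\<^sub>R) r ` B"
proof (cases "z \<in> (*\<^sub>R) r ` B")
  case True
  show ?thesis
    using eventually_at_right_less[of r]
  proof eventually_elim
    case (elim t)
    then show ?case using scaled_body_mono[OF B(2,3) r, of t] True by auto
  qed
next
  case False
  show ?thesis
  proof (cases "r = 0")
    case True
    have z0: "z \<noteq> 0" using False B(3) True by force
    obtain K where K: "K > 0" "\<forall>b\<in>B. norm b \<le> K" using compact_imp_bounded[OF B(1)] by (auto simp: bounded_pos)
    have "\<forall>\<^sub>F t in at_right 0. t \<in> {0<..<norm z / K}"
      by (rule eventually_at_right_real) (use z0 K in simp)
    then show ?thesis unfolding True
    proof eventually_elim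
      case (elim t)
      have "z \<notin> (*\<^sub>R) t ` B"
      proof
        assume "z \<in> (*\<^sub>R) t ` B"
        then obtain b where "b \<in> B" "z = t *\<^sub>R b" by blast
        then have "norm z \<le> t * K" using K elim by (auto intro!: mult_left_mono)
        then show False using elim K by (simp add: less_divide_eq)
      qed
      then show ?case using False True by simp
    qed
  next
    case r0: False
    have "((\<lambda>t. inverse t *\<^sub>R z) \<longlongrightarrow> inverse r *\<^sub>R z) (at_right r)"
      using r0 by (intro tendsto_intros)
    moreover have "inverse r *\<^sub>R z \<in> - B"
    proof
      assume "inverse r *\<^sub>R z \<in> B"
      then show False using False r0 by (auto intro!: image_eqI[of _ _ "inverse r *\<^sub>R z"] simp: image_iff)
    qed
    moreover have "open (- B)" using compact_imp_closed[OF B(1)] by (rule open_Compl)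
    ultimately have "\<forall>\<^sub>F t in at_right r. inverse t *\<^sub>R z \<in> - B" by (intro topological_tendstoD)
    then show ?thesis
      using eventually_at_right_less[of r]
    proof eventually_elim
      case (elim t)
      have "z \<notin> (*\<^sub>R) t ` B"
      proof
        assume "z \<in> (*\<^sub>R) t ` B"
        then obtain b where "b \<in> B" "z = t *\<^sub>R b" by blast
        then show False using elim r by simp
      qed
      then show ?case using False by simp
    qed
  qed
qed

lemma power_diff_le:
  fixes r s R :: real
  assumes "0 \<le> s" "s \<le> r" "r \<le> R"
  shows "r ^ d - s ^ d \<le> real d * R ^ (d - 1) * (r - s)"
proof -
  have "r ^ d - s ^ d = (r - s) * (\<Sum>i<d. s ^ (d - Suc i) * r ^ i)"
    by (rule power_diff_sumr2)
  also have "\<dots> \<le> (r - s) * (\<Sum>i<d. R ^ (d - 1))"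
  proof (intro mult_left_mono sum_mono)
    fix i assume "i \<in> {..<d}"
    then have "d - 1 = (d - Suc i) + i" by simp
    then have "R ^ (d - 1) = R ^ (d - Suc i) * R ^ i" by (metis power_add)
    then show "s ^ (d - Suc i) * r ^ i \<le> R ^ (d - 1)"
      using assms by (auto intro!: mult_mono power_mono)
  qed (use assms in simp)
  finally show ?thesis by (simp add: ac_simps)
qed

text \<open>Monotonicity of \<open>V\<close> provides the left limits; right continuity has to be
  supplied.\<close>

lemma cadlag_mono_minus_continuous:
  assumes V: "mono_on {0..R} V" and Vr: "\<And>t. t \<in> {0..<R} \<Longrightarrow> (V \<longlongrightarrow> V t) (at_right t)"
    and m: "continuous_on {0..R} m"
  shows "(\<lambda>r\<in>{0..R}. C * (V r - m r)) \<in> cadlag R"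
  unfolding cadlag_def
proof (intro CollectI conjI ballI)
  fix t assume t: "t \<in> {0..<R}"
  have "(m \<longlongrightarrow> m t) (at t within {0..R})" using m t by (auto simp: continuous_on_def)
  moreover have le: "at_right t \<le> at t within {0..R}"
  proof -
    have "at t within {t..R} = at_right t" using t by (intro at_within_Icc_at_right) simp
    then show ?thesis using at_le[of "{t..R}" "{0..R}" t] t by auto
  qed
  ultimately have "(m \<longlongrightarrow> m t) (at_right t)" by (metis tendsto_mono)
  with Vr[OF t] have "((\<lambda>r. C * (V r - m r)) \<longlongrightarrow> C * (V t - m t)) (at_right t)" by (intro tendsto_intros)
  moreover have "\<forall>\<^sub>F r in at_right t. C * (V r - m r) = (\<lambda>r\<in>{0..R}. C * (V r - m r)) r"
    using eventually_at_right_real[of t R] t by (auto elim!: eventually_mono)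
  ultimately have "((\<lambda>r\<in>{0..R}. C * (V r - m r)) \<longlongrightarrow> C * (V t - m t)) (at_right t)"
    by (rule Lim_transform_eventually)
  then show "((\<lambda>r\<in>{0..R}. C * (V r - m r)) \<longlongrightarrow> (\<lambda>r\<in>{0..R}. C * (V r - m r)) t) (at_right t)"
    using t by (subst restrict_apply') auto
next
  fix t assume t: "t \<in> {0<..R}"
  have le: "at_left t \<le> at t within {0..R}"
  proof -
    have "at t within {0..t} = at_left t" using t by (intro at_within_Icc_at_left) simp
    then show ?thesis using at_le[of "{0..t}" "{0..R}" t] t by auto
  qed
  have "(m \<longlongrightarrow> m t) (at t within {0..R})" using m t by (auto simp: continuous_on_def)
  then have m': "(m \<longlongrightarrow> m t) (at_left t)" using le by (metis tendsto_mono)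
  have "(V \<longlongrightarrow> Sup (V ` ({..<t} \<inter> {0..R}))) (at t within ({..<t} \<inter> {0..R}))"
    using V t by (intro Lim_left_bound[where K = "V t"]) (auto simp: mono_on_def)
  moreover have "at t within ({..<t} \<inter> {0..R}) = at_left t"
    using t by (intro at_within_nhd[of _ "{0<..}"]) auto
  ultimately obtain l where "(V \<longlongrightarrow> l) (at_left t)" by auto
  with m' have "((\<lambda>r. C * (V r - m r)) \<longlongrightarrow> C * (l - m t)) (at_left t)" by (intro tendsto_intros)
  moreover have "\<forall>\<^sub>F r in at_left t. C * (V r - m r) = (\<lambda>r\<in>{0..R}. C * (V r - m r)) r"
    using eventually_at_left_real[of 0 t] t by (auto elim!: eventually_mono)
  ultimately show "\<exists>l. ((\<lambda>r\<in>{0..R}. C * (V r - m r)) \<longlongrightarrow> l) (at_left t)"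
    by (blast intro: Lim_transform_eventually)
qed auto

section \<open>The estimator of the K-function\<close>

context k_process
begin

context
  fixes B W :: "'a set" and \<mu> :: "(nat \<Rightarrow> 'a) measure"
  assumes B: "compact B" "convex B" "uminus ` B = B" "0 \<in> B"
    and W: "convex W" "compact W"
    and \<mu>: "\<And>A. A \<in> sets borel \<Longrightarrow> measure \<mu> (tuple1 A) = measure \<mu>1 A"
begin

private abbreviation body :: "real \<Rightarrow> 'a set" where "body \<rho> \<equiv> (*\<^sub>R) \<rho> ` B"
private abbreviation "est \<equiv> K_estimator X W B"

private lemma window_body: "window (body \<rho>)"
  using compact_scaling[OF B(1), of \<rho>] by (simp add: window_def borel_compact compact_imp_bounded)

private lemma window_W: "window W"
  using W by (simp add: window_def borel_compact compact_imp_bounded)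

private lemma body_sym: "z \<in> body \<rho> \<Longrightarrow> - z \<in> body \<rho>"
proof -
  assume "z \<in> body \<rho>"
  then obtain b where b: "b \<in> B" "z = \<rho> *\<^sub>R b" by blast
  have "- b \<in> B" using b(1) B(3) by blast
  then show ?thesis using b(2) by (intro image_eqI[of _ _ "- b"]) auto
qed

private lemma body_mono: "0 \<le> s \<Longrightarrow> s \<le> r \<Longrightarrow> body s \<subseteq> body r"
  by (rule scaled_body_mono[OF B(2,4)])

text \<open>The differences that enter between the radii s and r. An increment of the estimator is
  again a pair sum, with the shell in place of the body, so the kernel bounds need the shell to be
  bounded and symmetric.\<close>

private lemma shell:
  assumes "0 \<le> s" "s \<le> r"
  shows "window (body r - body s)" "z \<in> body r - body s \<Longrightarrow> - z \<in> body r - body s"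
    "measure lborel (body r - body s) = (r ^ DIM('a) - s ^ DIM('a)) * measure lborel B"
    "measure \<mu>1 (body r - body s) = measure \<mu>1 (body r) - measure \<mu>1 (body s)"
proof -
  show "window (body r - body s)" using window_body[of r] window_body[of s]
    by (auto simp: window_def intro: bounded_subset)
  show "z \<in> body r - body s \<Longrightarrow> - z \<in> body r - body s" using body_sym[of z r] body_sym[of "- z" s] by auto
  have b: "body r \<in> sets borel" "body s \<in> sets borel" "bounded (body r)" "bounded (body s)"
    using window_body by (auto simp: window_def)
  have "measure lborel (body r - body s) = measure lborel (body r) - measure lborel (body s)"
    using b body_mono[OF assms] emeasure_bounded_finite[of "body r"] emeasure_bounded_finite[of "body s"]
    by (intro measure_Diff) auto
  then show "measure lborel (body r - body s) = (r ^ DIM('a) - s ^ DIM('a)) * measure lborel B"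
    using assms by (simp add: measure_lborel_scaleR_compact[OF B(1)] algebra_simps)
  show "measure \<mu>1 (body r - body s) = measure \<mu>1 (body r) - measure \<mu>1 (body s)"
    using b body_mono[OF assms] \<mu>1_finite(1)[OF window_body, of r] sets_\<mu>1
    by (intro measure_Diff) auto
qed

text \<open>A shift by x turns the intersection of the two translated windows into the set whose
  volume is \<open>overlap W (y - x)\<close>.\<close>

private lemma est_eq: "est \<rho> \<omega> = dsum2 (X \<omega> \<inter> W) (gker W (body \<rho>))"
  unfolding K_estimator_def dsum2_def
proof (intro sum.cong refl)
  fix x y assume xy: "x \<in> X \<omega> \<inter> W" "y \<in> X \<omega> \<inter> W - {x}"
  have Wm: "W \<in> sets borel" using W by (simp add: borel_compact)
  have m: "W \<inter> {u. u + (y - x) \<in> W} \<in> sets borel" using Wm by measurable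
  have "(\<lambda>w. w - x) ` W \<inter> (\<lambda>w. w - y) ` W = {u. x + u \<in> W \<inter> {u. u + (y - x) \<in> W}}"
    by (auto simp: algebra_simps intro!: image_eqI[where x = "_ + _"])
  then have "measure lborel ((\<lambda>w. w - x) ` W \<inter> (\<lambda>w. w - y) ` W) = overlap W (y - x)"
    unfolding overlap_def measure_def using emeasure_lborel_shift[OF m, of x] by simp
  then show "indicator (body \<rho>) (y - x) / measure lborel ((\<lambda>w. w - x) ` W \<inter> (\<lambda>w. w - y) ` W) = gker W (body \<rho>) (x, y)"
    using xy by (simp add: gker_def)
qed

private lemma est_zero: "est 0 \<omega> = 0"
  unfolding K_estimator_def by (intro sum.neutral ballI) (auto simp: indicator_def)

private lemma est_mono: "0 \<le> s \<Longrightarrow> s \<le> r \<Longrightarrow> est s \<omega> \<le> est r \<omega>"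
  unfolding K_estimator_def using body_mono[of s r]
  by (intro sum_mono divide_right_mono) (auto simp: indicator_def)

private lemma est_measurable: "est \<rho> \<in> borel_measurable M"
proof -
  have "body \<rho> \<in> sets borel" "W \<in> sets borel" using window_body window_W by (auto simp: window_def)
  note [measurable] = this overlap_measurable[OF window_W]
  have "gker W (body \<rho>) \<in> borel_measurable borel" unfolding gker_def[abs_def] by measurable
  then show ?thesis unfolding est_eq[abs_def] by (rule dsum_measurable(2)[OF window_W])
qed

private lemma est_right:
  assumes "\<omega> \<in> space M" "0 \<le> r"
  shows "\<forall>\<^sub>F t in at_right r. est t \<omega> = est r \<omega>"
proof -
  have fin: "finite (X \<omega> \<inter> W)" by (rule finite_points[OF assms(1) window_W])
  have "\<forall>\<^sub>F t in at_right r. \<forall>x\<in>X \<omega> \<inter> W. \<forall>y\<in>X \<omega> \<inter> W. y - x \<in> body t \<longleftrightarrow> y - x \<in> body r"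
    using fin scaled_body_right[OF B(1,2,4) assms(2)] by (intro eventually_ball_finite ballI) auto
  then show ?thesis
  proof eventually_elim
    case (elim t)
    show ?case unfolding K_estimator_def
      using elim by (intro sum.cong refl) (auto simp: indicator_def)
  qed
qed

text \<open>The bound by \<open>a0\<close> excludes an atom at the origin. Together with
  \<open>est_zero\<close> it makes the error process start at 0, as the chaining requires.\<close>

private lemma reduced_body_zero: "measure \<mu>1 (body 0) = 0"
proof -
  have "measure \<mu>1 (body 0) \<le> 0"
    using \<mu>1_finite(2)[OF window_body, of 0] measure_lborel_scaleR_compact[OF B(1), of 0] by (simp add: power_0_left)
  then show ?thesis using measure_nonneg[of \<mu>1 "body 0"] by linarith
qed

private lemma reduced_body_diff:
  assumes "0 \<le> s" "s \<le> r"
  shows "0 \<le> measure \<mu>1 (body r) - measure \<mu>1 (body s)"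
    "measure \<mu>1 (body r) - measure \<mu>1 (body s) \<le> a0 * measure lborel B * (r ^ DIM('a) - s ^ DIM('a))"
  using shell(3,4)[OF assms] \<mu>1_finite(2)[OF shell(1)[OF assms]] measure_nonneg[of \<mu>1 "body r - body s"]
  by (auto simp: ac_simps)

private lemma reduced_body_continuous: "continuous_on {0..} (\<lambda>r. measure \<mu>1 (body r))"
  unfolding continuous_on_def
proof (intro ballI)
  fix r :: real assume r: "r \<in> {0..}"
  have "((\<lambda>t. a0 * measure lborel B * \<bar>t ^ DIM('a) - r ^ DIM('a)\<bar>) \<longlongrightarrow> a0 * measure lborel B * \<bar>r ^ DIM('a) - r ^ DIM('a)\<bar>) (at r within {0..})"
    by (intro tendsto_intros)
  then have lim: "((\<lambda>t. a0 * measure lborel B * \<bar>t ^ DIM('a) - r ^ DIM('a)\<bar>) \<longlongrightarrow> 0) (at r within {0..})" by simp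
  have "((\<lambda>t. measure \<mu>1 (body t) - measure \<mu>1 (body r)) \<longlongrightarrow> 0) (at r within {0..})"
  proof (rule Lim_null_comparison[OF _ lim])
    have "norm (measure \<mu>1 (body t) - measure \<mu>1 (body r)) \<le> a0 * measure lborel B * \<bar>t ^ DIM('a) - r ^ DIM('a)\<bar>" if "t \<ge> 0" for t
    proof (cases "r \<le> t")
      case True
      then show ?thesis using reduced_body_diff[of r t] r power_mono[OF True, of "DIM('a)"] by simp
    next
      case False
      then have "t ^ DIM('a) \<le> r ^ DIM('a)" using that by (intro power_mono) auto
      then show ?thesis using reduced_body_diff[of t r] False that by (simp add: abs_minus_commute)
    qed
    then show "\<forall>\<^sub>F t in at r within {0..}. norm (measure \<mu>1 (body t) - measure \<mu>1 (body r)) \<le> a0 * measure lborel B * \<bar>t ^ DIM('a) - r ^ DIM('a)\<bar>"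
      by (auto simp: eventually_at_topological)
  qed
  then show "((\<lambda>r. measure \<mu>1 (body r)) \<longlongrightarrow> measure \<mu>1 (body r)) (at r within {0..})" by (rule LIM_zero_cancel)
qed

text \<open>One factor of the squared intensity cancels the division in \<open>K_function\<close>,
  and the tuple measure becomes \<open>\<mu>1\<close>.\<close>

lemma Delta_eq: "Delta lam \<mu> X W B \<alpha> r \<omega> = measure lborel W powr (1/2 - \<alpha>) *
    (K_estimator X W B (window_scale W powr \<alpha> * r) \<omega> - lam * measure \<mu>1 ((*\<^sub>R) (window_scale W powr \<alpha> * r) ` B))"
  using \<mu>[of "body (window_scale W powr \<alpha> * r)"] window_body[of "window_scale W powr \<alpha> * r"]
  by (simp add: Delta_def K_function_def window_def power2_eq_square)

lemma Delta_measurable: "Delta lam \<mu> X W B \<alpha> r \<in> borel_measurable M"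
  unfolding Delta_eq[abs_def] using est_measurable by measurable

lemma Delta_cadlag:
  assumes "\<omega> \<in> space M"
  shows "(\<lambda>r\<in>{0..R}. Delta lam \<mu> X W B \<alpha> r \<omega>) \<in> cadlag R"
proof -
  define c where "c = window_scale W powr \<alpha>"
  have c: "0 \<le> c" by (simp add: c_def)
  show ?thesis
    unfolding Delta_eq c_def[symmetric]
  proof (rule cadlag_mono_minus_continuous)
    show "mono_on {0..R} (\<lambda>r. est (c * r) \<omega>)"
      using c by (intro mono_onI est_mono) (auto intro: mult_left_mono)
    have "continuous_on {0..R} (\<lambda>r. measure \<mu>1 (body (c * r)))"
      by (rule continuous_on_compose2[OF reduced_body_continuous, of "{0..R}" "\<lambda>r. c * r"])
        (use c in \<open>auto intro!: continuous_intros\<close>)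
    then show "continuous_on {0..R} (\<lambda>r. lam * measure \<mu>1 (body (c * r)))" by (intro continuous_intros)
    fix t assume t: "t \<in> {0..<R}"
    have "\<forall>\<^sub>F r in at_right t. est (c * r) \<omega> = est (c * t) \<omega>"
    \<comment> \<open>A null window has scale 0; the estimator is then constant in r.\<close>
    proof (cases "c = 0")
      case False
      then have "filtermap (\<lambda>r. c * r) (at_right t) = at_right (c * t)"
        using c by (intro filtermap_times_pos_at_right) simp
      then have "\<forall>\<^sub>F u in filtermap (\<lambda>r. c * r) (at_right t). est u \<omega> = est (c * t) \<omega>"
        using est_right[OF assms, of "c * t"] c t by simp
      then show ?thesis unfolding eventually_filtermap .
    qed simp
    then show "((\<lambda>r. est (c * r) \<omega>) \<longlongrightarrow> est (c * t) \<omega>) (at_right t)" by (rule tendsto_eventually)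
  qed
qed

text \<open>The estimate for a single window. \<open>L\<close> is a Lipschitz constant of |B| r^d on
  [0, R], and \<open>P + K |A|\<close> bounds the third and fourth order terms. \<open>E\<close>
  collects three errors: the chaining over the grid, the oscillation of the mean within a cell, and
  that of the limit curve within a cell. Only \<open>P\<close> is multiplied by the number 2^J of
  grid cells, and here the two cases of the theorem part.\<close>

lemma window_error:
  fixes \<alpha> \<eta> R P K :: real and J :: nat
  defines "w \<equiv> measure lborel W"
  defines "L \<equiv> measure lborel B * (real DIM('a) * R ^ (DIM('a) - 1))" and "u \<equiv> w powr (- \<alpha>)"
  defines "Z \<equiv> \<lambda>\<omega>. (real (card (X \<omega> \<inter> W)) - lam * w) / sqrt w"
  assumes R: "0 < R" and w: "1 \<le> w" and \<eta>: "0 \<le> \<eta>" "\<eta> \<le> 1/2"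
    and deficit: "\<And>z. z \<in> (*\<^sub>R) (window_scale W powr \<alpha> * R) ` B \<Longrightarrow> w - overlap W z \<le> \<eta> * w"
    and PK: "0 \<le> P" "0 \<le> K" "\<And>A. window A \<Longrightarrow>
      measure Q4 {p. fst p \<in> A \<and> fst (snd p) - snd (snd p) \<in> A} + 4 * measure Q3 (A \<times> A) \<le> P + K * measure lborel A"
  obtains E where "E \<in> borel_measurable M" "integrable M (\<lambda>\<omega>. (E \<omega>)\<^sup>2)" "\<And>\<omega>. 0 \<le> E \<omega>"
    "\<And>\<omega> r. \<omega> \<in> space M \<Longrightarrow> r \<in> {0..R} \<Longrightarrow>
      \<bar>Delta lam \<mu> X W B \<alpha> r \<omega> - 2 * lam * measure lborel B * r ^ DIM('a) * Z \<omega>\<bar> \<le> E \<omega>"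
    "(\<integral>\<omega>. (E \<omega>)\<^sup>2 \<partial>M) \<le> 3 * (4 * (real J + 1)\<^sup>2 * 2 ^ J * (8 * lam * P * u\<^sup>2)
        + 2 * (real J + 1) ^ 3 * R * (8 * lam * (K + (2 * lam * q2\<^sup>2 + 4 * lam * q2 + 2 * a0)) * L * u)
        + 24 * R\<^sup>2 * (16 * (1 + q2) * lam ^ 3 * L\<^sup>2 * \<eta>))
      + 3 * (sqrt w * lam * a0 * L * R / 2 ^ J)\<^sup>2 + 3 * (2 * lam * L * R / 2 ^ J)\<^sup>2 * ((1 + q2) * lam)"
proof -
  define c where "c = window_scale W powr \<alpha>"
  define v where "v = w powr (1/2 - \<alpha>)"
  define b where "b = measure lborel B"
  define d where "d = DIM('a)"
  define K1 where "K1 = 2 * lam * q2\<^sup>2 + 4 * lam * q2 + 2 * a0"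
  define K2 where "K2 = 16 * (1 + q2) * lam ^ 3"
  have d: "d \<noteq> 0" by (simp add: d_def)
  have c0: "0 \<le> c" and u0: "0 \<le> u" and v0: "0 \<le> v" and b0: "0 \<le> b" and L0: "0 \<le> L" and w0: "0 < w"
    using w R by (simp_all add: c_def u_def v_def b_def L_def)
  have K10: "0 \<le> K1" and K20: "0 \<le> K2" using lam_nonneg a0(1) by (simp_all add: K1_def K2_def)
  have cd: "c ^ d = w powr \<alpha>"
  proof -
    have "c = w powr (\<alpha> / real d)" by (simp add: c_def window_scale_def powr_powr w_def d_def)
    then show ?thesis using w0 d by (simp add: powr_power)
  qed
  \<comment> \<open>The scaling identities: c^d = w^\<alpha> is the volume factor of the dilation, u
    is its inverse, and multiplication by v turns it into sqrt w, the normalisation in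
    \<open>Z\<close>.\<close>
  have uc: "u * c ^ d = 1" using w0 by (simp add: cd u_def powr_minus)
  have vu: "v = sqrt w * u"
  proof -
    have "v = w powr (1/2) * w powr (- \<alpha>)" unfolding v_def powr_add[symmetric] by simp
    then show ?thesis using w0 by (simp add: u_def powr_half_sqrt)
  qed
  have v2: "v\<^sup>2 / w = u\<^sup>2" using w0 by (simp add: vu power_mult_distrib)
  have vc: "v * c ^ d = sqrt w" using uc by (simp add: vu)
  define e where "e \<omega> r = Delta lam \<mu> X W B \<alpha> r \<omega> - 2 * lam * b * r ^ d * Z \<omega>" for \<omega> r
  have De: "Delta lam \<mu> X W B \<alpha> r \<omega> = v * (est (c * r) \<omega> - lam * measure \<mu>1 (body (c * r)))" for r \<omega>
    unfolding Delta_eq by (simp add: v_def w_def c_def)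
  have lip: "b * (r ^ d - s ^ d) \<le> L * (r - s)" if "0 \<le> s" "s \<le> r" "r \<le> R" for r s
    using mult_left_mono[OF power_diff_le[OF that, of d] b0] by (simp add: L_def b_def d_def ac_simps)
  have sq: "sqrt w * sqrt w = w" using w0 by simp
  have inc: "integrable M (\<lambda>\<omega>. (e \<omega> r - e \<omega> s)\<^sup>2)"
    "(\<integral>\<omega>. (e \<omega> r - e \<omega> s)\<^sup>2 \<partial>M) \<le> 8 * lam * P * u\<^sup>2 + (8 * lam * (K + K1) * L * u) * (r - s) + (K2 * L\<^sup>2 * \<eta>) * (r - s)\<^sup>2"
    if sr: "0 \<le> s" "s \<le> r" "r \<le> R" for r s
  proof -
    have csr: "0 \<le> c * s" "c * s \<le> c * r" "c * r \<le> c * R" using sr c0 by (auto intro: mult_left_mono)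
    define A where "A = body (c * r) - body (c * s)"
    define a where "a = measure lborel A"
    note sh = shell[OF csr(1,2), folded A_def]
    have aeq: "a = c ^ d * (b * (r ^ d - s ^ d))"
      using sh(3) by (simp add: a_def b_def d_def power_mult_distrib algebra_simps)
    have a0': "0 \<le> a" by (simp add: a_def)
    \<comment> \<open>After rescaling, the volume of the shell no longer depends on the
      window.\<close>
    have ua: "u * a = b * (r ^ d - s ^ d)"
      unfolding aeq mult.assoc[symmetric] uc by simp
    have ual: "u * a \<le> L * (r - s)" unfolding ua by (rule lip[OF sr])
    define T where "T \<omega> = dsum2 (X \<omega> \<inter> W) (gker W A) - lam * measure \<mu>1 A - 2 * lam * a / w * (real (card (X \<omega> \<inter> W)) - lam * w)" for \<omega>
    have def': "z \<in> A \<Longrightarrow> w - overlap W z \<le> \<eta> * w" for z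
      using body_mono[of "c * r" "c * R"] csr deficit[folded c_def, of z] by (auto simp: A_def)
    have T: "integrable M (\<lambda>\<omega>. (T \<omega>)\<^sup>2)"
      "(\<integral>\<omega>. (T \<omega>)\<^sup>2 \<partial>M) \<le> 8 * lam / w * (measure Q4 {p. fst p \<in> A \<and> fst (snd p) - snd (snd p) \<in> A}
        + 4 * measure Q3 (A \<times> A) + K1 * a) + K2 * \<eta> * a\<^sup>2 / w"
      unfolding T_def[abs_def] a_def w_def K1_def K2_def
      using pair_increment_bound[OF window_W sh(1,2) _ \<eta>] w0 def' unfolding w_def by auto
    have kdiff: "gker W A p = gker W (body (c * r)) p - gker W (body (c * s)) p" for p
      using body_mono[OF csr(1,2)] by (auto simp: gker_def A_def indicator_def)
    \<comment> \<open>The increment of the error is the normalised \<open>T\<close>: the point count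
      term of \<open>T\<close> becomes exactly the increment of the limit profile times
      \<open>Z\<close>, and the means correspond.\<close>
    have eT: "e \<omega> r - e \<omega> s = v * T \<omega>" for \<omega>
    proof -
      have ds: "dsum2 (X \<omega> \<inter> W) (gker W A) = est (c * r) \<omega> - est (c * s) \<omega>"
        unfolding est_eq dsum2_def kdiff by (simp only: sum_subtractf)
      have "v * (2 * lam * a / w * (real (card (X \<omega> \<inter> W)) - lam * w)) = 2 * lam * (b * (r ^ d - s ^ d)) * Z \<omega>"
      proof -
        have "v * a = sqrt w * (b * (r ^ d - s ^ d))" unfolding aeq mult.assoc[symmetric] vc by simp
        moreover have "v * (2 * lam * a / w * n) = 2 * lam * (v * a) * (n / w)" for n by simp
        ultimately have "v * (2 * lam * a / w * (real (card (X \<omega> \<inter> W)) - lam * w)) = 2 * lam * (b * (r ^ d - s ^ d)) * ((real (card (X \<omega> \<inter> W)) - lam * w) * (sqrt w / w))"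
          by simp
        moreover have "sqrt w / w = 1 / sqrt w" using sq w0 by (simp add: field_simps)
        ultimately show ?thesis by (simp add: Z_def)
      qed
      then show ?thesis unfolding e_def De T_def ds sh(4) by (simp add: algebra_simps)
    qed
    show "integrable M (\<lambda>\<omega>. (e \<omega> r - e \<omega> s)\<^sup>2)" unfolding eT power_mult_distrib using T(1) by simp
    have "(\<integral>\<omega>. (e \<omega> r - e \<omega> s)\<^sup>2 \<partial>M) = v\<^sup>2 * (\<integral>\<omega>. (T \<omega>)\<^sup>2 \<partial>M)" unfolding eT power_mult_distrib by simp
    also have "\<dots> \<le> v\<^sup>2 * (8 * lam / w * (P + K * a + K1 * a) + K2 * \<eta> * a\<^sup>2 / w)"
    proof (rule mult_left_mono)
      have "8 * lam / w * (measure Q4 {p. fst p \<in> A \<and> fst (snd p) - snd (snd p) \<in> A} + 4 * measure Q3 (A \<times> A) + K1 * a)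
          \<le> 8 * lam / w * (P + K * a + K1 * a)"
        using PK(3)[OF sh(1)] w0 lam_nonneg by (intro mult_left_mono add_right_mono) (auto simp: a_def)
      then show "(\<integral>\<omega>. (T \<omega>)\<^sup>2 \<partial>M) \<le> 8 * lam / w * (P + K * a + K1 * a) + K2 * \<eta> * a\<^sup>2 / w"
        using T(2) by linarith
    qed simp
    also have "\<dots> = (v\<^sup>2 / w) * (8 * lam * (P + (K + K1) * a) + K2 * \<eta> * a\<^sup>2)" using w0 by (simp add: field_simps)
    \<comment> \<open>With v^2 / w = u^2 the powers of \<open>a\<close> are matched by powers of
      \<open>u\<close>: the constant part keeps u^2, the linear part keeps one u, and the quadratic
      part keeps none but carries \<eta>.\<close>
    also have "\<dots> = 8 * lam * P * u\<^sup>2 + (8 * lam * (K + K1) * u) * (u * a) + (K2 * \<eta>) * (u * a)\<^sup>2"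
      unfolding v2 by (simp add: power2_eq_square algebra_simps)
    also have "\<dots> \<le> 8 * lam * P * u\<^sup>2 + (8 * lam * (K + K1) * u) * (L * (r - s)) + (K2 * \<eta>) * (L * (r - s))\<^sup>2"
      using ual u0 a0' lam_nonneg PK(2) K10 K20 \<eta> by (intro add_mono order_refl mult_left_mono power_mono) auto
    also have "\<dots> = 8 * lam * P * u\<^sup>2 + (8 * lam * (K + K1) * L * u) * (r - s) + (K2 * L\<^sup>2 * \<eta>) * (r - s)\<^sup>2"
      by (simp add: power_mult_distrib ac_simps)
    finally show "(\<integral>\<omega>. (e \<omega> r - e \<omega> s)\<^sup>2 \<partial>M) \<le> 8 * lam * P * u\<^sup>2 + (8 * lam * (K + K1) * L * u) * (r - s) + (K2 * L\<^sup>2 * \<eta>) * (r - s)\<^sup>2" .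
  qed
  define S where "S \<omega> = 2 * (\<Sum>l\<le>J. (real l + 1)\<^sup>2 * (\<Sum>i<2 ^ l. (dyadic_incr R (e \<omega>) l i)\<^sup>2))" for \<omega>
  have "0 \<le> 8 * lam * P * u\<^sup>2" "0 \<le> 8 * lam * (K + K1) * L * u" "0 \<le> K2 * L\<^sup>2 * \<eta>"
    using lam_nonneg PK(1,2) K10 K20 L0 u0 \<eta> by simp_all
  note cs = chaining_second_moment[where e = e, OF this R inc]
  have S: "integrable M S" "(\<integral>\<omega>. S \<omega> \<partial>M) \<le> 4 * (real J + 1)\<^sup>2 * 2 ^ J * (8 * lam * P * u\<^sup>2)
      + 2 * (real J + 1) ^ 3 * R * (8 * lam * (K + K1) * L * u) + 24 * R\<^sup>2 * (K2 * L\<^sup>2 * \<eta>)"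
    unfolding S_def[abs_def]
    by (rule cs(1), assumption+, rule cs(2))
  have S0: "0 \<le> S \<omega>" for \<omega> unfolding S_def by (intro mult_nonneg_nonneg sum_nonneg) auto
  define k where "k = sqrt w * lam * a0 * L * R / 2 ^ J"
  define q where "q = 2 * lam * L * R / 2 ^ J"
  have k0: "0 \<le> k" and q0: "0 \<le> q" using lam_nonneg a0(1) L0 R w0 by (simp_all add: k_def q_def)
  \<comment> \<open>The variance bound for linear statistics, applied to the constant function
    1.\<close>
  have Z2: "integrable M (\<lambda>\<omega>. (Z \<omega>)\<^sup>2)" "(\<integral>\<omega>. (Z \<omega>)\<^sup>2 \<partial>M) \<le> (1 + q2) * lam"
  proof -
    have mw: "measure (leb W) UNIV = lam * w"
      using emeasure_leb[OF window_W] lam_nonneg by (simp add: measure_def w_def)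
    note lv = linear_statistic_variance[OF window_W bdd_borel_const[of 1]]
    have Zeq: "(Z \<omega>)\<^sup>2 = (1 / w) * (sum (\<lambda>_. 1) (X \<omega> \<inter> W) - (\<integral>x. 1 \<partial>leb W))\<^sup>2" for \<omega>
      using w0 mw by (simp add: Z_def power_divide)
    show "integrable M (\<lambda>\<omega>. (Z \<omega>)\<^sup>2)" unfolding Zeq by (rule integrable_mult_right[OF lv(1)])
    have "(\<integral>\<omega>. (Z \<omega>)\<^sup>2 \<partial>M) = (1 / w) * (\<integral>\<omega>. (sum (\<lambda>_. 1) (X \<omega> \<inter> W) - (\<integral>x. 1 \<partial>leb W))\<^sup>2 \<partial>M)"
      unfolding Zeq by (rule integral_mult_right_zero)
    also have "\<dots> \<le> (1 / w) * ((1 + q2) * (\<integral>x. 1\<^sup>2 \<partial>leb W))"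
      using w0 by (intro mult_left_mono[OF lv(2)]) simp
    also have "\<dots> = (1 + q2) * lam" using w0 mw by simp
    finally show "(\<integral>\<omega>. (Z \<omega>)\<^sup>2 \<partial>M) \<le> (1 + q2) * lam" .
  qed
  have Zm: "Z \<in> borel_measurable M" unfolding Z_def using count_measurable[OF window_W] by measurable
  define E where "E \<omega> = sqrt (S \<omega>) + k + q * \<bar>Z \<omega>\<bar>" for \<omega>
  show thesis
  proof (rule that)
    show Em: "E \<in> borel_measurable M"
      unfolding E_def[abs_def] using Zm borel_measurable_integrable[OF S(1)] by measurable
    show "0 \<le> E \<omega>" for \<omega> using S0 k0 q0 by (simp add: E_def)
    have le: "(E \<omega>)\<^sup>2 \<le> 3 * S \<omega> + 3 * k\<^sup>2 + 3 * q\<^sup>2 * (Z \<omega>)\<^sup>2" for \<omega>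
    proof -
      have three: "(x + y + z)\<^sup>2 \<le> 3 * x\<^sup>2 + 3 * y\<^sup>2 + 3 * z\<^sup>2" for x y z :: real
      proof -
        have "3 * x\<^sup>2 + 3 * y\<^sup>2 + 3 * z\<^sup>2 - (x + y + z)\<^sup>2 = (x - y)\<^sup>2 + (x - z)\<^sup>2 + (y - z)\<^sup>2"
          by (simp add: power2_eq_square algebra_simps)
        moreover have "0 \<le> (x - y)\<^sup>2 + (x - z)\<^sup>2 + (y - z)\<^sup>2" by simp
        ultimately show ?thesis by linarith
      qed
      have "(q * \<bar>Z \<omega>\<bar>)\<^sup>2 = q\<^sup>2 * (Z \<omega>)\<^sup>2" by (simp add: power_mult_distrib)
      then show ?thesis using three[of "sqrt (S \<omega>)" k "q * \<bar>Z \<omega>\<bar>"] S0[of \<omega>] by (simp add: E_def)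
    qed
    have iB: "integrable M (\<lambda>\<omega>. 3 * S \<omega> + 3 * k\<^sup>2 + 3 * q\<^sup>2 * (Z \<omega>)\<^sup>2)" using S(1) Z2(1) by simp
    show iE: "integrable M (\<lambda>\<omega>. (E \<omega>)\<^sup>2)"
    proof (rule Bochner_Integration.integrable_bound[OF iB])
      show "(\<lambda>\<omega>. (E \<omega>)\<^sup>2) \<in> borel_measurable M" using Em by measurable
      show "AE \<omega> in M. norm ((E \<omega>)\<^sup>2) \<le> norm (3 * S \<omega> + 3 * k\<^sup>2 + 3 * q\<^sup>2 * (Z \<omega>)\<^sup>2)"
      proof (rule AE_I2)
        fix \<omega>
        show "norm ((E \<omega>)\<^sup>2) \<le> norm (3 * S \<omega> + 3 * k\<^sup>2 + 3 * q\<^sup>2 * (Z \<omega>)\<^sup>2)" using le[of \<omega>] S0[of \<omega>] by simp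
      qed
    qed
    have "(\<integral>\<omega>. (E \<omega>)\<^sup>2 \<partial>M) \<le> (\<integral>\<omega>. 3 * S \<omega> + 3 * k\<^sup>2 + 3 * q\<^sup>2 * (Z \<omega>)\<^sup>2 \<partial>M)" by (rule integral_mono[OF iE iB le])
    also have "\<dots> = 3 * (\<integral>\<omega>. S \<omega> \<partial>M) + 3 * k\<^sup>2 + 3 * q\<^sup>2 * (\<integral>\<omega>. (Z \<omega>)\<^sup>2 \<partial>M)"
      using S(1) Z2(1) by (simp add: prob_space)
    also have "\<dots> \<le> 3 * (4 * (real J + 1)\<^sup>2 * 2 ^ J * (8 * lam * P * u\<^sup>2)
      + 2 * (real J + 1) ^ 3 * R * (8 * lam * (K + K1) * L * u) + 24 * R\<^sup>2 * (K2 * L\<^sup>2 * \<eta>)) + 3 * k\<^sup>2 + 3 * q\<^sup>2 * ((1 + q2) * lam)"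
      using S(2) Z2(2) by (intro add_mono mult_left_mono) auto
    finally show "(\<integral>\<omega>. (E \<omega>)\<^sup>2 \<partial>M) \<le> 3 * (4 * (real J + 1)\<^sup>2 * 2 ^ J * (8 * lam * P * u\<^sup>2)
        + 2 * (real J + 1) ^ 3 * R * (8 * lam * (K + (2 * lam * q2\<^sup>2 + 4 * lam * q2 + 2 * a0)) * L * u)
        + 24 * R\<^sup>2 * (16 * (1 + q2) * lam ^ 3 * L\<^sup>2 * \<eta>))
      + 3 * (sqrt w * lam * a0 * L * R / 2 ^ J)\<^sup>2 + 3 * (2 * lam * L * R / 2 ^ J)\<^sup>2 * ((1 + q2) * lam)"
      unfolding k_def q_def K1_def K2_def .
    fix \<omega> r assume \<omega>: "\<omega> \<in> space M" and r: "r \<in> {0..R}"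
    have e0: "e \<omega> 0 = 0"
      using d by (simp add: e_def De est_zero reduced_body_zero[simplified] power_0_left)
    have pm: "s ^ d \<le> t ^ d" if "0 \<le> s" "s \<le> t" for s t :: real using that by (intro power_mono) auto
    have "\<bar>v * est (c * r) \<omega> - v * (lam * measure \<mu>1 (body (c * r))) - 2 * lam * b * r ^ d * Z \<omega>\<bar> \<le> sqrt (S \<omega>) + k + q * \<bar>Z \<omega>\<bar>"
    proof (rule monotone_sandwich[OF R, where V = "\<lambda>r. v * est (c * r) \<omega>" and m = "\<lambda>r. v * (lam * measure \<mu>1 (body (c * r)))"
          and p = "\<lambda>r. 2 * lam * b * r ^ d" and J = J, OF _ _ _ _ _ _ r])
      show "mono_on {0..R} (\<lambda>r. v * est (c * r) \<omega>)"
        using c0 v0 by (intro mono_onI mult_left_mono est_mono) auto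
      show "mono_on {0..R} (\<lambda>r. v * (lam * measure \<mu>1 (body (c * r))))"
      proof (intro mono_onI mult_left_mono)
        fix s t assume st: "s \<in> {0..R}" "t \<in> {0..R}" "s \<le> t"
        show "measure \<mu>1 (body (c * s)) \<le> measure \<mu>1 (body (c * t))"
          using reduced_body_diff(1)[of "c * s" "c * t"] st c0 by (simp add: mult_left_mono)
      qed (use v0 lam_nonneg in auto)
      show "mono_on {0..R} (\<lambda>r. 2 * lam * b * r ^ d)"
        using lam_nonneg b0 pm by (intro mono_onI mult_left_mono) auto
      fix i :: nat assume i: "i \<le> 2 ^ J"
      have "(e \<omega> (real i * R / 2 ^ J))\<^sup>2 \<le> S \<omega>" unfolding S_def by (rule dyadic_chain_square[where f = "e \<omega>", OF e0 i])
      then have "\<bar>e \<omega> (real i * R / 2 ^ J)\<bar> \<le> sqrt (S \<omega>)" using real_sqrt_le_mono by fastforce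
      then show "\<bar>v * est (c * (real i * R / 2 ^ J)) \<omega> - v * (lam * measure \<mu>1 (body (c * (real i * R / 2 ^ J))))
          - 2 * lam * b * (real i * R / 2 ^ J) ^ d * Z \<omega>\<bar> \<le> sqrt (S \<omega>)"
        unfolding e_def De by (simp only: right_diff_distrib)
    next
      fix s t assume st: "0 \<le> s" "s \<le> t" "t \<le> R" "t - s \<le> R / 2 ^ J"
      have Lst: "b * (t ^ d - s ^ d) \<le> L * (R / 2 ^ J)"
        by (rule order_trans[OF lip[OF st(1,2,3)] mult_left_mono[OF st(4) L0]])
      have "measure \<mu>1 (body (c * t)) - measure \<mu>1 (body (c * s)) \<le> a0 * b * ((c * t) ^ d - (c * s) ^ d)"
        unfolding b_def d_def using st c0 by (intro reduced_body_diff(2)) (auto intro: mult_left_mono)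
      also have "\<dots> = a0 * (c ^ d * (b * (t ^ d - s ^ d)))" by (simp add: power_mult_distrib algebra_simps)
      finally have "(v * lam) * (measure \<mu>1 (body (c * t)) - measure \<mu>1 (body (c * s))) \<le> (v * lam) * (a0 * (c ^ d * (b * (t ^ d - s ^ d))))"
        using v0 lam_nonneg by (intro mult_left_mono) auto
      also have "\<dots> = (v * c ^ d) * lam * a0 * (b * (t ^ d - s ^ d))" by simp
      also have "\<dots> \<le> (v * c ^ d) * lam * a0 * (L * (R / 2 ^ J))"
        using lam_nonneg a0(1) v0 c0 by (intro mult_left_mono[OF Lst]) auto
      also have "\<dots> = k" unfolding vc k_def by simp
      finally show "v * (lam * measure \<mu>1 (body (c * t))) - v * (lam * measure \<mu>1 (body (c * s))) \<le> k"
        by (simp add: algebra_simps)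
      have "(2 * lam) * (b * (t ^ d - s ^ d)) \<le> (2 * lam) * (L * (R / 2 ^ J))"
        using lam_nonneg by (intro mult_left_mono[OF Lst]) auto
      then show "2 * lam * b * t ^ d - 2 * lam * b * s ^ d \<le> q" by (simp add: q_def algebra_simps)
    qed
    then show "\<bar>Delta lam \<mu> X W B \<alpha> r \<omega> - 2 * lam * measure lborel B * r ^ DIM('a) * Z \<omega>\<bar> \<le> E \<omega>"
      unfolding De E_def by (simp only: right_diff_distrib b_def d_def)
  qed
qed

end

end

section \<open>Rates\<close>

text \<open>2^J lies between w^\<beta> / 2 and w^\<beta>. The mesh beats sqrt w because \<beta> >
  1/2, and the number of cells is beaten by w^(-2 \<alpha>), despite the logarithms, if \<beta> < 2
  \<alpha>; both can be had exactly when \<alpha> > 1/4.\<close>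

lemma dyadic_grid_rates:
  fixes w :: "nat \<Rightarrow> real" and \<alpha> \<beta> :: real
  defines "J \<equiv> \<lambda>n. nat \<lfloor>\<beta> * log 2 (w n)\<rfloor>"
  assumes w: "filterlim w at_top sequentially" and \<alpha>: "0 < \<alpha>" and \<beta>: "1/2 < \<beta>"
  shows "(\<lambda>n. (real (J n) + 1) ^ 3 * w n powr (- \<alpha>)) \<longlonglongrightarrow> 0"
    "(\<lambda>n. sqrt (w n) / 2 ^ J n) \<longlonglongrightarrow> 0" "(\<lambda>n. 1 / 2 ^ J n :: real) \<longlonglongrightarrow> 0"
    "\<beta> < 2 * \<alpha> \<Longrightarrow> (\<lambda>n. (real (J n) + 1)\<^sup>2 * 2 ^ J n * (w n powr (- \<alpha>))\<^sup>2) \<longlonglongrightarrow> 0"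
proof -
  have w1: "eventually (\<lambda>n. 1 \<le> w n) sequentially" using w by (simp add: filterlim_at_top)
  have J: "real (J n) \<le> \<beta> * log 2 (w n)" "2 ^ J n \<le> w n powr \<beta>" "1 / 2 ^ J n \<le> 2 * w n powr (- \<beta>)" if "1 \<le> w n" for n
  proof -
    have nn: "0 \<le> \<beta> * log 2 (w n)" using that \<beta> by simp
    show 1: "real (J n) \<le> \<beta> * log 2 (w n)" using nn unfolding J_def by linarith
    have 2: "\<beta> * log 2 (w n) < real (J n) + 1" using nn unfolding J_def by linarith
    have p: "2 powr (\<beta> * log 2 (w n)) = w n powr \<beta>"
    proof -
      have "2 powr (log 2 (w n) * \<beta>) = (2 powr log 2 (w n)) powr \<beta>" by (rule powr_powr[symmetric])
      then show ?thesis using that by (simp add: mult.commute)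
    qed
    have r: "2 powr real (J n) = 2 ^ J n" by (simp add: powr_realpow)
    have "2 powr real (J n) \<le> 2 powr (\<beta> * log 2 (w n))" using 1 by (intro powr_mono) auto
    then show "2 ^ J n \<le> w n powr \<beta>" unfolding p r .
    have "2 powr (\<beta> * log 2 (w n)) \<le> 2 powr (real (J n) + 1)" using 2 by (intro powr_mono) auto
    then have "w n powr \<beta> \<le> 2 * 2 ^ J n" unfolding p by (simp add: powr_add r)
    moreover have "0 < w n powr \<beta>" using that by simp
    ultimately show "1 / 2 ^ J n \<le> 2 * w n powr (- \<beta>)" by (simp add: powr_minus field_simps)
  qed
  have a1: "((\<lambda>x. (\<beta> * log 2 x + 1) ^ 3 * x powr (- \<alpha>)) \<longlongrightarrow> 0) at_top" using \<alpha> \<beta> by real_asymp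
  have a2: "((\<lambda>x. sqrt x * (2 * x powr (- \<beta>))) \<longlongrightarrow> 0) at_top" using \<beta> by real_asymp
  have a3: "((\<lambda>x. 2 * x powr (- \<beta>)) \<longlongrightarrow> 0) at_top" using \<beta> by real_asymp
  show "(\<lambda>n. (real (J n) + 1) ^ 3 * w n powr (- \<alpha>)) \<longlonglongrightarrow> 0"
  proof (rule Lim_null_comparison[OF _ filterlim_compose[OF a1 w]])
    show "\<forall>\<^sub>F n in sequentially. norm ((real (J n) + 1) ^ 3 * w n powr (- \<alpha>)) \<le> (\<beta> * log 2 (w n) + 1) ^ 3 * w n powr (- \<alpha>)"
      using w1
    proof eventually_elim
      case (elim n)
      then show ?case using J(1)[OF elim] by (auto intro!: mult_right_mono power_mono)
    qed
  qed
  show "(\<lambda>n. sqrt (w n) / 2 ^ J n) \<longlonglongrightarrow> 0"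
  proof (rule Lim_null_comparison[OF _ filterlim_compose[OF a2 w]])
    show "\<forall>\<^sub>F n in sequentially. norm (sqrt (w n) / 2 ^ J n) \<le> sqrt (w n) * (2 * w n powr (- \<beta>))"
      using w1
    proof eventually_elim
      case (elim n)
      then have "sqrt (w n) * (1 / 2 ^ J n) \<le> sqrt (w n) * (2 * w n powr (- \<beta>))"
        using J(3)[OF elim] by (intro mult_left_mono) auto
      then show ?case using elim by simp
    qed
  qed
  show "(\<lambda>n. 1 / 2 ^ J n :: real) \<longlonglongrightarrow> 0"
  proof (rule Lim_null_comparison[OF _ filterlim_compose[OF a3 w]])
    show "\<forall>\<^sub>F n in sequentially. norm (1 / 2 ^ J n :: real) \<le> 2 * w n powr (- \<beta>)"
      using w1
    proof eventually_elim
      case (elim n)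
      then show ?case using J(3)[OF elim] by simp
    qed
  qed
  assume \<beta>\<alpha>: "\<beta> < 2 * \<alpha>"
  have a4: "((\<lambda>x. (\<beta> * log 2 x + 1)\<^sup>2 * x powr \<beta> * (x powr (- \<alpha>))\<^sup>2) \<longlongrightarrow> 0) at_top"
    using \<alpha> \<beta> \<beta>\<alpha> by real_asymp
  show "(\<lambda>n. (real (J n) + 1)\<^sup>2 * 2 ^ J n * (w n powr (- \<alpha>))\<^sup>2) \<longlonglongrightarrow> 0"
  proof (rule Lim_null_comparison[OF _ filterlim_compose[OF a4 w]])
    show "\<forall>\<^sub>F n in sequentially. norm ((real (J n) + 1)\<^sup>2 * 2 ^ J n * (w n powr (- \<alpha>))\<^sup>2)
        \<le> (\<beta> * log 2 (w n) + 1)\<^sup>2 * w n powr \<beta> * (w n powr (- \<alpha>))\<^sup>2"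
      using w1
    proof eventually_elim
      case (elim n)
      then show ?case using J(1,2)[OF elim] by (auto intro!: mult_mono power_mono)
    qed
  qed
qed

section \<open>Convergence under a bound on the cumulant measures\<close>

lemma real_distribution_centered_normal: "real_distribution (centered_normal \<sigma>2)"
proof -
  interpret real_distribution std_normal_distribution by (rule real_dist_normal_dist)
  show ?thesis unfolding centered_normal_def by (rule real_distribution_distr) simp
qed

context k_process
begin

text \<open>Common form of the two parts of the final theorem: in general the bound
  \<open>P + K |A|\<close> holds with \<open>K = 0\<close>, under the density assumptions with
  \<open>P = 0\<close>.\<close>

theorem Delta_convergence:
  fixes B :: "'a set" and W :: "nat \<Rightarrow> 'a set" and \<mu> :: "(nat \<Rightarrow> 'a) measure" and \<alpha> R P K \<sigma>2 :: real
  assumes B: "compact B" "convex B" "uminus ` B = B" "0 \<in> B"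
    and W: "convex_averaging_sequence W"
    and \<mu>: "\<And>A. A \<in> sets borel \<Longrightarrow> measure \<mu> (tuple1 A) = measure \<mu>1 A"
    and R: "0 < R" and \<alpha>: "0 < \<alpha>" and P\<alpha>: "P = 0 \<or> 1/4 < \<alpha>"
    and PK: "0 \<le> P" "0 \<le> K" "\<And>A. window A \<Longrightarrow>
      measure Q4 {p. fst p \<in> A \<and> fst (snd p) - snd (snd p) \<in> A} + 4 * measure Q3 (A \<times> A) \<le> P + K * measure lborel A"
    and ratio: "(\<lambda>n. window_scale (W n) powr \<alpha> / inradius (W n)) \<longlonglongrightarrow> 0"
    and conv: "weak_conv_m (\<lambda>n. distr M borel
        (\<lambda>\<omega>. (real (point_count X (W n) \<omega>) - lam * measure lborel (W n)) / sqrt (measure lborel (W n)))) (centered_normal \<sigma>2)"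
  shows "converges_in_distribution (skorohod_topology R) M
    (\<lambda>n \<omega>. \<lambda>r\<in>{0..R}. Delta lam \<mu> X (W n) B \<alpha> r \<omega>)
    (centered_normal \<sigma>2) (\<lambda>z. \<lambda>r\<in>{0..R}. 2 * lam * measure lborel B * r ^ DIM('a) * z)"
proof -
  define w where "w n = measure lborel (W n)" for n
  define c where "c n = window_scale (W n) powr \<alpha>" for n
  define Z where "Z n \<omega> = (real (card (X \<omega> \<inter> W n)) - lam * w n) / sqrt (w n)" for n \<omega>
  define L where "L = measure lborel B * (real DIM('a) * R ^ (DIM('a) - 1))"
  have Wn: "convex (W n)" "compact (W n)" for n using W by (auto simp: convex_averaging_sequence_def)
  have winW: "window (W n)" for n using Wn by (simp add: window_def borel_compact compact_imp_bounded)
  have w: "filterlim w at_top sequentially" unfolding w_def by (rule averaging_sequence_volume[OF W])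
  obtain b0 where b0: "b0 > 0" "\<And>b. b \<in> B \<Longrightarrow> norm b \<le> b0" using compact_imp_bounded[OF B(1)] by (auto simp: bounded_pos)
  \<comment> \<open>The relative deficit d |z| / \<rho> for the largest difference, |z| \<le> c R
    b0, where \<rho> is half the inradius; hence the factor 2.\<close>
  define \<eta> where "\<eta> n = real DIM('a) * (2 * R * b0) * (c n / inradius (W n))" for n
  have \<eta>0: "\<eta> \<longlonglongrightarrow> 0" unfolding \<eta>_def c_def using tendsto_mult_right_zero[OF ratio] by simp
  define good where "good n \<longleftrightarrow> 1 \<le> w n \<and> 0 \<le> \<eta> n \<and> \<eta> n \<le> 1/2 \<and> (\<forall>z\<in>(*\<^sub>R) (c n * R) ` B. w n - overlap (W n) z \<le> \<eta> n * w n)" for n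
  have good: "eventually good sequentially"
  proof -
    have inr: "filterlim (\<lambda>n. inradius (W n)) at_top sequentially" using W by (simp add: convex_averaging_sequence_def)
    have "eventually (\<lambda>n. 1 \<le> w n) sequentially" "eventually (\<lambda>n. max 1 (1 + Sup {}) \<le> inradius (W n)) sequentially"
      using w inr unfolding filterlim_at_top by blast+
    moreover have "eventually (\<lambda>n. \<eta> n < 1/2) sequentially" using order_tendstoD(2)[OF \<eta>0, of "1/2"] by simp
    ultimately show ?thesis
    proof eventually_elim
      case (elim n)
      define \<rho> where "\<rho> = inradius (W n) / 2"
      have \<rho>: "0 < \<rho>" using elim by (simp add: \<rho>_def)
      have c0: "0 \<le> c n" by (simp add: c_def)
      obtain p where p: "cball p \<rho> \<subseteq> W n" unfolding \<rho>_def using inradius_cball[of "W n"] elim by auto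
      have \<eta>eq: "\<eta> n = real DIM('a) * (c n * R * b0 / \<rho>)" by (simp add: \<eta>_def \<rho>_def)
      have n0: "0 \<le> c n * R * b0 / \<rho>" using c0 R b0(1) \<rho> by simp
      have "1 * (c n * R * b0 / \<rho>) \<le> \<eta> n" unfolding \<eta>eq using n0 by (intro mult_right_mono) (auto simp: Suc_le_eq)
      then have "c n * R * b0 / \<rho> \<le> 1" using elim by simp
      then have crb: "c n * R * b0 \<le> \<rho>" using \<rho> by simp
      have "w n - overlap (W n) z \<le> \<eta> n * w n" if z: "z \<in> (*\<^sub>R) (c n * R) ` B" for z
      proof -
        obtain b where b: "b \<in> B" "z = (c n * R) *\<^sub>R b" using z by blast
        have nz: "norm z \<le> c n * R * b0" unfolding b using b0(2)[OF b(1)] c0 R by (simp add: mult_left_mono)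
        have eq: "(\<lambda>u. u - z) ` W n = {x. x + z \<in> W n}" by (auto intro!: image_eqI[where x = "_ + z"])
        have "w n - overlap (W n) z \<le> real DIM('a) * (norm z / \<rho>) * w n"
          using convex_overlap_deficit[OF Wn p \<rho>, of z] nz crb unfolding w_def overlap_def eq by simp
        also have "\<dots> \<le> \<eta> n * w n"
          unfolding \<eta>eq using nz \<rho> by (intro mult_right_mono mult_left_mono divide_right_mono) (auto simp: w_def)
        finally show ?thesis .
      qed
      moreover have "0 \<le> \<eta> n" unfolding \<eta>eq by (rule mult_nonneg_nonneg[OF _ n0]) simp
      ultimately show ?case using elim by (auto simp: good_def)
    qed
  qed
  \<comment> \<open>The midpoint of 1/2 and 2 \<alpha>; if P = 0, only the lower bound is required
    and 1 will do.\<close>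
  obtain \<beta> where \<beta>: "1/2 < \<beta>" "P = 0 \<or> \<beta> < 2 * \<alpha>"
  proof (cases "P = 0")
    case False
    then show thesis using P\<alpha> by (intro that[of "(1/2 + 2 * \<alpha>) / 2"]) auto
  qed (use that[of 1] in simp)
  define J where "J n = nat \<lfloor>\<beta> * log 2 (w n)\<rfloor>" for n
  define bd where "bd n = 3 * (4 * (real (J n) + 1)\<^sup>2 * 2 ^ J n * (8 * lam * P * (w n powr (- \<alpha>))\<^sup>2)
        + 2 * (real (J n) + 1) ^ 3 * R * (8 * lam * (K + (2 * lam * q2\<^sup>2 + 4 * lam * q2 + 2 * a0)) * L * w n powr (- \<alpha>))
        + 24 * R\<^sup>2 * (16 * (1 + q2) * lam ^ 3 * L\<^sup>2 * \<eta> n))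
      + 3 * (sqrt (w n) * lam * a0 * L * R / 2 ^ J n)\<^sup>2 + 3 * (2 * lam * L * R / 2 ^ J n)\<^sup>2 * ((1 + q2) * lam)" for n
  have bd0: "bd \<longlonglongrightarrow> 0"
  proof -
    note rates = dyadic_grid_rates[OF w \<alpha> \<beta>(1), folded J_def]
    have t1: "(\<lambda>n. P * ((real (J n) + 1)\<^sup>2 * 2 ^ J n * (w n powr (- \<alpha>))\<^sup>2)) \<longlonglongrightarrow> 0"
      using \<beta>(2) tendsto_mult_right_zero[OF rates(4), of P] by (cases "P = 0") simp_all
    have "bd = (\<lambda>n. 96 * lam * (P * ((real (J n) + 1)\<^sup>2 * 2 ^ J n * (w n powr (- \<alpha>))\<^sup>2))
        + 48 * R * lam * (K + (2 * lam * q2\<^sup>2 + 4 * lam * q2 + 2 * a0)) * L * ((real (J n) + 1) ^ 3 * w n powr (- \<alpha>))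
        + 72 * R\<^sup>2 * (16 * (1 + q2) * lam ^ 3 * L\<^sup>2) * \<eta> n
        + 3 * (lam * a0 * L * R * (sqrt (w n) / 2 ^ J n))\<^sup>2 + 3 * ((1 + q2) * lam) * (2 * lam * L * R * (1 / 2 ^ J n))\<^sup>2)"
      unfolding bd_def by (intro ext) (simp add: algebra_simps)
    moreover have "(\<lambda>n. 96 * lam * (P * ((real (J n) + 1)\<^sup>2 * 2 ^ J n * (w n powr (- \<alpha>))\<^sup>2))
        + 48 * R * lam * (K + (2 * lam * q2\<^sup>2 + 4 * lam * q2 + 2 * a0)) * L * ((real (J n) + 1) ^ 3 * w n powr (- \<alpha>))
        + 72 * R\<^sup>2 * (16 * (1 + q2) * lam ^ 3 * L\<^sup>2) * \<eta> n
        + 3 * (lam * a0 * L * R * (sqrt (w n) / 2 ^ J n))\<^sup>2 + 3 * ((1 + q2) * lam) * (2 * lam * L * R * (1 / 2 ^ J n))\<^sup>2)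
        \<longlonglongrightarrow> 96 * lam * 0 + 48 * R * lam * (K + (2 * lam * q2\<^sup>2 + 4 * lam * q2 + 2 * a0)) * L * 0
        + 72 * R\<^sup>2 * (16 * (1 + q2) * lam ^ 3 * L\<^sup>2) * 0 + 3 * (lam * a0 * L * R * 0)\<^sup>2 + 3 * ((1 + q2) * lam) * (2 * lam * L * R * 0)\<^sup>2"
      by (intro tendsto_add tendsto_mult tendsto_power tendsto_const t1 rates(1,2,3) \<eta>0)
    ultimately show ?thesis by simp
  qed
  have "\<exists>E. good n \<longrightarrow> E \<in> borel_measurable M \<and> integrable M (\<lambda>\<omega>. (E \<omega>)\<^sup>2) \<and> (\<forall>\<omega>. 0 \<le> E \<omega>) \<and>
      (\<forall>\<omega>\<in>space M. \<forall>r\<in>{0..R}. \<bar>Delta lam \<mu> X (W n) B \<alpha> r \<omega> - 2 * lam * measure lborel B * r ^ DIM('a) * Z n \<omega>\<bar> \<le> E \<omega>) \<and>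
      (\<integral>\<omega>. (E \<omega>)\<^sup>2 \<partial>M) \<le> bd n" for n
  proof (cases "good n")
    case True
    then have g: "1 \<le> w n" "0 \<le> \<eta> n" "\<eta> n \<le> 1/2" "\<And>z. z \<in> (*\<^sub>R) (c n * R) ` B \<Longrightarrow> w n - overlap (W n) z \<le> \<eta> n * w n"
      by (auto simp: good_def)
    obtain E where "E \<in> borel_measurable M" "integrable M (\<lambda>\<omega>. (E \<omega>)\<^sup>2)" "\<And>\<omega>. 0 \<le> E \<omega>"
      "\<And>\<omega> r. \<omega> \<in> space M \<Longrightarrow> r \<in> {0..R} \<Longrightarrow> \<bar>Delta lam \<mu> X (W n) B \<alpha> r \<omega> - 2 * lam * measure lborel B * r ^ DIM('a) * Z n \<omega>\<bar> \<le> E \<omega>"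
      "(\<integral>\<omega>. (E \<omega>)\<^sup>2 \<partial>M) \<le> bd n"
      by (rule window_error[OF B Wn \<mu> R g[unfolded w_def c_def] PK, where J = "J n" and \<alpha> = \<alpha>, folded w_def L_def, folded Z_def])
        (assumption | (rule that, assumption+, unfold bd_def, assumption))+
    then show ?thesis by blast
  qed simp
  then obtain E0 where E0: "\<And>n. good n \<Longrightarrow> E0 n \<in> borel_measurable M \<and> integrable M (\<lambda>\<omega>. (E0 n \<omega>)\<^sup>2) \<and> (\<forall>\<omega>. 0 \<le> E0 n \<omega>) \<and>
      (\<forall>\<omega>\<in>space M. \<forall>r\<in>{0..R}. \<bar>Delta lam \<mu> X (W n) B \<alpha> r \<omega> - 2 * lam * measure lborel B * r ^ DIM('a) * Z n \<omega>\<bar> \<le> E0 n \<omega>) \<and>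
      (\<integral>\<omega>. (E0 n \<omega>)\<^sup>2 \<partial>M) \<le> bd n" by metis
  \<comment> \<open>At most finitely many n fail to be good; for them the error variable is set to
    0, which keeps it measurable.\<close>
  define E where "E n \<omega> = (if good n then E0 n \<omega> else 0)" for n \<omega>
  show ?thesis
  proof (rule converges_in_distribution_linear_path[OF R prob_space_axioms, where Z = Z and E = E])
    show "(\<lambda>r\<in>{0..R}. Delta lam \<mu> X (W n) B \<alpha> r \<omega>) \<in> cadlag R" if "\<omega> \<in> space M" for n \<omega>
      using B Wn[of n] \<mu> that by (rule Delta_cadlag)
    show "(\<lambda>\<omega>. (\<lambda>r\<in>{0..R}. Delta lam \<mu> X (W n) B \<alpha> r \<omega>) t) \<in> borel_measurable M" if "t \<in> {0..R}" for n t
    proof -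
      have "Delta lam \<mu> X (W n) B \<alpha> t \<in> borel_measurable M" using B Wn[of n] \<mu> by (rule Delta_measurable)
      then show ?thesis using that by simp
    qed
    show "Z n \<in> borel_measurable M" for n unfolding Z_def using count_measurable[OF winW] by measurable
    show "real_distribution (centered_normal \<sigma>2)" by (rule real_distribution_centered_normal)
    show "weak_conv_m (\<lambda>n. distr M borel (Z n)) (centered_normal \<sigma>2)"
      using conv unfolding Z_def[abs_def] w_def point_count_def .
    show "continuous_on {0..R} (\<lambda>r. 2 * lam * measure lborel B * r ^ DIM('a))" by (intro continuous_intros)
    show "E n \<in> borel_measurable M" for n using E0[of n] by (cases "good n") (simp_all add: E_def[abs_def])
    show "\<forall>\<^sub>F n in sequentially. \<forall>\<omega>\<in>space M. \<forall>r\<in>{0..R}.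
        \<bar>(\<lambda>r\<in>{0..R}. Delta lam \<mu> X (W n) B \<alpha> r \<omega>) r - 2 * lam * measure lborel B * r ^ DIM('a) * Z n \<omega>\<bar> \<le> E n \<omega>"
      using good by eventually_elim (use E0 in \<open>auto simp: E_def\<close>)
    fix \<epsilon> :: real assume \<epsilon>: "\<epsilon> > 0"
    have lim: "(\<lambda>n. bd n / \<epsilon>\<^sup>2) \<longlonglongrightarrow> 0" using tendsto_divide[OF bd0 tendsto_const, of "\<epsilon>\<^sup>2"] \<epsilon> by simp
    show "(\<lambda>n. measure M {\<omega> \<in> space M. \<epsilon> \<le> E n \<omega>}) \<longlonglongrightarrow> 0"
    proof (rule Lim_null_comparison[OF _ lim])
      show "\<forall>\<^sub>F n in sequentially. norm (measure M {\<omega> \<in> space M. \<epsilon> \<le> E n \<omega>}) \<le> bd n / \<epsilon>\<^sup>2"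
        using good
      proof eventually_elim
        case (elim n)
        note En = E0[OF elim]
        have "{\<omega> \<in> space M. \<epsilon> \<le> E n \<omega>} = {\<omega> \<in> space M. \<epsilon>\<^sup>2 \<le> (E0 n \<omega>)\<^sup>2}"
          using elim En \<epsilon> by (auto simp: E_def abs_le_square_iff[symmetric])
        also have "measure M \<dots> \<le> (\<integral>\<omega>. (E0 n \<omega>)\<^sup>2 \<partial>M) / \<epsilon>\<^sup>2"
          using En \<epsilon> by (intro integral_Markov_inequality_measure[where A = "{}"]) auto
        also have "\<dots> \<le> bd n / \<epsilon>\<^sup>2" using En by (intro divide_right_mono) auto
        finally show ?case by simp
      qed
    qed
  qed
qed

end

section \<open>Cumulant measures with densities\<close>

text \<open>The two parts of the measure have the positive and negative parts of \<kappa> as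
  densities, since \<open>ennreal\<close> sends negative numbers to 0; the variation therefore has
  density |\<kappa>|.\<close>

lemma nn_integral_signed_density:
  assumes d: "has_signed_density \<nu> N \<kappa>"
    and var: "(\<integral>\<^sup>+y. f y \<partial>Q) = (\<integral>\<^sup>+v. f (T v) \<partial>fst \<nu>) + (\<integral>\<^sup>+v. f (T v) \<partial>snd \<nu>)"
    and f: "(\<lambda>v. f (T v)) \<in> borel_measurable N"
  shows "(\<integral>\<^sup>+y. f y \<partial>Q) = (\<integral>\<^sup>+v. ennreal \<bar>\<kappa> v\<bar> * f (T v) \<partial>N)"
proof -
  have [measurable]: "\<kappa> \<in> borel_measurable N" "(\<lambda>v. f (T v)) \<in> borel_measurable N"
    using d f by (simp_all add: has_signed_density_def)
  have "(\<integral>\<^sup>+y. f y \<partial>Q) = (\<integral>\<^sup>+v. ennreal (\<kappa> v) * f (T v) \<partial>N) + (\<integral>\<^sup>+v. ennreal (- \<kappa> v) * f (T v) \<partial>N)"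
    using d unfolding var has_signed_density_def by (simp add: nn_integral_density)
  also have "\<dots> = (\<integral>\<^sup>+v. ennreal (\<kappa> v) * f (T v) + ennreal (- \<kappa> v) * f (T v) \<partial>N)"
    by (rule nn_integral_add[symmetric]) measurable
  also have "\<dots> = (\<integral>\<^sup>+v. ennreal \<bar>\<kappa> v\<bar> * f (T v) \<partial>N)"
  proof (intro nn_integral_cong)
    fix v
    have "ennreal (\<kappa> v) + ennreal (- \<kappa> v) = ennreal \<bar>\<kappa> v\<bar>"
      by (cases "0 \<le> \<kappa> v") (simp_all add: ennreal_neg)
    then show "ennreal (\<kappa> v) * f (T v) + ennreal (- \<kappa> v) * f (T v) = ennreal \<bar>\<kappa> v\<bar> * f (T v)"
      by (simp add: distrib_right[symmetric])
  qed
  finally show ?thesis .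
qed

lemma sets_PiM_lborel: "sets (PiM I (\<lambda>_. lborel :: 'a::euclidean_space measure)) = sets (PiM I (\<lambda>_. borel))"
  by (intro sets_PiM_cong) auto

lemma nn_integral_PiM_lborel:
  fixes F :: "(nat \<Rightarrow> 'a::euclidean_space) \<Rightarrow> ennreal"
  shows "F \<in> borel_measurable (PiM {..<2 :: nat} (\<lambda>_. borel)) \<Longrightarrow>
      (\<integral>\<^sup>+v. F v \<partial>PiM {..<2 :: nat} (\<lambda>_. lborel)) = (\<integral>\<^sup>+x. \<integral>\<^sup>+y. F (tup2 (x, y)) \<partial>lborel \<partial>lborel)"
    "F \<in> borel_measurable (PiM {..<3 :: nat} (\<lambda>_. borel)) \<Longrightarrow>
      (\<integral>\<^sup>+v. F v \<partial>PiM {..<3 :: nat} (\<lambda>_. lborel)) = (\<integral>\<^sup>+x. \<integral>\<^sup>+y. \<integral>\<^sup>+z. F (tup3 (x, y, z)) \<partial>lborel \<partial>lborel \<partial>lborel)"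
proof -
  interpret product_sigma_finite "\<lambda>_ :: nat. lborel :: 'a measure" ..
  have two: "(\<integral>\<^sup>+v. F v \<partial>PiM {..<2 :: nat} (\<lambda>_. lborel)) = (\<integral>\<^sup>+x. \<integral>\<^sup>+y. F (tup2 (x, y)) \<partial>lborel \<partial>lborel)"
    if F: "F \<in> borel_measurable (PiM {..<2 :: nat} (\<lambda>_. borel))" for F :: "(nat \<Rightarrow> 'a) \<Rightarrow> ennreal"
  proof -
    have i: "{..<2} = insert 1 {0 :: nat}" by auto
    have Fm: "F \<in> borel_measurable (PiM (insert 1 {0}) (\<lambda>_. lborel))"
      using F unfolding i by (simp cong: measurable_cong_sets add: sets_PiM_lborel)
    have "(\<integral>\<^sup>+v. F v \<partial>PiM {..<2 :: nat} (\<lambda>_. lborel)) = (\<integral>\<^sup>+v. \<integral>\<^sup>+y. F (v(1 := y)) \<partial>lborel \<partial>PiM {0 :: nat} (\<lambda>_. lborel))"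
      unfolding i by (rule product_nn_integral_insert[OF _ _ Fm]) auto
    also have "\<dots> = (\<integral>\<^sup>+v. (\<integral>\<^sup>+y. F (tup2 (v 0, y)) \<partial>lborel) \<partial>PiM {0 :: nat} (\<lambda>_. lborel))"
    proof (intro nn_integral_cong)
      fix v :: "nat \<Rightarrow> 'a" and y assume "v \<in> space (PiM {0 :: nat} (\<lambda>_. lborel))"
      then have "v(1 := y) = tup2 (v 0, y)"
        by (auto simp: tup2_def space_PiM PiE_def extensional_def fun_eq_iff less_2_cases_iff)
      then show "F (v(1 := y)) = F (tup2 (v 0, y))" by simp
    qed
    also have "\<dots> = (\<integral>\<^sup>+x. (\<integral>\<^sup>+y. F (tup2 (x, y)) \<partial>lborel) \<partial>lborel)"
    proof (rule product_nn_integral_singleton)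
      have [measurable]: "(\<lambda>p. F (tup2 p)) \<in> borel_measurable borel" by (rule measurable_compose[OF tup_measurable(2) F])
      show "(\<lambda>x. \<integral>\<^sup>+y. F (tup2 (x, y)) \<partial>lborel) \<in> borel_measurable lborel" by measurable
    qed
    finally show ?thesis .
  qed
  then show "F \<in> borel_measurable (PiM {..<2 :: nat} (\<lambda>_. borel)) \<Longrightarrow>
      (\<integral>\<^sup>+v. F v \<partial>PiM {..<2 :: nat} (\<lambda>_. lborel)) = (\<integral>\<^sup>+x. \<integral>\<^sup>+y. F (tup2 (x, y)) \<partial>lborel \<partial>lborel)" .
  assume F: "F \<in> borel_measurable (PiM {..<3 :: nat} (\<lambda>_. borel))"
  have i: "{..<3} = insert 2 {..<2 :: nat}" by auto
  have Fm: "F \<in> borel_measurable (PiM (insert 2 {..<2}) (\<lambda>_. lborel))"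
    using F unfolding i by (simp cong: measurable_cong_sets add: sets_PiM_lborel)
  have [measurable]: "(\<lambda>p. F (tup3 p)) \<in> borel_measurable borel" by (rule measurable_compose[OF tup_measurable(3) F])
  have "(\<integral>\<^sup>+v. F v \<partial>PiM {..<3 :: nat} (\<lambda>_. lborel)) = (\<integral>\<^sup>+v. \<integral>\<^sup>+z. F (v(2 := z)) \<partial>lborel \<partial>PiM {..<2 :: nat} (\<lambda>_. lborel))"
    unfolding i by (rule product_nn_integral_insert[OF _ _ Fm]) auto
  also have "\<dots> = (\<integral>\<^sup>+v. (\<integral>\<^sup>+z. F (tup3 (v 0, v 1, z)) \<partial>lborel) \<partial>PiM {..<2 :: nat} (\<lambda>_. lborel))"
  proof (intro nn_integral_cong)
    fix v :: "nat \<Rightarrow> 'a" and z assume v: "v \<in> space (PiM {..<2 :: nat} (\<lambda>_. lborel))"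
    have "v(2 := z) = tup3 (v 0, v 1, z)"
    proof
      fix j :: nat
      consider "j = 0" | "j = 1" | "j = 2" | "3 \<le> j" by linarith
      then show "(v(2 := z)) j = tup3 (v 0, v 1, z) j"
        using v by cases (auto simp: tup3_def space_PiM PiE_def extensional_def)
    qed
    then show "F (v(2 := z)) = F (tup3 (v 0, v 1, z))" by simp
  qed
  also have "\<dots> = (\<integral>\<^sup>+x. \<integral>\<^sup>+y. (\<integral>\<^sup>+z. F (tup3 (tup2 (x, y) 0, tup2 (x, y) 1, z)) \<partial>lborel) \<partial>lborel \<partial>lborel)"
  proof (rule two)
    have "(\<lambda>p. \<integral>\<^sup>+z. F (tup3 (fst p, snd p, z)) \<partial>lborel) \<in> borel_measurable (borel :: ('a \<times> 'a) measure)" by measurable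
    moreover have "(\<lambda>v. (v 0, v 1)) \<in> PiM {..<2 :: nat} (\<lambda>_. borel) \<rightarrow>\<^sub>M (borel :: ('a \<times> 'a) measure)"
      by (intro borel_measurable_Pair measurable_component_singleton) auto
    ultimately have "(\<lambda>v. \<integral>\<^sup>+z. F (tup3 (fst (v 0, v 1), snd (v 0, v 1), z)) \<partial>lborel) \<in> borel_measurable (PiM {..<2 :: nat} (\<lambda>_. borel))"
      by (rule measurable_compose[rotated])
    then show "(\<lambda>v. \<integral>\<^sup>+z. F (tup3 (v 0, v 1, z)) \<partial>lborel) \<in> borel_measurable (PiM {..<2 :: nat} (\<lambda>_. borel))" by simp
  qed
  finally show "(\<integral>\<^sup>+v. F v \<partial>PiM {..<3 :: nat} (\<lambda>_. lborel)) = (\<integral>\<^sup>+x. \<integral>\<^sup>+y. \<integral>\<^sup>+z. F (tup3 (x, y, z)) \<partial>lborel \<partial>lborel \<partial>lborel)"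
    by (simp add: tup2_def)
qed

text \<open>Cauchy-Schwarz against the indicator of A \<times> A, whose squared norm is |A|^2,
  stated for iterated integrals to match the density hypothesis.\<close>

lemma nested_Cauchy_Schwarz:
  fixes h :: "'a::euclidean_space \<Rightarrow> 'a \<Rightarrow> ennreal"
  assumes [measurable]: "(\<lambda>p. h (fst p) (snd p)) \<in> borel_measurable borel" "A \<in> sets borel"
  shows "(\<integral>\<^sup>+x. \<integral>\<^sup>+y. h x y * (indicator A x * indicator A y) \<partial>lborel \<partial>lborel)\<^sup>2
    \<le> (\<integral>\<^sup>+x. \<integral>\<^sup>+y. (h x y)\<^sup>2 \<partial>lborel \<partial>lborel) * (emeasure lborel A)\<^sup>2"
proof -
  let ?L = "lborel :: 'a measure"
  have s: "sets (?L \<Otimes>\<^sub>M ?L) = sets borel" by (simp add: borel_prod[symmetric] cong: sets_pair_measure_cong)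
  have [measurable]: "(\<lambda>p. h (fst p) (snd p)) \<in> borel_measurable (?L \<Otimes>\<^sub>M ?L)"
    using assms(1) s by (simp cong: measurable_cong_sets)
  have nest: "(\<integral>\<^sup>+x. \<integral>\<^sup>+y. F (x, y) \<partial>?L \<partial>?L) = (\<integral>\<^sup>+p. F p \<partial>(?L \<Otimes>\<^sub>M ?L))" if "F \<in> borel_measurable (?L \<Otimes>\<^sub>M ?L)" for F
    by (rule lborel.nn_integral_fst[OF that])
  have 1: "(\<integral>\<^sup>+x. \<integral>\<^sup>+y. h x y * (indicator A x * indicator A y) \<partial>?L \<partial>?L)
      = (\<integral>\<^sup>+p. h (fst p) (snd p) * (indicator A (fst p) * indicator A (snd p)) \<partial>(?L \<Otimes>\<^sub>M ?L))"
    using nest[of "\<lambda>p. h (fst p) (snd p) * (indicator A (fst p) * indicator A (snd p))"] by simp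
  have 2: "(\<integral>\<^sup>+x. \<integral>\<^sup>+y. (h x y)\<^sup>2 \<partial>?L \<partial>?L) = (\<integral>\<^sup>+p. (h (fst p) (snd p))\<^sup>2 \<partial>(?L \<Otimes>\<^sub>M ?L))"
    using nest[of "\<lambda>p. (h (fst p) (snd p))\<^sup>2"] by simp
  have 3: "(\<integral>\<^sup>+p. (indicator A (fst p) * indicator A (snd p))\<^sup>2 \<partial>(?L \<Otimes>\<^sub>M ?L)) = (emeasure lborel A)\<^sup>2"
  proof -
    have "(\<integral>\<^sup>+p. (indicator A (fst p) * indicator A (snd p))\<^sup>2 \<partial>(?L \<Otimes>\<^sub>M ?L))
        = (\<integral>\<^sup>+x. \<integral>\<^sup>+y. (indicator A x * indicator A y)\<^sup>2 \<partial>?L \<partial>?L)"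
      using nest[of "\<lambda>p. (indicator A (fst p) * indicator A (snd p))\<^sup>2"] by simp
    also have "\<dots> = (\<integral>\<^sup>+x. \<integral>\<^sup>+y. indicator A x * indicator A y \<partial>?L \<partial>?L)"
      by (intro nn_integral_cong) (simp add: indicator_def)
    also have "\<dots> = (emeasure lborel A)\<^sup>2" by (simp add: nn_integral_cmult nn_integral_multc power2_eq_square)
    finally show ?thesis .
  qed
  show ?thesis unfolding 1 2 3[symmetric] by (rule Cauchy_Schwarz_nn_integral) measurable
qed

text \<open>The bounded density gives C |A|^2, finiteness gives the total mass. Their geometric mean
  is linear in |A|, as needed for shells of every size.\<close>

lemma bounded_density_variation:
  fixes \<nu> :: "(nat \<Rightarrow> 'a::euclidean_space) signed_measure"
  assumes d: "has_signed_density \<nu> (PiM {..<2 :: nat} (\<lambda>_. lborel)) (\<lambda>v. \<kappa> (v 0) (v 1))"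
    and Q: "finite_measure Q" "sets Q = sets borel"
    and var: "\<And>f. f \<in> borel_measurable borel \<Longrightarrow>
      (\<integral>\<^sup>+y. f y \<partial>Q) = (\<integral>\<^sup>+v. f (v 0, v 1) \<partial>fst \<nu>) + (\<integral>\<^sup>+v. f (v 0, v 1) \<partial>snd \<nu>)"
    and \<kappa>: "\<And>x y. \<bar>\<kappa> x y\<bar> \<le> C"
    and A: "A \<in> sets borel" "emeasure lborel A < \<infinity>"
  shows "measure Q (A \<times> A) \<le> sqrt (measure Q UNIV * C) * measure lborel A"
proof -
  interpret finite_measure Q by fact
  have C: "0 \<le> C" using \<kappa>[of 0 0] by linarith
  note [measurable] = A(1)
  have sp: "space Q = UNIV" using Q(2) by (auto dest: sets_eq_imp_space_eq)
  have AA: "A \<times> A \<in> sets borel" using A by (simp add: borel_Times)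
  have comp: "(\<lambda>v. (v 0, v 1)) \<in> PiM {..<2 :: nat} (\<lambda>_. borel) \<rightarrow>\<^sub>M (borel :: ('a \<times> 'a) measure)"
    by (intro borel_measurable_Pair measurable_component_singleton) auto
  have km: "(\<lambda>v. ennreal \<bar>\<kappa> (v 0) (v 1)\<bar>) \<in> borel_measurable (PiM {..<2 :: nat} (\<lambda>_. borel))"
    using d by (auto simp: has_signed_density_def sets_PiM_lborel cong: measurable_cong_sets)
  have im: "(\<lambda>v. indicator (A \<times> A) (v 0, v 1) :: ennreal) \<in> borel_measurable (PiM {..<2 :: nat} (\<lambda>_. borel))"
    by (rule measurable_compose[OF comp borel_measurable_indicator[OF AA]])
  have "emeasure Q (A \<times> A) = (\<integral>\<^sup>+y. indicator (A \<times> A) y \<partial>Q)" using AA Q(2) by simp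
  also have "\<dots> = (\<integral>\<^sup>+v. ennreal \<bar>\<kappa> (v 0) (v 1)\<bar> * indicator (A \<times> A) (v 0, v 1) \<partial>PiM {..<2 :: nat} (\<lambda>_. lborel))"
    using im AA by (intro nn_integral_signed_density[OF d var]) (auto simp: sets_PiM_lborel cong: measurable_cong_sets)
  also have "\<dots> = (\<integral>\<^sup>+x. \<integral>\<^sup>+y. ennreal \<bar>\<kappa> x y\<bar> * indicator (A \<times> A) (x, y) \<partial>lborel \<partial>lborel)"
    using km im by (subst nn_integral_PiM_lborel(1)) (auto simp: tup2_def)
  also have "\<dots> \<le> (\<integral>\<^sup>+x. \<integral>\<^sup>+y. ennreal C * (indicator A x * indicator A y) \<partial>lborel \<partial>lborel)"
    using \<kappa> by (intro nn_integral_mono) (auto simp: indicator_def intro: ennreal_leI)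
  also have "\<dots> = ennreal C * (emeasure lborel A * emeasure lborel A)"
    by (simp add: nn_integral_cmult nn_integral_multc)
  also have "\<dots> = ennreal (C * (measure lborel A)\<^sup>2)"
    using A(2) C by (simp add: emeasure_eq_ennreal_measure ennreal_mult power2_eq_square)
  finally have 1: "measure Q (A \<times> A) \<le> C * (measure lborel A)\<^sup>2"
    using C by (simp add: emeasure_eq_measure)
  have 2: "measure Q (A \<times> A) \<le> measure Q UNIV" using bounded_measure[of "A \<times> A"] by (simp add: sp)
  have "(measure Q (A \<times> A))\<^sup>2 \<le> measure Q UNIV * (C * (measure lborel A)\<^sup>2)"
    unfolding power2_eq_square[of "measure Q (A \<times> A)"] using 1 2 by (intro mult_mono) auto
  then have "measure Q (A \<times> A) \<le> sqrt (measure Q UNIV * (C * (measure lborel A)\<^sup>2))" by (rule real_le_rsqrt)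
  also have "\<dots> = sqrt (measure Q UNIV * C) * measure lborel A" by (simp add: real_sqrt_mult)
  finally show ?thesis .
qed

text \<open>Replacing y by y + z turns the condition on the difference of the last two arguments
  into y \<in> A and leaves z free. The inner integral over z is then the one in the hypothesis, and
  Cauchy-Schwarz over A \<times> A yields a bound linear in |A|.\<close>

lemma square_integrable_density_variation:
  fixes \<nu> :: "(nat \<Rightarrow> 'a::euclidean_space) signed_measure"
  assumes d: "has_signed_density \<nu> (PiM {..<3 :: nat} (\<lambda>_. lborel)) (\<lambda>v. \<kappa> (v 0) (v 1) (v 2))"
    and Q: "finite_measure Q" "sets Q = sets borel"
    and var: "\<And>f. f \<in> borel_measurable borel \<Longrightarrow>
      (\<integral>\<^sup>+y. f y \<partial>Q) = (\<integral>\<^sup>+v. f (v 0, v 1, v 2) \<partial>fst \<nu>) + (\<integral>\<^sup>+v. f (v 0, v 1, v 2) \<partial>snd \<nu>)"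
    and \<kappa>: "(\<integral>\<^sup>+x. \<integral>\<^sup>+y. (\<integral>\<^sup>+z. ennreal \<bar>\<kappa> x (y + z) z\<bar> \<partial>lborel)\<^sup>2 \<partial>lborel \<partial>lborel) \<le> ennreal C" and C: "0 \<le> C"
    and A: "A \<in> sets borel" "emeasure lborel A < \<infinity>"
  shows "measure Q {p. fst p \<in> A \<and> fst (snd p) - snd (snd p) \<in> A} \<le> sqrt C * measure lborel A"
proof -
  interpret finite_measure Q by fact
  note [measurable] = A(1)
  define S where "S = {p :: 'a \<times> 'a \<times> 'a. fst p \<in> A \<and> fst (snd p) - snd (snd p) \<in> A}"
  have S: "S \<in> sets borel" unfolding S_def by measurable
  have comp: "(\<lambda>v. (v 0, v 1, v 2)) \<in> PiM {..<3 :: nat} (\<lambda>_. borel) \<rightarrow>\<^sub>M (borel :: ('a \<times> 'a \<times> 'a) measure)"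
    by (intro borel_measurable_Pair measurable_component_singleton) auto
  have km: "(\<lambda>v. ennreal \<bar>\<kappa> (v 0) (v 1) (v 2)\<bar>) \<in> borel_measurable (PiM {..<3 :: nat} (\<lambda>_. borel))"
    using d by (auto simp: has_signed_density_def sets_PiM_lborel cong: measurable_cong_sets)
  have im: "(\<lambda>v. indicator S (v 0, v 1, v 2) :: ennreal) \<in> borel_measurable (PiM {..<3 :: nat} (\<lambda>_. borel))"
    by (rule measurable_compose[OF comp borel_measurable_indicator[OF S]])
  define k where "k p = ennreal \<bar>\<kappa> (fst p) (fst (snd p)) (snd (snd p))\<bar>" for p
  have [measurable]: "k \<in> borel_measurable borel"
    using measurable_compose[OF tup_measurable(3) km] unfolding k_def[abs_def] by (simp add: tup3_def)
  have "emeasure Q S = (\<integral>\<^sup>+y. indicator S y \<partial>Q)" using S Q(2) by simp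
  also have "\<dots> = (\<integral>\<^sup>+v. ennreal \<bar>\<kappa> (v 0) (v 1) (v 2)\<bar> * indicator S (v 0, v 1, v 2) \<partial>PiM {..<3 :: nat} (\<lambda>_. lborel))"
    using im S by (intro nn_integral_signed_density[OF d var]) (auto simp: sets_PiM_lborel cong: measurable_cong_sets)
  also have "\<dots> = (\<integral>\<^sup>+x. \<integral>\<^sup>+y. \<integral>\<^sup>+z. k (x, y, z) * indicator S (x, y, z) \<partial>lborel \<partial>lborel \<partial>lborel)"
    using km im by (subst nn_integral_PiM_lborel(2)) (auto simp: tup3_def k_def)
  also have "\<dots> = (\<integral>\<^sup>+x. \<integral>\<^sup>+y. (\<integral>\<^sup>+z. k (x, y + z, z) \<partial>lborel) * (indicator A x * indicator A y) \<partial>lborel \<partial>lborel)"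
  proof (rule nn_integral_cong)
    fix x
    have [measurable]: "S \<in> sets borel" by (rule S)
    have "(\<integral>\<^sup>+y. \<integral>\<^sup>+z. k (x, y, z) * indicator S (x, y, z) \<partial>lborel \<partial>lborel)
        = (\<integral>\<^sup>+z. \<integral>\<^sup>+y. k (x, y, z) * indicator S (x, y, z) \<partial>lborel \<partial>lborel)"
      by (rule lborel_pair.Fubini') measurable
    also have "\<dots> = (\<integral>\<^sup>+z. \<integral>\<^sup>+y. k (x, z + y, z) * indicator S (x, z + y, z) \<partial>lborel \<partial>lborel)"
      by (intro nn_integral_cong translate_nn_integral[symmetric]) measurable
    also have "\<dots> = (\<integral>\<^sup>+z. \<integral>\<^sup>+y. k (x, y + z, z) * (indicator A x * indicator A y) \<partial>lborel \<partial>lborel)"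
      by (intro nn_integral_cong) (auto simp: S_def indicator_def add.commute)
    also have "\<dots> = (\<integral>\<^sup>+y. \<integral>\<^sup>+z. k (x, y + z, z) * (indicator A x * indicator A y) \<partial>lborel \<partial>lborel)"
      by (rule lborel_pair.Fubini') measurable
    also have "\<dots> = (\<integral>\<^sup>+y. (\<integral>\<^sup>+z. k (x, y + z, z) \<partial>lborel) * (indicator A x * indicator A y) \<partial>lborel)"
      by (intro nn_integral_cong nn_integral_multc) measurable
    finally show "(\<integral>\<^sup>+y. \<integral>\<^sup>+z. k (x, y, z) * indicator S (x, y, z) \<partial>lborel \<partial>lborel)
        = (\<integral>\<^sup>+y. (\<integral>\<^sup>+z. k (x, y + z, z) \<partial>lborel) * (indicator A x * indicator A y) \<partial>lborel)" .
  qed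
  finally have "(emeasure Q S)\<^sup>2 \<le> (\<integral>\<^sup>+x. \<integral>\<^sup>+y. (\<integral>\<^sup>+z. k (x, y + z, z) \<partial>lborel)\<^sup>2 \<partial>lborel \<partial>lborel) * (emeasure lborel A)\<^sup>2"
    using nested_Cauchy_Schwarz[of "\<lambda>x y. \<integral>\<^sup>+z. k (x, y + z, z) \<partial>lborel", OF _ A(1)] by simp
  also have "\<dots> \<le> ennreal C * (emeasure lborel A)\<^sup>2" using \<kappa> by (intro mult_right_mono) (auto simp: k_def)
  also have "\<dots> = ennreal (C * (measure lborel A)\<^sup>2)"
    using A(2) C by (simp add: emeasure_eq_ennreal_measure ennreal_mult power2_eq_square)
  finally have "(measure Q S)\<^sup>2 \<le> C * (measure lborel A)\<^sup>2"
    using C by (simp add: emeasure_eq_measure ennreal_power)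
  then have "measure Q S \<le> sqrt (C * (measure lborel A)\<^sup>2)" by (rule real_le_rsqrt)
  then show ?thesis by (simp add: S_def real_sqrt_mult)
qed

section \<open>The functional limit theorem\<close>

theorem theorem2:
  fixes M :: "'w measure"
    and X :: "'w \<Rightarrow> 'a::euclidean_space set"
    and W :: "nat \<Rightarrow> 'a set"
    and B :: "'a set"
    and \<mu> :: "(nat \<Rightarrow> 'a) measure"
    and \<gamma> :: "nat \<Rightarrow> (nat \<Rightarrow> 'a) signed_measure"
    and lam \<sigma>2 R a0 :: real
  assumes "simple_point_process M X"
    and "lam = intensity M X" and "lam > 0"
    and "Bk_mixing 4 M X \<gamma>"
    and "reduced_moment_measure M X 2 \<mu>"
    and "convex_averaging_sequence W"
    and "compact B" and "convex B" and "uminus ` B = B" and "0 \<in> interior B"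
    and "R > 0"
    and "\<sigma>2 = lam * (1 + signed_value (\<gamma> 2) (tuple1 UNIV))"
    and "weak_conv_m
           (\<lambda>n. distr M borel
             (\<lambda>\<omega>. (real (point_count X (W n) \<omega>) - lam * measure lborel (W n)) / sqrt (measure lborel (W n))))
           (centered_normal \<sigma>2)"
    and "a0 > 0"
    and "\<forall>A\<in>sets borel. bounded A \<longrightarrow> emeasure \<mu> (tuple1 A) \<le> ennreal a0 * emeasure lborel A"
  shows
    "(\<forall>\<alpha>. 1/4 < \<alpha> \<and> \<alpha> < 1 \<and>
        (\<lambda>n. window_scale (W n) powr \<alpha> / inradius (W n)) \<longlonglongrightarrow> 0 \<longrightarrow>
        converges_in_distribution (skorohod_topology R)
          M (\<lambda>n \<omega>. \<lambda>r\<in>{0..R}. Delta lam \<mu> X (W n) B \<alpha> r \<omega>)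
          (centered_normal \<sigma>2) (\<lambda>z. \<lambda>r\<in>{0..R}. 2 * lam * measure lborel B * r ^ DIM('a) * z)) \<and>
     ((\<exists>\<kappa>3 \<kappa>4 a01 a02.
         has_signed_density (\<gamma> 3) (PiM {..<2} (\<lambda>_. lborel)) (\<lambda>v. \<kappa>3 (v 0) (v 1)) \<and>
         has_signed_density (\<gamma> 4) (PiM {..<3} (\<lambda>_. lborel)) (\<lambda>v. \<kappa>4 (v 0) (v 1) (v 2)) \<and>
         (\<forall>x y. \<bar>\<kappa>3 x y\<bar> \<le> a01) \<and>
         (\<integral>\<^sup>+x. \<integral>\<^sup>+y. (\<integral>\<^sup>+z. ennreal \<bar>\<kappa>4 x (y + z) z\<bar> \<partial>lborel)\<^sup>2 \<partial>lborel \<partial>lborel) \<le> ennreal a02)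
      \<longrightarrow>
      (\<forall>\<alpha>. 0 < \<alpha> \<and> \<alpha> < 1 \<and>
        (\<lambda>n. window_scale (W n) powr \<alpha> / inradius (W n)) \<longlonglongrightarrow> 0 \<longrightarrow>
        converges_in_distribution (skorohod_topology R)
          M (\<lambda>n \<omega>. \<lambda>r\<in>{0..R}. Delta lam \<mu> X (W n) B \<alpha> r \<omega>)
          (centered_normal \<sigma>2) (\<lambda>z. \<lambda>r\<in>{0..R}. 2 * lam * measure lborel B * r ^ DIM('a) * z)))"
proof -
  note lam = assms(2)
  have mix: "Bk_mixing 4 M X \<gamma>" by fact
  then have stat: "kth_order_stationary 4 M X" by (simp add: Bk_mixing_def)
  have B0: "0 \<in> B" using assms(10) interior_subset by blast
  have red: "locally_finite_signed (j - 1) (\<gamma> j)" "total_variation (\<gamma> j) < \<infinity>" if "j \<in> {2..4}" for j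
    using mix that by (auto simp: Bk_mixing_def reduced_cumulant_measure_def)
  have n: "(2::nat) - 1 = 1" "(3::nat) - 1 = 2" "(4::nat) - 1 = 3" by simp_all
  have lf: "locally_finite_signed 1 (\<gamma> 2)" "locally_finite_signed 2 (\<gamma> 3)" "locally_finite_signed 3 (\<gamma> 4)"
    using red(1)[of 2] red(1)[of 3] red(1)[of 4] unfolding n by simp_all
  have tv: "total_variation (\<gamma> 2) < \<infinity>" "total_variation (\<gamma> 3) < \<infinity>" "total_variation (\<gamma> 4) < \<infinity>"
    using red(2) by simp_all
  have T: "(\<lambda>v. v 0) \<in> PiM {..<1 :: nat} (\<lambda>_. borel) \<rightarrow>\<^sub>M (borel :: 'a measure)"
    "(\<lambda>v. (v 0, v 1)) \<in> PiM {..<2 :: nat} (\<lambda>_. borel) \<rightarrow>\<^sub>M (borel :: ('a \<times> 'a) measure)"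
    "(\<lambda>v. (v 0, v 1, v 2)) \<in> PiM {..<3 :: nat} (\<lambda>_. borel) \<rightarrow>\<^sub>M (borel :: ('a \<times> 'a \<times> 'a) measure)"
    by (intro borel_measurable_Pair measurable_component_singleton; simp)+
  have inv1: "tup1 (v 0) = v" if "v \<in> space (PiM {..<1 :: nat} (\<lambda>_. borel :: 'a measure))" for v
  proof
    fix j :: nat
    consider "j = 0" | "1 \<le> j" by linarith
    then show "tup1 (v 0) j = v j" using that by cases (auto simp: tup1_def space_PiM PiE_def extensional_def)
  qed
  have inv2: "tup2 (v 0, v 1) = v" if "v \<in> space (PiM {..<2 :: nat} (\<lambda>_. borel :: 'a measure))" for v
  proof
    fix j :: nat
    consider "j = 0" | "j = 1" | "2 \<le> j" by linarith
    then show "tup2 (v 0, v 1) j = v j" using that by cases (auto simp: tup2_def space_PiM PiE_def extensional_def)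
  qed
  have inv3: "tup3 (v 0, v 1, v 2) = v" if "v \<in> space (PiM {..<3 :: nat} (\<lambda>_. borel :: 'a measure))" for v
  proof
    fix j :: nat
    consider "j = 0" | "j = 1" | "j = 2" | "3 \<le> j" by linarith
    then show "tup3 (v 0, v 1, v 2) j = v j" using that by cases (auto simp: tup3_def space_PiM PiE_def extensional_def)
  qed
  \<comment> \<open>Variations and signs of the reduced cumulant measures, moved from tuples to
    products. For the orders three and four the integral formula is kept too, for the comparison
    with densities.\<close>
  obtain Q2 and s2 :: "'a \<Rightarrow> real" where Q2: "finite_measure Q2" "sets Q2 = sets borel" "s2 \<in> borel_measurable borel" "\<And>y. \<bar>s2 y\<bar> \<le> 1"
      "\<And>A. A \<in> sets (PiM {..<1 :: nat} (\<lambda>_. borel)) \<Longrightarrow> signed_value (\<gamma> 2) A = (\<integral>y. s2 y * indicator A (tup1 y) \<partial>Q2)"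
    by (rule signed_measure_variation[OF lf(1) tv(1) T(1) tup_measurable(1)]) (erule inv1, rule that)
  obtain Q3 and s3 :: "'a \<times> 'a \<Rightarrow> real" where Q3: "finite_measure Q3" "sets Q3 = sets borel" "s3 \<in> borel_measurable borel" "\<And>y. \<bar>s3 y\<bar> \<le> 1"
      "\<And>A. A \<in> sets (PiM {..<2 :: nat} (\<lambda>_. borel)) \<Longrightarrow> signed_value (\<gamma> 3) A = (\<integral>y. s3 y * indicator A (tup2 y) \<partial>Q3)"
    and var3: "\<And>f. f \<in> borel_measurable borel \<Longrightarrow>
      (\<integral>\<^sup>+y. f y \<partial>Q3) = (\<integral>\<^sup>+v. f (v 0, v 1) \<partial>fst (\<gamma> 3)) + (\<integral>\<^sup>+v. f (v 0, v 1) \<partial>snd (\<gamma> 3))"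
    by (rule signed_measure_variation[OF lf(2) tv(2) T(2) tup_measurable(2)]) (erule inv2, rule that)
  obtain Q4 and s4 :: "'a \<times> 'a \<times> 'a \<Rightarrow> real" where Q4: "finite_measure Q4" "sets Q4 = sets borel" "s4 \<in> borel_measurable borel" "\<And>y. \<bar>s4 y\<bar> \<le> 1"
      "\<And>A. A \<in> sets (PiM {..<3 :: nat} (\<lambda>_. borel)) \<Longrightarrow> signed_value (\<gamma> 4) A = (\<integral>y. s4 y * indicator A (tup3 y) \<partial>Q4)"
    and var4: "\<And>f. f \<in> borel_measurable borel \<Longrightarrow>
      (\<integral>\<^sup>+y. f y \<partial>Q4) = (\<integral>\<^sup>+v. f (v 0, v 1, v 2) \<partial>fst (\<gamma> 4)) + (\<integral>\<^sup>+v. f (v 0, v 1, v 2) \<partial>snd (\<gamma> 4))"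
    by (rule signed_measure_variation[OF lf(3) tv(3) T(3) tup_measurable(3)]) (erule inv3, rule that)
  \<comment> \<open>The reduced moment measure lives on tuples of length one; this is the same
    measure on the space itself.\<close>
  define \<mu>1 where "\<mu>1 = distr \<mu> borel (\<lambda>v. v 0)"
  have \<mu>s: "sets \<mu> = sets (PiM {..<1 :: nat} (\<lambda>_. borel))"
    using assms(5) unfolding reduced_moment_measure_def n by simp
  have \<mu>1: "emeasure \<mu>1 A = emeasure \<mu> (tuple1 A)" if "A \<in> sets borel" for A
  proof -
    have "emeasure \<mu>1 A = emeasure \<mu> ((\<lambda>v. v 0) -` A \<inter> space \<mu>)"
    proof -
      have "(\<lambda>v. v 0) \<in> \<mu> \<rightarrow>\<^sub>M borel" by (rule measurable_cong_sets[THEN equalityD2, THEN subsetD, OF \<mu>s refl T(1)])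
      then show ?thesis unfolding \<mu>1_def using that by (rule emeasure_distr)
    qed
    also have "space \<mu> = space (PiM {..<1 :: nat} (\<lambda>_. borel))" using \<mu>s by (rule sets_eq_imp_space_eq)
    also have "(\<lambda>v. v 0) -` A \<inter> space (PiM {..<1 :: nat} (\<lambda>_. borel)) = tuple1 A"
      by (auto simp: space_PiM PiE_def Pi_def)
    finally show ?thesis .
  qed
  have mom: "fact_moment M X {0, 1} (\<lambda>i. if i = 0 then A0 else A1) =
      ennreal (intensity M X) * (\<integral>\<^sup>+x. indicator A1 x * emeasure \<mu>1 {y. y + x \<in> A0} \<partial>lborel)"
    if A: "A0 \<in> sets borel" "A1 \<in> sets borel" for A0 A1
  proof -
    have i: "{..<2} = {0, 1 :: nat}" by auto
    let ?A = "\<lambda>i :: nat. if i = 0 then A0 else A1"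
    have m: "\<forall>A. (\<forall>i<2. A i \<in> sets borel) \<longrightarrow> fact_moment M X {..<2} A = ennreal (intensity M X) *
        (\<integral>\<^sup>+x\<in>A 1. emeasure \<mu> (\<Pi>\<^sub>E i\<in>{..<1 :: nat}. (\<lambda>y. y - x) ` A i) \<partial>lborel)"
      using assms(5) unfolding reduced_moment_measure_def n by (rule conjunct2)
    have "fact_moment M X {..<2} ?A = ennreal (intensity M X) *
        (\<integral>\<^sup>+x\<in>?A 1. emeasure \<mu> (\<Pi>\<^sub>E i\<in>{..<1 :: nat}. (\<lambda>y. y - x) ` ?A i) \<partial>lborel)"
      by (rule m[rule_format, where A = ?A]) (simp add: A)
    also have "(\<integral>\<^sup>+x\<in>?A 1. emeasure \<mu> (\<Pi>\<^sub>E i\<in>{..<1 :: nat}. (\<lambda>y. y - x) ` ?A i) \<partial>lborel)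
        = (\<integral>\<^sup>+x. indicator A1 x * emeasure \<mu>1 {y. y + x \<in> A0} \<partial>lborel)"
    proof (intro nn_integral_cong)
      fix x
      have "(\<lambda>y. y - x) ` A0 = {y. y + x \<in> A0}" by (auto intro!: image_eqI[where x = "_ + x"])
      then have "(\<Pi>\<^sub>E i\<in>{..<1 :: nat}. (\<lambda>y. y - x) ` ?A i) = tuple1 {y. y + x \<in> A0}"
        by (intro PiE_cong) simp
      moreover have "{y. y + x \<in> A0} \<in> sets borel" using A(1) by measurable
      ultimately show "emeasure \<mu> (\<Pi>\<^sub>E i\<in>{..<1 :: nat}. (\<lambda>y. y - x) ` ?A i) * indicator (?A 1) x
          = indicator A1 x * emeasure \<mu>1 {y. y + x \<in> A0}"
        using \<mu>1 by (simp add: mult.commute)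
    qed
    finally show ?thesis unfolding i .
  qed
  interpret S: stationary_point_process M X using assms(1) stat by unfold_locales
  have C: "cumulant_process M X \<gamma> Q2 s2 Q3 s3 Q4 s4"
    by (rule cumulant_process.intro[OF S.stationary_point_process_axioms], rule cumulant_process_axioms.intro[OF mix])
      (fact Q2 Q3 Q4 | erule Q2(5) | erule Q3(5) | erule Q4(5))+
  interpret K: k_process M X \<gamma> Q2 s2 Q3 s3 Q4 s4 \<mu>1 a0
  proof (rule k_process.intro[OF C], rule k_process_axioms.intro, goal_cases)
    case 1 show ?case by (simp add: \<mu>1_def)
  next
    case (2 A0 A1) then show ?case by (rule mom)
  next
    case 3 show ?case by fact
  next
    case (4 A) then show ?case using assms(15) \<mu>1 by (simp add: S.window_def)
  qed
  interpret F3: finite_measure Q3 by (rule Q3(1))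
  interpret F4: finite_measure Q4 by (rule Q4(1))
  have link: "measure \<mu> (tuple1 A) = measure \<mu>1 A" if "A \<in> sets borel" for A
    using \<mu>1[OF that] by (simp add: measure_def)
  have main: "converges_in_distribution (skorohod_topology R)
          M (\<lambda>n \<omega>. \<lambda>r\<in>{0..R}. Delta lam \<mu> X (W n) B \<alpha> r \<omega>)
          (centered_normal \<sigma>2) (\<lambda>z. \<lambda>r\<in>{0..R}. 2 * lam * measure lborel B * r ^ DIM('a) * z)"
    if "0 < \<alpha>" "P = 0 \<or> 1/4 < \<alpha>" "(\<lambda>n. window_scale (W n) powr \<alpha> / inradius (W n)) \<longlonglongrightarrow> 0"
      "0 \<le> P" "0 \<le> K" "\<And>A. S.window A \<Longrightarrow>
        measure Q4 {p. fst p \<in> A \<and> fst (snd p) - snd (snd p) \<in> A} + 4 * measure Q3 (A \<times> A) \<le> P + K * measure lborel A"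
    for \<alpha> P K :: real
    unfolding lam using assms(7,8,9) B0 assms(6) link assms(11) that(1,2,4,5,6,3) assms(13)[unfolded lam]
    by (rule K.Delta_convergence)
  show ?thesis
  proof (intro conjI allI impI)
    fix \<alpha> assume \<alpha>: "1/4 < \<alpha> \<and> \<alpha> < 1 \<and> (\<lambda>n. window_scale (W n) powr \<alpha> / inradius (W n)) \<longlonglongrightarrow> 0"
    show "converges_in_distribution (skorohod_topology R)
          M (\<lambda>n \<omega>. \<lambda>r\<in>{0..R}. Delta lam \<mu> X (W n) B \<alpha> r \<omega>)
          (centered_normal \<sigma>2) (\<lambda>z. \<lambda>r\<in>{0..R}. 2 * lam * measure lborel B * r ^ DIM('a) * z)"
    \<comment> \<open>The third and fourth order terms are bounded by total masses: a constant part
      and no linear part, so \<alpha> > 1/4 is required.\<close>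
    proof (rule main[of \<alpha> "measure Q4 UNIV + 4 * measure Q3 UNIV" 0])
      fix A :: "'a set"
      show "measure Q4 {p. fst p \<in> A \<and> fst (snd p) - snd (snd p) \<in> A} + 4 * measure Q3 (A \<times> A)
          \<le> (measure Q4 UNIV + 4 * measure Q3 UNIV) + 0 * measure lborel A"
        using F4.bounded_measure[of "{p. fst p \<in> A \<and> fst (snd p) - snd (snd p) \<in> A}"] F3.bounded_measure[of "A \<times> A"]
        by simp
    qed (use \<alpha> in auto)
  next
    fix \<alpha>
    assume "\<exists>\<kappa>3 \<kappa>4 a01 a02.
         has_signed_density (\<gamma> 3) (PiM {..<2 :: nat} (\<lambda>_. lborel)) (\<lambda>v. \<kappa>3 (v 0) (v 1)) \<and>
         has_signed_density (\<gamma> 4) (PiM {..<3 :: nat} (\<lambda>_. lborel)) (\<lambda>v. \<kappa>4 (v 0) (v 1) (v 2)) \<and>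
         (\<forall>x y. \<bar>\<kappa>3 x y\<bar> \<le> a01) \<and>
         (\<integral>\<^sup>+x. \<integral>\<^sup>+y. (\<integral>\<^sup>+z. ennreal \<bar>\<kappa>4 x (y + z) z\<bar> \<partial>lborel)\<^sup>2 \<partial>lborel \<partial>lborel) \<le> ennreal a02"
    then obtain \<kappa>3 \<kappa>4 a01 a02 where
      d3: "has_signed_density (\<gamma> 3) (PiM {..<2 :: nat} (\<lambda>_. lborel)) (\<lambda>v. \<kappa>3 (v 0) (v 1))" and
      d4: "has_signed_density (\<gamma> 4) (PiM {..<3 :: nat} (\<lambda>_. lborel)) (\<lambda>v. \<kappa>4 (v 0) (v 1) (v 2))" and
      k3: "\<And>x y. \<bar>\<kappa>3 x y\<bar> \<le> a01" and
      k4: "(\<integral>\<^sup>+x. \<integral>\<^sup>+y. (\<integral>\<^sup>+z. ennreal \<bar>\<kappa>4 x (y + z) z\<bar> \<partial>lborel)\<^sup>2 \<partial>lborel \<partial>lborel) \<le> ennreal a02"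
      by blast
    have a01: "0 \<le> a01" using k3[of 0 0] by linarith
    \<comment> \<open>\<open>a02\<close> is an arbitrary real. A negative value acts as 0, and the
      square root below is taken of the nonnegative version.\<close>
    have "ennreal a02 = ennreal (max 0 a02)" by (cases "0 \<le> a02") (simp_all add: ennreal_neg)
    note k4' = k4[unfolded this]
    assume \<alpha>: "0 < \<alpha> \<and> \<alpha> < 1 \<and> (\<lambda>n. window_scale (W n) powr \<alpha> / inradius (W n)) \<longlonglongrightarrow> 0"
    show "converges_in_distribution (skorohod_topology R)
          M (\<lambda>n \<omega>. \<lambda>r\<in>{0..R}. Delta lam \<mu> X (W n) B \<alpha> r \<omega>)
          (centered_normal \<sigma>2) (\<lambda>z. \<lambda>r\<in>{0..R}. 2 * lam * measure lborel B * r ^ DIM('a) * z)"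
    proof (rule main[of \<alpha> 0 "sqrt (max 0 a02) + 4 * sqrt (measure Q3 UNIV * a01)"])
      fix A :: "'a set" assume "S.window A"
      then have A: "A \<in> sets borel" "emeasure lborel A < \<infinity>"
        using emeasure_bounded_finite by (auto simp: S.window_def)
      have "measure Q3 (A \<times> A) \<le> sqrt (measure Q3 UNIV * a01) * measure lborel A"
        by (rule bounded_density_variation[OF d3 Q3(1,2) var3 k3 A])
      moreover have "measure Q4 {p. fst p \<in> A \<and> fst (snd p) - snd (snd p) \<in> A} \<le> sqrt (max 0 a02) * measure lborel A"
        by (rule square_integrable_density_variation[OF d4 Q4(1,2) var4 k4' _ A]) simp_all
      ultimately show "measure Q4 {p. fst p \<in> A \<and> fst (snd p) - snd (snd p) \<in> A} + 4 * measure Q3 (A \<times> A)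
          \<le> 0 + (sqrt (max 0 a02) + 4 * sqrt (measure Q3 UNIV * a01)) * measure lborel A"
        by (simp add: distrib_right)
    qed (use \<alpha> a01 in auto)
  qed
qed

end
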